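(* Suppose that $\sup_{\varepsilon>0}\tau(\varepsilon)/\varepsilon\le\overline{\tau}_0$ with $\overline{\tau}_0\in(0,+\infty)$. There exists a positive constant $C$ depending only on $\Phi$ and $T_0$ such that, setting $$\kappa=\frac{1}{C\,(\overline{\tau}_0^2+1)}>0,$$ for every $\varepsilon>0$ the solution $D=(D_k)_{k\in\mathbb N}$ to the Hermite system $$\partial_t D_k+\frac1\varepsilon\left(\sqrt{k}\,\mathcal A D_{k-1}-\sqrt{k+1}\,\mathcal A^\star D_{k+1}\right)=-\frac{k}{\tau(\varepsilon)}D_k,\qquad k\in\mathbb N,$$ with initial datum $D(0)=D^{0,\varepsilon}$ satisfies: (i) if $\|D(0)\|_{L^2}<+\infty$, then for all $t\ge 0$ $$\|D(t)-D_\infty\|_{L^2}\le\sqrt3\,\|D(0)-D_\infty\|_{L^2}\,\exp\left(-\frac{\tau(\varepsilon)}{\varepsilon^2}\,\kappa\,t\right);$$ (ii) if $\|\mathcal B D(0)\|_{L^2}+\|D(0)\|_{L^2}<+\infty$, then for all $t\ge0$ $$\|\mathcal B D(t)\|_{L^2}\le\sqrt3\,\Big(C(\overline{\tau}_0+1)\,\|D(0)-D_\infty\|_{L^2}+\|\mathcal B D(0)\|_{L^2}\Big)\exp\left(-\frac{\tau(\varepsilon)}{\varepsilon^2}\,\kappa\,t\right).$$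
   Context: $\mathbb T$ is the one-dimensional torus, $T_0>0$, $\Phi\in W^{2,\infty}(\mathbb T)$ is a given potential and $E=-\partial_x\Phi$. The function $\tau:(0,\infty)\to(0,\infty)$ is given. The stationary density is $\rho_\infty=c_0\exp(-\Phi/T_0)$, where $c_0>0$ is fixed by conservation of mass, i.e. $\int_{\mathbb T}\rho_\infty\,dx=\int_{\mathbb T}D_0(0)\sqrt{\rho_\infty}\,dx$ (the right-hand side is the total mass of the initial distribution $f_0$, since $D_k=C_k/\sqrt{\rho_\infty}$ where $C_k$ are the Hermite coefficients of $f$ in velocity). The operators are $\mathcal A u=\sqrt{T_0}\,\partial_x u-\frac{E}{2\sqrt{T_0}}u$ and $\mathcal A^\star u=-\sqrt{T_0}\,\partial_x u-\frac{E}{2\sqrt{T_0}}u$. In the Hermite system, $D_{-1}=0$ by convention (the term $\sqrt{k}\,\mathcal A D_{k-1}$ vanishes for $k=0$), and each $D_k$ is a function of $(t,x)\in\mathbb R^+\times\mathbb T$. The equilibrium $D_\infty=(D_{\infty,k})_{k\in\mathbb N}$ is $D_{\infty,0}=\sqrt{\rho_\infty}$, $D_{\infty,k}=0$ for $k\ge1$. For $D=(D_k)_{k\in\mathbb N}$, $\|D\|_{L^2}^2=\sum_{k\in\mathbb N}\|D_k\|_{L^2(\mathbb T)}^2$ (no weight). The family $\mathcal B=(\mathcal B_k)_{k\ge0}$ is $\mathcal B_0=\mathcal A$, $\mathcal B_k=\mathcal A^\star$ for $k\ge1$, and $\|\mathcal B D\|_{L^2}^2=\sum_{k\in\mathbb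 N}\|\mathcal B_kD_k\|_{L^2(\mathbb T)}^2$. *)

theory Defs
  imports "HOL-Analysis.Analysis"
begin

text \<open>
  The torus of length \<open>L\<close> is represented by the fundamental domain \<open>{0..L}\<close> (whose endpoints
  form a null set). A function on the torus is a function on the reals of which only the restriction
  to \<open>{0..L}\<close>, up to null sets, matters; the periodic geometry enters through the periodic
  test functions in the definition of the weak derivative.
\<close>

definition torus :: "real \<Rightarrow> real measure" where
  "torus L = lebesgue_on {0..L}"

definition in_L2 :: "real \<Rightarrow> (real \<Rightarrow> real) \<Rightarrow> bool" where
  "in_L2 L u \<longleftrightarrow> u \<in> borel_measurable (torus L) \<and> integrable (torus L) (\<lambda>x. (u x)\<^sup>2)"

definition L2_inner :: "real \<Rightarrow> (real \<Rightarrow> real) \<Rightarrow> (real \<Rightarrow> real) \<Rightarrow> real" where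
  "L2_inner L u v = (LINT x|torus L. u x * v x)"

definition L2_norm :: "real \<Rightarrow> (real \<Rightarrow> real) \<Rightarrow> real" where
  "L2_norm L u = sqrt (LINT x|torus L. (u x)\<^sup>2)"

definition is_weak_deriv :: "real \<Rightarrow> (real \<Rightarrow> real) \<Rightarrow> (real \<Rightarrow> real) \<Rightarrow> bool" where
  "is_weak_deriv L u v \<longleftrightarrow>
     integrable (torus L) u \<and> integrable (torus L) v \<and>
     (\<forall>\<phi> \<phi>'. (\<forall>x. \<phi> (x + L) = \<phi> x) \<and> (\<forall>x. (\<phi> has_real_derivative \<phi>' x) (at x)) \<and>
        continuous_on UNIV \<phi>' \<longrightarrow>
        (LINT x|torus L. u x * \<phi>' x) = - (LINT x|torus L. v x * \<phi> x))"

text \<open>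
  A representative of the weak derivative, which is unique up to null sets; it is unspecified for
  functions that are not weakly differentiable.
\<close>

definition weak_deriv :: "real \<Rightarrow> (real \<Rightarrow> real) \<Rightarrow> (real \<Rightarrow> real)" where
  "weak_deriv L u = (SOME v. is_weak_deriv L u v)"

definition in_H1 :: "real \<Rightarrow> (real \<Rightarrow> real) \<Rightarrow> bool" where
  "in_H1 L u \<longleftrightarrow> in_L2 L u \<and> (\<exists>v. is_weak_deriv L u v \<and> in_L2 L v)"

definition in_Linf :: "real \<Rightarrow> (real \<Rightarrow> real) \<Rightarrow> bool" where
  "in_Linf L u \<longleftrightarrow> u \<in> borel_measurable (torus L) \<and> (\<exists>M. AE x in torus L. \<bar>u x\<bar> \<le> M)"

definition in_W2inf :: "real \<Rightarrow> (real \<Rightarrow> real) \<Rightarrow> bool" where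
  "in_W2inf L u \<longleftrightarrow> in_Linf L u \<and>
     (\<exists>u1 u2. is_weak_deriv L u u1 \<and> in_Linf L u1 \<and> is_weak_deriv L u1 u2 \<and> in_Linf L u2)"

definition field_E :: "real \<Rightarrow> (real \<Rightarrow> real) \<Rightarrow> (real \<Rightarrow> real)" where
  "field_E L \<Phi> = (\<lambda>x. - weak_deriv L \<Phi> x)"

definition op_A :: "real \<Rightarrow> real \<Rightarrow> (real \<Rightarrow> real) \<Rightarrow> (real \<Rightarrow> real) \<Rightarrow> (real \<Rightarrow> real)" where
  "op_A L T0 \<Phi> u = (\<lambda>x. sqrt T0 * weak_deriv L u x - field_E L \<Phi> x / (2 * sqrt T0) * u x)"

definition op_A_star :: "real \<Rightarrow> real \<Rightarrow> (real \<Rightarrow> real) \<Rightarrow> (real \<Rightarrow> real) \<Rightarrow> (real \<Rightarrow> real)" where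
  "op_A_star L T0 \<Phi> u = (\<lambda>x. - sqrt T0 * weak_deriv L u x - field_E L \<Phi> x / (2 * sqrt T0) * u x)"

text \<open>Families \<open>(D\<^sub>k)\<close> of functions on the torus: finiteness of the norm, and the norm itself.\<close>

definition seq_L2 :: "real \<Rightarrow> (nat \<Rightarrow> real \<Rightarrow> real) \<Rightarrow> bool" where
  "seq_L2 L D \<longleftrightarrow> (\<forall>k. in_L2 L (D k)) \<and> summable (\<lambda>k. (L2_norm L (D k))\<^sup>2)"

definition seq_norm :: "real \<Rightarrow> (nat \<Rightarrow> real \<Rightarrow> real) \<Rightarrow> real" where
  "seq_norm L D = sqrt (\<Sum>k. (L2_norm L (D k))\<^sup>2)"

definition seq_diff :: "(nat \<Rightarrow> real \<Rightarrow> real) \<Rightarrow> (nat \<Rightarrow> real \<Rightarrow> real) \<Rightarrow> (nat \<Rightarrow> real \<Rightarrow> real)" where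
  "seq_diff D F = (\<lambda>k x. D k x - F k x)"

definition op_B ::
  "real \<Rightarrow> real \<Rightarrow> (real \<Rightarrow> real) \<Rightarrow> (nat \<Rightarrow> real \<Rightarrow> real) \<Rightarrow> (nat \<Rightarrow> real \<Rightarrow> real)" where
  "op_B L T0 \<Phi> D = (\<lambda>k. if k = 0 then op_A L T0 \<Phi> (D k) else op_A_star L T0 \<Phi> (D k))"

text \<open>
  Finiteness of the norm of \<open>\<B> D\<close>. Weak differentiability of every \<open>D\<^sub>k\<close> has to be
  asked for explicitly, since \<open>weak_deriv\<close> is a total function.
\<close>

definition seq_B_L2 :: "real \<Rightarrow> real \<Rightarrow> (real \<Rightarrow> real) \<Rightarrow> (nat \<Rightarrow> real \<Rightarrow> real) \<Rightarrow> bool" where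
  "seq_B_L2 L T0 \<Phi> D \<longleftrightarrow> (\<forall>k. in_H1 L (D k)) \<and> seq_L2 L (op_B L T0 \<Phi> D)"

definition rho_inf :: "real \<Rightarrow> (real \<Rightarrow> real) \<Rightarrow> real \<Rightarrow> (real \<Rightarrow> real)" where
  "rho_inf T0 \<Phi> c0 = (\<lambda>x. c0 * exp (- \<Phi> x / T0))"

definition D_inf :: "real \<Rightarrow> (real \<Rightarrow> real) \<Rightarrow> real \<Rightarrow> (nat \<Rightarrow> real \<Rightarrow> real)" where
  "D_inf T0 \<Phi> c0 = (\<lambda>k x. if k = 0 then sqrt (rho_inf T0 \<Phi> c0 x) else 0)"

text \<open>
  Solutions of the Hermite system with relaxation time \<open>\<tau>\<close>, for square-integrable data:
  \<open>D\<close> is strongly continuous from \<open>{0..}\<close> into the space of square-summable families, and each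
  equation of the system holds at every time in the dual of \<open>in_H1\<close>, the operators being moved to
  the test function by duality. The convention \<open>D\<^sub>-\<^sub>1 = 0\<close> is implemented by the factor
  \<open>sqrt k\<close>, which vanishes for \<open>k = 0\<close>.
\<close>

definition hermite_solution ::
  "real \<Rightarrow> real \<Rightarrow> (real \<Rightarrow> real) \<Rightarrow> real \<Rightarrow> real \<Rightarrow> (real \<Rightarrow> nat \<Rightarrow> real \<Rightarrow> real) \<Rightarrow> bool" where
  "hermite_solution L T0 \<Phi> \<epsilon> \<tau> D \<longleftrightarrow>
     (\<forall>t\<ge>0. seq_L2 L (D t)) \<and>
     (\<forall>t\<ge>0. ((\<lambda>s. seq_norm L (seq_diff (D s) (D t))) \<longlongrightarrow> 0) (at t within {0..})) \<and>
     (\<forall>t\<ge>0. \<forall>k \<phi>. in_H1 L \<phi> \<longrightarrow>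
        ((\<lambda>s. L2_inner L (D s k) \<phi>) has_real_derivative
           (- (1 / \<epsilon>) * (sqrt (real k) * L2_inner L (D t (k - 1)) (op_A_star L T0 \<Phi> \<phi>)
                         - sqrt (real (k + 1)) * L2_inner L (D t (k + 1)) (op_A L T0 \<Phi> \<phi>))
            - real k / \<tau> * L2_inner L (D t k) \<phi>)) (at t within {0..}))"

end

theory Submission
  imports Defs
begin

text \<open>Write \<open>r = sqrt T0\<close>, \<open>b = E / (2 * sqrt T0)\<close> and \<open>U\<^sub>k = D\<^sub>k - D\<^sub>\<infinity>\<^sub>,\<^sub>k\<close>, so that \<open>\<A> = r \<partial>\<^sub>x - b\<close> and
\<open>\<A>\<^sup>* = - r \<partial>\<^sub>x - b\<close>. Since \<open>\<A> sqrt \<rho>\<^sub>\<infinity> = 0\<close>, the family \<open>U\<close> solves the same system, and by conservation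
of mass \<open>U\<^sub>0\<close> stays orthogonal to \<open>sqrt \<rho>\<^sub>\<infinity>\<close>. The transport part of the system is skew-adjoint,
so the squared norm of \<open>U\<close> decreases at the rate \<open>(2 / \<tau>) \<Sum> k \<parallel>U\<^sub>k\<parallel>\<^sup>2\<close>: every mode is damped except
\<open>U\<^sub>0\<close>. The missing dissipation comes from the coupling of \<open>U\<^sub>0\<close> and \<open>U\<^sub>1\<close>. Let \<open>S\<close> be a bounded
right inverse of \<open>\<A>\<^sup>*\<close> on the orthogonal complement of \<open>sqrt \<rho>\<^sub>\<infinity>\<close>; on the circle it is given by
an explicit integration, and its boundedness plays the part of a Poincare inequality. The time
derivative of \<open>\<langle>U\<^sub>1, S U\<^sub>0\<rangle>\<close> contains \<open>- \<langle>\<A> U\<^sub>0, S U\<^sub>0\<rangle> / \<epsilon> = - \<parallel>U\<^sub>0\<parallel>\<^sup>2 / \<epsilon>\<close>, and all its other terms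
involve \<open>U\<^sub>1\<close> or \<open>U\<^sub>2\<close>. Hence \<open>\<parallel>U\<parallel>\<^sup>2 / 2 + \<alpha> \<langle>U\<^sub>1, S U\<^sub>0\<rangle>\<close> decays exponentially as soon as the damping
absorbs those terms, which the choice \<open>\<alpha> = const * (\<tau> / \<epsilon>) / (1 + \<tau>\<^sub>0\<^sup>2)\<close> achieves. Up to a
constant, this weight divided by \<open>\<epsilon>\<close> is the rate in the theorem. The functional lies between \<open>\<parallel>U\<parallel>\<^sup>2 / 4\<close> and \<open>3 \<parallel>U\<parallel>\<^sup>2 / 4\<close>, hence
the factor \<open>sqrt 3\<close>. This is \<open>mass2_decay\<close>.

The derivatives \<open>\<partial>\<^sub>x U\<^sub>k\<close> satisfy the same system up to the commutator of \<open>\<partial>\<^sub>x\<close> with \<open>b\<close>, which is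
bounded because \<open>\<Phi>\<close> has a bounded second derivative. Here \<open>\<langle>U\<^sub>1, \<partial>\<^sub>x U\<^sub>0\<rangle>\<close> restores the dissipation
of \<open>\<partial>\<^sub>x U\<^sub>0\<close>, with no inverse operator involved, and the terms without derivatives are a forcing
that decays by the first part. This is \<open>gradient_bound\<close>. Finally \<open>\<B> D = \<B> U\<close> differs from
\<open>\<plusminus> r \<partial>\<^sub>x U\<close> by a bounded multiple of \<open>U\<close>.

A solution is only continuous in time with values in square-summable families of \<open>L\<^sup>2\<close> functions,
so these functionals need not be differentiable in time. The computation is therefore carried out on
\<open>R\<^sub>h U\<close>, where \<open>R\<^sub>h\<close> is the mean over \<open>{x - h..x + h}\<close>: its derivative is the difference quotient
\<open>\<delta>\<^sub>h\<close>, a bounded operator, and it commutes with \<open>b\<close> up to an error of order \<open>h\<close>. The sum over the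
modes is weighted by \<open>1 - k / N\<close>; the transport terms telescope against these weights and leave
an error of order \<open>1 / sqrt N\<close> for fixed \<open>h\<close>. One lets \<open>N\<close> tend to infinity first and \<open>h\<close> to zero
afterwards. A bound on the difference quotients that is uniform in \<open>h\<close> yields weak
differentiability by Riesz representation.

The energy method only uses algebraic relations and norm bounds for \<open>R\<^sub>h\<close>, \<open>\<delta>\<^sub>h\<close>, \<open>b\<close> and \<open>S\<close>, collected in the
locales \<open>regularised_calculus\<close> and \<open>coercive_calculus\<close>. They are established on the circle in
\<open>calculus\<close>, and \<open>weak_equation\<close> with \<open>mass_conserved\<close> turns a solution into an instance of the
abstract flow.
\<close>

section \<open>Gronwall estimate, weak time derivatives and triangular sums\<close>

text \<open>The forcing \<open>c * exp (- 2 * a * s)\<close> decays twice as fast as the homogeneous solution, so it does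
not spoil the rate \<open>a\<close>. The constant \<open>\<eta>\<close> takes up the regularisation errors.\<close>

lemma gronwall_forced:
  fixes H H' :: "real \<Rightarrow> real"
  assumes a: "a > 0" and c: "c \<ge> 0" and \<eta>: "\<eta> \<ge> 0" and t: "0 \<le> t"
    and deriv: "\<And>s. 0 \<le> s \<Longrightarrow> (H has_real_derivative H' s) (at s within {0..})"
    and le: "\<And>s. 0 \<le> s \<Longrightarrow> s \<le> t \<Longrightarrow> H' s \<le> - a * H s + c * exp (- 2 * a * s) + \<eta>"
  shows "H t \<le> exp (- a * t) * (H 0 + c / a) + \<eta> / a"
proof -
  define K where "K = (\<lambda>s. exp (a * s) * H s + c / a * exp (- a * s) - \<eta> / a * exp (a * s))"
  have K': "(K has_real_derivative
      (exp (a * s) * H' s + a * exp (a * s) * H s - c * exp (- a * s) - \<eta> * exp (a * s))) (at s within {0..})"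
    if "0 \<le> s" for s
  proof -
    have e: "((\<lambda>s. exp (z * s)) has_real_derivative exp (z * s) * z) (at s within {0..})" for z
      by (rule DERIV_chain2[OF DERIV_exp, THEN DERIV_cong, OF DERIV_cmult[OF DERIV_ident]]) simp
    show ?thesis
      unfolding K_def
      using DERIV_diff[OF DERIV_add[OF DERIV_mult[OF e[of a] deriv[OF that]] DERIV_cmult[OF e[of "-a"], of "c / a"]]
          DERIV_cmult[OF e[of a], of "\<eta> / a"]]
      by (rule DERIV_cong) (use a in \<open>simp add: field_simps\<close>)
  qed
  have neg: "exp (a * s) * H' s + a * exp (a * s) * H s - c * exp (- a * s) - \<eta> * exp (a * s) \<le> 0"
    if "0 \<le> s" "s \<le> t" for s
  proof -
    have "exp (a * s) * H' s \<le> exp (a * s) * (- a * H s + c * exp (- 2 * a * s) + \<eta>)"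
      using le[OF that] by (intro mult_left_mono) auto
    also have "\<dots> = - a * exp (a * s) * H s + c * (exp (a * s) * exp (- 2 * a * s)) + \<eta> * exp (a * s)"
      by (simp add: algebra_simps)
    also have "exp (a * s) * exp (- 2 * a * s) = exp (- a * s)"
      by (simp flip: exp_add)
    finally show ?thesis by (simp add: algebra_simps)
  qed
  have "K t \<le> K 0"
  proof (cases "t = 0")
    case False
    have "continuous_on {0..t} K"
      by (rule continuous_on_subset[of "{0..}"], rule DERIV_continuous_on, rule K') auto
    moreover have "\<exists>y. (K has_real_derivative y) (at s) \<and> y \<le> 0" if s: "0 < s" "s < t" for s
    proof -
      have "at s within {0..} = at s" using s by (intro at_within_interior) simp
      thus ?thesis using K'[of s] neg[of s] s by fastforce
    qed
    ultimately show ?thesis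
      by (intro DERIV_nonpos_imp_decreasing_open[of 0 t K]) (use t False in auto)
  qed auto
  hence "exp (a * t) * H t \<le> H 0 + c / a - \<eta> / a - c / a * exp (- a * t) + \<eta> / a * exp (a * t)"
    by (simp add: K_def)
  also have "\<dots> \<le> (H 0 + c / a) + \<eta> / a * exp (a * t)"
  proof -
    have "0 \<le> c / a * exp (- a * t)" "0 \<le> \<eta> / a" using a c \<eta> by simp_all
    thus ?thesis by linarith
  qed
  finally have "exp (- a * t) * (exp (a * t) * H t) \<le> exp (- a * t) * ((H 0 + c / a) + \<eta> / a * exp (a * t))"
    by (intro mult_left_mono) auto
  moreover have e: "exp (- a * t) * exp (a * t) = 1"
    by (simp flip: exp_add)
  have "exp (- a * t) * (exp (a * t) * H t) = H t"
    by (simp only: mult.assoc[symmetric] e mult_1)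
  moreover have "exp (- a * t) * ((H 0 + c / a) + \<eta> / a * exp (a * t))
      = exp (- a * t) * (H 0 + c / a) + \<eta> / a * (exp (- a * t) * exp (a * t))"
    by (simp add: algebra_simps)
  ultimately show ?thesis unfolding e by linarith
qed

text \<open>The weak derivative is a priori a derivative for each \<open>w\<close> separately. The mean value theorem
applied to \<open>w = u s - u t - (s - t) d t\<close> itself makes the estimate uniform, provided that \<open>d\<close> is
continuous.\<close>

lemma strong_deriv_of_weak:
  fixes u d :: "real \<Rightarrow> 'a::real_inner"
  assumes weak: "\<And>t w. 0 \<le> t \<Longrightarrow> ((\<lambda>s. inner (u s) w) has_real_derivative inner (d t) w) (at t within {0..})"
    and cont: "continuous_on {0..} d" and t: "0 \<le> t"
  shows "(u has_vector_derivative d t) (at t within {0..})"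
proof -
  have "\<exists>\<rho>>0. \<forall>s\<in>{0..}. \<bar>s - t\<bar> < \<rho> \<longrightarrow> norm (u s - u t - (s - t) *\<^sub>R d t) \<le> e * \<bar>s - t\<bar>"
    if e: "e > 0" for e
  proof -
    obtain \<rho> where \<rho>: "\<rho> > 0" "\<And>s. s \<in> {0..} \<Longrightarrow> dist s t < \<rho> \<Longrightarrow> dist (d s) (d t) < e"
      using cont t e unfolding continuous_on_iff by (metis atLeast_iff)
    have "norm (u s - u t - (s - t) *\<^sub>R d t) \<le> e * \<bar>s - t\<bar>" if s: "0 \<le> s" "\<bar>s - t\<bar> < \<rho>" for s
    proof -
      define w where "w = u s - u t - (s - t) *\<^sub>R d t"
      define f where "f = (\<lambda>x. inner (u x) w - x * inner (d t) w)"
      have df: "(f has_derivative (\<lambda>y. inner (d x - d t) w * y)) (at x within closed_segment t s)"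
        if "x \<in> closed_segment t s" for x
      proof -
        have x: "0 \<le> x" using that s t by (auto simp: closed_segment_eq_real_ivl split: if_splits)
        have "(f has_real_derivative (inner (d x) w - inner (d t) w)) (at x within {0..})"
          unfolding f_def
          by (rule DERIV_diff[OF weak[OF x]]) (rule DERIV_cmult_right[OF DERIV_ident, THEN DERIV_cong], simp)
        hence "(f has_real_derivative inner (d x - d t) w) (at x within closed_segment t s)"
          unfolding inner_diff_left
          by (rule has_field_derivative_subset) (use s t in \<open>auto simp: closed_segment_eq_real_ivl split: if_splits\<close>)
        thus ?thesis by (simp add: has_field_derivative_def)
      qed
      have "norm (f s - f t) \<le> (e * norm w) * norm (s - t)"
      proof (rule differentiable_bound[of "closed_segment t s" f "\<lambda>x y. inner (d x - d t) w * y"])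
        fix x assume x: "x \<in> closed_segment t s"
        have "0 \<le> x" "\<bar>x - t\<bar> < \<rho>" using x s t
          by (auto simp: closed_segment_eq_real_ivl split: if_splits)
        hence "norm (d x - d t) \<le> e" using \<rho>(2)[of x] by (auto simp: dist_norm)
        hence "\<bar>inner (d x - d t) w\<bar> \<le> e * norm w"
          using Cauchy_Schwarz_ineq2[of "d x - d t" w] by (meson mult_right_mono norm_ge_zero order_trans)
        thus "onorm (\<lambda>y. inner (d x - d t) w * y) \<le> e * norm w"
          by (intro onorm_bound) (auto simp: abs_mult intro: mult_right_mono)
      qed (use df in auto)
      moreover have "f s - f t = inner w w"
        by (simp add: f_def w_def inner_simps algebra_simps)
      ultimately have "norm w * norm w \<le> (e * \<bar>s - t\<bar>) * norm w"
        by (simp add: power2_norm_eq_inner[symmetric] power2_eq_square mult_ac)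
      hence "norm w \<le> e * \<bar>s - t\<bar>"
        using e by (cases "norm w = 0") (auto simp: mult_le_cancel_right)
      thus ?thesis by (simp add: w_def)
    qed
    thus ?thesis using \<rho>(1) by auto
  qed
  note key = this
  show ?thesis
    unfolding has_vector_derivative_def has_derivative_within_alt
  proof (intro conjI allI impI)
    show "bounded_linear (\<lambda>x. x *\<^sub>R d t)" by (rule bounded_linear_scaleR_left)
    fix e :: real assume "0 < e"
    from key[OF this] show "\<exists>da>0. \<forall>y\<in>{0..}. norm (y - t) < da \<longrightarrow> norm (u y - u t - (y - t) *\<^sub>R d t) \<le> e * norm (y - t)"
      by simp
  qed
qed

text \<open>Summation by parts for the weights \<open>1 - k / N\<close>, multiplied by \<open>N\<close>.\<close>

lemma sum_triangular_telescope:
  fixes p :: "nat \<Rightarrow> real"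
  shows "(\<Sum>k<N. (real N - real k) * (p k - p (Suc k))) = real N * p 0 - (\<Sum>k<N. p (Suc k))"
proof (induction N)
  case (Suc N)
  have "(\<Sum>k<Suc N. (real (Suc N) - real k) * (p k - p (Suc k)))
      = (\<Sum>k<Suc N. (real N - real k) * (p k - p (Suc k))) + (\<Sum>k<Suc N. p k - p (Suc k))"
    by (simp only: sum.distrib[symmetric]) (simp add: algebra_simps)
  also have "(\<Sum>k<Suc N. p k - p (Suc k)) = p 0 - p (Suc N)"
    by (rule sum_lessThan_telescope')
  also have "(\<Sum>k<Suc N. (real N - real k) * (p k - p (Suc k))) = real N * p 0 - (\<Sum>k<N. p (Suc k))"
    using Suc by simp
  finally show ?case by (simp add: algebra_simps)
qed auto

section \<open>The regularised Hermite hierarchy in a Hilbert space\<close>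

lemma summable_norm2_diff:
  fixes x y :: "nat \<Rightarrow> 'a::real_inner"
  assumes "summable (\<lambda>k. (norm (x k))\<^sup>2)" "summable (\<lambda>k. (norm (y k))\<^sup>2)"
  shows "summable (\<lambda>k. (norm (x k - y k))\<^sup>2)"
proof (rule summable_comparison_test')
  show "summable (\<lambda>k. 2 * (norm (x k))\<^sup>2 + 2 * (norm (y k))\<^sup>2)"
    by (intro summable_add summable_mult assms)
  show "norm ((norm (x k - y k))\<^sup>2) \<le> 2 * (norm (x k))\<^sup>2 + 2 * (norm (y k))\<^sup>2" if "0 \<le> k" for k
  proof -
    have "(norm (x k - y k))\<^sup>2 \<le> (norm (x k) + norm (y k))\<^sup>2"
      by (rule power_mono[OF norm_triangle_ineq4]) simp
    also have "\<dots> \<le> 2 * (norm (x k))\<^sup>2 + 2 * (norm (y k))\<^sup>2"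
      using sum_squares_bound[of "norm (x k)" "norm (y k)"] by (simp add: power2_sum)
    finally show ?thesis by simp
  qed
qed

text \<open>The abstract counterparts of the mean \<open>R h\<close> over an interval of radius \<open>h\<close>, of the symmetric
difference quotient \<open>\<delta> h\<close> (which is the derivative of \<open>R h\<close>) and of multiplication by a function
\<open>b\<close> with bound \<open>B\<close> and Lipschitz constant \<open>\<beta>\<close>. The last two assumptions are the commutator
estimates that the Lipschitz continuity gives.\<close>

locale regularised_calculus =
  fixes R \<delta> :: "real \<Rightarrow> 'a::real_inner \<Rightarrow> 'a" and b :: "'a \<Rightarrow> 'a" and r \<beta> B h0 :: real
  assumes r_pos: "r > 0" and \<beta>_nonneg: "\<beta> \<ge> 0" and B_nonneg: "B \<ge> 0" and h0_pos: "h0 > 0"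
    and R_bl: "\<And>h. 0 < h \<Longrightarrow> h < h0 \<Longrightarrow> bounded_linear (R h)"
    and \<delta>_bl: "\<And>h. 0 < h \<Longrightarrow> h < h0 \<Longrightarrow> bounded_linear (\<delta> h)"
    and b_bl: "bounded_linear b"
    and R_sym: "\<And>h u v. 0 < h \<Longrightarrow> h < h0 \<Longrightarrow> inner (R h u) v = inner u (R h v)"
    and \<delta>_anti: "\<And>h u v. 0 < h \<Longrightarrow> h < h0 \<Longrightarrow> inner (\<delta> h u) v = - inner u (\<delta> h v)"
    and b_sym: "\<And>u v. inner (b u) v = inner u (b v)"
    and R_\<delta>: "\<And>h u. 0 < h \<Longrightarrow> h < h0 \<Longrightarrow> R h (\<delta> h u) = \<delta> h (R h u)"
    and R_norm: "\<And>h u. 0 < h \<Longrightarrow> h < h0 \<Longrightarrow> norm (R h u) \<le> norm u"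
    and \<delta>_norm: "\<And>h u. 0 < h \<Longrightarrow> h < h0 \<Longrightarrow> norm (\<delta> h u) \<le> norm u / h"
    and b_norm: "\<And>u. norm (b u) \<le> B * norm u"
    and R_b: "\<And>h u. 0 < h \<Longrightarrow> h < h0 \<Longrightarrow> norm (R h (b u) - b (R h u)) \<le> \<beta> * h * norm u"
    and \<delta>_b: "\<And>h u. 0 < h \<Longrightarrow> h < h0 \<Longrightarrow> norm (\<delta> h (b u) - b (\<delta> h u)) \<le> \<beta> * norm u"

text \<open>The flow is tested only against \<open>R h w\<close>, whose derivative is \<open>\<delta> h w\<close>: this makes sense for
every vector \<open>w\<close>, hence no domain of an unbounded operator has to be mentioned. For \<open>k = 0\<close> the
index \<open>k - 1\<close> is again \<open>0\<close>, but its coefficient vanishes.\<close>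

locale hermite_flow = regularised_calculus R \<delta> b r \<beta> B h0
  for R \<delta> :: "real \<Rightarrow> 'a::real_inner \<Rightarrow> 'a" and b r \<beta> B h0 +
  fixes U :: "real \<Rightarrow> nat \<Rightarrow> 'a" and \<epsilon> \<tau> :: real
  assumes \<epsilon>_pos: "\<epsilon> > 0" and \<tau>_pos: "\<tau> > 0"
    and U_summable: "\<And>t. 0 \<le> t \<Longrightarrow> summable (\<lambda>k. (norm (U t k))\<^sup>2)"
    and U_cont: "\<And>t. 0 \<le> t \<Longrightarrow> ((\<lambda>s. \<Sum>k. (norm (U s k - U t k))\<^sup>2) \<longlongrightarrow> 0) (at t within {0..})"
    and weak: "\<And>t h k w. 0 \<le> t \<Longrightarrow> 0 < h \<Longrightarrow> h < h0 \<Longrightarrow>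
       ((\<lambda>s. inner (U s k) (R h w)) has_real_derivative
         (1 / \<epsilon> * (sqrt (real k) * inner (U t (k - 1)) (r *\<^sub>R \<delta> h w + b (R h w))
                 + sqrt (real (k + 1)) * inner (U t (k + 1)) (r *\<^sub>R \<delta> h w - b (R h w)))
           - real k / \<tau> * inner (U t k) (R h w))) (at t within {0..})"
begin

definition mass2 :: "real \<Rightarrow> real" where "mass2 t = (\<Sum>k. (norm (U t k))\<^sup>2)"

lemma U_diff_summable: "0 \<le> s \<Longrightarrow> 0 \<le> t \<Longrightarrow> summable (\<lambda>k. (norm (U s k - U t k))\<^sup>2)"
  by (intro summable_norm2_diff U_summable)

lemma U_comp_le: "0 \<le> s \<Longrightarrow> 0 \<le> t \<Longrightarrow> (norm (U s k - U t k))\<^sup>2 \<le> (\<Sum>k. (norm (U s k - U t k))\<^sup>2)"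
  using sum_le_suminf[OF U_diff_summable, of s t "{k}"] by simp

lemma norm_le_mass2: "0 \<le> t \<Longrightarrow> (norm (U t k))\<^sup>2 \<le> mass2 t"
  using sum_le_suminf[OF U_summable, of t "{k}"] by (simp add: mass2_def)

lemma mass2_nonneg: "0 \<le> t \<Longrightarrow> 0 \<le> mass2 t"
  using norm_le_mass2[of t 0] by (meson order_trans zero_le_power2)

lemma U_continuous: "continuous_on {0..} (\<lambda>t. U t k)"
  unfolding continuous_on_def
proof
  fix t :: real assume t: "t \<in> {0..}"
  have "((\<lambda>s. (norm (U s k - U t k))\<^sup>2) \<longlongrightarrow> 0) (at t within {0..})"
  proof (rule tendsto_sandwich[OF _ _ tendsto_const U_cont])
    show "\<forall>\<^sub>F s in at t within {0..}. (norm (U s k - U t k))\<^sup>2 \<le> (\<Sum>k. (norm (U s k - U t k))\<^sup>2)"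
      using t by (auto simp: eventually_at_filter intro!: always_eventually U_comp_le)
  qed (use t in auto)
  from tendsto_real_sqrt[OF this]
  have "((\<lambda>s. norm (U s k - U t k)) \<longlongrightarrow> 0) (at t within {0..})" by simp
  thus "((\<lambda>s. U s k) \<longlongrightarrow> U t k) (at t within {0..})"
    by (simp add: LIM_zero_iff tendsto_norm_zero_iff)
qed

text \<open>By continuity in time the squared norm is locally bounded; a bisection argument makes this
uniform on compact intervals.\<close>

lemma mass2_bounded: "\<exists>K>0. \<forall>t\<in>{0..T}. mass2 t \<le> K"
proof (cases "0 \<le> T")
  case True
  define P where "P = (\<lambda>x y. \<exists>K. \<forall>t\<in>{x..y} \<inter> {0..}. mass2 t \<le> K)"
  have "P 0 T"
  proof (rule Bolzano[OF True])
    fix x y z assume "P x y" "P y z" "x \<le> y" "y \<le> z"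
    then obtain K1 K2 where "\<forall>t\<in>{x..y} \<inter> {0..}. mass2 t \<le> K1" "\<forall>t\<in>{y..z} \<inter> {0..}. mass2 t \<le> K2"
      unfolding P_def by blast
    hence "\<forall>t\<in>{x..z} \<inter> {0..}. mass2 t \<le> max K1 K2"
      by (metis IntE IntI atLeastAtMost_iff le_max_iff_disj linear)
    thus "P x z" unfolding P_def by blast
  next
    fix t assume "0 \<le> t" "t \<le> T"
    from order_tendstoD(2)[OF U_cont[OF this(1)], of 1]
    obtain d where d: "d > 0" "\<And>s. s \<ge> 0 \<Longrightarrow> s \<noteq> t \<Longrightarrow> dist s t < d \<Longrightarrow> (\<Sum>k. (norm (U s k - U t k))\<^sup>2) < 1"
      unfolding eventually_at by auto
    have "mass2 s \<le> 2 * mass2 t + 2" if s: "s \<ge> 0" "\<bar>s - t\<bar> < d" for s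
    proof -
      have lt: "(\<Sum>k. (norm (U s k - U t k))\<^sup>2) \<le> 1"
        using d(2)[of s] s by (cases "s = t") (auto simp: dist_real_def)
      have "mass2 s \<le> (\<Sum>k. 2 * (norm (U t k))\<^sup>2 + 2 * (norm (U s k - U t k))\<^sup>2)"
        unfolding mass2_def
      proof (rule suminf_le)
        fix k
        have "norm (U s k) \<le> norm (U t k) + norm (U s k - U t k)"
          using norm_triangle_sub by blast
        hence "(norm (U s k))\<^sup>2 \<le> (norm (U t k) + norm (U s k - U t k))\<^sup>2"
          by (intro power_mono) auto
        thus "(norm (U s k))\<^sup>2 \<le> 2 * (norm (U t k))\<^sup>2 + 2 * (norm (U s k - U t k))\<^sup>2"
          using sum_squares_bound[of "norm (U t k)" "norm (U s k - U t k)"] by (simp add: power2_sum)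
      qed (use s \<open>0 \<le> t\<close> in \<open>auto intro!: summable_add summable_mult U_summable U_diff_summable\<close>)
      also have "\<dots> = 2 * mass2 t + 2 * (\<Sum>k. (norm (U s k - U t k))\<^sup>2)"
        unfolding mass2_def using s \<open>0 \<le> t\<close>
        by (simp add: suminf_add[symmetric] suminf_mult summable_mult U_summable U_diff_summable)
      finally show ?thesis using lt by simp
    qed
    hence "P x y" if "x \<le> t" "t \<le> y" "y - x < d" for x y
      using that unfolding P_def by (intro exI[of _ "2 * mass2 t + 2"]) auto
    thus "\<exists>d>0. \<forall>x y. x \<le> t \<and> t \<le> y \<and> y - x < d \<longrightarrow> P x y" using d(1) by blast
  qed
  then obtain K where "\<forall>t\<in>{0..T} \<inter> {0..}. mass2 t \<le> K" unfolding P_def by blast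
  thus ?thesis by (intro exI[of _ "max K 1"]) (auto simp: le_max_iff_disj)
qed (auto intro: exI[of _ 1])

text \<open>The strong time derivative of \<open>R\<^sub>h U\<^sub>k\<close>, that is the right-hand side of the equation after \<open>R\<^sub>h\<close> has
been moved onto \<open>U\<close> by symmetry.\<close>

definition W' :: "real \<Rightarrow> nat \<Rightarrow> real \<Rightarrow> 'a" where
  "W' h k t = (1 / \<epsilon>) *\<^sub>R (sqrt (real k) *\<^sub>R (R h (b (U t (k - 1))) - r *\<^sub>R \<delta> h (U t (k - 1)))
       - sqrt (real (k + 1)) *\<^sub>R (R h (b (U t (k + 1))) + r *\<^sub>R \<delta> h (U t (k + 1))))
     - (real k / \<tau>) *\<^sub>R R h (U t k)"

lemma W_deriv:
  assumes h: "0 < h" "h < h0" and t: "0 \<le> t"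
  shows "((\<lambda>s. R h (U s k)) has_vector_derivative W' h k t) (at t within {0..})"
proof (rule strong_deriv_of_weak[OF _ _ t])
  fix t w assume t: "0 \<le> (t::real)"
  show "((\<lambda>s. inner (R h (U s k)) w) has_real_derivative inner (W' h k t) w) (at t within {0..})"
    unfolding R_sym[OF h]
    by (rule DERIV_cong[OF weak[OF t h]])
       (simp add: W'_def inner_simps R_sym[OF h] \<delta>_anti[OF h] b_sym algebra_simps)
next
  note bl = bounded_linear.continuous_on[OF R_bl[OF h]] bounded_linear.continuous_on[OF \<delta>_bl[OF h]]
     bounded_linear.continuous_on[OF b_bl]
  show "continuous_on {0..} (W' h k)"
    unfolding W'_def by (intro continuous_intros bl U_continuous)
qed

end

section \<open>Energy balance with cut-off mode weights\<close>

context hermite_flow begin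

text \<open>The operator \<open>G\<close> will be the identity or \<open>\<delta> h\<close>. The weights decrease linearly in \<open>k\<close>, so that the
transport terms, of order \<open>sqrt k\<close>, telescope into a quantity that vanishes as \<open>N\<close> grows.\<close>

definition energy :: "('a \<Rightarrow> 'a) \<Rightarrow> real \<Rightarrow> nat \<Rightarrow> real \<Rightarrow> real" where
  "energy G h N t = 1 / 2 * (\<Sum>k<N. (1 - real k / real N) * (norm (G (R h (U t k))))\<^sup>2)"

lemma inner_W_deriv:
  assumes h: "0 < h" "h < h0" and t: "0 \<le> t" and F: "bounded_linear F" and G: "bounded_linear G"
  shows "((\<lambda>s. inner (F (R h (U s j))) (G (R h (U s k)))) has_real_derivative
     inner (F (W' h j t)) (G (R h (U t k))) + inner (F (R h (U t j))) (G (W' h k t))) (at t within {0..})"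
proof -
  have "((\<lambda>s. inner (F (R h (U s j))) (G (R h (U s k)))) has_vector_derivative
     inner (F (R h (U t j))) (G (W' h k t)) + inner (F (W' h j t)) (G (R h (U t k)))) (at t within {0..})"
    by (intro bounded_bilinear.has_vector_derivative[OF bounded_bilinear_inner]
        bounded_linear.has_vector_derivative[OF F] bounded_linear.has_vector_derivative[OF G] W_deriv h t)
  thus ?thesis by (simp add: has_real_derivative_iff_has_vector_derivative add.commute)
qed

lemma energy_deriv:
  assumes h: "0 < h" "h < h0" and t: "0 \<le> t" and G: "bounded_linear G"
  shows "(energy G h N has_real_derivative
     (\<Sum>k<N. (1 - real k / real N) * inner (G (W' h k t)) (G (R h (U t k))))) (at t within {0..})"
proof -
  have "((\<lambda>t. (norm (G (R h (U t k))))\<^sup>2) has_real_derivative 2 * inner (G (W' h k t)) (G (R h (U t k)))) (at t within {0..})" for k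
    unfolding power2_norm_eq_inner
    by (rule DERIV_cong[OF inner_W_deriv[OF h t G G]]) (simp add: inner_commute)
  hence "((\<lambda>t. 1 / 2 * (\<Sum>k<N. (1 - real k / real N) * (norm (G (R h (U t k))))\<^sup>2)) has_real_derivative
     1 / 2 * (\<Sum>k<N. (1 - real k / real N) * (2 * inner (G (W' h k t)) (G (R h (U t k)))))) (at t within {0..})"
    by (intro DERIV_cmult DERIV_sum)
  thus ?thesis
    unfolding energy_def[abs_def] by (rule DERIV_cong) (simp add: sum_distrib_left)
qed

text \<open>The damping of the modes survives with half its strength; the other half absorbs the commutator
\<open>\<gamma>\<close> of \<open>G R\<^sub>h\<close> with \<open>b\<close>, whose coefficients grow like \<open>sqrt k\<close> too. Mode \<open>0\<close> is not damped, so
its commutator term is left over. The last term is the error of the cut-off.\<close>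

lemma energy_rate:
  fixes G :: "'a \<Rightarrow> 'a" and g \<gamma> :: real
  assumes h: "0 < h" "h < h0" and t: "0 \<le> t" and N: "N > 0"
    and G: "bounded_linear G"
    and GR: "\<And>u. G (R h u) = R h (G u)" and G\<delta>: "\<And>u. G (\<delta> h u) = \<delta> h (G u)"
    and g: "\<And>u. norm (G u) \<le> g * norm u" "g \<ge> 0"
    and \<gamma>: "\<And>u. norm (G (R h (b u)) - b (G (R h u))) \<le> \<gamma> * norm u" "\<gamma> \<ge> 0"
  shows "(\<Sum>k<N. (1 - real k / real N) * inner (G (W' h k t)) (G (R h (U t k))))
     \<le> - 1 / (2 * \<tau>) * (\<Sum>k<N. (1 - real k / real N) * real k * (norm (G (R h (U t k))))\<^sup>2)
       + 4 * \<tau> * \<gamma>\<^sup>2 / \<epsilon>\<^sup>2 * mass2 t + \<gamma> / \<epsilon> * norm (U t 1) * norm (G (R h (U t 0)))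
       + (r * g\<^sup>2 / h + B * g\<^sup>2) / (\<epsilon> * sqrt (real N)) * mass2 t"
proof -
  define X where "X = (\<lambda>k. G (R h (U t k)))"
  define Q where "Q = (\<lambda>u. G (R h (b u)) - b (G (R h u)))"
  \<comment> \<open>The flux \<open>p k\<close> passes between the modes \<open>k - 1\<close> and \<open>k\<close>: by skew-adjointness one gains what the other loses.\<close>
  define a where "a = (\<lambda>k. inner (b (X (k - 1))) (X k) - r * inner (\<delta> h (G (U t (k - 1)))) (X k))"
  define p where "p = (\<lambda>k. sqrt (real k) * a k)"
  define K where "K = r * g\<^sup>2 / h + B * g\<^sup>2"
  define n where "n = (\<lambda>k. norm (U t k))"
  define c where "c = \<tau> * \<gamma>\<^sup>2 / \<epsilon>\<^sup>2"
  have K0: "K \<ge> 0" unfolding K_def using r_pos B_nonneg h by simp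
  have c0: "c \<ge> 0" unfolding c_def using \<tau>_pos by simp
  interpret G: bounded_linear G by (rule G)
  interpret bb: bounded_linear b by (rule b_bl)
  have Rnonneg: "norm (R h u) \<le> norm u" for u by (rule R_norm[OF h])
  have X_le: "norm (X k) \<le> g * n k" for k
    using g(1)[of "R h (U t k)"] mult_left_mono[OF Rnonneg[of "U t k"] g(2)] unfolding X_def n_def by linarith
  have sw: "inner (\<delta> h u) (R h v) = - inner (\<delta> h v) (R h u)" for u v
    using \<delta>_anti[OF h, of u "R h v"] R_\<delta>[OF h, of v] R_sym[OF h, of u "\<delta> h v"] by (simp add: inner_commute)
  have split: "inner (G (W' h k t)) (X k) = 1 / \<epsilon> * (p k - p (Suc k))
      + 1 / \<epsilon> * (sqrt (real k) * inner (Q (U t (k - 1))) (X k) - sqrt (real (k + 1)) * inner (Q (U t (k + 1))) (X k))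
      - real k / \<tau> * (norm (X k))\<^sup>2" for k
  proof -
    have s1: "a (Suc k) = inner (b (X (Suc k))) (X k) + r * inner (\<delta> h (G (U t (Suc k)))) (X k)"
      unfolding a_def X_def GR using sw[of "G (U t k)" "G (U t (Suc k))"]
        b_sym[of "R h (G (U t k))" "R h (G (U t (Suc k)))"]
      by (simp add: inner_commute)
    have q: "inner (Q u) (X k) + inner (b (G (R h u))) (X k) = inner (G (R h (b u))) (X k)" for u
      by (simp add: Q_def inner_diff_left)
    have "inner (G (W' h k t)) (X k) = 1 / \<epsilon> * (sqrt (real k) * (inner (G (R h (b (U t (k - 1))))) (X k) - r * inner (G (\<delta> h (U t (k - 1)))) (X k))
       - sqrt (real (k + 1)) * (inner (G (R h (b (U t (k + 1))))) (X k) + r * inner (G (\<delta> h (U t (k + 1)))) (X k)))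
     - (real k / \<tau>) * inner (X k) (X k)"
      unfolding W'_def by (simp add: G.diff G.scaleR G.add inner_simps X_def)
    thus ?thesis unfolding p_def s1 unfolding a_def q[symmetric] G\<delta>
      by (simp add: X_def power2_norm_eq_inner algebra_simps)
  qed
  have src: "1 / \<epsilon> * (sqrt (real k) * inner (Q (U t (k - 1))) (X k) - sqrt (real (k + 1)) * inner (Q (U t (k + 1))) (X k))
      - real k / \<tau> * (norm (X k))\<^sup>2
     \<le> - (real k / (2 * \<tau>)) * (norm (X k))\<^sup>2 + c * ((n (k - 1))\<^sup>2 + 2 * (n (k + 1))\<^sup>2)
       + (if k = 0 then \<gamma> / \<epsilon> * n 1 * norm (X 0) else 0)" for k
  proof -
    have q: "\<bar>inner (Q (U t j)) (X k)\<bar> \<le> \<gamma> * n j * norm (X k)" for j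
      using Cauchy_Schwarz_ineq2[of "Q (U t j)" "X k"] \<gamma>(1)[of "U t j"] unfolding Q_def n_def
      by (meson mult_right_mono norm_ge_zero order_trans)
    show ?thesis
    proof (cases "k = 0")
      case True
      have "1 / \<epsilon> * (- inner (Q (U t 1)) (X 0)) \<le> 1 / \<epsilon> * (\<gamma> * n 1 * norm (X 0))"
        using q[of 1] \<epsilon>_pos True by (intro mult_left_mono) auto
      moreover have "0 \<le> c * ((n 0)\<^sup>2 + 2 * (n 1)\<^sup>2)" using c0 by simp
      ultimately show ?thesis using True by simp
    next
      case False
      define x where "x = norm (X k)"
      define y where "y = n (k - 1) + sqrt 2 * n (k + 1)"
      have y2: "y\<^sup>2 \<le> 2 * ((n (k - 1))\<^sup>2 + 2 * (n (k + 1))\<^sup>2)"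
        using sum_squares_bound[of "n (k - 1)" "sqrt 2 * n (k + 1)"]
        unfolding y_def by (simp add: power2_sum power_mult_distrib)
      \<comment> \<open>For \<open>k > 0\<close> the factor \<open>sqrt (k + 1)\<close> is comparable to \<open>sqrt k\<close>, hence within reach of the damping.\<close>
      have rt: "sqrt (real (k + 1)) \<le> sqrt (real k) * sqrt 2"
        unfolding real_sqrt_mult[symmetric] using False by (simp add: real_sqrt_le_iff)
      have "sqrt (real k) * inner (Q (U t (k - 1))) (X k) - sqrt (real (k + 1)) * inner (Q (U t (k + 1))) (X k)
         \<le> sqrt (real k) * (\<gamma> * n (k - 1) * x) + sqrt (real (k + 1)) * (\<gamma> * n (k + 1) * x)"
        using mult_left_mono[OF q[of "k - 1"], of "sqrt (real k)"] mult_left_mono[OF q[of "k + 1"], of "sqrt (real (k + 1))"]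
        unfolding x_def by (smt (verit) abs_ge_minus_self abs_ge_self mult_left_mono real_sqrt_ge_zero of_nat_0_le_iff mult_minus_right)
      also have "\<dots> \<le> sqrt (real k) * (\<gamma> * n (k - 1) * x) + (sqrt (real k) * sqrt 2) * (\<gamma> * n (k + 1) * x)"
        using rt \<gamma>(2) by (intro add_left_mono mult_right_mono) (auto simp: x_def n_def)
      also have "\<dots> = (sqrt (real k) * x) * (\<gamma> * y)" by (simp add: y_def algebra_simps)
      finally have 1: "1 / \<epsilon> * (sqrt (real k) * inner (Q (U t (k - 1))) (X k) - sqrt (real (k + 1)) * inner (Q (U t (k + 1))) (X k))
         \<le> (sqrt (real k) * x) * (\<gamma> * y) / \<epsilon>"
        using \<epsilon>_pos by (simp add: divide_right_mono)
      have "2 * (sqrt (real k) * x / sqrt \<tau>) * (sqrt \<tau> * \<gamma> * y / \<epsilon>) \<le> (sqrt (real k) * x / sqrt \<tau>)\<^sup>2 + (sqrt \<tau> * \<gamma> * y / \<epsilon>)\<^sup>2"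
        by (rule sum_squares_bound)
      hence 2: "2 * ((sqrt (real k) * x) * (\<gamma> * y) / \<epsilon>) \<le> real k / \<tau> * x\<^sup>2 + c * y\<^sup>2"
        using \<tau>_pos by (simp add: c_def power_mult_distrib power_divide field_simps)
      have "c * y\<^sup>2 \<le> c * (2 * ((n (k - 1))\<^sup>2 + 2 * (n (k + 1))\<^sup>2))" using y2 c0 by (rule mult_left_mono)
      moreover have "- (real k / (2 * \<tau>)) * x\<^sup>2 = 1 / 2 * (real k / \<tau> * x\<^sup>2) - real k / \<tau> * x\<^sup>2" 
        by (simp add: field_simps)
      ultimately show ?thesis using 1 2 False unfolding x_def[symmetric] by (simp only: if_False)
    qed
  qed
  have a_le: "\<bar>a (Suc k)\<bar> \<le> K * (((n k)\<^sup>2 + (n (Suc k))\<^sup>2) / 2)" for k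
  proof -
    have "norm (b (X k)) \<le> B * (g * n k)"
      using b_norm[of "X k"] mult_left_mono[OF X_le[of k] B_nonneg] by linarith
    hence 1: "norm (b (X k)) * norm (X (Suc k)) \<le> (B * (g * n k)) * (g * n (Suc k))"
      by (intro mult_mono X_le) (use B_nonneg g in \<open>auto simp: n_def\<close>)
    have "norm (\<delta> h (G (U t k))) \<le> (g * n k) / h"
      using \<delta>_norm[OF h, of "G (U t k)"] divide_right_mono[OF g(1)[of "U t k"], of h] h unfolding n_def by linarith
    hence 2: "norm (\<delta> h (G (U t k))) * norm (X (Suc k)) \<le> ((g * n k) / h) * (g * n (Suc k))"
      by (intro mult_mono X_le) (use h g in \<open>auto simp: n_def\<close>)
    have "\<bar>a (Suc k)\<bar> \<le> \<bar>inner (b (X k)) (X (Suc k))\<bar> + r * \<bar>inner (\<delta> h (G (U t k))) (X (Suc k))\<bar>"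
      unfolding a_def using r_pos by (simp add: abs_mult[symmetric]) (metis abs_mult abs_of_pos abs_triangle_ineq4)
    also have "\<dots> \<le> (B * (g * n k)) * (g * n (Suc k)) + r * (((g * n k) / h) * (g * n (Suc k)))"
      using order_trans[OF Cauchy_Schwarz_ineq2 1] mult_left_mono[OF order_trans[OF Cauchy_Schwarz_ineq2 2], of r] r_pos
      by simp
    also have "\<dots> = K * (n k * n (Suc k))" by (simp add: K_def power2_eq_square field_simps)
    also have "\<dots> \<le> K * (((n k)\<^sup>2 + (n (Suc k))\<^sup>2) / 2)"
      using sum_squares_bound[of "n k" "n (Suc k)"] K0 by (intro mult_left_mono) auto
    finally show ?thesis .
  qed
  have n_sum: "(\<Sum>k\<in>A. (n k)\<^sup>2) \<le> mass2 t" if "finite A" for A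
    unfolding mass2_def n_def using that by (intro sum_le_suminf U_summable t) auto
  have n_sum1: "(\<Sum>k<N. (n (Suc k))\<^sup>2) \<le> mass2 t"
    using n_sum[of "Suc ` {..<N}"] by (simp add: sum.reindex)
  have n_sum2: "(\<Sum>k<N. (n (k - 1))\<^sup>2) \<le> 2 * mass2 t"
  proof -
    have "(\<Sum>k<N. (n (k - 1))\<^sup>2) \<le> (\<Sum>k<Suc N. (n (k - 1))\<^sup>2)" by (rule sum_mono2) auto
    also have "\<dots> = (n 0)\<^sup>2 + (\<Sum>k<N. (n k)\<^sup>2)" by (subst sum.lessThan_Suc_shift) simp
    also have "\<dots> \<le> 2 * mass2 t" using n_sum[of "{0}"] n_sum[of "{..<N}"] by simp
    finally show ?thesis .
  qed
  have chi: "0 \<le> 1 - real k / real N" "1 - real k / real N \<le> 1" if "k < N" for k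
    using that by auto
  \<comment> \<open>Each flux is of order \<open>sqrt N\<close>, and the weights contribute \<open>1 / N\<close>.\<close>
  have tele: "(\<Sum>k<N. (1 - real k / real N) * (p k - p (Suc k))) \<le> K * mass2 t / sqrt (real N)"
  proof -
    have "(\<Sum>k<N. (1 - real k / real N) * (p k - p (Suc k))) = 1 / real N * (\<Sum>k<N. (real N - real k) * (p k - p (Suc k)))"
      unfolding sum_distrib_left using N by (intro sum.cong) (auto simp: field_simps)
    also have "\<dots> = 1 / real N * (\<Sum>k<N. - p (Suc k))"
      unfolding sum_triangular_telescope by (simp add: p_def sum_negf)
    also have "(\<Sum>k<N. - p (Suc k)) \<le> (\<Sum>k<N. sqrt (real N) * (K * (((n k)\<^sup>2 + (n (Suc k))\<^sup>2) / 2)))"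
    proof (rule sum_mono)
      fix k assume "k \<in> {..<N}"
      hence "sqrt (real (Suc k)) * \<bar>a (Suc k)\<bar> \<le> sqrt (real N) * (K * (((n k)\<^sup>2 + (n (Suc k))\<^sup>2) / 2))"
        by (intro mult_mono a_le) auto
      moreover have "- p (Suc k) \<le> sqrt (real (Suc k)) * \<bar>a (Suc k)\<bar>"
        unfolding p_def by (metis abs_ge_minus_self abs_mult abs_of_nonneg of_nat_0_le_iff real_sqrt_ge_zero)
      ultimately show "- p (Suc k) \<le> sqrt (real N) * (K * (((n k)\<^sup>2 + (n (Suc k))\<^sup>2) / 2))" by linarith
    qed
    also have "(\<Sum>k<N. sqrt (real N) * (K * (((n k)\<^sup>2 + (n (Suc k))\<^sup>2) / 2)))
        = sqrt (real N) * K * (((\<Sum>k<N. (n k)\<^sup>2) + (\<Sum>k<N. (n (Suc k))\<^sup>2)) / 2)"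
      by (simp add: sum_distrib_left sum_divide_distrib sum.distrib[symmetric] algebra_simps)
    also have "\<dots> \<le> sqrt (real N) * K * mass2 t"
      using n_sum[of "{..<N}"] n_sum1 K0 by (intro mult_left_mono) auto
    finally have "(\<Sum>k<N. (1 - real k / real N) * (p k - p (Suc k))) \<le> 1 / real N * (sqrt (real N) * K * mass2 t)"
      using N by (simp add: divide_right_mono)
    also have "\<dots> = K * mass2 t / sqrt (real N)"
      using N by (simp add: field_simps)
    finally show ?thesis .
  qed
  have "(\<Sum>k<N. (1 - real k / real N) * inner (G (W' h k t)) (X k))
     \<le> (\<Sum>k<N. (1 - real k / real N) * (1 / \<epsilon> * (p k - p (Suc k)) - (real k / (2 * \<tau>)) * (norm (X k))\<^sup>2)
          + (c * ((n (k - 1))\<^sup>2 + 2 * (n (k + 1))\<^sup>2) + (if k = 0 then \<gamma> / \<epsilon> * n 1 * norm (X 0) else 0)))"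
  proof (rule sum_mono)
    fix k assume k: "k \<in> {..<N}"
    define q where "q = c * ((n (k - 1))\<^sup>2 + 2 * (n (k + 1))\<^sup>2) + (if k = 0 then \<gamma> / \<epsilon> * n 1 * norm (X 0) else 0)"
    have q0: "q \<ge> 0" unfolding q_def using c0 \<gamma> \<epsilon>_pos by (auto simp: n_def)
    have "(1 - real k / real N) * inner (G (W' h k t)) (X k)
       \<le> (1 - real k / real N) * (1 / \<epsilon> * (p k - p (Suc k)) - (real k / (2 * \<tau>)) * (norm (X k))\<^sup>2 + q)"
      using src[of k] split[of k] chi[of k] k unfolding q_def by (intro mult_left_mono) auto
    also have "\<dots> \<le> (1 - real k / real N) * (1 / \<epsilon> * (p k - p (Suc k)) - (real k / (2 * \<tau>)) * (norm (X k))\<^sup>2) + q"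
      using chi[of k] k q0 mult_right_mono[of "1 - real k / real N" 1 q] by (simp add: ring_distribs)
    finally show "(1 - real k / real N) * inner (G (W' h k t)) (X k)
       \<le> (1 - real k / real N) * (1 / \<epsilon> * (p k - p (Suc k)) - (real k / (2 * \<tau>)) * (norm (X k))\<^sup>2)
         + (c * ((n (k - 1))\<^sup>2 + 2 * (n (k + 1))\<^sup>2) + (if k = 0 then \<gamma> / \<epsilon> * n 1 * norm (X 0) else 0))"
      unfolding q_def .
  qed
  also have "\<dots> = 1 / \<epsilon> * (\<Sum>k<N. (1 - real k / real N) * (p k - p (Suc k)))
      - 1 / (2 * \<tau>) * (\<Sum>k<N. (1 - real k / real N) * real k * (norm (X k))\<^sup>2)
      + c * ((\<Sum>k<N. (n (k - 1))\<^sup>2) + 2 * (\<Sum>k<N. (n (Suc k))\<^sup>2)) + \<gamma> / \<epsilon> * n 1 * norm (X 0)"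
  proof -
    define ct where "ct k = 1 - real k / real N" for k
    have "(\<Sum>k<N. ct k * (1 / \<epsilon> * (p k - p (Suc k)) - (real k / (2 * \<tau>)) * (norm (X k))\<^sup>2))
       = (\<Sum>k<N. 1 / \<epsilon> * (ct k * (p k - p (Suc k))) - 1 / (2 * \<tau>) * (ct k * real k * (norm (X k))\<^sup>2))"
      by (intro sum.cong) (auto simp: field_simps)
    moreover have "(\<Sum>k<N. if k = 0 then \<gamma> / \<epsilon> * n 1 * norm (X 0) else 0) = \<gamma> / \<epsilon> * n 1 * norm (X 0)"
      using N by (simp add: sum.delta)
    ultimately show ?thesis
      unfolding ct_def[symmetric] by (simp add: sum.distrib sum_subtractf sum_distrib_left[symmetric] sum_divide_distrib)
  qed
  also have "\<dots> \<le> 1 / \<epsilon> * (K * mass2 t / sqrt (real N))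
      - 1 / (2 * \<tau>) * (\<Sum>k<N. (1 - real k / real N) * real k * (norm (X k))\<^sup>2)
      + c * (4 * mass2 t) + \<gamma> / \<epsilon> * n 1 * norm (X 0)"
    using tele n_sum1 n_sum2 c0 \<epsilon>_pos by (intro add_mono diff_mono mult_left_mono order_refl) auto
  also have "1 / \<epsilon> * (K * mass2 t / sqrt (real N)) = K / (\<epsilon> * sqrt (real N)) * mass2 t" by simp
  also have "c * (4 * mass2 t) = 4 * \<tau> * \<gamma>\<^sup>2 / \<epsilon>\<^sup>2 * mass2 t" by (simp add: c_def)
  finally show ?thesis unfolding X_def n_def K_def by linarith
qed

end

section \<open>Coercivity in the undamped mode\<close>

text \<open>\<open>S\<close> is a right inverse of \<open>- r \<partial> - b\<close> up to a rank-one correction, which drops out on vectors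
orthogonal to the kernel vector \<open>m\<close> of \<open>r \<partial> - b\<close>. The operators \<open>S1\<close> and \<open>S1'\<close> are the derivatives
of \<open>S\<close> and of its adjoint \<open>S'\<close>.\<close>

locale coercive_calculus = regularised_calculus R \<delta> b r \<beta> B h0
  for R \<delta> :: "real \<Rightarrow> 'a::real_inner \<Rightarrow> 'a" and b r \<beta> B h0 +
  fixes S S1 S' S1' :: "'a \<Rightarrow> 'a" and m e :: 'a and c :: real
  assumes c_pos: "c > 0"
    and S_bl: "bounded_linear S"
    and S_adj: "\<And>u v. inner (S u) v = inner u (S' v)"
    and S_norm: "\<And>u. norm (S u) \<le> c * norm u" and S1_norm: "\<And>u. norm (S1 u) \<le> c * norm u"
    and S'_norm: "\<And>u. norm (S' u) \<le> c * norm u" and S1'_norm: "\<And>u. norm (S1' u) \<le> c * norm u"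
    and \<delta>_S: "\<And>h u. 0 < h \<Longrightarrow> h < h0 \<Longrightarrow> \<delta> h (S u) = R h (S1 u)"
    and \<delta>_S': "\<And>h u. 0 < h \<Longrightarrow> h < h0 \<Longrightarrow> \<delta> h (S' u) = R h (S1' u)"
    and S_eq: "\<And>h u. 0 < h \<Longrightarrow> h < h0 \<Longrightarrow>
       r *\<^sub>R S1 (R h u) + b (S (R h u)) = inner (R h u) m *\<^sub>R e - R h u"
    and R_m: "((\<lambda>h. R h m) \<longlongrightarrow> m) (at_right 0)"
begin

text \<open>\<open>ell\<close> bounds \<open>S\<close> and the operators \<open>r S1 \<plusminus> b S\<close> of the cross terms. With \<open>gap * ell\<^sup>2 = 1 / 16\<close>, Young's
inequality spends only half of the damping \<open>1 / (2 * \<tau>)\<close> on the cross terms.\<close>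

definition ell :: real where "ell = (r + B + 1) * (c + 1)"
definition gap :: real where "gap = 1 / (16 * ell\<^sup>2)"

lemma ell_ge: "1 \<le> ell" "c \<le> ell" "(r + B) * c \<le> ell"
proof -
  have "1 * 1 \<le> ell" "1 * c \<le> ell" "(r + B) * c \<le> ell"
    unfolding ell_def using r_pos B_nonneg c_pos by (intro mult_mono; simp)+
  thus "1 \<le> ell" "c \<le> ell" "(r + B) * c \<le> ell" by auto
qed

lemma gap_pos: "0 < gap" "gap \<le> 1 / 16" "gap * ell\<^sup>2 = 1 / 16"
proof -
  have "1 \<le> ell\<^sup>2" using ell_ge(1) by (simp add: one_le_power)
  thus "0 < gap" "gap \<le> 1 / 16" "gap * ell\<^sup>2 = 1 / 16"
    unfolding gap_def by (auto simp: divide_le_eq_1)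
qed

end

locale coercive_flow = hermite_flow R \<delta> b r \<beta> B h0 U \<epsilon> \<tau> + coercive_calculus R \<delta> b r \<beta> B h0 S S1 S' S1' m e c
  for R \<delta> :: "real \<Rightarrow> 'a::real_inner \<Rightarrow> 'a" and b r \<beta> B h0 U \<epsilon> \<tau> S S1 S' S1' m e c +
  fixes \<tau>0 :: real
  assumes \<tau>0_pos: "\<tau>0 > 0" and \<tau>_le: "\<tau> / \<epsilon> \<le> \<tau>0"
    and mean0: "\<And>t. 0 \<le> t \<Longrightarrow> inner (U t 0) m = 0"
    and R_U: "\<And>t k. 0 \<le> t \<Longrightarrow> ((\<lambda>h. R h (U t k)) \<longlongrightarrow> U t k) (at_right 0)"
begin

text \<open>The weight of the cross term. Relative to the damping \<open>1 / \<tau>\<close> it must satisfy both \<open>wt / \<epsilon> \<lesssim> 1 / \<tau>\<close>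
and \<open>wt * \<epsilon> / \<tau>\<^sup>2 \<lesssim> 1 / \<tau>\<close>, that is \<open>wt \<lesssim> \<epsilon> / \<tau>\<close> and \<open>wt \<lesssim> \<tau> / \<epsilon>\<close>; the denominator takes care of
ratios \<open>\<tau> / \<epsilon>\<close> that are large.\<close>

definition wt :: real where "wt = gap * (\<tau> / \<epsilon>) / (1 + \<tau>0\<^sup>2)"

lemma wt_bounds: "0 < wt" "wt / \<epsilon> \<le> gap / \<tau>" "wt * \<epsilon> / \<tau>\<^sup>2 \<le> gap / \<tau>" "wt \<le> gap"
proof -
  have p: "0 < 1 + \<tau>0\<^sup>2" by (simp add: add_pos_nonneg)
  show "0 < wt" unfolding wt_def using p gap_pos(1) \<epsilon>_pos \<tau>_pos by simp
  have q: "(\<tau> / \<epsilon>)\<^sup>2 \<le> 1 + \<tau>0\<^sup>2"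
    using power_mono[OF \<tau>_le, of 2] \<epsilon>_pos \<tau>_pos by simp
  have "wt / \<epsilon> = gap / \<tau> * ((\<tau> / \<epsilon>)\<^sup>2 / (1 + \<tau>0\<^sup>2))"
    unfolding wt_def using \<epsilon>_pos \<tau>_pos by (simp add: power2_eq_square field_simps)
  also have "\<dots> \<le> gap / \<tau> * 1" using q p gap_pos(1) \<tau>_pos by (intro mult_left_mono) auto
  finally show "wt / \<epsilon> \<le> gap / \<tau>" by simp
  have "wt * \<epsilon> / \<tau>\<^sup>2 = gap / \<tau> * (1 / (1 + \<tau>0\<^sup>2))"
    unfolding wt_def using \<epsilon>_pos \<tau>_pos by (simp add: power2_eq_square)
  also have "\<dots> \<le> gap / \<tau> * 1" using p gap_pos(1) \<tau>_pos by (intro mult_left_mono) auto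
  finally show "wt * \<epsilon> / \<tau>\<^sup>2 \<le> gap / \<tau>" by simp
  have "\<tau> / \<epsilon> \<le> 1 + \<tau>0\<^sup>2"
    using \<tau>_le sum_squares_bound[of 1 \<tau>0] \<tau>0_pos by (simp add: power2_eq_square)
  hence "gap * ((\<tau> / \<epsilon>) / (1 + \<tau>0\<^sup>2)) \<le> gap * 1"
    using gap_pos(1) by (intro mult_left_mono divide_le_eq_1_pos[OF p, THEN iffD2]) simp_all
  thus "wt \<le> gap" by (simp add: wt_def)
qed

text \<open>A vector \<open>\<phi>\<close> whose difference quotient is \<open>R\<^sub>h \<phi>1\<close> has the derivative \<open>\<phi>1\<close>, so the equation of
\<open>R\<^sub>h U\<^sub>k\<close> may be tested against it with the exact operators; the error is the commutator of \<open>R\<^sub>h\<close>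
with \<open>b\<close>.\<close>

lemma inner_W'_approx:
  assumes h: "0 < h" "h < h0" and t: "0 \<le> t" and \<phi>: "\<delta> h \<phi> = R h \<phi>1"
  shows "\<bar>inner (W' h k t) \<phi> - (1 / \<epsilon> * (sqrt (real k) * inner (R h (U t (k - 1))) (r *\<^sub>R \<phi>1 + b \<phi>)
           + sqrt (real (k + 1)) * inner (R h (U t (k + 1))) (r *\<^sub>R \<phi>1 - b \<phi>))
         - real k / \<tau> * inner (R h (U t k)) \<phi>)\<bar>
     \<le> \<beta> * h / \<epsilon> * norm \<phi> * (sqrt (real k) * norm (U t (k - 1)) + sqrt (real (k + 1)) * norm (U t (k + 1)))"
proof -
  define q where "q = b (R h \<phi>) - R h (b \<phi>)"
  have qn: "norm q \<le> \<beta> * h * norm \<phi>" unfolding q_def using R_b[OF h, of \<phi>] by (simp add: norm_minus_commute)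
  have i: "\<bar>inner u q\<bar> \<le> norm u * (\<beta> * h * norm \<phi>)" for u
    using Cauchy_Schwarz_ineq2[of u q] qn by (meson mult_left_mono norm_ge_zero order_trans)
  have "inner (W' h k t) \<phi> - (1 / \<epsilon> * (sqrt (real k) * inner (R h (U t (k - 1))) (r *\<^sub>R \<phi>1 + b \<phi>)
           + sqrt (real (k + 1)) * inner (R h (U t (k + 1))) (r *\<^sub>R \<phi>1 - b \<phi>))
         - real k / \<tau> * inner (R h (U t k)) \<phi>)
      = 1 / \<epsilon> * (sqrt (real k) * inner (U t (k - 1)) q - sqrt (real (k + 1)) * inner (U t (k + 1)) q)"
    unfolding W'_def q_def
    by (simp add: inner_simps R_sym[OF h] \<delta>_anti[OF h] b_sym \<phi> algebra_simps)
  also have "\<bar>\<dots>\<bar> \<le> 1 / \<epsilon> * (sqrt (real k) * (norm (U t (k - 1)) * (\<beta> * h * norm \<phi>))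
      + sqrt (real (k + 1)) * (norm (U t (k + 1)) * (\<beta> * h * norm \<phi>)))"
  proof -
    have "\<bar>sqrt (real k) * inner (U t (k - 1)) q - sqrt (real (k + 1)) * inner (U t (k + 1)) q\<bar>
       \<le> sqrt (real k) * \<bar>inner (U t (k - 1)) q\<bar> + sqrt (real (k + 1)) * \<bar>inner (U t (k + 1)) q\<bar>"
      by (rule order_trans[OF abs_triangle_ineq4]) (simp add: abs_mult)
    also have "\<dots> \<le> sqrt (real k) * (norm (U t (k - 1)) * (\<beta> * h * norm \<phi>))
      + sqrt (real (k + 1)) * (norm (U t (k + 1)) * (\<beta> * h * norm \<phi>))"
      by (intro add_mono mult_left_mono i) auto
    finally show ?thesis using \<epsilon>_pos by (simp add: abs_mult divide_right_mono)
  qed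
  also have "\<dots> = \<beta> * h / \<epsilon> * norm \<phi> * (sqrt (real k) * norm (U t (k - 1)) + sqrt (real (k + 1)) * norm (U t (k + 1)))"
    by (simp add: algebra_simps)
  finally show ?thesis .
qed

lemma norm_mult_le_mass2: "0 \<le> t \<Longrightarrow> norm (U t j) * norm (U t k) \<le> mass2 t"
  using sum_squares_bound[of "norm (U t j)" "norm (U t k)"] norm_le_mass2[of t j] norm_le_mass2[of t k] by linarith

text \<open>The errors of the cross term at scale \<open>h\<close>: the commutators, and the fact that \<open>R\<^sub>h U\<^sub>0\<close> is orthogonal
to \<open>m\<close> only in the limit.\<close>

definition \<omega> :: "real \<Rightarrow> real" where "\<omega> h = (4 * \<beta> * h * c + norm e * norm (R h m - m)) / \<epsilon>"

text \<open>The coercive contribution \<open>- (w 0)\<^sup>2 / \<epsilon>\<close> is the pairing of \<open>R\<^sub>h U\<^sub>0\<close> with \<open>(r S1 + b S) R\<^sub>h U\<^sub>0\<close>, which equals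
\<open>- R\<^sub>h U\<^sub>0\<close> up to the rank-one correction.\<close>

lemma cross_rate:
  assumes h: "0 < h" "h < h0" and t: "0 \<le> t"
  defines "w \<equiv> \<lambda>k. norm (R h (U t k))"
  shows "inner (W' h 1 t) (S (R h (U t 0))) + inner (R h (U t 1)) (S (W' h 0 t))
    \<le> 1 / \<epsilon> * (- (w 0)\<^sup>2 + sqrt 2 * ell * w 2 * w 0 + ell * (w 1)\<^sup>2) + ell / \<tau> * w 1 * w 0 + \<omega> h * mass2 t"
proof -
  define V where "V = (\<lambda>k. R h (U t k))"
  have wV: "w k = norm (V k)" for k by (simp add: w_def V_def)
  have wn: "w k \<le> norm (U t k)" for k unfolding w_def by (rule R_norm[OF h])
  have w0: "0 \<le> w k" for k by (simp add: w_def)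
  have n0: "norm (U t j) * norm (U t k) \<le> mass2 t" for j k by (rule norm_mult_le_mass2[OF t])
  have wnm: "w j * norm (U t k) \<le> mass2 t" for j k
    using mult_right_mono[OF wn[of j], of "norm (U t k)"] n0[of j k] by simp
  have bh: "0 \<le> \<beta> * h / \<epsilon>" using \<beta>_nonneg h \<epsilon>_pos by simp
  have comb: "norm (r *\<^sub>R x + b y) \<le> ell * z" "norm (r *\<^sub>R x - b y) \<le> ell * z" 
    if "norm x \<le> c * z" "norm y \<le> c * z" "0 \<le> z" for x y z
  proof -
    have "norm (r *\<^sub>R x) \<le> r * (c * z)" using that r_pos by simp
    moreover have "norm (b y) \<le> B * (c * z)"
      using b_norm[of y] mult_left_mono[OF that(2) B_nonneg] by linarith
    moreover have "r * (c * z) + B * (c * z) \<le> ell * z"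
      using mult_right_mono[OF ell_ge(3) that(3)] by (simp add: algebra_simps)
    ultimately show "norm (r *\<^sub>R x + b y) \<le> ell * z" "norm (r *\<^sub>R x - b y) \<le> ell * z"
      using norm_triangle_ineq[of "r *\<^sub>R x" "b y"] norm_triangle_ineq4[of "r *\<^sub>R x" "b y"] by linarith+
  qed
  \<comment> \<open>The time derivative of mode \<open>1\<close>: its coupling with mode \<open>0\<close> is the coercive contribution.\<close>
  have A1: "inner (W' h 1 t) (S (V 0)) \<le> 1 / \<epsilon> * (inner (V 0) (r *\<^sub>R S1 (V 0) + b (S (V 0)))
           + sqrt 2 * inner (V 2) (r *\<^sub>R S1 (V 0) - b (S (V 0)))) - 1 / \<tau> * inner (V 1) (S (V 0))
         + \<beta> * h / \<epsilon> * norm (S (V 0)) * (norm (U t 0) + sqrt 2 * norm (U t 2))"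
    using inner_W'_approx[OF h t \<delta>_S[OF h, of "V 0"], of 1] unfolding V_def
    by (simp flip: numeral_2_eq_2)
  have A2: "inner (V 0) (r *\<^sub>R S1 (V 0) + b (S (V 0))) \<le> - (w 0)\<^sup>2 + norm e * norm (R h m - m) * mass2 t"
  proof -
    have "inner (V 0) m = inner (U t 0) (R h m - m)"
      unfolding V_def using mean0[OF t] by (simp add: R_sym[OF h] inner_simps)
    hence "\<bar>inner (V 0) m\<bar> \<le> norm (U t 0) * norm (R h m - m)"
      using Cauchy_Schwarz_ineq2 by metis
    moreover have "\<bar>inner (V 0) e\<bar> \<le> norm (U t 0) * norm e"
      using Cauchy_Schwarz_ineq2[of "V 0" e] mult_right_mono[OF wn[of 0], of "norm e"] unfolding wV by simp
    ultimately have "\<bar>inner (V 0) m * inner (V 0) e\<bar> \<le> (norm (U t 0) * norm (R h m - m)) * (norm (U t 0) * norm e)"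
      unfolding abs_mult by (intro mult_mono) auto
    also have "\<dots> = norm e * norm (R h m - m) * (norm (U t 0) * norm (U t 0))" by simp
    also have "\<dots> \<le> norm e * norm (R h m - m) * mass2 t"
      by (intro mult_left_mono n0) auto
    finally have "inner (V 0) m * inner (V 0) e \<le> norm e * norm (R h m - m) * mass2 t" by linarith
    moreover have "r *\<^sub>R S1 (V 0) + b (S (V 0)) = inner (V 0) m *\<^sub>R e - V 0"
      unfolding V_def by (rule S_eq[OF h])
    ultimately show ?thesis by (simp add: inner_simps wV power2_norm_eq_inner)
  qed
  have A3: "sqrt 2 * inner (V 2) (r *\<^sub>R S1 (V 0) - b (S (V 0))) \<le> sqrt 2 * ell * w 2 * w 0"
  proof -
    have "norm (r *\<^sub>R S1 (V 0) - b (S (V 0))) \<le> ell * w 0"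
      unfolding wV by (intro comb S1_norm S_norm) auto
    hence "inner (V 2) (r *\<^sub>R S1 (V 0) - b (S (V 0))) \<le> w 2 * (ell * w 0)"
      unfolding wV by (meson mult_left_mono norm_cauchy_schwarz norm_ge_zero order_trans)
    thus ?thesis by (simp add: mult_ac)
  qed
  have A4: "- 1 / \<tau> * inner (V 1) (S (V 0)) \<le> ell / \<tau> * w 1 * w 0"
  proof -
    have "\<bar>inner (V 1) (S (V 0))\<bar> \<le> w 1 * (c * w 0)"
      unfolding wV by (meson Cauchy_Schwarz_ineq2 S_norm mult_left_mono norm_ge_zero order_trans)
    also have "\<dots> \<le> w 1 * (ell * w 0)" using ell_ge w0 by (intro mult_left_mono mult_right_mono) auto
    finally have "1 / \<tau> * (- inner (V 1) (S (V 0))) \<le> 1 / \<tau> * (w 1 * (ell * w 0))"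
      using \<tau>_pos by (intro mult_left_mono) auto
    thus ?thesis by (simp add: mult_ac)
  qed
  have A5: "\<beta> * h / \<epsilon> * norm (S (V 0)) * (norm (U t 0) + sqrt 2 * norm (U t 2)) \<le> \<beta> * h / \<epsilon> * (3 * c * mass2 t)"
  proof -
    have s2: "sqrt 2 \<le> 2" by (rule real_le_lsqrt) auto
    have "norm (S (V 0)) * (norm (U t 0) + sqrt 2 * norm (U t 2)) \<le> (c * w 0) * (norm (U t 0) + 2 * norm (U t 2))"
      using S_norm[of "V 0"] s2 c_pos w0[of 0] unfolding wV by (intro mult_mono add_left_mono mult_right_mono) auto
    also have "\<dots> = c * (w 0 * norm (U t 0) + 2 * (w 0 * norm (U t 2)))" by (simp add: algebra_simps)
    also have "\<dots> \<le> c * (3 * mass2 t)"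
      using wnm[of 0 0] wnm[of 0 2] c_pos by (intro mult_left_mono) auto
    finally have "\<beta> * h / \<epsilon> * (norm (S (V 0)) * (norm (U t 0) + sqrt 2 * norm (U t 2))) \<le> \<beta> * h / \<epsilon> * (c * (3 * mass2 t))"
      using bh by (intro mult_left_mono)
    thus ?thesis by (simp add: mult_ac)
  qed
  \<comment> \<open>The time derivative of mode \<open>0\<close> involves mode \<open>1\<close> only, once \<open>S\<close> is moved to the other side.\<close>
  have B1: "inner (W' h 0 t) (S' (V 1)) \<le> 1 / \<epsilon> * inner (V 1) (r *\<^sub>R S1' (V 1) - b (S' (V 1)))
         + \<beta> * h / \<epsilon> * norm (S' (V 1)) * norm (U t 1)"
    using inner_W'_approx[OF h t \<delta>_S'[OF h, of "V 1"], of 0] unfolding V_def by simp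
  have B2: "inner (V 1) (r *\<^sub>R S1' (V 1) - b (S' (V 1))) \<le> ell * (w 1)\<^sup>2"
  proof -
    have "norm (r *\<^sub>R S1' (V 1) - b (S' (V 1))) \<le> ell * w 1"
      unfolding wV by (intro comb S1'_norm S'_norm) auto
    hence "inner (V 1) (r *\<^sub>R S1' (V 1) - b (S' (V 1))) \<le> w 1 * (ell * w 1)"
      unfolding wV by (meson mult_left_mono norm_cauchy_schwarz norm_ge_zero order_trans)
    thus ?thesis by (simp add: power2_eq_square mult_ac)
  qed
  have B3: "\<beta> * h / \<epsilon> * norm (S' (V 1)) * norm (U t 1) \<le> \<beta> * h / \<epsilon> * (c * mass2 t)"
  proof -
    have "norm (S' (V 1)) * norm (U t 1) \<le> (c * w 1) * norm (U t 1)"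
      unfolding wV by (intro mult_right_mono S'_norm) auto
    also have "\<dots> = c * (w 1 * norm (U t 1))" by simp
    also have "\<dots> \<le> c * mass2 t" using wnm[of 1 1] c_pos by (intro mult_left_mono) auto
    finally show ?thesis using mult_left_mono[OF _ bh] by (simp add: mult.assoc)
  qed
  have C1: "inner (V 1) (S (W' h 0 t)) = inner (W' h 0 t) (S' (V 1))"
    using S_adj[of "W' h 0 t" "V 1"] by (simp add: inner_commute)
  have D1: "1 / \<epsilon> * (inner (V 0) (r *\<^sub>R S1 (V 0) + b (S (V 0))) + sqrt 2 * inner (V 2) (r *\<^sub>R S1 (V 0) - b (S (V 0))))
     \<le> 1 / \<epsilon> * (- (w 0)\<^sup>2 + norm e * norm (R h m - m) * mass2 t + sqrt 2 * ell * w 2 * w 0)"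
    by (rule mult_left_mono[OF add_mono[OF A2 A3]]) (use \<epsilon>_pos in simp)
  have D2: "1 / \<epsilon> * inner (V 1) (r *\<^sub>R S1' (V 1) - b (S' (V 1))) \<le> 1 / \<epsilon> * (ell * (w 1)\<^sup>2)"
    using B2 \<epsilon>_pos by (intro mult_left_mono) auto
  have "inner (W' h 1 t) (S (V 0)) + inner (V 1) (S (W' h 0 t))
    \<le> 1 / \<epsilon> * (- (w 0)\<^sup>2 + norm e * norm (R h m - m) * mass2 t + sqrt 2 * ell * w 2 * w 0)
      + ell / \<tau> * w 1 * w 0 + \<beta> * h / \<epsilon> * (3 * c * mass2 t) + 1 / \<epsilon> * (ell * (w 1)\<^sup>2) + \<beta> * h / \<epsilon> * (c * mass2 t)"
    using A1 A4 A5 B1 B3 D1 D2 C1 by linarith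
  also have "\<dots> = 1 / \<epsilon> * (- (w 0)\<^sup>2 + sqrt 2 * ell * w 2 * w 0 + ell * (w 1)\<^sup>2) + ell / \<tau> * w 1 * w 0 + \<omega> h * mass2 t"
    using \<epsilon>_pos by (simp add: \<omega>_def field_simps)
  finally show ?thesis by (simp add: V_def)
qed

end

section \<open>Exponential decay of the deviation\<close>

text \<open>Comparison of the weighted norm and of the weighted dissipation. For \<open>N \<ge> 4\<close> the weights of the
modes \<open>1\<close> and \<open>2\<close>, which occur in the cross terms, are at least \<open>3 / 4\<close> and \<open>1 / 2\<close>.\<close>

lemma cutoff_sums:
  fixes y :: "nat \<Rightarrow> real"
  assumes y: "\<And>k. 0 \<le> y k" and N: "4 \<le> N"
  shows "3 / 4 * y 1 + y 2 \<le> (\<Sum>k<N. (1 - real k / real N) * real k * y k)"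
    and "(\<Sum>k<N. (1 - real k / real N) * y k) \<le> y 0 + (\<Sum>k<N. (1 - real k / real N) * real k * y k)"
    and "y 0 + 3 / 4 * y 1 \<le> (\<Sum>k<N. (1 - real k / real N) * y k)"
proof -
  have chi: "0 \<le> 1 - real k / real N" if "k < N" for k using that by auto
  have c1: "3 / 4 \<le> 1 - 1 / real N" and c2: "1 / 2 \<le> 1 - 2 / real N"
    using N by (auto simp: field_simps)
  have "3 / 4 * y 1 + y 2 \<le> (1 - 1 / real N) * 1 * y 1 + (1 - 2 / real N) * 2 * y 2"
    using mult_right_mono[OF c1 y[of 1]] mult_right_mono[OF c2 y[of 2]] by linarith
  also have "\<dots> = (\<Sum>k\<in>{1, 2}. (1 - real k / real N) * real k * y k)" by simp
  also have "\<dots> \<le> (\<Sum>k<N. (1 - real k / real N) * real k * y k)"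
    using N y chi by (intro sum_mono2) auto
  finally show "3 / 4 * y 1 + y 2 \<le> (\<Sum>k<N. (1 - real k / real N) * real k * y k)" .
  have "(\<Sum>k<N. (1 - real k / real N) * y k) \<le> (\<Sum>k<N. (if k = 0 then y 0 else 0) + (1 - real k / real N) * real k * y k)"
  proof (rule sum_mono)
    fix k assume "k \<in> {..<N}"
    hence "0 \<le> (1 - real k / real N) * y k" using chi[of k] y[of k] by simp
    hence "k \<noteq> 0 \<Longrightarrow> 1 * ((1 - real k / real N) * y k) \<le> real k * ((1 - real k / real N) * y k)"
      by (intro mult_right_mono) auto
    thus "(1 - real k / real N) * y k \<le> (if k = 0 then y 0 else 0) + (1 - real k / real N) * real k * y k"
      by (auto simp: mult_ac)
  qed
  also have "\<dots> = y 0 + (\<Sum>k<N. (1 - real k / real N) * real k * y k)"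
    using N by (simp add: sum.distrib)
  finally show "(\<Sum>k<N. (1 - real k / real N) * y k) \<le> y 0 + (\<Sum>k<N. (1 - real k / real N) * real k * y k)" .
  have "y 0 + 3 / 4 * y 1 \<le> y 0 + (1 - 1 / real N) * y 1"
    using mult_right_mono[OF c1 y[of 1]] by linarith
  also have "\<dots> = (\<Sum>k\<in>{0, 1}. (1 - real k / real N) * y k)" by simp
  also have "\<dots> \<le> (\<Sum>k<N. (1 - real k / real N) * y k)"
    using N y chi by (intro sum_mono2) auto
  finally show "y 0 + 3 / 4 * y 1 \<le> (\<Sum>k<N. (1 - real k / real N) * y k)" .
qed

lemma young: "0 < q \<Longrightarrow> (x::real) * y \<le> q * x\<^sup>2 + y\<^sup>2 / (4 * q)"
proof -
  assume q: "0 < q"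
  have "0 \<le> (2 * q * x - y)\<^sup>2 / (4 * q)" using q by simp
  also have "\<dots> = q * x\<^sup>2 + y\<^sup>2 / (4 * q) - x * y"
    using q by (simp add: power2_eq_square field_simps)
  finally show ?thesis by simp
qed

context coercive_flow begin

text \<open>The decay rate of the squared norm.\<close>

definition \<mu> :: real where "\<mu> = 2 * wt / (3 * \<epsilon>)"

lemma \<mu>_pos: "0 < \<mu>" using wt_bounds(1) \<epsilon>_pos by (simp add: \<mu>_def)

definition cross0 :: "real \<Rightarrow> real \<Rightarrow> real" where "cross0 h t = inner (R h (U t 1)) (S (R h (U t 0)))"
definition hypo0 :: "real \<Rightarrow> nat \<Rightarrow> real \<Rightarrow> real" where "hypo0 h N t = energy id h N t + wt * cross0 h t"
text \<open>All regularisation errors: it tends to \<open>0\<close> if first \<open>N\<close> tends to infinity and then \<open>h\<close> to \<open>0\<close>.\<close>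

definition \<zeta> :: "real \<Rightarrow> nat \<Rightarrow> real" where
  "\<zeta> h N = 4 * \<tau> * (\<beta> * h)\<^sup>2 / \<epsilon>\<^sup>2 + \<beta> * h / \<epsilon> + (r / h + B) / (\<epsilon> * sqrt (real N)) + wt * \<omega> h"

lemma \<omega>_nonneg: "0 < h \<Longrightarrow> 0 \<le> \<omega> h"
  unfolding \<omega>_def using \<beta>_nonneg c_pos \<epsilon>_pos by simp

lemma \<zeta>_nonneg: "0 < h \<Longrightarrow> 0 \<le> \<zeta> h N"
  unfolding \<zeta>_def using \<beta>_nonneg \<tau>_pos \<epsilon>_pos r_pos B_nonneg wt_bounds(1) \<omega>_nonneg[of h]
  by (auto intro!: add_nonneg_nonneg)

lemma mass_rate:
  assumes h: "0 < h" "h < h0" and t: "0 \<le> t" and N: "0 < N"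
  shows "(\<Sum>k<N. (1 - real k / real N) * inner (id (W' h k t)) (id (R h (U t k))))
     \<le> - 1 / (2 * \<tau>) * (\<Sum>k<N. (1 - real k / real N) * real k * (norm (R h (U t k)))\<^sup>2)
       + (4 * \<tau> * (\<beta> * h)\<^sup>2 / \<epsilon>\<^sup>2 + \<beta> * h / \<epsilon> + (r / h + B) / (\<epsilon> * sqrt (real N))) * mass2 t"
proof -
  have bh: "0 \<le> \<beta> * h" using \<beta>_nonneg h by simp
  have "norm (U t 1) * norm (R h (U t 0)) \<le> mass2 t"
    using mult_left_mono[OF R_norm[OF h, of "U t 0"], of "norm (U t 1)"] norm_mult_le_mass2[OF t, of 1 0] by simp
  hence "\<beta> * h / \<epsilon> * (norm (U t 1) * norm (R h (U t 0))) \<le> \<beta> * h / \<epsilon> * mass2 t"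
    using bh \<epsilon>_pos by (intro mult_left_mono) auto
  thus ?thesis
    using energy_rate[OF h t N bounded_linear_ident[folded id_def], where g = 1 and \<gamma> = "\<beta> * h"] R_b[OF h] bh
    by (simp add: algebra_simps)
qed

text \<open>The cross term is at most a quarter of the weighted norm because \<open>wt * ell \<le> 1 / 16\<close>.\<close>

lemma hypo0_bounds:
  assumes h: "0 < h" "h < h0" and t: "0 \<le> t" and N: "4 \<le> N"
  shows "1 / 4 * (\<Sum>k<N. (1 - real k / real N) * (norm (R h (U t k)))\<^sup>2) \<le> hypo0 h N t"
    and "hypo0 h N t \<le> 3 / 4 * (\<Sum>k<N. (1 - real k / real N) * (norm (R h (U t k)))\<^sup>2)"
    and "hypo0 h N t \<le> 3 / 4 * mass2 t"
proof -
  define w where "w = (\<lambda>k. norm (R h (U t k)))"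
  define E where "E = (\<Sum>k<N. (1 - real k / real N) * (w k)\<^sup>2)"
  have w0: "0 \<le> w k" for k by (simp add: w_def)
  note cs = cutoff_sums[of "\<lambda>k. (w k)\<^sup>2" N, OF zero_le_power2 N, folded E_def]
  have "\<bar>cross0 h t\<bar> \<le> w 1 * (ell * w 0)"
  proof -
    have "norm (S (R h (U t 0))) \<le> ell * w 0"
      using S_norm[of "R h (U t 0)"] mult_right_mono[OF ell_ge(2) w0[of 0]] unfolding w_def by linarith
    thus ?thesis unfolding cross0_def w_def by (meson Cauchy_Schwarz_ineq2 mult_left_mono norm_ge_zero order_trans)
  qed
  hence "\<bar>wt * cross0 h t\<bar> \<le> gap * (w 1 * (ell * w 0))"
    using wt_bounds gap_pos unfolding abs_mult by (intro mult_mono) auto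
  also have "\<dots> \<le> (gap * ell\<^sup>2) * (w 1 * w 0)"
    using ell_ge(1) w0 gap_pos mult_right_mono[of ell "ell\<^sup>2" "w 1 * w 0"]
    by (simp add: power2_eq_square mult_left_mono mult_ac)
  also have "\<dots> \<le> 1 / 32 * ((w 0)\<^sup>2 + (w 1)\<^sup>2)"
    unfolding gap_pos(3) using sum_squares_bound[of "w 0" "w 1"] by (simp add: mult_ac)
  also have "\<dots> \<le> 1 / 4 * ((w 0)\<^sup>2 + 3 / 4 * (w 1)\<^sup>2)" by simp
  also have "\<dots> \<le> 1 / 4 * E" using cs(3) by simp
  finally have *: "\<bar>wt * cross0 h t\<bar> \<le> 1 / 4 * E" .
  have e: "energy id h N t = 1 / 2 * E" by (simp add: energy_def E_def w_def)
  have "E \<le> (\<Sum>k<N. (norm (U t k))\<^sup>2)"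
    unfolding E_def
  proof (rule sum_mono)
    fix k assume "k \<in> {..<N}"
    hence "(1 - real k / real N) * (w k)\<^sup>2 \<le> 1 * (norm (U t k))\<^sup>2"
      unfolding w_def by (intro mult_mono power_mono R_norm[OF h]) auto
    thus "(1 - real k / real N) * (w k)\<^sup>2 \<le> (norm (U t k))\<^sup>2" by simp
  qed
  also have "\<dots> \<le> mass2 t" unfolding mass2_def by (intro sum_le_suminf U_summable t) auto
  finally have E: "E \<le> mass2 t" .
  show "1 / 4 * (\<Sum>k<N. (1 - real k / real N) * (norm (R h (U t k)))\<^sup>2) \<le> hypo0 h N t"
    using * e unfolding hypo0_def E_def w_def by linarith
  show "hypo0 h N t \<le> 3 / 4 * (\<Sum>k<N. (1 - real k / real N) * (norm (R h (U t k)))\<^sup>2)"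
    using * e unfolding hypo0_def E_def w_def by linarith
  show "hypo0 h N t \<le> 3 / 4 * mass2 t" using * e E unfolding hypo0_def by linarith
qed

text \<open>The cross term supplies \<open>- wt / \<epsilon> * (w 0)\<^sup>2\<close> and, by Young's inequality, costs half of that plus
multiples of \<open>(w 1)\<^sup>2\<close> and \<open>(w 2)\<^sup>2\<close> which the damping of these modes dominates.\<close>

lemma hypo0_rate:
  assumes h: "0 < h" "h < h0" and t: "0 \<le> t" and N: "4 \<le> N"
  shows "\<exists>H'. (hypo0 h N has_real_derivative H') (at t within {0..}) \<and> H' \<le> - \<mu> * hypo0 h N t + \<zeta> h N * mass2 t"
proof -
  define w where "w = (\<lambda>k. norm (R h (U t k)))"
  define Y where "Y = (\<Sum>k<N. (1 - real k / real N) * real k * (w k)\<^sup>2)"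
  define E where "E = (\<Sum>k<N. (1 - real k / real N) * (w k)\<^sup>2)"
  define s where "s = (\<Sum>k<N. (1 - real k / real N) * inner (id (W' h k t)) (id (R h (U t k))))"
  define x where "x = inner (W' h 1 t) (S (R h (U t 0))) + inner (R h (U t 1)) (S (W' h 0 t))"
  have w0: "0 \<le> w k" for k by (simp add: w_def)
  note cs = cutoff_sums[of "\<lambda>k. (w k)\<^sup>2" N, OF zero_le_power2 N, folded Y_def E_def]
  have der: "(hypo0 h N has_real_derivative s + wt * x) (at t within {0..})"
    unfolding hypo0_def[abs_def] cross0_def s_def x_def
    by (intro DERIV_add DERIV_cmult energy_deriv[OF h t bounded_linear_ident[folded id_def]]
        inner_W_deriv[OF h t bounded_linear_ident S_bl])
  have 1: "s \<le> - 1 / (2 * \<tau>) * Y + (\<zeta> h N - wt * \<omega> h) * mass2 t"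
    using mass_rate[OF h t, of N] N unfolding s_def Y_def \<zeta>_def w_def by simp
  have "x \<le> 1 / \<epsilon> * (- (w 0)\<^sup>2 + sqrt 2 * ell * w 2 * w 0 + ell * (w 1)\<^sup>2) + ell / \<tau> * w 1 * w 0 + \<omega> h * mass2 t"
    using cross_rate[OF h t] unfolding x_def w_def by simp
  hence 2: "wt * x \<le> wt * (1 / \<epsilon> * (- (w 0)\<^sup>2 + sqrt 2 * ell * w 2 * w 0 + ell * (w 1)\<^sup>2) + ell / \<tau> * w 1 * w 0 + \<omega> h * mass2 t)"
    using wt_bounds(1) by (intro mult_left_mono) auto
  have y2: "sqrt 2 * ell * w 2 * w 0 \<le> 2 * ell\<^sup>2 * (w 2)\<^sup>2 + (w 0)\<^sup>2 / 4"
    using sum_squares_bound[of "sqrt 2 * ell * w 2" "w 0 / 2"] by (simp add: power_mult_distrib power_divide)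
  have y1: "ell / \<tau> * w 1 * w 0 \<le> \<epsilon> / \<tau>\<^sup>2 * (ell\<^sup>2 * (w 1)\<^sup>2) + 1 / \<epsilon> * ((w 0)\<^sup>2 / 4)"
    using sum_squares_bound[of "sqrt \<epsilon> * ell * w 1 / \<tau>" "w 0 / (2 * sqrt \<epsilon>)"] \<epsilon>_pos
    by (simp add: power_mult_distrib power_divide field_simps)
  have "1 / \<epsilon> * (- (w 0)\<^sup>2 + sqrt 2 * ell * w 2 * w 0 + ell * (w 1)\<^sup>2) + ell / \<tau> * w 1 * w 0
     \<le> 1 / \<epsilon> * (- (w 0)\<^sup>2 + (2 * ell\<^sup>2 * (w 2)\<^sup>2 + (w 0)\<^sup>2 / 4) + ell * (w 1)\<^sup>2) + (\<epsilon> / \<tau>\<^sup>2 * (ell\<^sup>2 * (w 1)\<^sup>2) + 1 / \<epsilon> * ((w 0)\<^sup>2 / 4))"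
    using y1 y2 \<epsilon>_pos ell_ge(1) by (intro add_mono mult_left_mono) auto
  hence "wt * (1 / \<epsilon> * (- (w 0)\<^sup>2 + sqrt 2 * ell * w 2 * w 0 + ell * (w 1)\<^sup>2) + ell / \<tau> * w 1 * w 0)
     \<le> wt * (1 / \<epsilon> * (- (w 0)\<^sup>2 + (2 * ell\<^sup>2 * (w 2)\<^sup>2 + (w 0)\<^sup>2 / 4) + ell * (w 1)\<^sup>2) + (\<epsilon> / \<tau>\<^sup>2 * (ell\<^sup>2 * (w 1)\<^sup>2) + 1 / \<epsilon> * ((w 0)\<^sup>2 / 4)))"
    using wt_bounds(1) by (intro mult_left_mono) auto
  also have "\<dots> = - (wt / \<epsilon>) * (w 0)\<^sup>2 / 2 + (wt / \<epsilon>) * (2 * ell\<^sup>2 * (w 2)\<^sup>2) + (wt / \<epsilon>) * (ell * (w 1)\<^sup>2) + (wt * \<epsilon> / \<tau>\<^sup>2) * (ell\<^sup>2 * (w 1)\<^sup>2)"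
    using \<epsilon>_pos by (simp add: field_simps)
  also have "\<dots> \<le> - (wt / \<epsilon>) * (w 0)\<^sup>2 / 2 + (gap / \<tau>) * (2 * ell\<^sup>2 * (w 2)\<^sup>2) + (gap / \<tau>) * (ell\<^sup>2 * (w 1)\<^sup>2) + (gap / \<tau>) * (ell\<^sup>2 * (w 1)\<^sup>2)"
    using ell_ge(1) wt_bounds gap_pos(1) \<tau>_pos by (intro add_mono mult_mono mult_right_mono order_refl) (auto simp: power2_eq_square)
  also have "\<dots> = - (wt / \<epsilon>) * (w 0)\<^sup>2 / 2 + (gap * ell\<^sup>2) * 2 / \<tau> * ((w 2)\<^sup>2 + (w 1)\<^sup>2)"
    using \<tau>_pos by (simp add: field_simps)
  also have "\<dots> \<le> - (wt / \<epsilon>) * (w 0)\<^sup>2 / 2 + 1 / (4 * \<tau>) * Y"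
  proof -
    have "(w 2)\<^sup>2 + (w 1)\<^sup>2 \<le> 2 * Y" using cs(1) zero_le_power2[of "w 1"] zero_le_power2[of "w 2"] by linarith
    hence "1 / (8 * \<tau>) * ((w 2)\<^sup>2 + (w 1)\<^sup>2) \<le> 1 / (8 * \<tau>) * (2 * Y)" using \<tau>_pos by (intro mult_left_mono) auto
    thus ?thesis unfolding gap_pos(3) by simp
  qed
  finally have 3: "wt * (1 / \<epsilon> * (- (w 0)\<^sup>2 + sqrt 2 * ell * w 2 * w 0 + ell * (w 1)\<^sup>2) + ell / \<tau> * w 1 * w 0)
     \<le> - (wt / \<epsilon>) * (w 0)\<^sup>2 / 2 + 1 / (4 * \<tau>) * Y" .
  have Y0: "0 \<le> Y" using cs(1) zero_le_power2[of "w 1"] zero_le_power2[of "w 2"] by linarith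
  have 4: "wt / \<epsilon> / 2 * Y \<le> 1 / (4 * \<tau>) * Y"
  proof (rule mult_right_mono[OF _ Y0])
    have "gap / \<tau> \<le> 1 / 16 / \<tau>" using gap_pos(2) \<tau>_pos by (intro divide_right_mono) auto
    thus "wt / \<epsilon> / 2 \<le> 1 / (4 * \<tau>)" using wt_bounds(2) \<tau>_pos by (simp add: field_simps)
  qed
  have 5: "wt / \<epsilon> / 2 * E \<le> wt / \<epsilon> / 2 * ((w 0)\<^sup>2 + Y)"
    using cs(2) wt_bounds(1) \<epsilon>_pos by (intro mult_left_mono) auto
  have 6: "hypo0 h N t \<le> 3 / 4 * E"
    using hypo0_bounds(2)[OF h t N] unfolding E_def w_def .
  have 7: "wt / \<epsilon> / 2 * (4 / 3 * hypo0 h N t) \<le> wt / \<epsilon> / 2 * E"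
    using 6 wt_bounds(1) \<epsilon>_pos by (intro mult_left_mono) auto
  have "wt * (A + \<omega> h * mass2 t) = wt * A + wt * \<omega> h * mass2 t" for A by (simp add: algebra_simps)
  hence "s + wt * x \<le> - 1 / (2 * \<tau>) * Y + \<zeta> h N * mass2 t - (wt / \<epsilon>) * (w 0)\<^sup>2 / 2 + 1 / (4 * \<tau>) * Y"
    using 1 2 3 by (simp add: left_diff_distrib)
  also have "- 1 / (2 * \<tau>) * Y = - (1 / (4 * \<tau>) * Y) - 1 / (4 * \<tau>) * Y"
    using \<tau>_pos by (simp add: field_simps)
  finally have "s + wt * x \<le> - (wt / \<epsilon> / 2 * ((w 0)\<^sup>2 + Y)) + \<zeta> h N * mass2 t"
    using 4 by (simp add: distrib_left)
  also have "\<dots> \<le> - (wt / \<epsilon> / 2 * (4 / 3 * hypo0 h N t)) + \<zeta> h N * mass2 t" using 5 7 by linarith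
  also have "wt / \<epsilon> / 2 * (4 / 3 * hypo0 h N t) = \<mu> * hypo0 h N t"
    using \<epsilon>_pos by (simp add: \<mu>_def field_simps)
  finally show ?thesis using der by auto
qed

lemma sqrt_N_tendsto: "(\<lambda>N. a / (\<epsilon> * sqrt (real N))) \<longlonglongrightarrow> 0"
proof -
  have "filterlim (\<lambda>N. \<epsilon> * sqrt (real N)) at_top sequentially"
    by (rule filterlim_tendsto_pos_mult_at_top[OF tendsto_const \<epsilon>_pos])
       (intro filterlim_compose[OF sqrt_at_top] filterlim_real_sequentially)
  thus ?thesis by (intro real_tendsto_divide_at_top[OF tendsto_const])
qed

lemma \<omega>_tendsto: "(\<omega> \<longlongrightarrow> 0) (at_right 0)"
proof -
  have "((\<lambda>h. (4 * \<beta> * h * c + norm e * norm (R h m - m)) / \<epsilon>) \<longlongrightarrow> (4 * \<beta> * 0 * c + norm e * 0) / \<epsilon>) (at_right 0)"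
    using \<epsilon>_pos by (intro tendsto_intros tendsto_norm_zero) (use R_m LIM_zero in auto)
  thus ?thesis by (simp add: \<omega>_def[abs_def])
qed

lemma cutoff_tendsto:
  "(\<lambda>N. \<Sum>k<n. (1 - real k / real N) * y k) \<longlonglongrightarrow> (\<Sum>k<n. y k)"
proof -
  have "(\<lambda>N. \<Sum>k<n. (1 - real k / real N) * y k) \<longlonglongrightarrow> (\<Sum>k<n. (1 - 0) * y k)"
    by (intro tendsto_intros real_tendsto_divide_at_top[OF tendsto_const] filterlim_real_sequentially)
  thus ?thesis by simp
qed

lemma cutoff_partial_le:
  assumes "n \<le> N" "\<And>k. 0 \<le> y k"
  shows "(\<Sum>k<n. (1 - real k / real N) * y k) \<le> (\<Sum>k<N. (1 - real k / real N) * (y k :: real))"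
  using assms by (intro sum_mono2) auto

text \<open>The Gronwall estimate is applied to the cut-off functional at scale \<open>h\<close>, followed by \<open>N \<rightarrow> \<infinity>\<close>,
\<open>h \<rightarrow> 0\<close> and summation over the modes. The factor \<open>3\<close> is the ratio of the bounds \<open>3 / 4\<close> and
\<open>1 / 4\<close> of the functional.\<close>

theorem mass2_decay:
  assumes t: "0 \<le> t"
  shows "mass2 t \<le> 3 * mass2 0 * exp (- \<mu> * t)"
proof -
  obtain K where K: "K > 0" "\<And>s. s \<in> {0..t} \<Longrightarrow> mass2 s \<le> K" using mass2_bounded by blast
  have main: "(\<Sum>k<n. (1 - real k / real N) * (norm (R h (U t k)))\<^sup>2) \<le> 3 * mass2 0 * exp (- \<mu> * t) + 4 * (\<zeta> h N * K / \<mu>)"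
    if h: "0 < h" "h < h0" and N: "4 \<le> N" "n \<le> N" for h n N
  proof -
    obtain H' where H': "\<And>s. 0 \<le> s \<Longrightarrow> (hypo0 h N has_real_derivative H' s) (at s within {0..})"
       "\<And>s. 0 \<le> s \<Longrightarrow> H' s \<le> - \<mu> * hypo0 h N s + \<zeta> h N * mass2 s"
      using hypo0_rate[OF h _ N(1)] by metis
    have "hypo0 h N t \<le> exp (- \<mu> * t) * (hypo0 h N 0 + 0 / \<mu>) + \<zeta> h N * K / \<mu>"
    proof (rule gronwall_forced[OF \<mu>_pos order_refl _ t H'(1)])
      show "0 \<le> \<zeta> h N * K" using \<zeta>_nonneg h K by simp
      fix s assume s: "0 \<le> s" "s \<le> t"
      have "\<zeta> h N * mass2 s \<le> \<zeta> h N * K" using \<zeta>_nonneg h K s by (intro mult_left_mono) auto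
      thus "H' s \<le> - \<mu> * hypo0 h N s + 0 * exp (- 2 * \<mu> * s) + \<zeta> h N * K" using H'(2)[OF s(1)] by simp
    qed
    also have "exp (- \<mu> * t) * (hypo0 h N 0 + 0 / \<mu>) \<le> exp (- \<mu> * t) * (3 / 4 * mass2 0)"
      using hypo0_bounds(3)[OF h _ N(1), of 0] by (intro mult_left_mono) auto
    finally have "hypo0 h N t \<le> exp (- \<mu> * t) * (3 / 4 * mass2 0) + \<zeta> h N * K / \<mu>" by simp
    hence "4 * hypo0 h N t \<le> 4 * (exp (- \<mu> * t) * (3 / 4 * mass2 0) + \<zeta> h N * K / \<mu>)" by (rule mult_left_mono) simp
    also have "4 * (exp (- \<mu> * t) * (3 / 4 * mass2 0) + \<zeta> h N * K / \<mu>) = 3 * mass2 0 * exp (- \<mu> * t) + 4 * (\<zeta> h N * K / \<mu>)"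
      by simp
    finally have "4 * hypo0 h N t \<le> 3 * mass2 0 * exp (- \<mu> * t) + 4 * (\<zeta> h N * K / \<mu>)" .
    moreover have "(\<Sum>k<n. (1 - real k / real N) * (norm (R h (U t k)))\<^sup>2) \<le> 4 * hypo0 h N t"
      using cutoff_partial_le[OF N(2), of "\<lambda>k. (norm (R h (U t k)))\<^sup>2"] hypo0_bounds(1)[OF h t N(1)] by simp
    ultimately show ?thesis by (rule order_trans[rotated])
  qed
  \<comment> \<open>The cut-off is removed at fixed \<open>h\<close>, since its error is only bounded by a multiple of \<open>1 / (h * sqrt N)\<close>.\<close>
  have main2: "(\<Sum>k<n. (norm (R h (U t k)))\<^sup>2) \<le> 3 * mass2 0 * exp (- \<mu> * t) + 4 * ((4 * \<tau> * (\<beta> * h)\<^sup>2 / \<epsilon>\<^sup>2 + \<beta> * h / \<epsilon> + 0 + wt * \<omega> h) * K / \<mu>)"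
    if h: "0 < h" "h < h0" for h n
  proof (rule LIMSEQ_le[OF cutoff_tendsto])
    show "(\<lambda>N. 3 * mass2 0 * exp (- \<mu> * t) + 4 * (\<zeta> h N * K / \<mu>)) \<longlonglongrightarrow>
       3 * mass2 0 * exp (- \<mu> * t) + 4 * ((4 * \<tau> * (\<beta> * h)\<^sup>2 / \<epsilon>\<^sup>2 + \<beta> * h / \<epsilon> + 0 + wt * \<omega> h) * K / \<mu>)"
      unfolding \<zeta>_def using \<mu>_pos by (intro tendsto_intros sqrt_N_tendsto) auto
    show "\<exists>N. \<forall>m\<ge>N. (\<Sum>k<n. (1 - real k / real m) * (norm (R h (U t k)))\<^sup>2) \<le> 3 * mass2 0 * exp (- \<mu> * t) + 4 * (\<zeta> h m * K / \<mu>)"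
      using main[OF h] by (intro exI[of _ "max 4 n"]) auto
  qed
  have main3: "(\<Sum>k<n. (norm (U t k))\<^sup>2) \<le> 3 * mass2 0 * exp (- \<mu> * t)" for n
  proof (rule tendsto_le[OF trivial_limit_at_right_real])
    show "((\<lambda>h. \<Sum>k<n. (norm (R h (U t k)))\<^sup>2) \<longlongrightarrow> (\<Sum>k<n. (norm (U t k))\<^sup>2)) (at_right 0)"
      by (intro tendsto_intros R_U t)
    have "((\<lambda>h. 3 * mass2 0 * exp (- \<mu> * t) + 4 * ((4 * \<tau> * (\<beta> * h)\<^sup>2 / \<epsilon>\<^sup>2 + \<beta> * h / \<epsilon> + 0 + wt * \<omega> h) * K / \<mu>)) \<longlongrightarrow>
       3 * mass2 0 * exp (- \<mu> * t) + 4 * ((4 * \<tau> * (\<beta> * 0)\<^sup>2 / \<epsilon>\<^sup>2 + \<beta> * 0 / \<epsilon> + 0 + wt * 0) * K / \<mu>)) (at_right 0)"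
      using \<mu>_pos \<epsilon>_pos by (intro tendsto_intros \<omega>_tendsto) auto
    thus "((\<lambda>h. 3 * mass2 0 * exp (- \<mu> * t) + 4 * ((4 * \<tau> * (\<beta> * h)\<^sup>2 / \<epsilon>\<^sup>2 + \<beta> * h / \<epsilon> + 0 + wt * \<omega> h) * K / \<mu>)) \<longlongrightarrow>
       3 * mass2 0 * exp (- \<mu> * t)) (at_right 0)" by simp
    show "\<forall>\<^sub>F h in at_right 0. (\<Sum>k<n. (norm (R h (U t k)))\<^sup>2)
       \<le> 3 * mass2 0 * exp (- \<mu> * t) + 4 * ((4 * \<tau> * (\<beta> * h)\<^sup>2 / \<epsilon>\<^sup>2 + \<beta> * h / \<epsilon> + 0 + wt * \<omega> h) * K / \<mu>)"
      using eventually_at_right_real[OF h0_pos] by eventually_elim (use main2 in auto)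
  qed
  show ?thesis
    unfolding mass2_def[of t] by (rule suminf_le_const[OF U_summable[OF t] main3])
qed

end

section \<open>Exponential decay of the derivatives\<close>

context coercive_calculus begin

text \<open>These constants depend on the calculus alone. \<open>slope\<close> bounds the weight \<open>wt / (2 * r)\<close> of the cross
term of the derivatives, \<open>M0\<close> fixes the multiple of the energy of \<open>U\<close> that absorbs its first mode,
\<open>C3\<close> collects the forcing by terms without derivatives, and \<open>C4\<close> is the resulting constant in the
gradient estimate.\<close>

definition slope :: real where "slope = gap / (2 * r)"
definition M0 :: real where "M0 = 8 / 3 * (4 * slope / r + 32 * \<beta>\<^sup>2 / (r * slope) + slope\<^sup>2)"
definition C3 :: real where "C3 = 16 * \<beta>\<^sup>2 + 13 * gap / 2 * (B / r)\<^sup>2 + gap / 2 * (slope\<^sup>2 + M0)"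
definition C4 :: real where "C4 = 4 * slope\<^sup>2 + 2 * M0 + 36 * C3 / gap"

lemma slope_pos: "0 < slope" using gap_pos r_pos by (simp add: slope_def)
lemma M0_pos: "0 < M0" unfolding M0_def using slope_pos r_pos by (simp add: add_pos_nonneg)
lemma C3_nonneg: "0 \<le> C3" unfolding C3_def using gap_pos M0_pos by simp
lemma C4_nonneg: "0 \<le> C4" unfolding C4_def using gap_pos M0_pos C3_nonneg by simp

end

context coercive_flow begin

text \<open>The energy estimate for \<open>\<delta>\<^sub>h R\<^sub>h U\<close> contains the mode \<open>U\<^sub>1\<close> itself, whereas only \<open>R\<^sub>h U\<^sub>1\<close> is
dissipated. Their distance vanishes with \<open>h\<close> uniformly on compact time intervals, because \<open>U\<^sub>1\<close> is
continuous and the operators \<open>R\<^sub>h\<close> are contractions.\<close>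

lemma R_uniform:
  assumes \<eta>: "0 < \<eta>" and T: "0 \<le> T"
  shows "\<forall>\<^sub>F h in at_right 0. \<forall>t\<in>{0..T}. norm (U t k - R h (U t k)) \<le> \<eta>"
proof -
  define P where "P = (\<lambda>x y. \<forall>\<^sub>F h in at_right 0. \<forall>t\<in>{x..y} \<inter> {0..}. norm (U t k - R h (U t k)) \<le> \<eta>)"
  have "P 0 T"
  proof (rule Bolzano[OF T])
    fix x y z assume "P x y" "P y z" "x \<le> y" "y \<le> z"
    from eventually_conj[OF this(1,2)[unfolded P_def]]
    show "P x z" unfolding P_def by (rule eventually_mono) (meson IntE IntI atLeastAtMost_iff linear)
  next
    fix t assume "0 \<le> t" "t \<le> T"
    have "0 < \<eta> / 4" using \<eta> by simp
    then obtain d where d: "d > 0" "\<And>s. s \<in> {0..} \<Longrightarrow> dist s t < d \<Longrightarrow> dist (U s k) (U t k) < \<eta> / 4"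
      using U_continuous[of k] \<open>0 \<le> t\<close> unfolding continuous_on_iff by (metis atLeast_iff)
    have ev: "\<forall>\<^sub>F h in at_right 0. dist (R h (U t k)) (U t k) < \<eta> / 4"
      using tendstoD[OF R_U[OF \<open>0 \<le> t\<close>, of k] \<open>0 < \<eta> / 4\<close>] .
    have "P x y" if "x \<le> t" "t \<le> y" "y - x < d" for x y
      unfolding P_def using ev eventually_at_right_real[OF h0_pos]
    proof eventually_elim
      case (elim h)
      hence h: "0 < h" "h < h0" by auto
      show ?case
      proof
        fix s assume s: "s \<in> {x..y} \<inter> {0..}"
        have u: "norm (U s k - U t k) \<le> \<eta> / 4"
        proof -
          have "dist s t < d" using s that by (auto simp: dist_real_def abs_if)
          thus ?thesis using d(2)[of s] s by (simp add: dist_norm)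
        qed
        have "R h (U t k) - R h (U s k) = R h (U t k - U s k)"
          using bounded_linear.linear[OF R_bl[OF h]] by (simp add: linear_diff)
        hence v: "norm (R h (U t k) - R h (U s k)) \<le> \<eta> / 4"
          using R_norm[OF h, of "U t k - U s k"] u by (simp add: norm_minus_commute)
        have "U s k - R h (U s k) = (U s k - U t k) + (U t k - R h (U t k)) + (R h (U t k) - R h (U s k))" by simp
        also have "norm \<dots> \<le> norm (U s k - U t k) + norm (U t k - R h (U t k)) + norm (R h (U t k) - R h (U s k))"
          by (intro norm_triangle_le add_mono order_refl norm_triangle_ineq)
        finally show "norm (U s k - R h (U s k)) \<le> \<eta>"
          using u v elim(1) \<eta> by (simp add: dist_norm norm_minus_commute)
      qed
    qed
    thus "\<exists>d>0. \<forall>x y. x \<le> t \<and> t \<le> y \<and> y - x < d \<longrightarrow> P x y" using d(1) by blast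
  qed
  thus ?thesis unfolding P_def by (rule eventually_mono) auto
qed

text \<open>The regularised form of \<open>\<langle>U\<^sub>1, \<partial> U\<^sub>0\<rangle>\<close>.\<close>

definition cross1 :: "real \<Rightarrow> real \<Rightarrow> real" where
  "cross1 h t = inner (R h (R h (U t 1))) (\<delta> h (R h (U t 0)))"
text \<open>The factor \<open>1 + \<tau>\<^sub>0\<^sup>2\<close> compensates the one in the weight \<open>wt\<close>: the commutator term of mode \<open>0\<close>
is paid for by the dissipation of \<open>\<partial> U\<^sub>0\<close>, which carries the small weight \<open>wt\<close>.\<close>

definition Mw :: real where "Mw = M0 * (1 + \<tau>0\<^sup>2)"
definition hypo1 :: "real \<Rightarrow> nat \<Rightarrow> real \<Rightarrow> real" where
  "hypo1 h N t = energy (\<delta> h) h N t + wt / (2 * r) * cross1 h t + Mw * energy id h N t"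

text \<open>Since \<open>\<delta>\<^sub>h\<close> is skew and commutes with \<open>R\<^sub>h\<close>, the derivative of mode \<open>0\<close> in the second term moves to
mode \<open>1\<close>; the first one produces \<open>- r (x 0)\<^sup>2 / \<epsilon>\<close>.\<close>

lemma cross1_rate:
  assumes h: "0 < h" "h < h0" and t: "0 \<le> t"
  defines "x \<equiv> \<lambda>k. norm (\<delta> h (R h (U t k)))" and "u \<equiv> \<lambda>k. norm (U t k)"
  shows "inner (R h (W' h 1 t)) (\<delta> h (R h (U t 0))) + inner (R h (R h (U t 1))) (\<delta> h (W' h 0 t))
    \<le> 1 / \<epsilon> * (r * (- (x 0)\<^sup>2 + sqrt 2 * x 2 * x 0 + (x 1)\<^sup>2) + B * (u 0 * x 0 + sqrt 2 * u 2 * x 0 + u 1 * x 1))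
      + 1 / \<tau> * norm (R h (U t 1)) * x 0"
proof -
  interpret R: bounded_linear "R h" by (rule R_bl[OF h])
  interpret d: bounded_linear "\<delta> h" by (rule \<delta>_bl[OF h])
  define X where "X = (\<lambda>k. \<delta> h (R h (U t k)))"
  have xX: "x k = norm (X k)" for k by (simp add: x_def X_def)
  define b' where "b' = (\<lambda>k. R h (R h (b (U t k))))"
  have b': "norm (b' k) \<le> B * u k" for k
    unfolding b'_def u_def using R_norm[OF h] b_norm by (meson order_trans)
  have ib: "\<bar>inner (b' j) (X k)\<bar> \<le> B * u j * x k" for j k
    unfolding xX by (rule order_trans[OF Cauchy_Schwarz_ineq2 mult_right_mono[OF b' norm_ge_zero]])
  have iX: "\<bar>inner (X j) (X k)\<bar> \<le> x j * x k" for j k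
    unfolding xX by (rule Cauchy_Schwarz_ineq2)
  have RW: "R h (W' h k t) = (1 / \<epsilon>) *\<^sub>R (sqrt (real k) *\<^sub>R (b' (k - 1) - r *\<^sub>R X (k - 1))
       - sqrt (real (k + 1)) *\<^sub>R (b' (k + 1) + r *\<^sub>R X (k + 1))) - (real k / \<tau>) *\<^sub>R R h (R h (U t k))" for k
    unfolding W'_def b'_def X_def by (simp add: R.diff R.add R.scaleR R_\<delta>[OF h])
  have 1: "inner (R h (W' h 1 t)) (X 0) = 1 / \<epsilon> * (inner (b' 0) (X 0) - r * inner (X 0) (X 0)
       - sqrt 2 * (inner (b' 2) (X 0) + r * inner (X 2) (X 0))) - 1 / \<tau> * inner (R h (R h (U t 1))) (X 0)"
    unfolding RW by (simp add: inner_simps flip: numeral_2_eq_2)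
  have "inner (R h (R h (U t 1))) (\<delta> h (W' h 0 t)) = - inner (X 1) (R h (W' h 0 t))"
    using \<delta>_anti[OF h, of "R h (R h (U t 1))" "W' h 0 t"] R_\<delta>[OF h, of "R h (U t 1)"] R_sym[OF h, of "X 1" "W' h 0 t"]
    unfolding X_def by simp
  also have "\<dots> = 1 / \<epsilon> * (inner (b' 1) (X 1) + r * inner (X 1) (X 1))"
    unfolding RW by (simp add: inner_simps inner_commute diff_divide_distrib add_divide_distrib)
  finally have 2: "inner (R h (R h (U t 1))) (\<delta> h (W' h 0 t)) = 1 / \<epsilon> * (inner (b' 1) (X 1) + r * inner (X 1) (X 1))" .
  have 3: "- inner (R h (R h (U t 1))) (X 0) \<le> norm (R h (U t 1)) * x 0"
    using Cauchy_Schwarz_ineq2[of "R h (R h (U t 1))" "X 0"] mult_right_mono[OF R_norm[OF h, of "R h (U t 1)"], of "x 0"]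
    unfolding xX by simp
  have "1 / \<tau> * (- inner (R h (R h (U t 1))) (X 0)) \<le> 1 / \<tau> * (norm (R h (U t 1)) * x 0)"
    using 3 \<tau>_pos by (intro mult_left_mono) auto
  moreover have "inner (b' 0) (X 0) - r * inner (X 0) (X 0) - sqrt 2 * (inner (b' 2) (X 0) + r * inner (X 2) (X 0))
      + (inner (b' 1) (X 1) + r * inner (X 1) (X 1))
    \<le> B * u 0 * x 0 - r * (x 0)\<^sup>2 + sqrt 2 * (B * u 2 * x 0 + r * (x 2 * x 0)) + (B * u 1 * x 1 + r * (x 1)\<^sup>2)"
  proof -
    have "inner (b' 0) (X 0) \<le> B * u 0 * x 0" "inner (b' 1) (X 1) \<le> B * u 1 * x 1"
      using ib[of 0 0] ib[of 1 1] by linarith+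
    moreover have "sqrt 2 * (- (inner (b' 2) (X 0) + r * inner (X 2) (X 0))) \<le> sqrt 2 * (B * u 2 * x 0 + r * (x 2 * x 0))"
    proof (rule mult_left_mono)
      have "r * (- inner (X 2) (X 0)) \<le> r * (x 2 * x 0)"
        using iX[of 2 0] r_pos by (intro mult_left_mono) auto
      thus "- (inner (b' 2) (X 0) + r * inner (X 2) (X 0)) \<le> B * u 2 * x 0 + r * (x 2 * x 0)"
        using ib[of 2 0] by simp
    qed simp
    moreover have sq: "inner (X k) (X k) = (x k)\<^sup>2" for k
      by (simp add: xX power2_norm_eq_inner)
    ultimately show ?thesis unfolding sq by linarith
  qed
  hence "1 / \<epsilon> * (inner (b' 0) (X 0) - r * inner (X 0) (X 0) - sqrt 2 * (inner (b' 2) (X 0) + r * inner (X 2) (X 0))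
      + (inner (b' 1) (X 1) + r * inner (X 1) (X 1)))
    \<le> 1 / \<epsilon> * (B * u 0 * x 0 - r * (x 0)\<^sup>2 + sqrt 2 * (B * u 2 * x 0 + r * (x 2 * x 0)) + (B * u 1 * x 1 + r * (x 1)\<^sup>2))"
    using \<epsilon>_pos by (intro mult_left_mono) auto
  ultimately show ?thesis
    using 1 2 unfolding X_def by (simp add: algebra_simps)
qed

text \<open>Regularisation errors. The bound \<open>1 / h\<close> of \<open>\<delta>\<^sub>h\<close> enters squared, which is harmless since \<open>N\<close> tends
to infinity for fixed \<open>h\<close>.\<close>

definition \<zeta>1 :: "real \<Rightarrow> nat \<Rightarrow> real" where
  "\<zeta>1 h N = (r * (1 / h)\<^sup>2 / h + B * (1 / h)\<^sup>2) / (\<epsilon> * sqrt (real N))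
     + Mw * (4 * \<tau> * (\<beta> * h)\<^sup>2 / \<epsilon>\<^sup>2 + \<beta> * h / \<epsilon> + (r / h + B) / (\<epsilon> * sqrt (real N)))"
text \<open>The price, in terms of the squared norm of mode \<open>1\<close>, of the commutator term of mode \<open>0\<close>.\<close>

definition Pw :: real where "Pw = 16 * \<beta>\<^sup>2 * (1 + \<tau>0\<^sup>2) / (slope * r * \<tau>)"

lemma Mw_pos: "0 < Mw" unfolding Mw_def using M0_pos by (simp add: add_pos_nonneg)

lemma Pw_nonneg: "0 \<le> Pw" unfolding Pw_def using slope_pos r_pos \<tau>_pos by simp

lemma \<zeta>1_nonneg: "0 < h \<Longrightarrow> 0 \<le> \<zeta>1 h N"
  unfolding \<zeta>1_def using \<beta>_nonneg \<tau>_pos \<epsilon>_pos r_pos B_nonneg Mw_pos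
  by (auto intro!: add_nonneg_nonneg mult_nonneg_nonneg)

lemma hypo1_bounds:
  assumes h: "0 < h" "h < h0" and t: "0 \<le> t" and N: "4 \<le> N"
  defines "F \<equiv> \<Sum>k<N. (1 - real k / real N) * (norm (\<delta> h (R h (U t k))))\<^sup>2"
  shows "1 / 4 * F \<le> hypo1 h N t"
    and "hypo1 h N t \<le> 3 / 4 * F + (slope\<^sup>2 + Mw / 2) * mass2 t"
proof -
  define x where "x = (\<lambda>k. norm (\<delta> h (R h (U t k))))"
  define w where "w = (\<lambda>k. norm (R h (U t k)))"
  define E where "E = (\<Sum>k<N. (1 - real k / real N) * (w k)\<^sup>2)"
  have F: "F = (\<Sum>k<N. (1 - real k / real N) * (x k)\<^sup>2)" by (simp add: F_def x_def)
  note csx = cutoff_sums[of "\<lambda>k. (x k)\<^sup>2" N, OF zero_le_power2 N, folded F]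
  note csw = cutoff_sums[of "\<lambda>k. (w k)\<^sup>2" N, OF zero_le_power2 N, folded E_def]
  have A: "0 < wt / (2 * r)" "wt / (2 * r) \<le> slope"
    using wt_bounds r_pos by (auto simp: slope_def divide_right_mono)
  have "\<bar>cross1 h t\<bar> \<le> w 1 * x 0"
    unfolding cross1_def x_def w_def
    by (rule order_trans[OF Cauchy_Schwarz_ineq2 mult_right_mono[OF R_norm[OF h] norm_ge_zero]])
  hence "\<bar>wt / (2 * r) * cross1 h t\<bar> \<le> slope * (w 1 * x 0)"
    unfolding abs_mult using A slope_pos by (intro mult_mono) auto
  also have "\<dots> \<le> 1 / 4 * (x 0)\<^sup>2 + slope\<^sup>2 * (w 1)\<^sup>2"
    using young[of "1 / 4" "x 0" "slope * w 1"] by (simp add: power_mult_distrib mult_ac)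
  finally have *: "\<bar>wt / (2 * r) * cross1 h t\<bar> \<le> 1 / 4 * (x 0)\<^sup>2 + slope\<^sup>2 * (w 1)\<^sup>2" .
  have eF: "energy (\<delta> h) h N t = 1 / 2 * F" by (simp add: energy_def F_def)
  have eE: "energy id h N t = 1 / 2 * E" by (simp add: energy_def E_def w_def)
  have x0: "(x 0)\<^sup>2 \<le> F" by (rule order_trans[OF _ csx(3)]) simp
  have E0: "3 / 4 * (w 1)\<^sup>2 \<le> E" by (rule order_trans[OF _ csw(3)]) simp
  have "slope\<^sup>2 * (w 1)\<^sup>2 \<le> Mw * (3 / 8 * (w 1)\<^sup>2)"
  proof -
    have "8 / 3 * slope\<^sup>2 * 1 \<le> M0 * (1 + \<tau>0\<^sup>2)"
      using slope_pos r_pos M0_pos by (intro mult_mono) (auto simp: M0_def)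
    hence "8 / 3 * slope\<^sup>2 * (3 / 8 * (w 1)\<^sup>2) \<le> Mw * (3 / 8 * (w 1)\<^sup>2)"
      unfolding Mw_def by (intro mult_right_mono) auto
    thus ?thesis by (simp add: mult_ac)
  qed
  also have "\<dots> \<le> Mw * (1 / 2 * E)" using E0 Mw_pos by (intro mult_left_mono) auto
  finally show "1 / 4 * F \<le> hypo1 h N t"
    unfolding hypo1_def eF eE using * x0 by linarith
  have "E \<le> (\<Sum>k<N. (norm (U t k))\<^sup>2)"
    unfolding E_def
  proof (rule sum_mono)
    fix k assume "k \<in> {..<N}"
    hence "(1 - real k / real N) * (w k)\<^sup>2 \<le> 1 * (norm (U t k))\<^sup>2"
      unfolding w_def by (intro mult_mono power_mono R_norm[OF h]) auto
    thus "(1 - real k / real N) * (w k)\<^sup>2 \<le> (norm (U t k))\<^sup>2" by simp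
  qed
  also have "\<dots> \<le> mass2 t" unfolding mass2_def by (intro sum_le_suminf U_summable t) auto
  finally have "Mw * (1 / 2 * E) \<le> Mw / 2 * mass2 t" using Mw_pos by simp
  moreover have "slope\<^sup>2 * (w 1)\<^sup>2 \<le> slope\<^sup>2 * mass2 t"
    unfolding w_def by (intro mult_left_mono order_trans[OF power_mono[OF R_norm[OF h]] norm_le_mass2[OF t]]) auto
  ultimately show "hypo1 h N t \<le> 3 / 4 * F + (slope\<^sup>2 + Mw / 2) * mass2 t"
    unfolding hypo1_def eF eE ring_distribs using * x0 by linarith
qed

text \<open>The rate is \<open>\<mu> / 2\<close>, half of the rate of the squared norm: the forcing by \<open>mass2\<close> then decays twice
as fast as the solution of the homogeneous inequality.\<close>

lemma hypo1_rate:
  assumes h: "0 < h" "h < h0" and t: "0 \<le> t" and N: "4 \<le> N"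
  shows "\<exists>H'. (hypo1 h N has_real_derivative H') (at t within {0..}) \<and>
     H' \<le> - (\<mu> / 2) * hypo1 h N t + C3 * (\<tau> / \<epsilon>\<^sup>2) * mass2 t + \<zeta>1 h N * mass2 t
       + 2 * Pw * (norm (U t 1 - R h (U t 1)))\<^sup>2"
proof -
  define x where "x = (\<lambda>k. norm (\<delta> h (R h (U t k))))"
  define w where "w = (\<lambda>k. norm (R h (U t k)))"
  define u where "u = (\<lambda>k. norm (U t k))"
  define d where "d = norm (U t 1 - R h (U t 1))"
  define n where "n = mass2 t"
  define Y where "Y = (\<Sum>k<N. (1 - real k / real N) * real k * (x k)\<^sup>2)"
  define F where "F = (\<Sum>k<N. (1 - real k / real N) * (x k)\<^sup>2)"
  define Y0 where "Y0 = (\<Sum>k<N. (1 - real k / real N) * real k * (w k)\<^sup>2)"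
  define s where "s = (\<Sum>k<N. (1 - real k / real N) * inner (\<delta> h (W' h k t)) (\<delta> h (R h (U t k))))"
  define s0 where "s0 = (\<Sum>k<N. (1 - real k / real N) * inner (id (W' h k t)) (id (R h (U t k))))"
  define z where "z = inner (R h (W' h 1 t)) (\<delta> h (R h (U t 0))) + inner (R h (R h (U t 1))) (\<delta> h (W' h 0 t))"
  define D where "D = wt / (2 * \<epsilon>)"
  define A where "A = wt / (2 * r)"
  define q where "q = 4 * \<tau> * (\<beta> * h)\<^sup>2 / \<epsilon>\<^sup>2 + \<beta> * h / \<epsilon> + (r / h + B) / (\<epsilon> * sqrt (real N))"
  define q1 where "q1 = (r * (1 / h)\<^sup>2 / h + B * (1 / h)\<^sup>2) / (\<epsilon> * sqrt (real N))"
  have csx1: "3 / 4 * (x 1)\<^sup>2 + (x 2)\<^sup>2 \<le> Y" and csx2: "F \<le> (x 0)\<^sup>2 + Y"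
    using cutoff_sums[of "\<lambda>k. (x k)\<^sup>2" N, OF zero_le_power2 N, folded Y_def F_def] by auto
  have csw: "3 / 4 * (w 1)\<^sup>2 + (w 2)\<^sup>2 \<le> Y0"
    using cutoff_sums[of "\<lambda>k. (w k)\<^sup>2" N, OF zero_le_power2 N, folded Y0_def] by auto
  have A: "0 < A" and D: "0 < D" using wt_bounds r_pos \<epsilon>_pos by (auto simp: A_def D_def)
  have AD: "A * r / \<epsilon> = D" using r_pos by (simp add: A_def D_def)
  have D\<tau>: "D \<le> 1 / (32 * \<tau>)"
  proof -
    have "gap / \<tau> \<le> 1 / 16 / \<tau>" using gap_pos(2) \<tau>_pos by (intro divide_right_mono) auto
    thus ?thesis using wt_bounds(2) unfolding D_def by simp
  qed
  have der: "(hypo1 h N has_real_derivative s + A * z + Mw * s0) (at t within {0..})"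
    unfolding hypo1_def[abs_def] cross1_def s_def s0_def z_def A_def
    by (intro DERIV_add DERIV_cmult energy_deriv[OF h t] inner_W_deriv[OF h t] bounded_linear_ident[folded id_def]
        R_bl[OF h] \<delta>_bl[OF h])
  have e1: "s \<le> - 1 / (2 * \<tau>) * Y + 16 * \<beta>\<^sup>2 * (\<tau> / \<epsilon>\<^sup>2) * n + 2 * \<beta> / \<epsilon> * u 1 * x 0 + q1 * n"
  proof -
    have g: "norm (\<delta> h v) \<le> 1 / h * norm v" for v using \<delta>_norm[OF h, of v] by simp
    have \<gamma>: "norm (\<delta> h (R h (b v)) - b (\<delta> h (R h v))) \<le> 2 * \<beta> * norm v" for v
    proof -
      interpret R: bounded_linear "R h" by (rule R_bl[OF h])
      have "\<delta> h (R h (b v)) - b (\<delta> h (R h v)) = R h (\<delta> h (b v) - b (\<delta> h v)) + (R h (b (\<delta> h v)) - b (R h (\<delta> h v)))"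
        by (simp add: R.diff R_\<delta>[OF h])
      also have "norm \<dots> \<le> \<beta> * norm v + \<beta> * h * norm (\<delta> h v)"
        by (intro norm_triangle_le add_mono R_b[OF h] order_trans[OF R_norm[OF h] \<delta>_b[OF h]])
      also have "\<beta> * h * norm (\<delta> h v) \<le> \<beta> * h * (norm v / h)"
        using \<beta>_nonneg h by (intro mult_left_mono \<delta>_norm[OF h]) auto
      finally show ?thesis using h by simp
    qed
    show ?thesis
      using energy_rate[OF h t _ \<delta>_bl[OF h] R_\<delta>[OF h, symmetric] refl g _ \<gamma>, of N] N h \<beta>_nonneg
      unfolding s_def Y_def x_def u_def n_def q1_def by (simp add: power_mult_distrib mult_ac)
  qed
  have e0: "s0 \<le> - 1 / (2 * \<tau>) * Y0 + q * n"
    using mass_rate[OF h t, of N] N unfolding s0_def Y0_def q_def w_def n_def by simp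
  have ez: "A * z \<le> D * (- (x 0)\<^sup>2 + sqrt 2 * x 2 * x 0 + (x 1)\<^sup>2 + (B / r * u 0 * x 0 + B / r * sqrt 2 * u 2 * x 0 + B / r * u 1 * x 1))
      + A / \<tau> * w 1 * x 0"
  proof -
    have "A * z \<le> A * (1 / \<epsilon> * (r * (- (x 0)\<^sup>2 + sqrt 2 * x 2 * x 0 + (x 1)\<^sup>2) + B * (u 0 * x 0 + sqrt 2 * u 2 * x 0 + u 1 * x 1))
      + 1 / \<tau> * w 1 * x 0)"
      using cross1_rate[OF h t] A unfolding z_def x_def u_def w_def by (intro mult_left_mono) auto
    also have "\<dots> = D * (- (x 0)\<^sup>2 + sqrt 2 * x 2 * x 0 + (x 1)\<^sup>2 + (B / r * u 0 * x 0 + B / r * sqrt 2 * u 2 * x 0 + B / r * u 1 * x 1))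
      + A / \<tau> * w 1 * x 0"
      unfolding AD[symmetric] using r_pos \<epsilon>_pos by (simp add: field_simps)
    finally show ?thesis .
  qed
  have y1: "sqrt 2 * x 2 * x 0 \<le> 1 / 8 * (x 0)\<^sup>2 + 4 * (x 2)\<^sup>2"
    using young[of "1 / 8" "x 0" "sqrt 2 * x 2"] by (simp add: power_mult_distrib mult_ac)
  have y2: "B / r * u 0 * x 0 \<le> 1 / 16 * (x 0)\<^sup>2 + 4 * ((B / r)\<^sup>2 * (u 0)\<^sup>2)"
    using young[of "1 / 16" "x 0" "B / r * u 0"] by (simp add: power_mult_distrib power_divide mult_ac)
  have y3: "B / r * sqrt 2 * u 2 * x 0 \<le> 1 / 16 * (x 0)\<^sup>2 + 8 * ((B / r)\<^sup>2 * (u 2)\<^sup>2)"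
    using young[of "1 / 16" "x 0" "B / r * sqrt 2 * u 2"] by (simp add: power_mult_distrib power_divide mult_ac)
  have y4: "B / r * u 1 * x 1 \<le> 1 / 4 * (x 1)\<^sup>2 + (B / r)\<^sup>2 * (u 1)\<^sup>2"
    using young[of "1 / 4" "x 1" "B / r * u 1"] by (simp add: power_mult_distrib power_divide mult_ac)
  have un: "(u k)\<^sup>2 \<le> n" for k unfolding u_def n_def by (rule norm_le_mass2[OF t])
  have n0: "0 \<le> n" unfolding n_def by (rule mass2_nonneg[OF t])
  have "- (x 0)\<^sup>2 + sqrt 2 * x 2 * x 0 + (x 1)\<^sup>2 + (B / r * u 0 * x 0 + B / r * sqrt 2 * u 2 * x 0 + B / r * u 1 * x 1)
     \<le> - (3 / 4) * (x 0)\<^sup>2 + 4 * ((x 1)\<^sup>2 + (x 2)\<^sup>2) + 13 * (B / r)\<^sup>2 * n"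
  proof -
    have "(B / r)\<^sup>2 * (u k)\<^sup>2 \<le> (B / r)\<^sup>2 * n" for k by (intro mult_left_mono un) auto
    from this[of 0] this[of 1] this[of 2]
    have "4 * ((B / r)\<^sup>2 * (u 0)\<^sup>2) + 8 * ((B / r)\<^sup>2 * (u 2)\<^sup>2) + (B / r)\<^sup>2 * (u 1)\<^sup>2 \<le> 13 * ((B / r)\<^sup>2 * n)" by linarith
    moreover have "5 / 4 * (x 1)\<^sup>2 \<le> 4 * (x 1)\<^sup>2" by simp
    ultimately show ?thesis using y1 y2 y3 y4 by (simp only: mult.assoc distrib_left)
  qed
  hence "D * (- (x 0)\<^sup>2 + sqrt 2 * x 2 * x 0 + (x 1)\<^sup>2 + (B / r * u 0 * x 0 + B / r * sqrt 2 * u 2 * x 0 + B / r * u 1 * x 1))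
     \<le> D * (- (3 / 4) * (x 0)\<^sup>2 + 4 * ((x 1)\<^sup>2 + (x 2)\<^sup>2) + 13 * (B / r)\<^sup>2 * n)"
    using D by (intro mult_left_mono) auto
  also have "\<dots> = - (3 / 4) * (D * (x 0)\<^sup>2) + D * (4 * ((x 1)\<^sup>2 + (x 2)\<^sup>2)) + D * (13 * (B / r)\<^sup>2 * n)"
    by (simp add: algebra_simps)
  also have "\<dots> \<le> - (3 / 4) * (D * (x 0)\<^sup>2) + 1 / (4 * \<tau>) * Y + 13 * gap / 2 * (B / r)\<^sup>2 * (\<tau> / \<epsilon>\<^sup>2) * n"
  proof -
    have "4 * ((x 1)\<^sup>2 + (x 2)\<^sup>2) \<le> 8 * Y"
    proof -
      have "0 \<le> Y" by (rule order_trans[OF _ csx1]) simp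
      have "4 * ((x 1)\<^sup>2 + (x 2)\<^sup>2) \<le> 16 / 3 * (3 / 4 * (x 1)\<^sup>2 + (x 2)\<^sup>2)" by simp
      also have "\<dots> \<le> 16 / 3 * Y" using csx1 by (rule mult_left_mono) simp
      also have "\<dots> \<le> 8 * Y" using \<open>0 \<le> Y\<close> by simp
      finally show ?thesis .
    qed
    hence "D * (4 * ((x 1)\<^sup>2 + (x 2)\<^sup>2)) \<le> 1 / (32 * \<tau>) * (8 * Y)"
      by (rule mult_mono[OF D\<tau>]) (use \<tau>_pos in auto)
    moreover have "D * (13 * (B / r)\<^sup>2 * n) \<le> gap / 2 * (\<tau> / \<epsilon>\<^sup>2) * (13 * (B / r)\<^sup>2 * n)"
    proof (rule mult_right_mono)
      have "D = gap / 2 * (\<tau> / \<epsilon>\<^sup>2) / (1 + \<tau>0\<^sup>2)"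
        using \<epsilon>_pos by (simp add: D_def wt_def power2_eq_square)
      also have "\<dots> \<le> gap / 2 * (\<tau> / \<epsilon>\<^sup>2) / 1"
        using gap_pos \<tau>_pos by (intro divide_left_mono) (auto simp: add_pos_nonneg)
      finally show "D \<le> gap / 2 * (\<tau> / \<epsilon>\<^sup>2)" by simp
    qed (use n0 in auto)
    ultimately show ?thesis by (simp add: mult_ac)
  qed
  finally have f1: "D * (- (x 0)\<^sup>2 + sqrt 2 * x 2 * x 0 + (x 1)\<^sup>2 + (B / r * u 0 * x 0 + B / r * sqrt 2 * u 2 * x 0 + B / r * u 1 * x 1))
     \<le> - (3 / 4) * (D * (x 0)\<^sup>2) + 1 / (4 * \<tau>) * Y + 13 * gap / 2 * (B / r)\<^sup>2 * (\<tau> / \<epsilon>\<^sup>2) * n" .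
  have f2: "A / \<tau> * w 1 * x 0 \<le> 1 / 16 * (D * (x 0)\<^sup>2) + 4 * slope / (r * \<tau>) * (w 1)\<^sup>2"
  proof -
    have "A / \<tau> * w 1 * x 0 \<le> D / 16 * (x 0)\<^sup>2 + (A / \<tau> * w 1)\<^sup>2 / (4 * (D / 16))"
      using young[of "D / 16" "x 0" "A / \<tau> * w 1"] D by (simp add: mult_ac)
    also have "(A / \<tau> * w 1)\<^sup>2 / (4 * (D / 16)) = 2 / r\<^sup>2 * (wt * \<epsilon> / \<tau>\<^sup>2) * (w 1)\<^sup>2"
      unfolding A_def D_def using wt_bounds(1) r_pos \<tau>_pos \<epsilon>_pos by (simp add: power2_eq_square field_simps)
    also have "\<dots> \<le> 2 / r\<^sup>2 * (gap / \<tau>) * (w 1)\<^sup>2"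
      using wt_bounds(3) by (intro mult_right_mono mult_left_mono) auto
    also have "\<dots> = 4 * slope / (r * \<tau>) * (w 1)\<^sup>2"
      unfolding slope_def using r_pos by (simp add: power2_eq_square)
    finally show ?thesis by simp
  qed
  \<comment> \<open>Only \<open>w 1\<close> is dissipated, whereas the commutator involves \<open>u 1\<close>; the remainder \<open>d\<close> is small with \<open>h\<close>.\<close>
  have f3: "2 * \<beta> / \<epsilon> * u 1 * x 0 \<le> 1 / 16 * (D * (x 0)\<^sup>2) + 2 * Pw * (w 1)\<^sup>2 + 2 * Pw * d\<^sup>2"
  proof -
    have p: "0 < 1 + \<tau>0\<^sup>2" by (simp add: add_pos_nonneg)
    have "2 * \<beta> / \<epsilon> * u 1 * x 0 \<le> D / 16 * (x 0)\<^sup>2 + (2 * \<beta> / \<epsilon> * u 1)\<^sup>2 / (4 * (D / 16))"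
      using young[of "D / 16" "x 0" "2 * \<beta> / \<epsilon> * u 1"] D by (simp add: mult_ac)
    also have "(2 * \<beta> / \<epsilon> * u 1)\<^sup>2 / (4 * (D / 16)) = Pw * (u 1)\<^sup>2"
      unfolding D_def wt_def Pw_def slope_def using gap_pos r_pos \<tau>_pos \<epsilon>_pos p
      by (simp add: power2_eq_square divide_simps)
    also have "Pw * (u 1)\<^sup>2 \<le> Pw * (2 * (w 1)\<^sup>2 + 2 * d\<^sup>2)"
    proof (rule mult_left_mono[OF _ Pw_nonneg])
      have "u 1 \<le> w 1 + d" unfolding u_def w_def d_def by (rule norm_triangle_sub)
      hence "(u 1)\<^sup>2 \<le> (w 1 + d)\<^sup>2" by (intro power_mono) (auto simp: u_def)
      thus "(u 1)\<^sup>2 \<le> 2 * (w 1)\<^sup>2 + 2 * d\<^sup>2" using sum_squares_bound[of "w 1" d] by (simp add: power2_sum)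
    qed
    finally show ?thesis by (simp add: algebra_simps)
  qed
  \<comment> \<open>The choice of \<open>Mw\<close>: the damping in the energy of \<open>U\<close> absorbs the first mode.\<close>
  have f4: "4 * slope / (r * \<tau>) * (w 1)\<^sup>2 + 2 * Pw * (w 1)\<^sup>2 \<le> Mw * (1 / (2 * \<tau>) * Y0)"
  proof -
    have p: "1 \<le> 1 + \<tau>0\<^sup>2" by simp
    have "4 * slope / (r * \<tau>) + 2 * Pw \<le> 4 * slope / (r * \<tau>) * (1 + \<tau>0\<^sup>2) + 32 * \<beta>\<^sup>2 / (r * slope) / \<tau> * (1 + \<tau>0\<^sup>2)"
    proof (rule add_mono)
      show "4 * slope / (r * \<tau>) \<le> 4 * slope / (r * \<tau>) * (1 + \<tau>0\<^sup>2)"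
        using mult_left_mono[OF p, of "4 * slope / (r * \<tau>)"] slope_pos r_pos \<tau>_pos by simp
    qed (simp add: Pw_def field_simps)
    also have "\<dots> \<le> Mw * (3 / 8) / \<tau>"
    proof -
      have "4 * slope / r + 32 * \<beta>\<^sup>2 / (r * slope) \<le> M0 * (3 / 8)" by (simp add: M0_def)
      hence "(4 * slope / r + 32 * \<beta>\<^sup>2 / (r * slope)) * ((1 + \<tau>0\<^sup>2) / \<tau>) \<le> M0 * (3 / 8) * ((1 + \<tau>0\<^sup>2) / \<tau>)"
        using \<tau>_pos p by (intro mult_right_mono) auto
      moreover have "(A + C) * (g / \<tau>) = A / \<tau> * g + C / \<tau> * g" "M0 * (3 / 8) * (g / \<tau>) = M0 * g * (3 / 8) / \<tau>" for A C g
        by (simp_all add: ring_distribs add_divide_distrib)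
      ultimately show ?thesis unfolding Mw_def by (simp only: divide_divide_eq_left)
    qed
    finally have "(4 * slope / (r * \<tau>) + 2 * Pw) * (w 1)\<^sup>2 \<le> Mw * (3 / 8) / \<tau> * (w 1)\<^sup>2"
      by (intro mult_right_mono) auto
    also have "\<dots> = Mw * (1 / (2 * \<tau>) * (3 / 4 * (w 1)\<^sup>2))" by simp
    also have "\<dots> \<le> Mw * (1 / (2 * \<tau>) * Y0)"
    proof (intro mult_left_mono)
      show "3 / 4 * (w 1)\<^sup>2 \<le> Y0" by (rule order_trans[OF _ csw]) simp
    qed (use Mw_pos \<tau>_pos in auto)
    finally show ?thesis by (simp add: ring_distribs)
  qed
  have f5: "Mw * s0 \<le> - (Mw * (1 / (2 * \<tau>) * Y0)) + Mw * q * n"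
    using mult_left_mono[OF e0, of Mw] Mw_pos by (simp add: algebra_simps)
  have Y: "0 \<le> Y" by (rule order_trans[OF _ csx1]) simp
  have f6: "D / 2 * F \<le> 1 / (4 * \<tau>) * Y + D / 2 * (x 0)\<^sup>2"
  proof -
    have "D / 2 * F \<le> D / 2 * ((x 0)\<^sup>2 + Y)" using csx2 D by (intro mult_left_mono) auto
    moreover have "D / 2 * Y \<le> 1 / (4 * \<tau>) * Y"
    proof (rule mult_right_mono[OF _ Y])
      show "D / 2 \<le> 1 / (4 * \<tau>)" using D\<tau> \<tau>_pos by (simp add: field_simps)
    qed
    ultimately show ?thesis by (simp add: distrib_left)
  qed
  have f7: "\<mu> / 2 * hypo1 h N t \<le> D / 2 * F + gap / 2 * (slope\<^sup>2 + M0) * (\<tau> / \<epsilon>\<^sup>2) * n"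
  proof -
    have \<mu>D: "\<mu> / 2 = 2 / 3 * D" by (simp add: \<mu>_def D_def)
    have D1: "D = gap / 2 * (\<tau> / \<epsilon>\<^sup>2) / (1 + \<tau>0\<^sup>2)"
      using \<epsilon>_pos by (simp add: D_def wt_def power2_eq_square)
    have "\<mu> / 2 * hypo1 h N t \<le> 2 / 3 * D * (3 / 4 * F + (slope\<^sup>2 + Mw / 2) * n)"
      unfolding \<mu>D using hypo1_bounds(2)[OF h t N] D unfolding F_def x_def n_def by (intro mult_left_mono) auto
    also have "\<dots> = D / 2 * F + 2 / 3 * (D * (slope\<^sup>2 + Mw / 2)) * n" by (simp add: algebra_simps)
    also have "2 / 3 * (D * (slope\<^sup>2 + Mw / 2)) * n \<le> gap / 2 * (slope\<^sup>2 + M0) * (\<tau> / \<epsilon>\<^sup>2) * n"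
    proof (rule mult_right_mono[OF _ n0])
      have p: "0 < 1 + \<tau>0\<^sup>2" by (simp add: add_pos_nonneg)
      have "slope\<^sup>2 * 1 \<le> slope\<^sup>2 * (1 + \<tau>0\<^sup>2)" by (intro mult_left_mono) auto
      moreover have "Mw / 2 \<le> M0 * (1 + \<tau>0\<^sup>2)" using M0_pos p by (simp add: Mw_def)
      ultimately have "slope\<^sup>2 + Mw / 2 \<le> (slope\<^sup>2 + M0) * (1 + \<tau>0\<^sup>2)" by (simp add: distrib_right)
      hence "D * (slope\<^sup>2 + Mw / 2) \<le> D * ((slope\<^sup>2 + M0) * (1 + \<tau>0\<^sup>2))" using D by (intro mult_left_mono) auto
      also have "\<dots> = gap / 2 * (slope\<^sup>2 + M0) * (\<tau> / \<epsilon>\<^sup>2)" unfolding D1 using p by simp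
      finally have *: "D * (slope\<^sup>2 + Mw / 2) \<le> gap / 2 * (slope\<^sup>2 + M0) * (\<tau> / \<epsilon>\<^sup>2)" .
      have "0 \<le> D * (slope\<^sup>2 + Mw / 2)" using D Mw_pos by simp
      with * show "2 / 3 * (D * (slope\<^sup>2 + Mw / 2)) \<le> gap / 2 * (slope\<^sup>2 + M0) * (\<tau> / \<epsilon>\<^sup>2)" by linarith
    qed
    finally show ?thesis by simp
  qed
  have Yh: "- 1 / (2 * \<tau>) * Y = - (1 / (4 * \<tau>) * Y) - 1 / (4 * \<tau>) * Y" using \<tau>_pos by (simp add: field_simps)
  have Dx: "D / 2 * (x 0)\<^sup>2 = 1 / 2 * (D * (x 0)\<^sup>2)" by simp
  have Dx0: "0 \<le> D * (x 0)\<^sup>2" using D by simp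
  have C3: "C3 * (\<tau> / \<epsilon>\<^sup>2) * n = 16 * \<beta>\<^sup>2 * (\<tau> / \<epsilon>\<^sup>2) * n + 13 * gap / 2 * (B / r)\<^sup>2 * (\<tau> / \<epsilon>\<^sup>2) * n
      + gap / 2 * (slope\<^sup>2 + M0) * (\<tau> / \<epsilon>\<^sup>2) * n"
    unfolding C3_def by (simp only: ring_distribs)
  have Z: "\<zeta>1 h N * n = q1 * n + Mw * q * n" unfolding \<zeta>1_def q_def q1_def by (simp only: ring_distribs)
  have "s + A * z + Mw * s0 \<le> - (D / 2 * F) + 16 * \<beta>\<^sup>2 * (\<tau> / \<epsilon>\<^sup>2) * n + q1 * n + 13 * gap / 2 * (B / r)\<^sup>2 * (\<tau> / \<epsilon>\<^sup>2) * n
      + 2 * Pw * d\<^sup>2 + Mw * q * n"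
    using e1 ez f1 f2 f3 f4 f5 f6 unfolding Yh Dx using Dx0 by linarith
  hence "s + A * z + Mw * s0 \<le> - (\<mu> / 2) * hypo1 h N t + C3 * (\<tau> / \<epsilon>\<^sup>2) * n + \<zeta>1 h N * n + 2 * Pw * d\<^sup>2"
    unfolding C3 Z using f7 by linarith
  with der show ?thesis unfolding n_def d_def by auto
qed

text \<open>The bound holds eventually as \<open>h \<rightarrow> 0\<close> with an arbitrarily small loss \<open>\<eta>\<close>; the initial quantity \<open>Z0\<close>
has to bound the difference quotients at all scales.\<close>

theorem gradient_bound:
  assumes t: "0 \<le> t" and \<eta>: "0 < \<eta>"
    and init: "\<And>h n. 0 < h \<Longrightarrow> h < h0 \<Longrightarrow> (\<Sum>k<n. (norm (\<delta> h (R h (U 0 k))))\<^sup>2) \<le> Z0"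
  shows "\<forall>\<^sub>F h in at_right 0. (\<Sum>k<n. (norm (\<delta> h (R h (U t k))))\<^sup>2)
     \<le> exp (- (\<mu> / 2) * t) * (3 * Z0 + C4 * (1 + \<tau>0\<^sup>2) * mass2 0) + \<eta>"
proof -
  define G where "G = exp (- (\<mu> / 2) * t) * (3 * Z0 + C4 * (1 + \<tau>0\<^sup>2) * mass2 0)"
  obtain K where K: "K > 0" "\<And>s. s \<in> {0..t} \<Longrightarrow> mass2 s \<le> K" using mass2_bounded by blast
  \<comment> \<open>With this bound on the distance of \<open>U\<^sub>1\<close> and \<open>R\<^sub>h U\<^sub>1\<close>, its contribution is at most \<open>\<eta> / 2\<close>.\<close>
  define \<rho> where "\<rho> = sqrt (\<eta> * \<mu> / (32 * (Pw + 1)))"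
  have \<rho>: "0 < \<rho>" unfolding \<rho>_def using \<eta> \<mu>_pos Pw_nonneg by simp
  have \<rho>2: "\<rho>\<^sup>2 = \<eta> * \<mu> / (32 * (Pw + 1))" unfolding \<rho>_def using \<eta> \<mu>_pos Pw_nonneg by simp
  have \<rho>P: "4 * ((2 * Pw * \<rho>\<^sup>2) / (\<mu> / 2)) \<le> \<eta> / 2"
  proof -
    have p: "\<mu> \<noteq> 0" "Pw + 1 \<noteq> 0" using \<mu>_pos Pw_nonneg by auto
    have "4 * ((2 * Pw * \<rho>\<^sup>2) / (\<mu> / 2)) = \<eta> / 2 * (Pw / (Pw + 1))"
      unfolding \<rho>2 using p by (simp add: divide_simps)
    also have "\<dots> \<le> \<eta> / 2 * 1" using \<eta> Pw_nonneg by (intro mult_left_mono) auto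
    finally show ?thesis by simp
  qed
  have m0: "0 \<le> mass2 0" by (rule mass2_nonneg) simp
  have \<mu>2: "0 < \<mu> / 2" using \<mu>_pos by simp
  define c where "c = 3 * C3 * (\<tau> / \<epsilon>\<^sup>2) * mass2 0"
  have c0: "0 \<le> c" unfolding c_def using C3_nonneg m0 \<tau>_pos by simp
  have cdiv: "c / (\<mu> / 2) = 9 * C3 / gap * (1 + \<tau>0\<^sup>2) * mass2 0"
  proof -
    have p: "0 < 1 + \<tau>0\<^sup>2" by (simp add: add_pos_nonneg)
    have "\<mu> / 2 = gap * (\<tau> / \<epsilon>\<^sup>2) / (3 * (1 + \<tau>0\<^sup>2))"
      unfolding \<mu>_def wt_def using \<epsilon>_pos p by (simp add: power2_eq_square divide_simps)
    thus ?thesis unfolding c_def using gap_pos \<tau>_pos \<epsilon>_pos p by (simp add: field_simps)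
  qed
  have main: "(\<Sum>k<n. (1 - real k / real N) * (norm (\<delta> h (R h (U t k))))\<^sup>2) \<le> G + 4 * ((\<zeta>1 h N * K + 2 * Pw * \<rho>\<^sup>2) / (\<mu> / 2))"
    if h: "0 < h" "h < h0" and N: "4 \<le> N" "n \<le> N" and d: "\<forall>s\<in>{0..t}. norm (U s 1 - R h (U s 1)) \<le> \<rho>" for h N
  proof -
    obtain H' where H': "\<And>s. 0 \<le> s \<Longrightarrow> (hypo1 h N has_real_derivative H' s) (at s within {0..})"
       "\<And>s. 0 \<le> s \<Longrightarrow> H' s \<le> - (\<mu> / 2) * hypo1 h N s + C3 * (\<tau> / \<epsilon>\<^sup>2) * mass2 s + \<zeta>1 h N * mass2 s
         + 2 * Pw * (norm (U s 1 - R h (U s 1)))\<^sup>2"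
      using hypo1_rate[OF h _ N(1)] by metis
    have "hypo1 h N t \<le> exp (- (\<mu> / 2) * t) * (hypo1 h N 0 + c / (\<mu> / 2)) + (\<zeta>1 h N * K + 2 * Pw * \<rho>\<^sup>2) / (\<mu> / 2)"
    proof (rule gronwall_forced[OF \<mu>2 c0 _ t H'(1)])
      show "0 \<le> \<zeta>1 h N * K + 2 * Pw * \<rho>\<^sup>2" using \<zeta>1_nonneg h K Pw_nonneg by simp
      fix s assume s: "0 \<le> s" "s \<le> t"
      have "\<zeta>1 h N * mass2 s \<le> \<zeta>1 h N * K" using \<zeta>1_nonneg h K s by (intro mult_left_mono) auto
      moreover have "2 * Pw * (norm (U s 1 - R h (U s 1)))\<^sup>2 \<le> 2 * Pw * \<rho>\<^sup>2"
        using d s Pw_nonneg by (intro mult_left_mono power_mono) auto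
      moreover have "C3 * (\<tau> / \<epsilon>\<^sup>2) * mass2 s \<le> C3 * (\<tau> / \<epsilon>\<^sup>2) * (3 * mass2 0 * exp (- \<mu> * s))"
        using mass2_decay[OF s(1)] C3_nonneg \<tau>_pos by (intro mult_left_mono) auto
      moreover have "C3 * (\<tau> / \<epsilon>\<^sup>2) * (3 * mass2 0 * exp (- \<mu> * s)) = c * exp (- 2 * (\<mu> / 2) * s)"
        by (simp add: c_def)
      ultimately show "H' s \<le> - (\<mu> / 2) * hypo1 h N s + c * exp (- 2 * (\<mu> / 2) * s) + (\<zeta>1 h N * K + 2 * Pw * \<rho>\<^sup>2)"
        using H'(2)[OF s(1)] by linarith
    qed
    hence "4 * hypo1 h N t \<le> 4 * (exp (- (\<mu> / 2) * t) * (hypo1 h N 0 + c / (\<mu> / 2)) + (\<zeta>1 h N * K + 2 * Pw * \<rho>\<^sup>2) / (\<mu> / 2))"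
      by (rule mult_left_mono) simp
    also have "\<dots> = exp (- (\<mu> / 2) * t) * (4 * hypo1 h N 0 + 4 * (c / (\<mu> / 2))) + 4 * ((\<zeta>1 h N * K + 2 * Pw * \<rho>\<^sup>2) / (\<mu> / 2))"
      by (simp only: ring_distribs mult.left_commute[of 4])
    also have "\<dots> \<le> G + 4 * ((\<zeta>1 h N * K + 2 * Pw * \<rho>\<^sup>2) / (\<mu> / 2))"
      unfolding G_def
    proof (intro add_right_mono mult_left_mono)
      have "(\<Sum>k<N. (1 - real k / real N) * (norm (\<delta> h (R h (U 0 k))))\<^sup>2) \<le> (\<Sum>k<N. (norm (\<delta> h (R h (U 0 k))))\<^sup>2)"
        by (intro sum_mono mult_left_le_one_le) auto
      hence 1: "4 * hypo1 h N 0 \<le> 3 * Z0 + (4 * slope\<^sup>2 + 2 * Mw) * mass2 0"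
        using hypo1_bounds(2)[OF h order_refl N(1)] init[OF h, of N] by (simp add: algebra_simps)
      have "4 * slope\<^sup>2 * 1 \<le> 4 * slope\<^sup>2 * (1 + \<tau>0\<^sup>2)" by (intro mult_left_mono) auto
      hence "4 * slope\<^sup>2 + 2 * Mw + 36 * C3 / gap * (1 + \<tau>0\<^sup>2) \<le> C4 * (1 + \<tau>0\<^sup>2)"
        by (simp add: C4_def Mw_def ring_distribs)
      hence "(4 * slope\<^sup>2 + 2 * Mw + 36 * C3 / gap * (1 + \<tau>0\<^sup>2)) * mass2 0 \<le> C4 * (1 + \<tau>0\<^sup>2) * mass2 0"
        using m0 by (rule mult_right_mono)
      moreover have "(4 * slope\<^sup>2 + 2 * Mw + 36 * C3 / gap * (1 + \<tau>0\<^sup>2)) * mass2 0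
          = (4 * slope\<^sup>2 + 2 * Mw) * mass2 0 + 4 * (9 * C3 / gap * (1 + \<tau>0\<^sup>2) * mass2 0)"
        by (simp add: algebra_simps)
      ultimately show "4 * hypo1 h N 0 + 4 * (c / (\<mu> / 2)) \<le> 3 * Z0 + C4 * (1 + \<tau>0\<^sup>2) * mass2 0"
        unfolding cdiv using 1 by linarith
    qed simp
    finally have "4 * hypo1 h N t \<le> G + 4 * ((\<zeta>1 h N * K + 2 * Pw * \<rho>\<^sup>2) / (\<mu> / 2))" .
    moreover have "(\<Sum>k<n. (1 - real k / real N) * (norm (\<delta> h (R h (U t k))))\<^sup>2) \<le> 4 * hypo1 h N t"
      using cutoff_partial_le[OF N(2), of "\<lambda>k. (norm (\<delta> h (R h (U t k))))\<^sup>2"] hypo1_bounds(1)[OF h t N(1)] by simp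
    ultimately show ?thesis by (rule order_trans[rotated])
  qed
  define \<kappa> where "\<kappa> = (\<lambda>h. 4 * ((Mw * (4 * \<tau> * (\<beta> * h)\<^sup>2 / \<epsilon>\<^sup>2 + \<beta> * h / \<epsilon>)) * K / (\<mu> / 2)))"
  have main2: "(\<Sum>k<n. (norm (\<delta> h (R h (U t k))))\<^sup>2) \<le> G + 4 * ((2 * Pw * \<rho>\<^sup>2) / (\<mu> / 2)) + \<kappa> h"
    if h: "0 < h" "h < h0" and d: "\<forall>s\<in>{0..t}. norm (U s 1 - R h (U s 1)) \<le> \<rho>" for h
  proof (rule LIMSEQ_le[OF cutoff_tendsto])
    have "(\<lambda>N. G + 4 * ((\<zeta>1 h N * K + 2 * Pw * \<rho>\<^sup>2) / (\<mu> / 2))) \<longlonglongrightarrow>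
       G + 4 * (((0 + Mw * (4 * \<tau> * (\<beta> * h)\<^sup>2 / \<epsilon>\<^sup>2 + \<beta> * h / \<epsilon> + 0)) * K + 2 * Pw * \<rho>\<^sup>2) / (\<mu> / 2))"
      unfolding \<zeta>1_def using \<mu>_pos by (intro tendsto_intros sqrt_N_tendsto) auto
    moreover have "G + 4 * (((0 + Mw * (4 * \<tau> * (\<beta> * h)\<^sup>2 / \<epsilon>\<^sup>2 + \<beta> * h / \<epsilon> + 0)) * K + 2 * Pw * \<rho>\<^sup>2) / (\<mu> / 2))
       = G + 4 * ((2 * Pw * \<rho>\<^sup>2) / (\<mu> / 2)) + \<kappa> h"
      unfolding \<kappa>_def by (simp add: add_divide_distrib)
    ultimately show "(\<lambda>N. G + 4 * ((\<zeta>1 h N * K + 2 * Pw * \<rho>\<^sup>2) / (\<mu> / 2))) \<longlonglongrightarrow> G + 4 * ((2 * Pw * \<rho>\<^sup>2) / (\<mu> / 2)) + \<kappa> h"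
      by (simp only:)
    show "\<exists>N. \<forall>m\<ge>N. (\<Sum>k<n. (1 - real k / real m) * (norm (\<delta> h (R h (U t k))))\<^sup>2)
        \<le> G + 4 * ((\<zeta>1 h m * K + 2 * Pw * \<rho>\<^sup>2) / (\<mu> / 2))"
      using main[OF h _ _ d] by (intro exI[of _ "max 4 n"]) auto
  qed
  have "(\<kappa> \<longlongrightarrow> 4 * ((Mw * (4 * \<tau> * (\<beta> * 0)\<^sup>2 / \<epsilon>\<^sup>2 + \<beta> * 0 / \<epsilon>)) * K / (\<mu> / 2))) (at_right 0)"
    unfolding \<kappa>_def using \<mu>_pos \<epsilon>_pos by (intro tendsto_intros) auto
  hence "(\<kappa> \<longlongrightarrow> 0) (at_right 0)" by simp
  moreover have "0 < \<eta> / 2" using \<eta> by simp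
  ultimately have "\<forall>\<^sub>F h in at_right 0. \<kappa> h < \<eta> / 2" by (rule order_tendstoD)
  with R_uniform[OF \<rho> t, of 1] eventually_at_right_real[OF h0_pos]
  have "\<forall>\<^sub>F h in at_right 0. (\<Sum>k<n. (norm (\<delta> h (R h (U t k))))\<^sup>2) \<le> G + \<eta>"
  proof eventually_elim
    case (elim h)
    thus ?case using main2[of h] \<rho>P by simp
  qed
  thus ?thesis unfolding G_def .
qed

end

section \<open>The Hilbert space of square-integrable functions on the line\<close>

definition square_integrable :: "(real \<Rightarrow> real) \<Rightarrow> bool" where
  "square_integrable u \<longleftrightarrow> u \<in> borel_measurable lebesgue \<and> integrable lebesgue (\<lambda>x. (u x)\<^sup>2)"

lemma square_integrable_measurable: "square_integrable u \<Longrightarrow> u \<in> borel_measurable lebesgue"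
  by (simp add: square_integrable_def)

lemma square_integrable_mult:
  assumes "square_integrable u" "square_integrable v"
  shows "integrable lebesgue (\<lambda>x. u x * v x)"
proof (rule Bochner_Integration.integrable_bound)
  show "integrable lebesgue (\<lambda>x. (u x)\<^sup>2 + (v x)\<^sup>2)"
    using assms by (simp add: square_integrable_def)
  show "AE x in lebesgue. norm (u x * v x) \<le> norm ((u x)\<^sup>2 + (v x)\<^sup>2)"
  proof (intro always_eventually allI)
    fix x
    show "norm (u x * v x) \<le> norm ((u x)\<^sup>2 + (v x)\<^sup>2)"
    proof -
      have "2 * \<bar>u x * v x\<bar> \<le> (u x)\<^sup>2 + (v x)\<^sup>2"
        using sum_squares_bound[of "\<bar>u x\<bar>" "\<bar>v x\<bar>"] by (simp add: abs_mult mult.assoc)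
      thus ?thesis using abs_ge_zero[of "u x * v x"] unfolding real_norm_def by linarith
    qed
  qed
qed (use assms in \<open>auto simp: square_integrable_def\<close>)

lemma square_integrable_add:
  assumes "square_integrable u" "square_integrable v"
  shows "square_integrable (\<lambda>x. u x + v x)"
  using assms square_integrable_mult[OF assms]
  by (auto simp: square_integrable_def power2_sum mult.assoc)

lemma square_integrable_cmult:
  assumes "square_integrable u"
  shows "square_integrable (\<lambda>x. c * u x)"
  using assms by (auto simp: square_integrable_def power_mult_distrib)

lemma square_integrable_zero: "square_integrable (\<lambda>x. 0)"
  by (simp add: square_integrable_def)

text \<open>The quotient is partial because only square-integrable functions represent a class; the whole real
line carries the measure, and functions on a period are extended by zero.\<close>

quotient_type l2 = "real \<Rightarrow> real" / partial:
  "\<lambda>u v. square_integrable u \<and> square_integrable v \<and> (AE x in lebesgue. u x = v x)"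
proof (rule part_equivpI)
  show "\<exists>x. square_integrable x \<and> square_integrable x \<and> (AE xa in lebesgue. x xa = x xa)"
    by (rule exI[of _ "\<lambda>x. 0"]) (simp add: square_integrable_zero)
qed (auto intro!: sympI transpI elim: AE_mp)

instantiation l2 :: real_inner
begin

lift_definition zero_l2 :: l2 is "\<lambda>x. 0" by (simp add: square_integrable_zero)
lift_definition plus_l2 :: "l2 \<Rightarrow> l2 \<Rightarrow> l2" is "\<lambda>u v x. u x + v x"
  by (auto intro: square_integrable_add)
lift_definition scaleR_l2 :: "real \<Rightarrow> l2 \<Rightarrow> l2" is "\<lambda>c u x. c * u x"
  by (auto intro: square_integrable_cmult)
lift_definition uminus_l2 :: "l2 \<Rightarrow> l2" is "\<lambda>u x. - u x"
  using square_integrable_cmult[of _ "-1"] by auto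
lift_definition minus_l2 :: "l2 \<Rightarrow> l2 \<Rightarrow> l2" is "\<lambda>u v x. u x - v x"
  using square_integrable_add[OF _ square_integrable_cmult[of _ "-1"]] by auto
lift_definition inner_l2 :: "l2 \<Rightarrow> l2 \<Rightarrow> real" is "\<lambda>u v. LINT x|lebesgue. u x * v x"
  by (auto intro!: integral_cong_AE borel_measurable_times dest: square_integrable_measurable)
definition norm_l2 :: "l2 \<Rightarrow> real" where "norm_l2 u = sqrt (inner u u)"
definition sgn_l2 :: "l2 \<Rightarrow> l2" where "sgn_l2 u = scaleR (inverse (norm u)) u"
definition dist_l2 :: "l2 \<Rightarrow> l2 \<Rightarrow> real" where "dist_l2 u v = norm (u - v)"
definition uniformity_l2 :: "(l2 \<times> l2) filter" where
  "uniformity_l2 = (INF e\<in>{0<..}. principal {(x, y). dist x y < e})"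
definition open_l2 :: "l2 set \<Rightarrow> bool" where
  "open_l2 U \<longleftrightarrow> (\<forall>x\<in>U. \<forall>\<^sub>F (x', y) in uniformity. x' = x \<longrightarrow> y \<in> U)"

instance
proof
  fix x y z :: l2 and r s :: real and U :: "l2 set"
  show "dist x y = norm (x - y)" by (rule dist_l2_def)
  show "x + y + z = x + (y + z)" by transfer (auto simp: add.assoc intro!: square_integrable_add)
  show "x + y = y + x" by transfer (auto simp: add.commute intro!: square_integrable_add)
  show "0 + x = x" by transfer auto
  show "- x + x = 0" by transfer (auto simp: square_integrable_zero)
  show "x - y = x + - y"
    by transfer (use square_integrable_add[OF _ square_integrable_cmult[of _ "-1"]] in auto)
  show "r *\<^sub>R (x + y) = r *\<^sub>R x + r *\<^sub>R y"
    by transfer (auto simp: ring_distribs intro!: square_integrable_add square_integrable_cmult)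
  show "(r + s) *\<^sub>R x = r *\<^sub>R x + s *\<^sub>R x"
    by transfer (auto simp: ring_distribs intro!: square_integrable_add square_integrable_cmult)
  show "r *\<^sub>R s *\<^sub>R x = (r * s) *\<^sub>R x"
    by transfer (auto simp: mult.assoc intro!: square_integrable_cmult square_integrable_cmult[of _ "r * s" for r s, unfolded mult.assoc])
  show "1 *\<^sub>R x = x" by transfer auto
  show "sgn x = scaleR (inverse (norm x)) x" by (rule sgn_l2_def)
  show "(uniformity :: (l2 \<times> l2) filter) = (INF e\<in>{0<..}. principal {(x, y). dist x y < e})"
    by (rule uniformity_l2_def)
  show "open U \<longleftrightarrow> (\<forall>x\<in>U. \<forall>\<^sub>F (x', y) in uniformity. x' = x \<longrightarrow> y \<in> U)"
    by (rule open_l2_def)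
  show "inner x y = inner y x" by transfer (simp add: mult.commute)
  show "inner (x + y) z = inner x z + inner y z"
    by transfer (simp add: ring_distribs square_integrable_mult)
  show "inner (r *\<^sub>R x) y = r * inner x y"
    by transfer (simp add: mult.assoc)
  show "0 \<le> inner x x" by transfer simp
  show "inner x x = 0 \<longleftrightarrow> x = 0"
  proof transfer
    fix u assume "square_integrable u \<and> square_integrable u \<and> (AE x in lebesgue. u x = u x)"
    hence u: "square_integrable u" by simp
    have "(LINT x|lebesgue. u x * u x) = 0 \<longleftrightarrow> (AE x in lebesgue. u x * u x = 0)"
      by (rule integral_nonneg_eq_0_iff_AE) (auto simp: square_integrable_mult[OF u u])
    thus "((LINT x|lebesgue. u x * u x) = 0) =
       (square_integrable u \<and> square_integrable (\<lambda>x. 0) \<and> (AE x in lebesgue. u x = 0))"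
      using u by (simp add: square_integrable_zero)
  qed
  show "norm x = sqrt (inner x x)" by (rule norm_l2_def)
qed

end

text \<open>Functions that are not square-integrable get the class of \<open>0\<close>.\<close>

definition l2_class :: "(real \<Rightarrow> real) \<Rightarrow> l2" where
  "l2_class u = abs_l2 (if square_integrable u then u else (\<lambda>x. 0))"

lemma rep_l2_square_integrable: "square_integrable (rep_l2 u)"
  using Quotient_rep_reflp[OF Quotient_l2, of u] by simp

lemma l2_class_rep: "l2_class (rep_l2 u) = u"
  using Quotient_abs_rep[OF Quotient_l2, of u] by (simp add: l2_class_def rep_l2_square_integrable)

lemma rep_l2_class: "square_integrable u \<Longrightarrow> AE x in lebesgue. rep_l2 (l2_class u) x = u x"
  using Quotient_rep_abs[OF Quotient_l2, of u] by (simp add: l2_class_def)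

lemma l2_class_eqI:
  "square_integrable u \<Longrightarrow> square_integrable v \<Longrightarrow> AE x in lebesgue. u x = v x \<Longrightarrow> l2_class u = l2_class v"
  using Quotient_rel_abs[OF Quotient_l2, of u v] by (simp add: l2_class_def)

lemma l2_class_add: "square_integrable u \<Longrightarrow> square_integrable v \<Longrightarrow> l2_class u + l2_class v = l2_class (\<lambda>x. u x + v x)"
  by (simp add: l2_class_def square_integrable_add plus_l2.abs_eq)

lemma l2_class_diff:
  assumes "square_integrable u" "square_integrable v"
  shows "l2_class u - l2_class v = l2_class (\<lambda>x. u x - v x)"
  using square_integrable_add[OF assms(1) square_integrable_cmult[OF assms(2), of "-1"]] assms
  by (simp add: l2_class_def minus_l2.abs_eq)

lemma l2_class_scaleR: "square_integrable u \<Longrightarrow> c *\<^sub>R l2_class u = l2_class (\<lambda>x. c * u x)"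
  by (simp add: l2_class_def square_integrable_cmult scaleR_l2.abs_eq)

lemma l2_class_inner:
  "square_integrable u \<Longrightarrow> square_integrable v \<Longrightarrow> inner (l2_class u) (l2_class v) = (LINT x|lebesgue. u x * v x)"
  by (simp add: l2_class_def inner_l2.abs_eq)

lemma l2_class_norm2:
  "square_integrable u \<Longrightarrow> (norm (l2_class u))\<^sup>2 = (LINT x|lebesgue. (u x)\<^sup>2)"
  by (simp add: power2_norm_eq_inner l2_class_inner flip: power2_eq_square)

text \<open>Riesz--Fischer: along a subsequence \<open>f i\<close> with differences of norm at most \<open>(1 / 2) ^ i\<close>, the sum
of \<open>2 ^ i * (f (Suc i) x - f i x)\<^sup>2\<close> is integrable, hence finite almost everywhere, and therefore
\<open>f\<close> converges pointwise; Fatou's lemma identifies the limit.\<close>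

instance l2 :: complete_space
proof
  fix X :: "nat \<Rightarrow> l2" assume X: "Cauchy X"
  have "\<exists>N. \<forall>m\<ge>N. \<forall>n\<ge>N. norm (X m - X n) < (1 / 2) ^ i" for i
    using CauchyD[OF X, of "(1 / 2) ^ i"] by simp
  then obtain N where N: "\<And>i m n. m \<ge> N i \<Longrightarrow> n \<ge> N i \<Longrightarrow> norm (X m - X n) < (1 / 2) ^ i" by metis
  define s where "s i = (\<Sum>j\<le>i. N j)" for i
  have sN: "N i \<le> s i" and sN': "N i \<le> s (Suc i)" for i
    unfolding s_def by (auto intro!: member_le_sum trans_le_add1)
  define f where "f i = rep_l2 (X (s i))" for i
  have f: "square_integrable (f i)" for i unfolding f_def by (rule rep_l2_square_integrable)
  have fX: "l2_class (f i) = X (s i)" for i unfolding f_def by (rule l2_class_rep)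
  have fm[measurable]: "f i \<in> borel_measurable lebesgue" for i using f by (simp add: square_integrable_def)
  have fdiff: "square_integrable (\<lambda>x. f i x - f j x)" for i j
    using square_integrable_add[OF f[of i] square_integrable_cmult[OF f[of j], of "-1"]] by simp
  have n2: "(norm (X (s i) - X (s j)))\<^sup>2 = (LINT x|lebesgue. (f i x - f j x)\<^sup>2)" for i j
    unfolding fX[symmetric] l2_class_diff[OF f f] by (rule l2_class_norm2[OF fdiff])
  have nn2: "(\<integral>\<^sup>+x. ennreal ((f i x - f j x)\<^sup>2) \<partial>lebesgue) = ennreal ((norm (X (s i) - X (s j)))\<^sup>2)" for i j
    unfolding n2 by (rule nn_integral_eq_integral) (use fdiff in \<open>auto simp: square_integrable_def\<close>)
  have "(\<integral>\<^sup>+x. (\<Sum>i. ennreal (2 ^ i * (f (Suc i) x - f i x)\<^sup>2)) \<partial>lebesgue)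
     = (\<Sum>i. \<integral>\<^sup>+x. ennreal (2 ^ i * (f (Suc i) x - f i x)\<^sup>2) \<partial>lebesgue)"
    by (rule nn_integral_suminf) measurable
  also have "\<dots> \<le> (\<Sum>i. ennreal ((1 / 2) ^ i))"
  proof (rule suminf_le)
    fix i
    have "(\<integral>\<^sup>+x. ennreal (2 ^ i * (f (Suc i) x - f i x)\<^sup>2) \<partial>lebesgue)
       = ennreal (2 ^ i) * (\<integral>\<^sup>+x. ennreal ((f (Suc i) x - f i x)\<^sup>2) \<partial>lebesgue)"
      by (subst nn_integral_cmult[symmetric]) (auto simp: ennreal_mult)
    also have "\<dots> = ennreal (2 ^ i * (norm (X (s (Suc i)) - X (s i)))\<^sup>2)"
      unfolding nn2 by (simp add: ennreal_mult)
    also have "\<dots> \<le> ennreal ((1 / 2) ^ i)"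
    proof (rule ennreal_leI)
      have "(norm (X (s (Suc i)) - X (s i)))\<^sup>2 \<le> ((1 / 2) ^ i)\<^sup>2"
        using N[OF sN' sN, of i] by (intro power_mono) auto
      hence "2 ^ i * (norm (X (s (Suc i)) - X (s i)))\<^sup>2 \<le> 2 ^ i * ((1 / 2) ^ i)\<^sup>2"
        by (intro mult_left_mono) auto
      also have "\<dots> = (1 / 2 :: real) ^ i" by (simp add: power2_eq_square power_one_over field_simps)
      finally show "2 ^ i * (norm (X (s (Suc i)) - X (s i)))\<^sup>2 \<le> (1 / 2) ^ i" .
    qed
    finally show "(\<integral>\<^sup>+x. ennreal (2 ^ i * (f (Suc i) x - f i x)\<^sup>2) \<partial>lebesgue) \<le> ennreal ((1 / 2) ^ i)" .
  qed auto
  also have "\<dots> < \<infinity>"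
    by (subst suminf_ennreal2) (auto intro!: summable_geometric)
  finally have "AE x in lebesgue. (\<Sum>i. ennreal (2 ^ i * (f (Suc i) x - f i x)\<^sup>2)) \<noteq> \<infinity>"
    by (intro nn_integral_PInf_AE) auto
  hence conv: "AE x in lebesgue. convergent (\<lambda>i. f i x)"
  proof eventually_elim
    case (elim x)
    have "summable (\<lambda>i. 2 ^ i * (f (Suc i) x - f i x)\<^sup>2)"
      by (rule summable_suminf_not_top) (use elim in auto)
    hence "summable (\<lambda>i. (1 / 2) ^ i + 2 ^ i * (f (Suc i) x - f i x)\<^sup>2)"
      by (intro summable_add summable_geometric) auto
    hence "summable (\<lambda>i. f (Suc i) x - f i x)"
    proof (rule summable_comparison_test'[where N = 0])
      fix i
      define q where "q = (sqrt 2) ^ i"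
      have q: "q > 0" "q\<^sup>2 = 2 ^ i" unfolding q_def by (simp_all flip: power_mult power2_eq_square add: power_commutes mult.commute[of i 2] power_mult)
      have "2 * (1 / q) * (q * \<bar>f (Suc i) x - f i x\<bar>) \<le> (1 / q)\<^sup>2 + (q * \<bar>f (Suc i) x - f i x\<bar>)\<^sup>2"
        by (rule sum_squares_bound)
      hence "2 * \<bar>f (Suc i) x - f i x\<bar> \<le> (1 / 2) ^ i + 2 ^ i * (f (Suc i) x - f i x)\<^sup>2"
        using q by (simp add: power_mult_distrib power_divide)
      thus "norm (f (Suc i) x - f i x) \<le> (1 / 2) ^ i + 2 ^ i * (f (Suc i) x - f i x)\<^sup>2"
        unfolding real_norm_def by (rule order_trans[rotated]) simp
    qed
    from tendsto_add[OF summable_LIMSEQ[OF this] tendsto_const[of "f 0 x"]]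
    show "convergent (\<lambda>i. f i x)"
      unfolding sum_lessThan_telescope[of "\<lambda>i. f i x"] by (auto intro: convergentI)
  qed
  define g where "g x = lim (\<lambda>i. f i x)" for x
  have gm[measurable]: "g \<in> borel_measurable lebesgue" unfolding g_def by (rule borel_measurable_lim_metric) auto
  have lim: "AE x in lebesgue. (\<lambda>i. f i x) \<longlonglongrightarrow> g x"
    using conv by eventually_elim (simp add: g_def convergent_LIMSEQ_iff)
  have bound: "(\<integral>\<^sup>+x. ennreal ((f i x - g x)\<^sup>2) \<partial>lebesgue) \<le> ennreal (((1 / 2) ^ i)\<^sup>2)" for i
  proof -
    have "(\<integral>\<^sup>+x. ennreal ((f i x - g x)\<^sup>2) \<partial>lebesgue) = (\<integral>\<^sup>+x. liminf (\<lambda>j. ennreal ((f i x - f j x)\<^sup>2)) \<partial>lebesgue)"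
    proof (rule nn_integral_cong_AE, use lim in eventually_elim)
      case (elim x)
      have "(\<lambda>j. ennreal ((f i x - f j x)\<^sup>2)) \<longlonglongrightarrow> ennreal ((f i x - g x)\<^sup>2)"
        by (intro tendsto_intros elim)
      from lim_imp_Liminf[OF sequentially_bot this] show ?case by (rule sym)
    qed
    also have "\<dots> \<le> liminf (\<lambda>j. \<integral>\<^sup>+x. ennreal ((f i x - f j x)\<^sup>2) \<partial>lebesgue)"
      by (rule nn_integral_liminf) measurable
    also have "\<dots> \<le> ennreal (((1 / 2) ^ i)\<^sup>2)"
      unfolding nn2
    proof (rule order_trans[OF Liminf_le_Limsup[OF sequentially_bot] Limsup_bounded], rule eventually_sequentiallyI[of i])
      fix j assume "i \<le> j"
      hence "s i \<le> s j" unfolding s_def by (intro sum_mono2) auto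
      hence "norm (X (s i) - X (s j)) < (1 / 2) ^ i" using N sN[of i] by (meson order_trans)
      thus "ennreal ((norm (X (s i) - X (s j)))\<^sup>2) \<le> ennreal (((1 / 2) ^ i)\<^sup>2)"
        by (intro ennreal_leI power_mono) auto
    qed
    finally show ?thesis .
  qed
  have "integrable lebesgue (\<lambda>x. (f i x - g x)\<^sup>2)" for i
    by (rule integrableI_nonneg) (auto intro: le_less_trans[OF bound])
  hence fg: "square_integrable (\<lambda>x. f i x - g x)" for i by (simp add: square_integrable_def)
  have g: "square_integrable g"
    using square_integrable_add[OF f[of 0] square_integrable_cmult[OF fg[of 0], of "-1"]] by simp
  have "norm (X (s i) - l2_class g) \<le> (1 / 2) ^ i" for i
  proof -
    have "ennreal ((norm (X (s i) - l2_class g))\<^sup>2) = (\<integral>\<^sup>+x. ennreal ((f i x - g x)\<^sup>2) \<partial>lebesgue)"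
      unfolding fX[symmetric] l2_class_diff[OF f g] l2_class_norm2[OF fg]
      by (rule nn_integral_eq_integral[symmetric]) (use fg in \<open>auto simp: square_integrable_def\<close>)
    hence "ennreal ((norm (X (s i) - l2_class g))\<^sup>2) \<le> ennreal (((1 / 2) ^ i)\<^sup>2)"
      using bound[of i] by (simp only:)
    hence "(norm (X (s i) - l2_class g))\<^sup>2 \<le> ((1 / 2) ^ i)\<^sup>2"
      by (subst (asm) ennreal_le_iff) (rule zero_le_power2)
    thus ?thesis by (rule power2_le_imp_le) simp
  qed
  hence close: "norm (X n - l2_class g) \<le> 2 * (1 / 2) ^ i" if "n \<ge> s i" for n i
  proof -
    have "norm (X n - X (s i)) < (1 / 2) ^ i" using N that sN[of i] by (meson order_trans)
    thus ?thesis using \<open>\<And>i. norm (X (s i) - l2_class g) \<le> (1 / 2) ^ i\<close>[of i] norm_triangle_ineq[of "X n - X (s i)" "X (s i) - l2_class g"]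
      by simp
  qed
  have "X \<longlonglongrightarrow> l2_class g"
  proof (rule LIMSEQ_I)
    fix e :: real assume "0 < e"
    hence "\<exists>i. (1 / 2) ^ i < e / 2" by (intro real_arch_pow_inv) auto
    then obtain i where "2 * (1 / 2) ^ i < e" by (auto simp: mult.commute)
    thus "\<exists>no. \<forall>n\<ge>no. norm (X n - l2_class g) < e" using close by (meson order_le_less_trans)
  qed
  thus "convergent X" by (rule convergentI)
qed

text \<open>The functional is given on a subspace \<open>F\<close> that need not be closed. The representing vector
minimises \<open>(norm x)\<^sup>2 / 2 - l x\<close>: by the parallelogram identity every minimising sequence is Cauchy,
and it converges to a point of the closure of \<open>F\<close>.\<close>

lemma riesz_subspace:
  fixes F :: "'a::{real_inner, complete_space} set"
  assumes F: "subspace F" and add: "\<And>x y. x \<in> F \<Longrightarrow> y \<in> F \<Longrightarrow> l (x + y) = l x + l y"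
    and scale: "\<And>c x. x \<in> F \<Longrightarrow> l (c *\<^sub>R x) = c * l x"
    and bound: "\<And>x. x \<in> F \<Longrightarrow> \<bar>l x\<bar> \<le> C * norm x"
  obtains v where "v \<in> closure F" "\<And>x. x \<in> F \<Longrightarrow> inner v x = (l x :: real)"
proof -
  define J where "J x = (norm x)\<^sup>2 / 2 - l x" for x
  define I where "I = Inf (J ` F)"
  have zero: "0 \<in> F" by (rule subspace_0[OF F])
  have low: "- C\<^sup>2 / 2 \<le> J x" if "x \<in> F" for x
    using bound[OF that] sum_squares_bound[of C "norm x"] unfolding J_def by linarith
  have bdd: "bdd_below (J ` F)" using low by (intro bdd_belowI2)
  have I_le: "I \<le> J x" if "x \<in> F" for x unfolding I_def using bdd that by (intro cINF_lower)
  define q where "q n = 1 / real (Suc n)" for n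
  have q_pos: "0 < q n" for n by (simp add: q_def)
  have q_lim: "q \<longlonglongrightarrow> 0" unfolding q_def[abs_def] by (rule LIMSEQ_Suc[OF lim_1_over_n])
  have "\<exists>x\<in>F. J x < I + q n" for n
    using cInf_lessD[of "J ` F" "I + q n"] zero q_pos[of n] unfolding I_def by auto
  then obtain f where f: "\<And>n. f n \<in> F" "\<And>n. J (f n) < I + q n" by metis
  have mid: "(norm (x - y))\<^sup>2 = 4 * (J x + J y - 2 * J ((1 / 2) *\<^sub>R (x + y)))" if "x \<in> F" "y \<in> F" for x y
    unfolding J_def using that scale[OF subspace_add[OF F that], of "1/2"] add[OF that]
    by (simp add: power2_norm_eq_inner inner_simps inner_commute field_simps)
  have cau: "(norm (f m - f n))\<^sup>2 \<le> 4 * (q m + q n)" for m n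
  proof -
    have "J (f m) + J (f n) - 2 * J ((1 / 2) *\<^sub>R (f m + f n)) \<le> q m + q n"
      using f(2)[of m] f(2)[of n] I_le[OF subspace_scale[OF F subspace_add[OF F f(1) f(1)]], of "1/2" m n]
      by linarith
    thus ?thesis unfolding mid[OF f(1) f(1)] by (rule mult_left_mono) simp
  qed
  have "Cauchy f"
  proof (rule CauchyI)
    fix e :: real assume e: "0 < e"
    then obtain k where k: "q k < e\<^sup>2 / 8" using nat_approx_posE[of "e\<^sup>2 / 8"] by (auto simp: q_def)
    have "norm (f m - f n) < e" if "m \<ge> k" "n \<ge> k" for m n
    proof -
      have "q m \<le> q k" "q n \<le> q k"
        using that by (auto simp: q_def frac_le)
      hence "4 * (q m + q n) < e\<^sup>2" using k by simp
      hence "(norm (f m - f n))\<^sup>2 < e\<^sup>2" using cau[of m n] by (rule le_less_trans[rotated])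
      thus ?thesis by (rule power2_less_imp_less) (use e in simp)
    qed
    thus "\<exists>M. \<forall>m\<ge>M. \<forall>n\<ge>M. norm (f m - f n) < e" by blast
  qed
  then obtain v where v: "f \<longlonglongrightarrow> v" using Cauchy_convergent convergent_def by blast
  have "inner v x = l x" if x: "x \<in> F" for x
  proof -
    define d where "d = inner v x - l x"
    \<comment> \<open>Almost minimality of \<open>f n\<close>, compared with \<open>f n + s x\<close>, in the limit \<open>n \<rightarrow> \<infinity>\<close>.\<close>
    have key: "0 \<le> s * d + s\<^sup>2 / 2 * (norm x)\<^sup>2" for s
    proof (rule LIMSEQ_le)
      have "(\<lambda>n. s * (inner (f n) x - l x) + s\<^sup>2 / 2 * (norm x)\<^sup>2) \<longlonglongrightarrow> s * (inner v x - l x) + s\<^sup>2 / 2 * (norm x)\<^sup>2"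
        by (intro tendsto_intros v)
      thus "(\<lambda>n. s * (inner (f n) x - l x) + s\<^sup>2 / 2 * (norm x)\<^sup>2) \<longlonglongrightarrow> s * d + s\<^sup>2 / 2 * (norm x)\<^sup>2"
        by (simp add: d_def)
      show "(\<lambda>n. - q n) \<longlonglongrightarrow> 0"
        using tendsto_minus[OF q_lim] by simp
      have "- q n \<le> s * (inner (f n) x - l x) + s\<^sup>2 / 2 * (norm x)\<^sup>2" for n
      proof -
        have "J (f n + s *\<^sub>R x) = J (f n) + (s * (inner (f n) x - l x) + s\<^sup>2 / 2 * (norm x)\<^sup>2)"
        proof -
          have "(norm (f n + s *\<^sub>R x))\<^sup>2 = (norm (f n))\<^sup>2 + 2 * s * inner (f n) x + s\<^sup>2 * (norm x)\<^sup>2"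
            unfolding power2_norm_eq_inner by (simp add: inner_simps inner_commute power2_eq_square algebra_simps)
          thus ?thesis
            unfolding J_def using add[OF f(1)[of n] subspace_scale[OF F x, of s]] scale[OF x, of s]
            by (simp add: field_simps)
        qed
        moreover have "I \<le> J (f n + s *\<^sub>R x)" by (intro I_le subspace_add[OF F] subspace_scale[OF F] f x)
        ultimately show ?thesis using f(2)[of n] by linarith
      qed
      thus "\<exists>N. \<forall>n\<ge>N. - q n \<le> s * (inner (f n) x - l x) + s\<^sup>2 / 2 * (norm x)\<^sup>2" by blast
    qed
    \<comment> \<open>\<open>s = - d / p\<close> makes the quadratic polynomial negative unless \<open>d = 0\<close>; adding \<open>1\<close> covers \<open>x = 0\<close>.\<close>
    define p where "p = (norm x)\<^sup>2 + 1"
    have p: "p > 0" "(norm x)\<^sup>2 \<le> p" unfolding p_def by (auto simp: add_nonneg_pos)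
    have "0 \<le> (- d / p) * d + (- d / p)\<^sup>2 / 2 * (norm x)\<^sup>2" by (rule key)
    also have "\<dots> \<le> (- d / p) * d + (- d / p)\<^sup>2 / 2 * p"
      using p by (intro add_left_mono mult_left_mono) auto
    also have "\<dots> = - (d\<^sup>2 / (2 * p))" using p by (simp add: power2_eq_square field_simps)
    finally have "d\<^sup>2 / (2 * p) \<le> 0" by simp
    hence "d = 0" using p by (simp add: divide_le_0_iff)
    thus ?thesis by (simp add: d_def)
  qed
  moreover have "v \<in> closure F" using f(1) v by (auto simp: closure_sequential)
  ultimately show ?thesis using that by blast
qed

section \<open>Fubini on a triangle and functions with vanishing primitive\<close>

lemma measurable_shift_lebesgue: "(\<lambda>x::real. x + h) \<in> lebesgue \<rightarrow>\<^sub>M lebesgue"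
  using lebesgue_affine_measurable[where c = "\<lambda>x::real. 1" and t = h] by (simp add: add.commute)

lemma borel_measurable_shift:
  "u \<in> borel_measurable lebesgue \<Longrightarrow> (\<lambda>x::real. u (x + h)) \<in> borel_measurable lebesgue"
  using measurable_compose[OF measurable_shift_lebesgue] .

lemma lebesgue_on_measurableI: "u \<in> borel_measurable lebesgue \<Longrightarrow> u \<in> borel_measurable (lebesgue_on S)"
  by (rule measurable_restrict_space1)

lemma LINT_lebesgue_on_eq:
  fixes f :: "real \<Rightarrow> real"
  assumes "f absolutely_integrable_on S" "S \<in> sets lebesgue"
  shows "(LINT x|lebesgue_on S. f x) = integral S f"
  using lebesgue_integral_eq_integral absolutely_integrable_imp_integrable assms by blast

text \<open>Fubini's theorem for \<open>f x * g y\<close> on the triangle \<open>x \<le> y\<close>. It yields integration by parts for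
primitives of integrable functions without any differentiation.\<close>

lemma integral_primitive_swap:
  fixes f g :: "real \<Rightarrow> real"
  assumes f: "f absolutely_integrable_on {0..L}" and g: "g absolutely_integrable_on {0..L}"
  shows "integral {0..L} (\<lambda>y. g y * integral {0..y} f) = integral {0..L} (\<lambda>x. f x * integral {x..L} g)"
    and "(\<lambda>y. g y * integral {0..y} f) absolutely_integrable_on {0..L}"
    and "(\<lambda>x. f x * integral {x..L} g) absolutely_integrable_on {0..L}"
proof -
  define M where "M = lebesgue_on {0..L}"
  have S: "{0..L} \<in> sets lebesgue" by simp
  have sp: "space M = {0..L}" by (simp add: M_def)
  interpret M: finite_measure M unfolding M_def by (intro finite_measure_lebesgue_on) auto
  interpret P: pair_sigma_finite M M ..
  have fi: "integrable M f" and gi: "integrable M g"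
    unfolding M_def using f g by (auto intro: absolutely_integrable_imp_integrable)
  have fm[measurable]: "f \<in> borel_measurable M" and gm[measurable]: "g \<in> borel_measurable M"
    using fi gi by auto
  have idm[measurable]: "(\<lambda>x. x) \<in> borel_measurable M"
    unfolding M_def using id_borel_measurable_lebesgue_on[of "{0..L}"] by (simp add: id_def)
  define h where "h = (\<lambda>x y. f x * (g y * indicator {z. fst z \<le> snd z} (x, y)))"
  have ineq: "{z \<in> space (M \<Otimes>\<^sub>M M). fst z \<le> snd z} \<in> sets (M \<Otimes>\<^sub>M M)"
    by (rule borel_measurable_le) (auto intro: measurable_compose[OF measurable_fst idm] measurable_compose[OF measurable_snd idm])
  have hm: "case_prod h \<in> borel_measurable (M \<Otimes>\<^sub>M M)"
  proof -
    have "(\<lambda>z. f (fst z) * (g (snd z) * (indicator {z. fst z \<le> snd z} z :: real))) \<in> borel_measurable (M \<Otimes>\<^sub>M M)"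
      by (intro borel_measurable_times measurable_compose[OF measurable_fst fm] measurable_compose[OF measurable_snd gm])
        (rule borel_measurable_indicator', use ineq in \<open>simp add: Int_def conj_commute vimage_def\<close>)
    thus ?thesis by (simp add: h_def case_prod_beta')
  qed
  have bnd: "integrable M (\<lambda>y. h x y)" if "x \<in> {0..L}" for x
    unfolding h_def
    by (intro integrable_mult_right Bochner_Integration.integrable_bound[OF gi])
      (auto simp: indicator_def intro!: borel_measurable_times measurable_If)
  have hint: "integrable (M \<Otimes>\<^sub>M M) (case_prod h)"
  proof (rule Bochner_Integration.integrable_bound[OF _ hm])
    show "integrable (M \<Otimes>\<^sub>M M) (\<lambda>z. f (fst z) * g (snd z))"
    proof (rule P.Fubini_integrable)
      show "(\<lambda>z. f (fst z) * g (snd z)) \<in> borel_measurable (M \<Otimes>\<^sub>M M)"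
        by (intro borel_measurable_times measurable_compose[OF measurable_fst fm] measurable_compose[OF measurable_snd gm])
      show "integrable M (\<lambda>x. LINT y|M. norm (f (fst (x, y)) * g (snd (x, y))))"
        using fi gi by (simp add: abs_mult)
      show "AE x in M. integrable M (\<lambda>y. f (fst (x, y)) * g (snd (x, y)))"
        using gi by simp
    qed
    show "AE z in M \<Otimes>\<^sub>M M. norm (case_prod h z) \<le> norm (f (fst z) * g (snd z))"
      by (intro always_eventually allI) (auto simp: h_def indicator_def abs_mult)
  qed
  have x_int: "(LINT x|M. h x y) = g y * integral {0..y} f" if y: "y \<in> {0..L}" for y
  proof -
    have fy: "f absolutely_integrable_on {0..y}" by (rule absolutely_integrable_on_subinterval[OF f]) (use y in auto)
    have "(LINT x|M. h x y) = (LINT x|M. g y * (if x \<in> {0..y} then f x else 0))"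
      by (rule Bochner_Integration.integral_cong) (auto simp: sp h_def indicator_def)
    also have "\<dots> = g y * (LINT x|M. (if x \<in> {0..y} then f x else 0))" by simp
    also have "(LINT x|M. (if x \<in> {0..y} then f x else 0)) = (LINT x|lebesgue_on {0..y}. f x)"
      unfolding M_def using y by (intro integral_restrict) auto
    also have "\<dots> = integral {0..y} f" by (rule LINT_lebesgue_on_eq[OF fy]) simp
    finally show ?thesis .
  qed
  have y_int: "(LINT y|M. h x y) = f x * integral {x..L} g" if x: "x \<in> {0..L}" for x
  proof -
    have gx: "g absolutely_integrable_on {x..L}" by (rule absolutely_integrable_on_subinterval[OF g]) (use x in auto)
    have "(LINT y|M. h x y) = (LINT y|M. f x * (if y \<in> {x..L} then g y else 0))"
      by (rule Bochner_Integration.integral_cong) (auto simp: sp h_def indicator_def)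
    also have "\<dots> = f x * (LINT y|M. (if y \<in> {x..L} then g y else 0))" by simp
    also have "(LINT y|M. (if y \<in> {x..L} then g y else 0)) = (LINT y|lebesgue_on {x..L}. g y)"
      unfolding M_def using x by (intro integral_restrict) auto
    also have "\<dots> = integral {x..L} g" by (rule LINT_lebesgue_on_eq[OF gx]) simp
    finally show ?thesis .
  qed
  have i1: "integrable M (\<lambda>y. g y * integral {0..y} f)"
    using P.integrable_snd[OF hint] by (rule Bochner_Integration.integrable_cong[THEN iffD1, rotated -1]) (auto simp: sp x_int)
  have i2: "integrable M (\<lambda>x. f x * integral {x..L} g)"
    using P.integrable_fst[OF hint] by (rule Bochner_Integration.integrable_cong[THEN iffD1, rotated -1]) (auto simp: sp y_int)
  show a1: "(\<lambda>y. g y * integral {0..y} f) absolutely_integrable_on {0..L}"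
    using i1 unfolding M_def by (simp add: integrable_restrict_space set_integrable_def)
  show a2: "(\<lambda>x. f x * integral {x..L} g) absolutely_integrable_on {0..L}"
    using i2 unfolding M_def by (simp add: integrable_restrict_space set_integrable_def)
  have "integral {0..L} (\<lambda>y. g y * integral {0..y} f) = (LINT y|M. (LINT x|M. h x y))"
    unfolding LINT_lebesgue_on_eq[OF a1 S, symmetric] M_def[symmetric]
    by (rule Bochner_Integration.integral_cong) (auto simp: sp x_int)
  also have "\<dots> = (LINT x|M. (LINT y|M. h x y))" by (rule P.Fubini_integral[OF hint])
  also have "\<dots> = integral {0..L} (\<lambda>x. f x * integral {x..L} g)"
    unfolding LINT_lebesgue_on_eq[OF a2 S, symmetric] M_def[symmetric]
    by (rule Bochner_Integration.integral_cong) (auto simp: sp y_int)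
  finally show "integral {0..L} (\<lambda>y. g y * integral {0..y} f) = integral {0..L} (\<lambda>x. f x * integral {x..L} g)" .
qed

text \<open>The sets on which \<open>v\<close> has integral \<open>0\<close> contain the intervals and are stable under complements and
disjoint countable unions; hence they contain all Borel sets.\<close>

lemma zero_primitive_imp_AE_zero:
  fixes v :: "real \<Rightarrow> real"
  assumes v: "v absolutely_integrable_on {0..L}" and z: "\<And>x. 0 \<le> x \<Longrightarrow> x \<le> L \<Longrightarrow> integral {0..x} v = 0"
  shows "AE x in lebesgue_on {0..L}. v x = 0"
proof -
  interpret M: finite_measure "lebesgue_on {0..L}" by (intro finite_measure_lebesgue_on) auto
  have S: "{0..L} \<in> sets lebesgue" by simp
  have vi: "integrable (lebesgue_on {0..L}) v" by (rule absolutely_integrable_imp_integrable[OF v S])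
  define w where "w = (\<lambda>x. if x \<in> {0..L} then v x else 0)"
  have wi: "integrable lebesgue w" unfolding w_def using Lebesgue_Measure.integrable_restrict_UNIV[OF S, of v] vi by blast
  have sub: "integral {a..b} v = 0" if "0 \<le> a" "a \<le> b" "b \<le> L" for a b
  proof -
    have "integral {0..a} v + integral {a..b} v = integral {0..b} v"
      using that by (intro Henstock_Kurzweil_Integration.integral_combine
          integrable_subinterval_real[OF set_lebesgue_integral_eq_integral(1)[OF v]]) auto
    thus ?thesis using z[of a] z[of b] that by simp
  qed
  have borel: "(LINT x|lebesgue. indicator A x * w x) = 0" if "A \<in> sets borel" for A
    using that
  proof (induction A rule: borel_set_induct)
    case (interval a b)
    have "(LINT x|lebesgue. indicator {a..b} x * w x) = (LINT x|lebesgue. (if x \<in> {max a 0..min b L} then v x else 0))"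
      by (rule Bochner_Integration.integral_cong) (auto simp: w_def indicator_def)
    also have "\<dots> = (LINT x|lebesgue_on {max a 0..min b L}. v x)" by (rule Lebesgue_Measure.integral_restrict_UNIV) simp
    also have "\<dots> = integral {max a 0..min b L} v"
      by (intro LINT_lebesgue_on_eq absolutely_integrable_on_subinterval[OF v]) auto
    also have "\<dots> = 0"
      by (cases "max a 0 \<le> min b L") (auto intro!: sub)
    finally show ?case .
  next
    case (compl A)
    have A: "A \<in> sets lebesgue" using compl by (simp add: sets_completionI_sets)
    have iA: "integrable lebesgue (\<lambda>x. indicator A x * w x)"
      using integrable_mult_indicator[OF A wi] by simp
    have "(LINT x|lebesgue. indicator (- A) x * w x) = (LINT x|lebesgue. w x - indicator A x * w x)"
      by (rule Bochner_Integration.integral_cong) (auto simp: indicator_def)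
    also have "\<dots> = (LINT x|lebesgue. w x) - 0" using wi iA compl by simp
    also have "(LINT x|lebesgue. w x) = (LINT x|lebesgue_on {0..L}. v x)" unfolding w_def by (rule Lebesgue_Measure.integral_restrict_UNIV) simp
    also have "\<dots> = integral {0..L} v" by (rule LINT_lebesgue_on_eq[OF v]) simp
    also have "\<dots> = 0" by (cases "0 \<le> L") (auto intro: z)
    finally show ?case by simp
  next
    case (union f)
    have f: "f i \<in> sets lebesgue" for i by (rule sets_completionI_sets) (simp add: union)
    have dis: "f i \<inter> f j = {}" if "i \<noteq> j" for i j
      using union(1) that unfolding disjoint_family_on_def by blast
    have "set_integrable lebesgue (\<Union>i. f i) w"
      unfolding set_integrable_def by (intro integrable_mult_indicator wi sets.countable_UN) (use f in blast)
    hence "set_lebesgue_integral lebesgue (\<Union>i. f i) w = (\<Sum>i. set_lebesgue_integral lebesgue (f i) w)"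
      using lebesgue_integral_countable_add[of f lebesgue w] f dis by blast
    also have "\<dots> = 0" using union(3) unfolding set_lebesgue_integral_def by simp
    finally show ?case by (simp add: set_lebesgue_integral_def)
  qed simp
  have "set_lebesgue_integral (lebesgue_on {0..L}) A v = 0" if A: "A \<in> sets (lebesgue_on {0..L})" for A
  proof -
    have A': "A \<in> sets lebesgue" "A \<subseteq> {0..L}" using A by (auto simp: sets_restrict_space)
    obtain B N where B: "B \<in> sets borel" and N: "N \<in> null_sets lebesgue" and AB: "A = B \<union> N \<or> (\<forall>x. x \<notin> N \<longrightarrow> (x \<in> A \<longleftrightarrow> x \<in> B))"
    proof -
      from A'(1) obtain S N N' where *: "S \<union> N = A" "N \<subseteq> N'" "N' \<in> null_sets lborel" "S \<in> sets lborel"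
        unfolding sets_completion by auto
      have "N' \<in> null_sets lebesgue" using *(3) by (rule null_sets_completionI)
      thus ?thesis using that[of S N'] * by auto
    qed
    have "set_lebesgue_integral (lebesgue_on {0..L}) A v = (LINT x|lebesgue. (if x \<in> {0..L} then indicator A x * v x else 0))"
      unfolding set_lebesgue_integral_def using Lebesgue_Measure.integral_restrict_UNIV[OF S, of "\<lambda>x. indicator A x * v x"] by simp
    also have "\<dots> = (LINT x|lebesgue. indicator A x * w x)"
      by (rule Bochner_Integration.integral_cong) (auto simp: w_def)
    also have "\<dots> = (LINT x|lebesgue. indicator B x * w x)"
    proof (rule integral_cong_AE)
      have "AE x in lebesgue. x \<notin> N" using N by (rule AE_not_in)
      thus "AE x in lebesgue. indicator A x * w x = indicator B x * w x"
        by eventually_elim (use AB in \<open>auto simp: indicator_def\<close>)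
    qed (use A' B wi in \<open>auto intro!: borel_measurable_times borel_measurable_indicator simp: sets_completionI_sets\<close>)
    also have "\<dots> = 0" by (rule borel[OF B])
    finally show ?thesis .
  qed
  thus ?thesis by (rule M.density_zero[OF vi])
qed

section \<open>Periodic functions and periodic primitives\<close>

text \<open>Functions on the circle are represented by periodic functions on the whole line, where
translations are available.\<close>

locale circle =
  fixes L :: real
  assumes L_pos: "L > 0"
begin

definition pint :: "(real \<Rightarrow> real) \<Rightarrow> real" where "pint u = integral {0..L} u"

definition ploc :: "(real \<Rightarrow> real) \<Rightarrow> bool" where
  "ploc u \<longleftrightarrow> (\<forall>x. u (x + L) = u x) \<and> u \<in> borel_measurable lebesgue \<and> u absolutely_integrable_on {0..L}"

definition pl2 :: "(real \<Rightarrow> real) \<Rightarrow> bool" where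
  "pl2 u \<longleftrightarrow> (\<forall>x. u (x + L) = u x) \<and> u \<in> borel_measurable lebesgue \<and> (\<lambda>x. (u x)\<^sup>2) absolutely_integrable_on {0..L}"

lemma ploc_periodic: "ploc u \<Longrightarrow> u (x + L) = u x" and ploc_measurable: "ploc u \<Longrightarrow> u \<in> borel_measurable lebesgue"
  by (auto simp: ploc_def)

lemma pl2_periodic: "pl2 u \<Longrightarrow> u (x + L) = u x" and pl2_measurable: "pl2 u \<Longrightarrow> u \<in> borel_measurable lebesgue"
  by (auto simp: pl2_def)

lemma ploc_boundedI:
  assumes "\<And>x. u (x + L) = u x" "u \<in> borel_measurable lebesgue" "g absolutely_integrable_on {0..L}"
    and "\<And>x. x \<in> {0..L} \<Longrightarrow> \<bar>u x\<bar> \<le> g x"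
  shows "ploc u"
  unfolding ploc_def
  using assms set_lebesgue_integral_eq_integral(1)[OF assms(3)]
  by (auto intro!: measurable_bounded_by_integrable_imp_absolutely_integrable[of _ _ g] lebesgue_on_measurableI)

lemma pl2_square: "pl2 u \<Longrightarrow> ploc (\<lambda>x. (u x)\<^sup>2)"
  by (auto simp: pl2_def ploc_def intro!: borel_measurable_power)

lemma pl2_mult:
  assumes "pl2 u" "pl2 v"
  shows "ploc (\<lambda>x. u x * v x)"
proof (rule ploc_boundedI)
  show "(\<lambda>x. (u x)\<^sup>2 + (v x)\<^sup>2) absolutely_integrable_on {0..L}"
    using assms by (intro set_integral_add) (auto simp: pl2_def)
  fix x
  have "2 * \<bar>u x * v x\<bar> \<le> (u x)\<^sup>2 + (v x)\<^sup>2"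
    using sum_squares_bound[of "\<bar>u x\<bar>" "\<bar>v x\<bar>"] by (simp add: abs_mult mult.assoc)
  thus "\<bar>u x * v x\<bar> \<le> (u x)\<^sup>2 + (v x)\<^sup>2" by (rule order_trans[rotated]) simp
qed (use assms in \<open>auto simp: pl2_def intro!: borel_measurable_times\<close>)

lemma ploc_add: "ploc u \<Longrightarrow> ploc v \<Longrightarrow> ploc (\<lambda>x. u x + v x)"
  by (auto simp: ploc_def)
lemma ploc_diff: "ploc u \<Longrightarrow> ploc v \<Longrightarrow> ploc (\<lambda>x. u x - v x)"
  by (auto simp: ploc_def)
lemma ploc_cmult: "ploc u \<Longrightarrow> ploc (\<lambda>x. c * u x)"
  by (auto simp: ploc_def)
lemma ploc_const: "ploc (\<lambda>x. c)"
  by (auto simp: ploc_def intro!: absolutely_integrable_continuous_real)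
lemma ploc_abs: "ploc u \<Longrightarrow> ploc (\<lambda>x. \<bar>u x\<bar>)"
  by (auto simp: ploc_def intro!: borel_measurable_abs set_integrable_abs)

lemma pl2_add:
  assumes "pl2 u" "pl2 v"
  shows "pl2 (\<lambda>x. u x + v x)"
proof -
  have "ploc (\<lambda>x. (u x)\<^sup>2 + (v x)\<^sup>2 + 2 * (u x * v x))"
    by (intro ploc_add ploc_cmult pl2_square pl2_mult assms)
  thus ?thesis using assms by (auto simp: pl2_def ploc_def power2_sum mult.assoc)
qed

lemma pl2_cmult: "pl2 u \<Longrightarrow> pl2 (\<lambda>x. c * u x)"
proof -
  assume u: "pl2 u"
  have "ploc (\<lambda>x. c\<^sup>2 * (u x)\<^sup>2)" by (intro ploc_cmult pl2_square u)
  moreover have "(\<lambda>x. c * u x) \<in> borel_measurable lebesgue"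
    by (intro borel_measurable_times borel_measurable_const pl2_measurable u)
  ultimately show ?thesis using pl2_periodic[OF u] by (simp add: pl2_def ploc_def power_mult_distrib)
qed

lemma pl2_diff:
  assumes "pl2 u" "pl2 v"
  shows "pl2 (\<lambda>x. u x - v x)"
  using pl2_add[OF assms(1) pl2_cmult[OF assms(2), of "-1"]] by simp

lemma pl2_const: "pl2 (\<lambda>x. c)"
  using ploc_const[of "c\<^sup>2"] by (simp add: pl2_def ploc_def)

lemma pl2_ploc:
  assumes "pl2 u"
  shows "ploc u"
  using pl2_mult[OF assms pl2_const[of 1]] by simp

lemma pl2_abs: "pl2 u \<Longrightarrow> pl2 (\<lambda>x. \<bar>u x\<bar>)"
  by (auto simp: pl2_def)

lemma continuous_lebesgue_measurable: "continuous_on UNIV u \<Longrightarrow> u \<in> borel_measurable (lebesgue :: real measure)"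
  using measurable_completion[of u lborel borel] borel_measurable_continuous_onI[of u] by simp

lemma pl2_continuous:
  assumes "continuous_on UNIV u" "\<And>x. u (x + L) = u x"
  shows "pl2 u"
proof -
  have "continuous_on {0..L} (\<lambda>x. (u x)\<^sup>2)"
    by (intro continuous_on_power continuous_on_subset[OF assms(1)]) simp
  thus ?thesis
    unfolding pl2_def using assms absolutely_integrable_continuous_real continuous_lebesgue_measurable by blast
qed

lemma continuous_bounded:
  fixes b :: "real \<Rightarrow> real"
  assumes "continuous_on UNIV b"
  obtains B where "B \<ge> 0" "\<And>x. x \<in> {0..L} \<Longrightarrow> \<bar>b x\<bar> \<le> B"
proof -
  have "compact (b ` {0..L})"
    by (rule compact_continuous_image[OF continuous_on_subset[OF assms]]) auto
  then obtain B where "\<forall>x\<in>b ` {0..L}. norm x \<le> B" using compact_imp_bounded bounded_iff by metis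
  thus ?thesis by (intro that[of "max B 0"]) (auto simp: le_max_iff_disj)
qed

lemma pl2_bmult:
  assumes b: "continuous_on UNIV b" "\<And>x. b (x + L) = b x" and u: "pl2 u"
  shows "pl2 (\<lambda>x. b x * u x)"
proof -
  obtain B where B: "B \<ge> 0" "\<And>x. x \<in> {0..L} \<Longrightarrow> \<bar>b x\<bar> \<le> B" using continuous_bounded[OF b(1)] by blast
  have bm: "b \<in> borel_measurable lebesgue" by (rule continuous_lebesgue_measurable[OF b(1)])
  have "ploc (\<lambda>x. (b x * u x)\<^sup>2)"
  proof (rule ploc_boundedI)
    show "(\<lambda>x. B\<^sup>2 * (u x)\<^sup>2) absolutely_integrable_on {0..L}" using u by (auto simp: pl2_def)
    fix x assume "x \<in> {0..L}"
    hence "(b x)\<^sup>2 \<le> B\<^sup>2" using B(2)[of x] by (metis abs_ge_zero power2_abs power_mono)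
    thus "\<bar>(b x * u x)\<^sup>2\<bar> \<le> B\<^sup>2 * (u x)\<^sup>2" by (simp add: power_mult_distrib mult_right_mono)
  qed (use b u bm in \<open>auto simp: pl2_def intro!: borel_measurable_times borel_measurable_power\<close>)
  moreover have "(\<lambda>x. b x * u x) \<in> borel_measurable lebesgue"
    by (intro borel_measurable_times bm pl2_measurable u)
  ultimately show ?thesis using b(2) pl2_periodic[OF u] by (simp add: pl2_def ploc_def)
qed

lemma periodic_int: 
  assumes "\<And>x. u (x + L) = (u x :: real)"
  shows "u (x + real n * L) = u x" "u (x - real n * L) = u x"
proof -
  show *: "u (x + real n * L) = u x" for x n
  proof (induction n)
    case (Suc n)
    have "x + real (Suc n) * L = (x + real n * L) + L" by (simp add: algebra_simps)
    hence "u (x + real (Suc n) * L) = u ((x + real n * L) + L)" by (simp only:)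
    also have "\<dots> = u (x + real n * L)" by (rule assms)
    finally show ?case using Suc by simp
  qed simp
  have "x - real n * L + real n * L = x" by simp
  with *[of "x - real n * L" n] show "u (x - real n * L) = u x" by metis
qed

lemma ploc_integrable:
  assumes "ploc u"
  shows "u absolutely_integrable_on {a..b}"
proof -
  have base: "v integrable_on {a..b}" if p: "\<And>x. v (x + L) = (v x :: real)" and i: "v integrable_on {0..L}" for v
  proof -
    have step: "v integrable_on {- real n * L..real n * L}" for n
    proof (induction n)
      case (Suc n)
      have "(\<lambda>x. v (x + real n * L)) integrable_on {0..L}" unfolding periodic_int[of v, OF p] by (rule i)
      hence 1: "v integrable_on {real n * L..real (Suc n) * L}"
        using integrable_shift_real_ivl_iff[of v "real n * L" "real n * L" "real (Suc n) * L"]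
        by (simp add: algebra_simps)
      have "(\<lambda>x. v (x - real (Suc n) * L)) integrable_on {0..L}" unfolding periodic_int[of v, OF p] by (rule i)
      hence 2: "v integrable_on {- real (Suc n) * L..- real n * L}"
        using integrable_shift_real_ivl_iff[of v "- real (Suc n) * L" "- real (Suc n) * L" "- real n * L"]
        by (simp add: algebra_simps)
      have 3: "v integrable_on {- real (Suc n) * L..real n * L}"
        by (rule Henstock_Kurzweil_Integration.integrable_combine[OF _ _ 2 Suc.IH])
          (use L_pos in \<open>auto simp: algebra_simps intro: order_trans[of "- L" 0]\<close>)
      show ?case
        by (rule Henstock_Kurzweil_Integration.integrable_combine[OF _ _ 3 1])
          (use L_pos in \<open>auto simp: algebra_simps intro: order_trans[of "- L" 0]\<close>)
    qed (simp add: integrable_on_refl[of v 0, simplified])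
    obtain n where n: "max \<bar>a\<bar> \<bar>b\<bar> \<le> real n * L"
      using reals_Archimedean3[OF L_pos] by (meson less_imp_le)
    show ?thesis by (rule integrable_subinterval_real[OF step[of n]]) (use n in auto)
  qed
  show ?thesis
    using assms base[of u] base[of "\<lambda>x. norm (u x)"]
    unfolding ploc_def absolutely_integrable_on_def by auto
qed

lemma ploc_integrable_on: "ploc u \<Longrightarrow> u integrable_on {a..b}"
  using ploc_integrable set_lebesgue_integral_eq_integral(1) by blast

lemma ploc_shift: "ploc u \<Longrightarrow> ploc (\<lambda>x. u (x + h))"
proof -
  assume u: "ploc u"
  have 1: "(\<lambda>x. u (x + h)) integrable_on {0..L}"
    using integrable_shift_real_ivl[OF ploc_integrable_on[OF u, of h "L + h"], of h] by simp
  have 2: "(\<lambda>x. \<bar>u (x + h)\<bar>) integrable_on {0..L}"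
    using integrable_shift_real_ivl[OF ploc_integrable_on[OF ploc_abs[OF u], of h "L + h"], of h] by simp
  have "u (x + L + h) = u (x + h)" for x
    using ploc_periodic[OF u, of "x + h"] by (simp add: ac_simps)
  thus ?thesis
    using 1 2 borel_measurable_shift[OF ploc_measurable[OF u], of h]
    by (simp add: ploc_def absolutely_integrable_on_def)
qed

lemma pl2_shift: "pl2 u \<Longrightarrow> pl2 (\<lambda>x. u (x + h))"
proof -
  assume u: "pl2 u"
  have "u (x + L + h) = u (x + h)" for x
    using pl2_periodic[OF u, of "x + h"] by (simp add: ac_simps)
  thus ?thesis
    using ploc_shift[OF pl2_square[OF u], of h] borel_measurable_shift[OF pl2_measurable[OF u], of h]
    by (simp add: pl2_def ploc_def)
qed

lemma integral_window:
  assumes u: "ploc u"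
  shows "integral {a..a + L} u = pint u"
proof -
  note i = ploc_integrable_on[OF u]
  have shift: "integral {x + L..y + L} u = integral {x..y} u" for x y
    using integral_shift_real_ivl[of "x + L" L "y + L" u] ploc_periodic[OF u] by simp
  have move: "integral {x..x + L} u = integral {c..c + L} u" if "c \<le> x" for c x
  proof -
    define d where "d = max x (c + L)"
    have "integral {c..x} u + integral {x..x + L} u = integral {c..x + L} u"
      using that L_pos by (intro Henstock_Kurzweil_Integration.integral_combine i) auto
    moreover have "integral {c..c + L} u + integral {c + L..x + L} u = integral {c..x + L} u"
      using that L_pos by (intro Henstock_Kurzweil_Integration.integral_combine i) auto
    ultimately show ?thesis using shift[of c x] by linarith
  qed
  show ?thesis
    using move[of "min a 0" a] move[of "min a 0" 0] by (simp add: pint_def)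
qed

lemma pint_shift:
  assumes u: "ploc u"
  shows "pint (\<lambda>x. u (x + h)) = pint u"
  using integral_window[OF u, of h] integral_shift_real_ivl[of h h "h + L" u]
  by (simp add: pint_def)

lemma pint_add: "ploc u \<Longrightarrow> ploc v \<Longrightarrow> pint (\<lambda>x. u x + v x) = pint u + pint v"
  unfolding pint_def by (intro Henstock_Kurzweil_Integration.integral_add ploc_integrable_on)
lemma pint_diff: "ploc u \<Longrightarrow> ploc v \<Longrightarrow> pint (\<lambda>x. u x - v x) = pint u - pint v"
  unfolding pint_def by (intro Henstock_Kurzweil_Integration.integral_diff ploc_integrable_on)
lemma pint_cmult: "pint (\<lambda>x. c * u x) = c * pint u"
  unfolding pint_def by (rule Henstock_Kurzweil_Integration.integral_mult_right)
lemma pint_const: "pint (\<lambda>x. c) = L * c"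
  unfolding pint_def using L_pos by simp
lemma pint_mono: "ploc u \<Longrightarrow> ploc v \<Longrightarrow> (\<And>x. u x \<le> v x) \<Longrightarrow> pint u \<le> pint v"
  unfolding pint_def by (intro integral_le ploc_integrable_on) auto
lemma pint_nonneg: "ploc u \<Longrightarrow> (\<And>x. 0 \<le> u x) \<Longrightarrow> 0 \<le> pint u"
  unfolding pint_def by (intro Henstock_Kurzweil_Integration.integral_nonneg ploc_integrable_on) auto

text \<open>\<open>F\<close> is periodic and absolutely continuous with density \<open>f\<close>. Stating this through the integral
avoids differentiation almost everywhere.\<close>

definition prim :: "(real \<Rightarrow> real) \<Rightarrow> (real \<Rightarrow> real) \<Rightarrow> bool" where
  "prim F f \<longleftrightarrow> (\<forall>x. F (x + L) = F x) \<and> ploc f \<and> (\<forall>x y. x \<le> y \<longrightarrow> F y - F x = integral {x..y} f)"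

lemma primD: "prim F f \<Longrightarrow> x \<le> y \<Longrightarrow> F y - F x = integral {x..y} f" by (simp add: prim_def)
lemma prim_ploc: "prim F f \<Longrightarrow> ploc f" by (simp add: prim_def)
lemma prim_periodic: "prim F f \<Longrightarrow> F (x + L) = F x" by (simp add: prim_def)

lemma prim_continuous:
  assumes "prim F f"
  shows "continuous_on UNIV F"
proof -
  have "isCont F x" for x
  proof -
    have "continuous_on {x - 1..x + 1} (\<lambda>y. F (x - 1) + integral {x - 1..y} f)"
      by (intro continuous_intros indefinite_integral_continuous_1 ploc_integrable_on prim_ploc[OF assms])
    hence "continuous_on {x - 1..x + 1} F"
    proof (rule continuous_on_eq)
      fix y assume "y \<in> {x - 1..x + 1}"
      thus "F (x - 1) + integral {x - 1..y} f = F y" using primD[OF assms, of "x - 1" y] by simp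
    qed
    thus ?thesis by (rule continuous_on_interior) simp
  qed
  thus ?thesis by (simp add: continuous_at_imp_continuous_on)
qed

lemma prim_pl2: "prim F f \<Longrightarrow> pl2 F"
  by (intro pl2_continuous prim_continuous prim_periodic)

lemma prim_add: "prim F f \<Longrightarrow> prim G g \<Longrightarrow> prim (\<lambda>x. F x + G x) (\<lambda>x. f x + g x)"
  unfolding prim_def by (auto intro!: ploc_add simp: Henstock_Kurzweil_Integration.integral_add ploc_integrable_on)
     (smt (verit, best))
lemma prim_cmult: "prim F f \<Longrightarrow> prim (\<lambda>x. c * F x) (\<lambda>x. c * f x)"
  unfolding prim_def by (auto intro!: ploc_cmult simp: right_diff_distrib[symmetric])
lemma prim_const: "prim (\<lambda>x. c) (\<lambda>x. 0)"
  unfolding prim_def using ploc_const by auto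

lemma prim_mean: "prim F f \<Longrightarrow> pint f = 0"
  using primD[of F f 0 L] prim_periodic[of F f 0] L_pos by (simp add: pint_def)

text \<open>The product rule for absolutely continuous functions, obtained from Fubini's theorem on the triangle
\<open>x \<le> s \<le> t \<le> y\<close>.\<close>

lemma prim_mult:
  assumes F: "prim F f" and G: "prim G g"
  shows "prim (\<lambda>x. F x * G x) (\<lambda>x. F x * g x + f x * G x)"
  unfolding prim_def
proof (intro conjI allI impI)
  have lo: "ploc (\<lambda>x. F x * g x)" if F: "prim F f" and g: "ploc g" for F f g
  proof -
    obtain B where B: "B \<ge> 0" "\<And>x. x \<in> {0..L} \<Longrightarrow> \<bar>F x\<bar> \<le> B"
      using continuous_bounded[OF prim_continuous[OF F]] by blast
    show ?thesis
    proof (rule ploc_boundedI)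
      show "(\<lambda>x. B * \<bar>g x\<bar>) absolutely_integrable_on {0..L}" using ploc_cmult[OF ploc_abs[OF g]] by (auto simp: ploc_def)
      show "\<bar>F x * g x\<bar> \<le> B * \<bar>g x\<bar>" if "x \<in> {0..L}" for x
        using B(2)[OF that] by (simp add: abs_mult mult_right_mono)
      show "(\<lambda>x. F x * g x) \<in> borel_measurable lebesgue"
        by (intro borel_measurable_times continuous_lebesgue_measurable[OF prim_continuous[OF F]] ploc_measurable[OF g])
    qed (simp add: prim_periodic[OF F] ploc_periodic[OF g])
  qed
  have l1: "ploc (\<lambda>x. F x * g x)" by (rule lo[OF F prim_ploc[OF G]])
  have l2: "ploc (\<lambda>x. f x * G x)" using lo[OF G prim_ploc[OF F]] by (simp add: mult.commute)
  show "ploc (\<lambda>x. F x * g x + f x * G x)" by (rule ploc_add[OF l1 l2])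
  show "F (x + L) * G (x + L) = F x * G x" for x using prim_periodic[OF F] prim_periodic[OF G] by simp
  fix x y :: real assume xy: "x \<le> y"
  define l where "l = y - x"
  have l0: "0 \<le> l" using xy by (simp add: l_def)
  have sh: "integral {a..b} (\<lambda>t. u (t + x)) = integral {a + x..b + x} u" for a b and u :: "real \<Rightarrow> real"
    using integral_shift_real_ivl[of "a + x" x "b + x" u] by simp
  have ab: "(\<lambda>t. u (t + x)) absolutely_integrable_on {0..l}" if "ploc u" for u
    by (rule ploc_integrable[OF ploc_shift[OF that]])
  note sw = integral_primitive_swap[OF ab[OF prim_ploc[OF F]] ab[OF prim_ploc[OF G]]]
  have e1: "integral {0..t} (\<lambda>t. f (t + x)) = F (t + x) - F x" if "t \<in> {0..l}" for t
    unfolding sh using primD[OF F, of x "t + x"] that by simp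
  have e2: "integral {t..l} (\<lambda>t. g (t + x)) = G y - G (t + x)" if "t \<in> {0..l}" for t
    unfolding sh using primD[OF G, of "t + x" y] that by (simp add: l_def)
  have "integral {0..l} (\<lambda>t. g (t + x) * (F (t + x) - F x)) = integral {0..l} (\<lambda>t. f (t + x) * (G y - G (t + x)))"
    using sw(1) by (subst (asm) (1 2) Henstock_Kurzweil_Integration.integral_cong) (auto simp: e1 e2)
  hence "integral {x..y} (\<lambda>t. g t * (F t - F x)) = integral {x..y} (\<lambda>t. f t * (G y - G t))"
    using sh[of 0 l "\<lambda>t. g t * (F t - F x)"] sh[of 0 l "\<lambda>t. f t * (G y - G t)"] by (simp add: l_def)
  moreover have "integral {x..y} (\<lambda>t. g t * (F t - F x)) = integral {x..y} (\<lambda>t. F t * g t) - F x * (G y - G x)"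
  proof -
    have "integral {x..y} (\<lambda>t. g t * (F t - F x)) = integral {x..y} (\<lambda>t. F t * g t - F x * g t)"
      by (simp add: algebra_simps)
    also have "\<dots> = integral {x..y} (\<lambda>t. F t * g t) - integral {x..y} (\<lambda>t. F x * g t)"
      by (intro Henstock_Kurzweil_Integration.integral_diff ploc_integrable_on l1 ploc_cmult prim_ploc[OF G])
    finally show ?thesis using primD[OF G xy] by simp
  qed
  moreover have "integral {x..y} (\<lambda>t. f t * (G y - G t)) = G y * (F y - F x) - integral {x..y} (\<lambda>t. f t * G t)"
  proof -
    have "integral {x..y} (\<lambda>t. f t * (G y - G t)) = integral {x..y} (\<lambda>t. G y * f t - f t * G t)"
      by (simp add: algebra_simps)
    also have "\<dots> = integral {x..y} (\<lambda>t. G y * f t) - integral {x..y} (\<lambda>t. f t * G t)"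
      by (intro Henstock_Kurzweil_Integration.integral_diff ploc_integrable_on l2 ploc_cmult prim_ploc[OF F])
    finally show ?thesis using primD[OF F xy] by simp
  qed
  moreover have "integral {x..y} (\<lambda>t. F t * g t + f t * G t) = integral {x..y} (\<lambda>t. F t * g t) + integral {x..y} (\<lambda>t. f t * G t)"
    by (intro Henstock_Kurzweil_Integration.integral_add ploc_integrable_on l1 l2)
  ultimately show "F y * G y - F x * G x = integral {x..y} (\<lambda>t. F t * g t + f t * G t)"
    by (simp add: algebra_simps)
qed

lemma prim_C1:
  assumes "\<And>x. F (x + L) = F x" "\<And>x. (F has_real_derivative f x) (at x)" "continuous_on UNIV f"
  shows "prim F f"
  unfolding prim_def
proof (intro conjI allI impI)
  have per: "f (x + L) = f x" for x
  proof -
    have "((\<lambda>y. F (y + L)) has_real_derivative f (x + L)) (at x)"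
      by (rule DERIV_shift[THEN iffD1, OF assms(2)])
    thus ?thesis using assms(2)[of x] unfolding assms(1) by (rule DERIV_unique)
  qed
  show "ploc f" by (intro pl2_ploc pl2_continuous assms per)
  show "F y - F x = integral {x..y} f" if "x \<le> y" for x y
    using fundamental_theorem_of_calculus[OF that, of F f] assms(2)
    by (metis has_real_derivative_iff_has_vector_derivative has_vector_derivative_at_within integral_unique)
qed (use assms in auto)

end

section \<open>Symmetric means, difference quotients and mean-free primitives\<close>

context circle begin

text \<open>The mean over \<open>{x - h..x + h}\<close> and, in \<open>dl\<close>, the symmetric difference quotient: \<open>dl h u\<close> is the
density of \<open>R h u\<close>.\<close>

definition R :: "real \<Rightarrow> (real \<Rightarrow> real) \<Rightarrow> real \<Rightarrow> real" where
  "R h u x = integral {x - h..x + h} u / (2 * h)"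

definition dl :: "real \<Rightarrow> (real \<Rightarrow> real) \<Rightarrow> real \<Rightarrow> real" where
  "dl h u x = (u (x + h) - u (x - h)) / (2 * h)"

definition mean :: "(real \<Rightarrow> real) \<Rightarrow> real" where "mean u = pint u / L"

text \<open>A periodic primitive of \<open>u - mean u\<close>; \<open>J\<close> is the one with mean zero, which makes \<open>J\<close> skew-symmetric.\<close>

definition J0 :: "(real \<Rightarrow> real) \<Rightarrow> real \<Rightarrow> real" where
  "J0 u x = (if 0 \<le> x then integral {0..x} (\<lambda>y. u y - mean u) else - integral {x..0} (\<lambda>y. u y - mean u))"

definition J :: "(real \<Rightarrow> real) \<Rightarrow> real \<Rightarrow> real" where "J u x = J0 u x - mean (J0 u)"

lemma dl_prim: "prim F f \<Longrightarrow> 0 < h \<Longrightarrow> dl h F x = R h f x"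
  using primD[of F f "x - h" "x + h"] by (simp add: dl_def R_def)

lemma dl_ploc:
  assumes "ploc u"
  shows "ploc (dl h u)"
proof -
  have "ploc (\<lambda>x. 1 / (2 * h) * (u (x + h) - u (x + (- h))))"
    by (intro ploc_cmult ploc_diff ploc_shift assms)
  thus ?thesis by (simp add: dl_def[abs_def])
qed

lemma dl_pl2:
  assumes "pl2 u"
  shows "pl2 (dl h u)"
proof -
  have "pl2 (\<lambda>x. 1 / (2 * h) * (u (x + h) - u (x + (- h))))"
    by (intro pl2_cmult pl2_diff pl2_shift assms)
  thus ?thesis by (simp add: dl_def[abs_def])
qed

lemma integral_shifted: "integral {a..b} (\<lambda>t. u (t + x)) = integral {a + x..b + x} (u :: real \<Rightarrow> real)"
  using integral_shift_real_ivl[of "a + x" x "b + x" u] by simp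

lemma prim_R:
  assumes u: "ploc u" and h: "0 < h"
  shows "prim (R h u) (dl h u)"
  unfolding prim_def
proof (intro conjI allI impI dl_ploc[OF u])
  show "R h u (x + L) = R h u x" for x
    using integral_shifted[of "x - h" "x + h" u L] ploc_periodic[OF u] by (simp add: R_def algebra_simps)
  fix x y :: real assume xy: "x \<le> y"
  note i = ploc_integrable_on[OF u]
  have "integral {x..y} (\<lambda>t. u (t + h) - u (t + (- h))) = integral {x..y} (\<lambda>t. u (t + h)) - integral {x..y} (\<lambda>t. u (t + (- h)))"
    by (intro Henstock_Kurzweil_Integration.integral_diff ploc_integrable_on ploc_shift u)
  hence d: "integral {x..y} (\<lambda>t. u (t + h) - u (t - h)) = integral {x + h..y + h} u - integral {x - h..y - h} u"
    unfolding integral_shifted by simp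
  have 1: "integral {x - h..x + h} u + integral {x + h..y + h} u = integral {x - h..y + h} u"
    using xy h by (intro Henstock_Kurzweil_Integration.integral_combine i) auto
  have 2: "integral {x - h..y - h} u + integral {y - h..y + h} u = integral {x - h..y + h} u"
    using xy h by (intro Henstock_Kurzweil_Integration.integral_combine i) auto
  have "integral {x..y} (dl h u) = integral {x..y} (\<lambda>t. u (t + h) - u (t - h)) / (2 * h)"
    unfolding dl_def[abs_def] by (rule Henstock_Kurzweil_Integration.integral_divide)
  thus "R h u y - R h u x = integral {x..y} (dl h u)"
    unfolding d R_def using 1 2 h by (simp add: field_simps)
qed

lemma R_pl2: "ploc u \<Longrightarrow> 0 < h \<Longrightarrow> pl2 (R h u)"
  by (rule prim_pl2[OF prim_R])

lemma R_mono_abs: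
  assumes u: "ploc u" and v: "ploc v" and h: "0 < h" and le: "\<And>y. x - h \<le> y \<Longrightarrow> y \<le> x + h \<Longrightarrow> \<bar>u y\<bar> \<le> v y"
  shows "\<bar>R h u x\<bar> \<le> R h v x"
proof -
  have "norm (integral {x - h..x + h} u) \<le> integral {x - h..x + h} v"
    by (rule integral_norm_bound_integral) (use le in \<open>auto intro!: ploc_integrable_on u v\<close>)
  thus ?thesis unfolding R_def using h by (simp add: divide_right_mono)
qed

lemma R_add: "ploc u \<Longrightarrow> ploc v \<Longrightarrow> R h (\<lambda>x. u x + v x) x = R h u x + R h v x"
  unfolding R_def by (subst Henstock_Kurzweil_Integration.integral_add) (auto intro: ploc_integrable_on simp: add_divide_distrib)
lemma R_cmult: "R h (\<lambda>x. c * u x) x = c * R h u x"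
  unfolding R_def by simp
lemma R_const: "0 < h \<Longrightarrow> R h (\<lambda>x. c) x = c"
  unfolding R_def by simp
lemma R_diff: "ploc u \<Longrightarrow> ploc v \<Longrightarrow> R h (\<lambda>x. u x - v x) x = R h u x - R h v x"
  unfolding R_def by (subst Henstock_Kurzweil_Integration.integral_diff) (auto intro: ploc_integrable_on simp: diff_divide_distrib)

lemma R_dl:
  assumes u: "ploc u"
  shows "R h (dl h u) x = dl h (R h u) x"
proof -
  have "integral {x - h..x + h} (\<lambda>t. u (t + h) - u (t + (- h)))
      = integral {x - h..x + h} (\<lambda>t. u (t + h)) - integral {x - h..x + h} (\<lambda>t. u (t + (- h)))"
    by (intro Henstock_Kurzweil_Integration.integral_diff ploc_integrable_on ploc_shift u)
  hence "integral {x - h..x + h} (\<lambda>t. u (t + h) - u (t - h)) = integral {x - h + h..x + h + h} u - integral {x - h - h..x + h - h} u"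
    unfolding integral_shifted by simp
  moreover have "integral {x - h..x + h} (dl h u) = integral {x - h..x + h} (\<lambda>t. u (t + h) - u (t - h)) / (2 * h)"
    unfolding dl_def[abs_def] by (rule Henstock_Kurzweil_Integration.integral_divide)
  ultimately show ?thesis unfolding R_def dl_def[of h "R h u"]
    by (simp add: R_def diff_divide_distrib)
qed

lemma prim_J0:
  assumes u: "ploc u"
  shows "prim (J0 u) (\<lambda>x. u x - mean u)"
proof -
  define g where "g = (\<lambda>x. u x - mean u)"
  have g: "ploc g" unfolding g_def by (intro ploc_diff ploc_const u)
  have g0: "pint g = 0"
    unfolding g_def using pint_diff[OF u ploc_const] L_pos by (simp add: pint_const mean_def)
  have J0: "J0 u x = (if 0 \<le> x then integral {0..x} g else - integral {x..0} g)" for x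
    by (simp add: J0_def g_def)
  note i = ploc_integrable_on[OF g]
  have inc: "J0 u y - J0 u x = integral {x..y} g" if "x \<le> y" for x y
  proof -
    consider "0 \<le> x" | "x < 0" "0 \<le> y" | "y < 0" by linarith
    thus ?thesis
    proof cases
      case 1
      have "integral {0..x} g + integral {x..y} g = integral {0..y} g"
        using 1 that by (intro Henstock_Kurzweil_Integration.integral_combine i) auto
      thus ?thesis using 1 that by (simp add: J0)
    next
      case 2
      have "integral {x..0} g + integral {0..y} g = integral {x..y} g"
        using 2 that by (intro Henstock_Kurzweil_Integration.integral_combine i) auto
      thus ?thesis using 2 that by (simp add: J0)
    next
      case 3
      have "integral {x..y} g + integral {y..0} g = integral {x..0} g"
        using 3 that by (intro Henstock_Kurzweil_Integration.integral_combine i) auto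
      thus ?thesis using 3 that by (simp add: J0)
    qed
  qed
  show ?thesis
    unfolding prim_def g_def[symmetric]
    using g inc inc[of x "x + L" for x] integral_window[OF g] g0 L_pos
    by (auto simp: eq_diff_eq') (smt (verit, best))
qed

lemma prim_J:
  assumes u: "ploc u"
  shows "prim (J u) (\<lambda>x. u x - mean u)"
  using prim_J0[OF u] unfolding prim_def J_def by auto

lemma pint_J: "ploc u \<Longrightarrow> pint (J u) = 0"
  unfolding J_def[abs_def]
  using pint_diff[OF pl2_ploc[OF prim_pl2[OF prim_J0]] ploc_const, of u] L_pos
  by (simp add: pint_const mean_def)

lemma pint_dl:
  assumes "ploc u"
  shows "pint (dl h u) = 0"
proof -
  have "pint (\<lambda>x. 1 / (2 * h) * (u (x + h) - u (x + (- h)))) = 0"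
    unfolding pint_cmult using pint_diff[OF ploc_shift ploc_shift, OF assms assms, of h "- h"]
      pint_shift[OF assms, of h] pint_shift[OF assms, of "- h"] by simp
  thus ?thesis by (simp add: dl_def[abs_def])
qed

text \<open>This representation reduces the symmetry of \<open>R h\<close> to integration by parts and to the skew-symmetry
of the difference quotient.\<close>

lemma R_as_J: "ploc u \<Longrightarrow> 0 < h \<Longrightarrow> R h u x = mean u + dl h (J u) x"
  using dl_prim[OF prim_J, of u h x] R_diff[OF _ ploc_const, of u h "mean u" x] R_const[of h "mean u" x] by simp

lemma pint_R: "ploc u \<Longrightarrow> 0 < h \<Longrightarrow> pint (R h u) = pint u"
proof -
  assume u: "ploc u" and h: "0 < h"
  have "pint (R h u) = pint (\<lambda>x. mean u + dl h (J u) x)" by (simp add: R_as_J[OF u h, abs_def])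
  also have "\<dots> = pint u"
    using pint_add[OF ploc_const dl_ploc[OF pl2_ploc[OF prim_pl2[OF prim_J[OF u]]]], of "mean u" h]
      pint_dl[OF pl2_ploc[OF prim_pl2[OF prim_J[OF u]]], of h] L_pos
    by (simp add: pint_const mean_def)
  finally show ?thesis .
qed

lemma prim_parts:
  assumes F: "prim F f" and G: "prim G g" and f: "pl2 f" and g: "pl2 g"
  shows "pint (\<lambda>x. F x * g x) = - pint (\<lambda>x. f x * G x)"
  using prim_mean[OF prim_mult[OF F G]]
    pint_add[OF pl2_mult[OF prim_pl2[OF F] g] pl2_mult[OF f prim_pl2[OF G]]] by simp

lemma dl_anti:
  assumes u: "pl2 u" and w: "pl2 w"
  shows "pint (\<lambda>x. dl h u x * w x) = - pint (\<lambda>x. u x * dl h w x)"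
proof -
  have "pint (\<lambda>x. u (x + h) * w x) = pint (\<lambda>x. u x * w (x - h))" 
    using pint_shift[OF pl2_mult[OF pl2_shift[OF u, of h] w], of "- h"] by simp
  moreover have "pint (\<lambda>x. u (x - h) * w x) = pint (\<lambda>x. u x * w (x + h))"
    using pint_shift[OF pl2_mult[OF pl2_shift[OF u, of "- h"] w], of h] by simp
  moreover have "(\<lambda>x. dl h u x * w x) = (\<lambda>x. 1 / (2 * h) * (u (x + h) * w x - u (x + (- h)) * w x))"
    by (rule ext) (simp add: dl_def left_diff_distrib diff_divide_distrib)
  hence "pint (\<lambda>x. dl h u x * w x) = 1 / (2 * h) * (pint (\<lambda>x. u (x + h) * w x) - pint (\<lambda>x. u (x + (- h)) * w x))"
    by (simp only: pint_cmult pint_diff[OF pl2_mult[OF pl2_shift[OF u, of h] w] pl2_mult[OF pl2_shift[OF u, of "- h"] w]])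
  moreover have "(\<lambda>x. u x * dl h w x) = (\<lambda>x. 1 / (2 * h) * (u x * w (x + h) - u x * w (x + (- h))))"
    by (rule ext) (simp add: dl_def right_diff_distrib diff_divide_distrib)
  hence "pint (\<lambda>x. u x * dl h w x) = 1 / (2 * h) * (pint (\<lambda>x. u x * w (x + h)) - pint (\<lambda>x. u x * w (x + (- h))))"
    by (simp only: pint_cmult pint_diff[OF pl2_mult[OF u pl2_shift[OF w, of h]] pl2_mult[OF u pl2_shift[OF w, of "- h"]]])
  ultimately show ?thesis by (simp add: algebra_simps)
qed

lemma pl2_mean_free: "pl2 u \<Longrightarrow> pl2 (\<lambda>x. u x - mean u)"
  by (intro pl2_diff pl2_const)

lemma R_sym:
  assumes u: "pl2 u" and w: "pl2 w" and h: "0 < h"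
  shows "pint (\<lambda>x. R h u x * w x) = pint (\<lambda>x. u x * R h w x)"
proof -
  note pu = pl2_ploc[OF u] and pw = pl2_ploc[OF w]
  note Jw = prim_J[OF pw]
  have Ru: "pl2 (R h u)" by (rule R_pl2[OF pu h])
  have Rw: "pl2 (R h w)" by (rule R_pl2[OF pw h])
  have "pint (\<lambda>x. R h u x * (w x - mean w)) = - pint (\<lambda>x. dl h u x * J w x)"
    by (rule prim_parts[OF prim_R[OF pu h] Jw dl_pl2[OF u] pl2_mean_free[OF w]])
  also have "\<dots> = pint (\<lambda>x. u x * dl h (J w) x)"
    using dl_anti[OF u prim_pl2[OF Jw], of h] by simp
  also have "\<dots> = pint (\<lambda>x. u x * R h w x - mean w * u x)"
    by (simp add: R_as_J[OF pw h] algebra_simps)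
  also have "\<dots> = pint (\<lambda>x. u x * R h w x) - mean w * pint u"
    using pint_diff[OF pl2_mult[OF u Rw] ploc_cmult[OF pu, of "mean w"]] by (simp add: pint_cmult)
  finally have "pint (\<lambda>x. R h u x * (w x - mean w)) = pint (\<lambda>x. u x * R h w x) - mean w * pint u" .
  moreover have "pint (\<lambda>x. R h u x * (w x - mean w)) = pint (\<lambda>x. R h u x * w x) - mean w * pint (R h u)"
    using pint_diff[OF pl2_mult[OF Ru w] ploc_cmult[OF pl2_ploc[OF Ru], of "mean w"]]
    by (simp add: pint_cmult algebra_simps)
  ultimately show ?thesis using pint_R[OF pu h] by simp
qed

lemma J_anti:
  assumes u: "pl2 u" and w: "pl2 w"
  shows "pint (\<lambda>x. J u x * w x) = - pint (\<lambda>x. u x * J w x)"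
proof -
  note Ju = prim_J[OF pl2_ploc[OF u]] and Jw = prim_J[OF pl2_ploc[OF w]]
  have "pint (\<lambda>x. J u x * (w x - mean w)) = - pint (\<lambda>x. (u x - mean u) * J w x)"
    by (rule prim_parts[OF Ju Jw pl2_mean_free[OF u] pl2_mean_free[OF w]])
  moreover have "pint (\<lambda>x. J u x * (w x - mean w)) = pint (\<lambda>x. J u x * w x) - mean w * pint (J u)"
    using pint_diff[OF pl2_mult[OF prim_pl2[OF Ju] w] ploc_cmult[OF pl2_ploc[OF prim_pl2[OF Ju]], of "mean w"]]
    by (simp add: pint_cmult algebra_simps)
  moreover have "pint (\<lambda>x. (u x - mean u) * J w x) = pint (\<lambda>x. u x * J w x) - mean u * pint (J w)"
    using pint_diff[OF pl2_mult[OF u prim_pl2[OF Jw]] ploc_cmult[OF pl2_ploc[OF prim_pl2[OF Jw]], of "mean u"]]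
    by (simp add: pint_cmult algebra_simps)
  ultimately show ?thesis using pint_J[OF pl2_ploc[OF u]] pint_J[OF pl2_ploc[OF w]] by simp
qed

text \<open>Jensen's inequality.\<close>

lemma R_square_le:
  assumes u: "pl2 u" and h: "0 < h"
  shows "(R h u x)\<^sup>2 \<le> R h (\<lambda>y. (u y)\<^sup>2) x"
proof -
  define c where "c = R h u x"
  note q = pl2_square[OF u] and pu = pl2_ploc[OF u]
  have "\<bar>R h (\<lambda>y. 0) x\<bar> \<le> R h (\<lambda>y. (u y - c)\<^sup>2) x"
    by (rule R_mono_abs[OF ploc_const pl2_square[OF pl2_diff[OF u pl2_const]] h]) simp
  also have "(\<lambda>y. (u y - c)\<^sup>2) = (\<lambda>y. ((u y)\<^sup>2 + c\<^sup>2) - (2 * c) * u y)"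
    by (rule ext) (simp add: power2_diff)
  also have "R h \<dots> x = R h (\<lambda>y. (u y)\<^sup>2) x + c\<^sup>2 - 2 * c * c"
    unfolding R_diff[OF ploc_add[OF q ploc_const] ploc_cmult[OF pu]] R_add[OF q ploc_const] R_const[OF h] R_cmult
    c_def[symmetric] ..
  finally show ?thesis unfolding c_def[symmetric] by (simp add: power2_eq_square)
qed

lemma R_norm_le:
  assumes u: "pl2 u" and h: "0 < h"
  shows "pint (\<lambda>x. (R h u x)\<^sup>2) \<le> pint (\<lambda>x. (u x)\<^sup>2)"
proof -
  have "pint (\<lambda>x. (R h u x)\<^sup>2) \<le> pint (R h (\<lambda>y. (u y)\<^sup>2))"
    by (intro pint_mono pl2_square R_pl2 pl2_ploc R_square_le u h)
  thus ?thesis using pint_R[OF pl2_square[OF u] h] by simp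
qed

lemma pint_two_point:
  assumes u: "pl2 u" and v: "pl2 v" and le: "\<And>x. \<bar>v x\<bar> \<le> K * (\<bar>u (x + h)\<bar> + \<bar>u (x - h)\<bar>)"
  shows "pint (\<lambda>x. (v x)\<^sup>2) \<le> 4 * K\<^sup>2 * pint (\<lambda>x. (u x)\<^sup>2)"
proof -
  have "pint (\<lambda>x. (v x)\<^sup>2) \<le> pint (\<lambda>x. 2 * K\<^sup>2 * ((u (x + h))\<^sup>2 + (u (x + (- h)))\<^sup>2))"
  proof (intro pint_mono pl2_square v ploc_cmult ploc_add pl2_shift u)
    fix x
    have "(v x)\<^sup>2 \<le> (K * (\<bar>u (x + h)\<bar> + \<bar>u (x - h)\<bar>))\<^sup>2"
      using le[of x] by (metis abs_ge_zero power2_abs power_mono)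
    also have "\<dots> \<le> 2 * K\<^sup>2 * ((u (x + h))\<^sup>2 + (u (x - h))\<^sup>2)"
    proof -
      have "(\<bar>u (x + h)\<bar> + \<bar>u (x - h)\<bar>)\<^sup>2 \<le> 2 * ((u (x + h))\<^sup>2 + (u (x - h))\<^sup>2)"
        using sum_squares_bound[of "\<bar>u (x + h)\<bar>" "\<bar>u (x - h)\<bar>"] by (simp add: power2_sum)
      hence "K\<^sup>2 * (\<bar>u (x + h)\<bar> + \<bar>u (x - h)\<bar>)\<^sup>2 \<le> K\<^sup>2 * (2 * ((u (x + h))\<^sup>2 + (u (x - h))\<^sup>2))"
        by (rule mult_left_mono) simp
      also have "\<dots> = 2 * K\<^sup>2 * ((u (x + h))\<^sup>2 + (u (x - h))\<^sup>2)" by simp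
      finally show ?thesis unfolding power_mult_distrib .
    qed
    finally show "(v x)\<^sup>2 \<le> 2 * K\<^sup>2 * ((u (x + h))\<^sup>2 + (u (x + (- h)))\<^sup>2)" by simp
  qed
  also have "\<dots> = 2 * K\<^sup>2 * (pint (\<lambda>x. (u x)\<^sup>2) + pint (\<lambda>x. (u x)\<^sup>2))"
    unfolding pint_cmult
    using pint_add[OF pl2_square[OF pl2_shift[OF u, of h]] pl2_square[OF pl2_shift[OF u, of "- h"]]]
      pint_shift[OF pl2_square[OF u], of h] pint_shift[OF pl2_square[OF u], of "- h"] by simp
  finally show ?thesis by simp
qed

lemma dl_norm_le:
  assumes u: "pl2 u" and h: "0 < h"
  shows "pint (\<lambda>x. (dl h u x)\<^sup>2) \<le> (1 / h)\<^sup>2 * pint (\<lambda>x. (u x)\<^sup>2)"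
proof -
  have "pint (\<lambda>x. (dl h u x)\<^sup>2) \<le> 4 * (1 / (2 * h))\<^sup>2 * pint (\<lambda>x. (u x)\<^sup>2)"
  proof (rule pint_two_point[OF u dl_pl2[OF u]])
    fix x
    have "\<bar>u (x + h) - u (x - h)\<bar> / (2 * h) \<le> (\<bar>u (x + h)\<bar> + \<bar>u (x - h)\<bar>) / (2 * h)"
      using h by (intro divide_right_mono abs_triangle_ineq4) auto
    thus "\<bar>dl h u x\<bar> \<le> 1 / (2 * h) * (\<bar>u (x + h)\<bar> + \<bar>u (x - h)\<bar>)"
      using h by (simp add: dl_def)
  qed
  thus ?thesis by (simp add: power_divide power_mult_distrib)
qed

text \<open>Pointwise the commutator is the mean of \<open>(b y - b x) * u y\<close>, and \<open>\<bar>y - x\<bar> \<le> h\<close> there.\<close>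

lemma R_commutator_le:
  assumes u: "pl2 u" and h: "0 < h" and bc: "continuous_on UNIV b" "\<And>x. b (x + L) = b x"
    and K: "K \<ge> 0" "\<And>x y. \<bar>b x - b y\<bar> \<le> K * \<bar>x - y\<bar>"
  shows "pint (\<lambda>x. (R h (\<lambda>y. b y * u y) x - b x * R h u x)\<^sup>2) \<le> (K * h)\<^sup>2 * pint (\<lambda>x. (u x)\<^sup>2)"
proof -
  have bu: "pl2 (\<lambda>y. b y * u y)" by (rule pl2_bmult[OF bc u])
  note au = pl2_abs[OF u]
  have pt: "\<bar>R h (\<lambda>y. b y * u y) x - b x * R h u x\<bar> \<le> K * h * R h (\<lambda>y. \<bar>u y\<bar>) x" for x
  proof -
    have "R h (\<lambda>y. b y * u y) x - b x * R h u x = R h (\<lambda>y. b y * u y - b x * u y) x"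
      by (subst R_diff) (auto intro: pl2_ploc bu ploc_cmult u simp: R_cmult)
    also have "\<bar>\<dots>\<bar> \<le> R h (\<lambda>y. (K * h) * \<bar>u y\<bar>) x"
    proof (rule R_mono_abs[OF _ _ h])
      show "ploc (\<lambda>y. b y * u y - b x * u y)" by (intro ploc_diff ploc_cmult pl2_ploc bu u)
      show "ploc (\<lambda>y. K * h * \<bar>u y\<bar>)" by (intro ploc_cmult pl2_ploc au)
      fix y assume y: "x - h \<le> y" "y \<le> x + h"
      have "\<bar>b y - b x\<bar> \<le> K * h"
        using K(2)[of y x] mult_left_mono[of "\<bar>y - x\<bar>" h K] K(1) y by (simp add: abs_le_iff)
      hence "\<bar>b y - b x\<bar> * \<bar>u y\<bar> \<le> K * h * \<bar>u y\<bar>" by (rule mult_right_mono) simp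
      thus "\<bar>b y * u y - b x * u y\<bar> \<le> K * h * \<bar>u y\<bar>" by (simp add: abs_mult[symmetric] left_diff_distrib)
    qed
    finally show ?thesis by (simp add: R_cmult)
  qed
  have "pint (\<lambda>x. (R h (\<lambda>y. b y * u y) x - b x * R h u x)\<^sup>2) \<le> pint (\<lambda>x. (K * h)\<^sup>2 * (R h (\<lambda>y. \<bar>u y\<bar>) x)\<^sup>2)"
  proof (intro pint_mono pl2_square ploc_cmult pl2_diff pl2_bmult bc R_pl2 pl2_ploc h bu u au)
    fix x
    show "(R h (\<lambda>y. b y * u y) x - b x * R h u x)\<^sup>2 \<le> (K * h)\<^sup>2 * (R h (\<lambda>y. \<bar>u y\<bar>) x)\<^sup>2"
      unfolding power_mult_distrib[symmetric] using pt[of x] by (metis abs_ge_zero power2_abs power_mono)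
  qed
  also have "\<dots> \<le> (K * h)\<^sup>2 * pint (\<lambda>x. (u x)\<^sup>2)"
    unfolding pint_cmult using R_norm_le[OF au h] by (intro mult_left_mono) auto
  finally show ?thesis .
qed

text \<open>The factor \<open>1 / (2 * h)\<close> of the difference quotient cancels against \<open>\<bar>b (x \<plusminus> h) - b x\<bar> \<le> K * h\<close>.\<close>

lemma dl_commutator_le:
  assumes u: "pl2 u" and h: "0 < h" and bc: "continuous_on UNIV b" "\<And>x. b (x + L) = b x"
    and K: "K \<ge> 0" "\<And>x y. \<bar>b x - b y\<bar> \<le> K * \<bar>x - y\<bar>"
  shows "pint (\<lambda>x. (dl h (\<lambda>y. b y * u y) x - b x * dl h u x)\<^sup>2) \<le> K\<^sup>2 * pint (\<lambda>x. (u x)\<^sup>2)"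
proof -
  have "pint (\<lambda>x. (dl h (\<lambda>y. b y * u y) x - b x * dl h u x)\<^sup>2) \<le> 4 * (K / 2)\<^sup>2 * pint (\<lambda>x. (u x)\<^sup>2)"
  proof (rule pint_two_point[OF u])
    show "pl2 (\<lambda>x. dl h (\<lambda>y. b y * u y) x - b x * dl h u x)"
      by (intro pl2_diff pl2_bmult dl_pl2 bc u)
    fix x
    have p: "\<bar>b (x + h) - b x\<bar> * \<bar>u (x + h)\<bar> \<le> K * h * \<bar>u (x + h)\<bar>"
      using K(2)[of "x + h" x] h by (intro mult_right_mono) auto
    have m: "\<bar>b (x - h) - b x\<bar> * \<bar>u (x - h)\<bar> \<le> K * h * \<bar>u (x - h)\<bar>"
      using K(2)[of "x - h" x] h by (intro mult_right_mono) auto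
    have "dl h (\<lambda>y. b y * u y) x - b x * dl h u x = ((b (x + h) - b x) * u (x + h) - (b (x - h) - b x) * u (x - h)) / (2 * h)"
      unfolding dl_def by (simp add: diff_divide_distrib[symmetric] algebra_simps)
    also have "\<bar>\<dots>\<bar> \<le> (K * h * \<bar>u (x + h)\<bar> + K * h * \<bar>u (x - h)\<bar>) / (2 * h)"
      using h p m abs_triangle_ineq4[of "(b (x + h) - b x) * u (x + h)" "(b (x - h) - b x) * u (x - h)"]
      by (simp add: abs_mult divide_right_mono)
    also have "\<dots> = K / 2 * (\<bar>u (x + h)\<bar> + \<bar>u (x - h)\<bar>)" using h by (simp add: field_simps)
    finally show "\<bar>dl h (\<lambda>y. b y * u y) x - b x * dl h u x\<bar> \<le> K / 2 * (\<bar>u (x + h)\<bar> + \<bar>u (x - h)\<bar>)" .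
  qed
  thus ?thesis by (simp add: power_divide)
qed

lemma pint_abs_square_le:
  assumes u: "pl2 u"
  shows "(pint (\<lambda>x. \<bar>u x\<bar>))\<^sup>2 \<le> L * pint (\<lambda>x. (u x)\<^sup>2)"
proof -
  note au = pl2_ploc[OF pl2_abs[OF u]]
  define c where "c = pint (\<lambda>x. \<bar>u x\<bar>) / L"
  have "0 \<le> pint (\<lambda>x. (\<bar>u x\<bar> - c)\<^sup>2)"
    by (intro pint_nonneg pl2_square pl2_diff pl2_abs pl2_const u) simp
  also have "(\<lambda>x. (\<bar>u x\<bar> - c)\<^sup>2) = (\<lambda>x. ((u x)\<^sup>2 + c\<^sup>2) - 2 * c * \<bar>u x\<bar>)"
    by (rule ext) (simp add: power2_diff)
  also have "pint \<dots> = pint (\<lambda>x. (u x)\<^sup>2) + L * c\<^sup>2 - 2 * c * pint (\<lambda>x. \<bar>u x\<bar>)"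
    by (subst pint_diff, intro ploc_add pl2_square u ploc_const, intro ploc_cmult au,
        subst pint_add[OF pl2_square[OF u] ploc_const], subst pint_const, subst pint_cmult, simp)
  finally show ?thesis unfolding c_def using L_pos by (simp add: power2_eq_square field_simps)
qed

lemma J_norm_le:
  assumes u: "pl2 u"
  shows "pint (\<lambda>x. (J u x)\<^sup>2) \<le> (4 * L)\<^sup>2 * pint (\<lambda>x. (u x)\<^sup>2)"
proof -
  note pu = pl2_ploc[OF u] and au = pl2_ploc[OF pl2_abs[OF u]]
  define a where "a = pint (\<lambda>x. \<bar>u x\<bar>)"
  have mean: "\<bar>mean u\<bar> * L \<le> a"
  proof -
    have "norm (integral {0..L} u) \<le> integral {0..L} (\<lambda>x. \<bar>u x\<bar>)"
      by (rule integral_norm_bound_integral) (auto intro!: ploc_integrable_on pu au)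
    thus ?thesis using L_pos by (simp add: mean_def a_def pint_def)
  qed
  have g: "ploc (\<lambda>x. \<bar>u x\<bar> + \<bar>mean u\<bar>)" by (intro ploc_add au ploc_const)
  have J0: "\<bar>J0 u x\<bar> \<le> 2 * a" if "x \<in> {0..L}" for x
  proof -
    have "\<bar>J0 u x\<bar> = norm (integral {0..x} (\<lambda>y. u y - mean u))" using that by (simp add: J0_def)
    also have "\<dots> \<le> integral {0..x} (\<lambda>y. \<bar>u y\<bar> + \<bar>mean u\<bar>)"
      by (rule integral_norm_bound_integral) (auto intro!: ploc_integrable_on[OF ploc_diff[OF pu ploc_const]] ploc_integrable_on[OF g])
    also have "\<dots> \<le> integral {0..L} (\<lambda>y. \<bar>u y\<bar> + \<bar>mean u\<bar>)"
      using that by (intro integral_subset_le ploc_integrable_on[OF g]) auto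
    also have "\<dots> = a + L * \<bar>mean u\<bar>"
      using pint_add[OF au ploc_const, of "\<bar>mean u\<bar>"] unfolding a_def pint_const by (simp add: pint_def)
    finally show ?thesis using mean by (simp add: mult.commute)
  qed
  note J0p = pl2_ploc[OF prim_pl2[OF prim_J0[OF pu]]]
  have mJ0: "\<bar>mean (J0 u)\<bar> \<le> 2 * a"
  proof -
    have "norm (integral {0..L} (J0 u)) \<le> integral {0..L} (\<lambda>x. 2 * a)"
      by (rule integral_norm_bound_integral) (use J0 in \<open>auto intro!: ploc_integrable_on J0p ploc_const\<close>)
    thus ?thesis using L_pos by (simp add: mean_def pint_def field_simps)
  qed
  have "pint (\<lambda>x. (J u x)\<^sup>2) \<le> pint (\<lambda>x. (4 * a)\<^sup>2)"
    unfolding pint_def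
  proof (intro integral_le ploc_integrable_on[OF pl2_square[OF prim_pl2[OF prim_J[OF pu]]]] ploc_integrable_on[OF ploc_const])
    fix x assume "x \<in> {0..L}"
    hence "\<bar>J u x\<bar> \<le> 4 * a" using J0[of x] mJ0 unfolding J_def by linarith
    thus "(J u x)\<^sup>2 \<le> (4 * a)\<^sup>2" by (metis abs_ge_zero power2_abs power_mono)
  qed
  also have "\<dots> = 16 * L * a\<^sup>2" by (simp add: pint_const power_mult_distrib)
  also have "\<dots> \<le> 16 * L * (L * pint (\<lambda>x. (u x)\<^sup>2))"
    unfolding a_def using pint_abs_square_le[OF u] L_pos by (intro mult_left_mono) auto
  finally show ?thesis by (simp add: power2_eq_square mult_ac)
qed

lemma J_add: assumes "ploc u" "ploc v" shows "J (\<lambda>x. u x + v x) = (\<lambda>x. J u x + J v x)"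
proof -
  have m: "mean (\<lambda>x. u x + v x) = mean u + mean v"
    using pint_add[OF assms] by (simp add: mean_def add_divide_distrib)
  have i: "integral {a..b} (\<lambda>y. u y + v y - mean (\<lambda>x. u x + v x)) = integral {a..b} (\<lambda>y. u y - mean u) + integral {a..b} (\<lambda>y. v y - mean v)" for a b
    unfolding m by (subst Henstock_Kurzweil_Integration.integral_add[symmetric])
      (auto intro!: ploc_integrable_on ploc_diff ploc_const assms simp: algebra_simps)
  have J0: "J0 (\<lambda>x. u x + v x) = (\<lambda>x. J0 u x + J0 v x)"
    by (rule ext) (simp add: J0_def i)
  have "mean (\<lambda>x. J0 u x + J0 v x) = mean (J0 u) + mean (J0 v)"
    using pint_add[OF pl2_ploc[OF prim_pl2[OF prim_J0[OF assms(1)]]] pl2_ploc[OF prim_pl2[OF prim_J0[OF assms(2)]]]]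
    by (simp add: mean_def add_divide_distrib)
  thus ?thesis unfolding J_def[abs_def] J0 by (simp add: algebra_simps)
qed

lemma J_cmult: "J (\<lambda>x. c * u x) = (\<lambda>x. c * J u x)"
proof -
  have m: "mean (\<lambda>x. c * u x) = c * mean u" for u by (simp add: mean_def pint_cmult)
  have i: "integral {a..b} (\<lambda>y. c * u y - mean (\<lambda>x. c * u x)) = c * integral {a..b} (\<lambda>y. u y - mean u)" for a b
    unfolding m right_diff_distrib[symmetric] by simp
  have J0: "J0 (\<lambda>x. c * u x) = (\<lambda>x. c * J0 u x)"
    by (rule ext) (simp add: J0_def i)
  show ?thesis unfolding J_def[abs_def] J0 m by (simp add: algebra_simps)
qed

end

section \<open>Weak derivatives on the circle as primitives\<close>

context circle begin

lemma ploc_continuous_mult: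
  assumes F: "continuous_on UNIV F" "\<And>x. F (x + L) = F x" and g: "ploc g"
  shows "ploc (\<lambda>x. F x * g x)"
proof -
  obtain B where B: "B \<ge> 0" "\<And>x. x \<in> {0..L} \<Longrightarrow> \<bar>F x\<bar> \<le> B"
    using continuous_bounded[OF F(1)] by blast
  show ?thesis
  proof (rule ploc_boundedI)
    show "(\<lambda>x. B * \<bar>g x\<bar>) absolutely_integrable_on {0..L}" using ploc_cmult[OF ploc_abs[OF g]] by (auto simp: ploc_def)
    show "\<bar>F x * g x\<bar> \<le> B * \<bar>g x\<bar>" if "x \<in> {0..L}" for x
      using B(2)[OF that] by (simp add: abs_mult mult_right_mono)
    show "(\<lambda>x. F x * g x) \<in> borel_measurable lebesgue"
      by (intro borel_measurable_times continuous_lebesgue_measurable[OF F(1)] ploc_measurable[OF g])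
  qed (simp add: F(2) ploc_periodic[OF g])
qed

lemma prim_mult_ploc: "prim F f \<Longrightarrow> ploc g \<Longrightarrow> ploc (\<lambda>x. F x * g x)"
  by (intro ploc_continuous_mult prim_continuous prim_periodic)

lemma prim_by_parts:
  assumes F: "prim F f" and G: "prim G g"
  shows "pint (\<lambda>x. F x * g x) = - pint (\<lambda>x. f x * G x)"
proof -
  have "ploc (\<lambda>x. f x * G x)" using prim_mult_ploc[OF G prim_ploc[OF F]] by (simp add: mult.commute)
  thus ?thesis
    using prim_mean[OF prim_mult[OF F G]] pint_add[OF prim_mult_ploc[OF F prim_ploc[OF G]], of "\<lambda>x. f x * G x"] by simp
qed

lemma prim_deriv:
  assumes F: "prim F f" and f: "continuous_on UNIV f"
  shows "(F has_real_derivative f x) (at x)"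
proof -
  have "((\<lambda>y. integral {x - 1..y} f) has_real_derivative f x) (at x within {x - 1..x + 1})"
    by (rule integral_has_real_derivative[OF continuous_on_subset[OF f]]) auto
  from DERIV_add[OF DERIV_const this, of "F (x - 1)"]
  have "((\<lambda>y. F (x - 1) + integral {x - 1..y} f) has_real_derivative f x) (at x within {x - 1..x + 1})"
    by simp
  hence "((\<lambda>y. F (x - 1) + integral {x - 1..y} f) has_real_derivative f x) (at x)"
    by (subst (asm) at_within_interior) auto
  moreover have "\<forall>\<^sub>F y in nhds x. F (x - 1) + integral {x - 1..y} f = F y"
  proof -
    have "\<forall>\<^sub>F y in nhds x. y \<in> {x - 1<..}" by (intro eventually_nhds_in_open) auto
    thus ?thesis
    proof eventually_elim
      case (elim y)
      thus ?case using primD[OF F, of "x - 1" y] by simp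
    qed
  qed
  ultimately show ?thesis using DERIV_cong_ev[OF refl _ refl, of "\<lambda>y. F (x - 1) + integral {x - 1..y} f" F x "f x"] by blast
qed

text \<open>The test functions of the definition of weak derivatives.\<close>

definition test :: "(real \<Rightarrow> real) \<Rightarrow> (real \<Rightarrow> real) \<Rightarrow> bool" where
  "test \<phi> \<phi>' \<longleftrightarrow> (\<forall>x. \<phi> (x + L) = \<phi> x) \<and> (\<forall>x. (\<phi> has_real_derivative \<phi>' x) (at x)) \<and> continuous_on UNIV \<phi>'"

lemma test_prim: "test \<phi> \<phi>' \<Longrightarrow> prim \<phi> \<phi>'"
  unfolding test_def by (intro prim_C1) auto

text \<open>Double integration supplies continuously differentiable test functions from continuous ones.\<close>

lemma test_J:
  assumes "continuous_on UNIV \<psi>" "\<And>x. \<psi> (x + L) = \<psi> x"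
  shows "test (J \<psi>) (\<lambda>x. \<psi> x - mean \<psi>)"
proof -
  have p: "prim (J \<psi>) (\<lambda>x. \<psi> x - mean \<psi>)" by (intro prim_J pl2_ploc pl2_continuous assms)
  have c: "continuous_on UNIV (\<lambda>x. \<psi> x - mean \<psi>)" by (intro continuous_intros assms)
  show ?thesis unfolding test_def using prim_periodic[OF p] prim_deriv[OF p c] c by auto
qed

lemma test_const: "test (\<lambda>x. c) (\<lambda>x. 0)"
  unfolding test_def by auto

text \<open>The test function \<open>J (J v)\<close> suffices: integration by parts turns the pairing into the squared norm of
\<open>J v\<close>, so the primitive of \<open>v\<close> vanishes.\<close>

lemma fundamental_lemma:
  assumes v: "ploc v" and z: "\<And>\<phi> \<phi>'. test \<phi> \<phi>' \<Longrightarrow> pint (\<lambda>x. v x * \<phi> x) = 0"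
  shows "AE x in torus L. v x = 0"
proof -
  have mean0: "mean v = 0" using z[OF test_const[of 1]] by (simp add: mean_def)
  have p: "prim (J v) v" using prim_J[OF v] by (simp add: mean0)
  have t: "test (J (J v)) (J v)"
    using test_J[OF prim_continuous[OF p] prim_periodic[OF p]] pint_J[OF v] by (simp add: mean_def)
  have "pint (\<lambda>x. J v x * J v x) = - pint (\<lambda>x. v x * J (J v) x)"
    by (rule prim_by_parts[OF p test_prim[OF t]])
  hence "integral {0..L} (\<lambda>x. J v x * J v x) = 0" unfolding z[OF t] pint_def by simp
  hence i0: "((\<lambda>x. J v x * J v x) has_integral 0) (cbox 0 L)"
    using integrable_integral[OF ploc_integrable_on[OF pl2_mult[OF prim_pl2[OF p] prim_pl2[OF p]], of 0 L]] by simp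
  have c: "continuous_on (cbox 0 L) (\<lambda>x. J v x * J v x)"
    using continuous_on_subset[OF continuous_on_mult[OF prim_continuous[OF p] prim_continuous[OF p]]] by blast
  have "J v x * J v x = 0" if "x \<in> {0..L}" for x
    by (rule has_integral_0_cbox_imp_0[OF c _ i0]) (use that L_pos in auto)
  hence "integral {0..x} v = 0" if "0 \<le> x" "x \<le> L" for x
    using primD[OF p, of 0 x] that L_pos by simp
  thus ?thesis
    unfolding torus_def using zero_primitive_imp_AE_zero[where v = v and L = L] v by (auto simp: ploc_def)
qed

text \<open>The periodic extension of the restriction to the period starting at \<open>0\<close>.\<close>

definition pz :: "(real \<Rightarrow> real) \<Rightarrow> real \<Rightarrow> real" where "pz u x = u (x - L * real_of_int \<lfloor>x / L\<rfloor>)"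

lemma pz_periodic: "pz u (x + L) = pz u x"
proof -
  have "(x + L) / L = x / L + 1" using L_pos by (simp add: field_simps)
  thus ?thesis by (simp add: pz_def algebra_simps)
qed

lemma pz_eq: "0 \<le> x \<Longrightarrow> x < L \<Longrightarrow> pz u x = u x"
proof -
  assume "0 \<le> x" "x < L"
  hence "\<lfloor>x / L\<rfloor> = 0" by (simp add: floor_eq_iff)
  thus ?thesis by (simp add: pz_def)
qed

lemma torus_space: "space (torus L) = {0..L}" by (simp add: torus_def)

lemma AE_torus_neq: "AE x in torus L. x \<noteq> (a :: real)"
  unfolding torus_def by (subst AE_restrict_space_iff) (auto intro!: AE_I'[of "{a}"])

lemma AE_pz: "AE x in torus L. pz u x = u x"
  using AE_torus_neq[of L] AE_space
  by eventually_elim (auto simp: torus_space intro!: pz_eq)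

lemma pz_measurable:
  assumes "u \<in> borel_measurable (torus L)"
  shows "pz u \<in> borel_measurable lebesgue"
proof -
  define u0 where "u0 = (\<lambda>x. if x \<in> {0..L} then u x else 0)"
  have u0: "u0 \<in> borel_measurable lebesgue"
    unfolding u0_def using assms borel_measurable_if[of "{0..L}" u] by (simp add: torus_def)
  have "(\<lambda>x. u0 (x + - (L * real_of_int \<lfloor>x / L\<rfloor>))) \<in> borel_measurable lebesgue"
  proof (rule measurable_compose_countable[of "\<lambda>n x. u0 (x + - (L * real_of_int n))" lebesgue borel "\<lambda>x. \<lfloor>x / L\<rfloor>"])
    show "(\<lambda>x. u0 (x + - (L * real_of_int n))) \<in> borel_measurable lebesgue" for n
      by (rule borel_measurable_shift[OF u0])
    have "(\<lambda>x. \<lfloor>x / L\<rfloor>) \<in> lborel \<rightarrow>\<^sub>M count_space UNIV" by measurable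
    thus "(\<lambda>x. \<lfloor>x / L\<rfloor>) \<in> lebesgue \<rightarrow>\<^sub>M count_space UNIV"
      by (rule measurable_completion)
  qed
  also have "(\<lambda>x. u0 (x + - (L * real_of_int \<lfloor>x / L\<rfloor>))) = pz u"
  proof
    fix x
    have n: "real_of_int \<lfloor>x / L\<rfloor> \<le> x / L" "x / L \<le> real_of_int \<lfloor>x / L\<rfloor> + 1" by linarith+
    have "L * real_of_int \<lfloor>x / L\<rfloor> \<le> L * (x / L)" "L * (x / L) \<le> L * (real_of_int \<lfloor>x / L\<rfloor> + 1)"
      by (rule mult_left_mono[OF n(1)] mult_left_mono[OF n(2)], use L_pos in simp)+
    hence "L * real_of_int \<lfloor>x / L\<rfloor> \<le> x" "x \<le> L * real_of_int \<lfloor>x / L\<rfloor> + L"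
      using L_pos by (simp_all add: distrib_left)
    thus "u0 (x + - (L * real_of_int \<lfloor>x / L\<rfloor>)) = pz u x" by (simp add: u0_def pz_def)
  qed
  finally show ?thesis .
qed

lemma abs_int_torus: "u absolutely_integrable_on {0..L} \<longleftrightarrow> integrable (torus L) u"
  unfolding torus_def by (simp add: integrable_restrict_space set_integrable_def)

lemma ploc_torus: "ploc u \<Longrightarrow> integrable (torus L) u"
  by (simp add: ploc_def abs_int_torus)

lemma pint_torus: "ploc u \<Longrightarrow> (LINT x|torus L. u x) = pint u"
  unfolding torus_def pint_def by (rule LINT_lebesgue_on_eq) (auto simp: ploc_def)

lemma LINT_torus_cong: 
  assumes "AE x in torus L. f x = g x" "f \<in> borel_measurable (torus L)" "ploc g"
  shows "(LINT x|torus L. f x) = pint g"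
  unfolding pint_torus[OF assms(3), symmetric]
  by (rule integral_cong_AE[OF assms(2) borel_measurable_integrable[OF ploc_torus[OF assms(3)]] assms(1)])

lemma measurable_torusI: "u \<in> borel_measurable lebesgue \<Longrightarrow> u \<in> borel_measurable (torus L)"
  unfolding torus_def by (rule lebesgue_on_measurableI)

lemma pz_ploc:
  assumes "integrable (torus L) u"
  shows "ploc (pz u)"
proof -
  have m: "pz u \<in> borel_measurable lebesgue" by (rule pz_measurable[OF borel_measurable_integrable[OF assms]])
  have "integrable (torus L) (pz u)"
    by (rule integrable_cong_AE[THEN iffD2, OF measurable_torusI[OF m] borel_measurable_integrable[OF assms] AE_pz assms])
  thus ?thesis unfolding ploc_def using m pz_periodic by (simp add: abs_int_torus)
qed

lemma pz_pl2:
  assumes "in_L2 L u"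
  shows "pl2 (pz u)"
proof -
  have "pz (\<lambda>x. (u x)\<^sup>2) = (\<lambda>x. (pz u x)\<^sup>2)" by (auto simp: pz_def)
  moreover have "ploc (pz (\<lambda>x. (u x)\<^sup>2))" using assms by (intro pz_ploc) (auto simp: in_L2_def)
  moreover have "pz u \<in> borel_measurable lebesgue" using assms by (intro pz_measurable) (auto simp: in_L2_def)
  ultimately show ?thesis using pz_periodic by (simp add: pl2_def ploc_def)
qed

lemma pl2_in_L2: "pl2 u \<Longrightarrow> in_L2 L u"
  using ploc_torus[OF pl2_square, of u] measurable_torusI[OF pl2_measurable] by (simp add: in_L2_def)

lemma in_L2_integrable: "in_L2 L u \<Longrightarrow> integrable (torus L) u"
proof -
  assume u: "in_L2 L u"
  have "integrable (torus L) (pz u)" by (intro ploc_torus pl2_ploc pz_pl2 u)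
  moreover have "u \<in> borel_measurable (torus L)" using u by (simp add: in_L2_def)
  ultimately show ?thesis
    using integrable_cong_AE[OF measurable_torusI[OF pz_measurable] _ AE_pz, of u] by blast
qed

lemma is_weak_deriv_iff:
  "is_weak_deriv L u v \<longleftrightarrow> integrable (torus L) u \<and> integrable (torus L) v \<and>
     (\<forall>\<phi> \<phi>'. test \<phi> \<phi>' \<longrightarrow> (LINT x|torus L. u x * \<phi>' x) = - (LINT x|torus L. v x * \<phi> x))"
  by (simp add: is_weak_deriv_def test_def)

lemma prim_weak_deriv:
  assumes "prim F f"
  shows "is_weak_deriv L F f"
  unfolding is_weak_deriv_iff
proof (intro conjI allI impI)
  show "integrable (torus L) F" "integrable (torus L) f"
    using assms by (auto intro: ploc_torus prim_ploc pl2_ploc prim_pl2)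
  fix \<phi> \<phi>' assume "test \<phi> \<phi>'"
  hence p: "prim \<phi> \<phi>'" by (rule test_prim)
  have "ploc (\<lambda>x. f x * \<phi> x)" using prim_mult_ploc[OF p prim_ploc[OF assms]] by (simp add: mult.commute)
  thus "(LINT x|torus L. F x * \<phi>' x) = - (LINT x|torus L. f x * \<phi> x)"
    using pint_torus[OF prim_mult_ploc[OF assms prim_ploc[OF p]]] pint_torus[of "\<lambda>x. f x * \<phi> x"] prim_by_parts[OF assms p] by simp
qed

text \<open>If \<open>v\<close> is a weak derivative of \<open>u\<close>, then \<open>u - J v\<close> is orthogonal to the derivatives of all test
functions, and hence constant by the fundamental lemma.\<close>

lemma weak_deriv_representation:
  assumes "is_weak_deriv L u v"
  shows "\<exists>F. prim F (pz v) \<and> (AE x in torus L. u x = F x)"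
proof -
  have ui: "integrable (torus L) u" and vi: "integrable (torus L) v" using assms by (auto simp: is_weak_deriv_iff)
  define w where "w = pz v"
  have w: "ploc w" unfolding w_def by (rule pz_ploc[OF vi])
  have pu: "ploc (pz u)" by (rule pz_ploc[OF ui])
  have weak: "pint (\<lambda>x. \<phi>' x * pz u x) = - pint (\<lambda>x. \<phi> x * w x)" if t: "test \<phi> \<phi>'" for \<phi> \<phi>'
  proof -
    have p: "prim \<phi> \<phi>'" by (rule test_prim[OF t])
    have c: "continuous_on UNIV \<phi>'" "\<And>x. \<phi>' (x + L) = \<phi>' x"
      using t ploc_periodic[OF prim_ploc[OF p]] by (auto simp: test_def)
    have "(LINT x|torus L. u x * \<phi>' x) = pint (\<lambda>x. \<phi>' x * pz u x)"
    proof (rule LINT_torus_cong)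
      show "AE x in torus L. u x * \<phi>' x = \<phi>' x * pz u x" using AE_pz[of u] by eventually_elim simp
    qed (use ui ploc_continuous_mult[OF c pu] measurable_torusI[OF continuous_lebesgue_measurable[OF c(1)]] in auto)
    moreover have "(LINT x|torus L. v x * \<phi> x) = pint (\<lambda>x. \<phi> x * w x)"
    proof (rule LINT_torus_cong)
      show "AE x in torus L. v x * \<phi> x = \<phi> x * w x" unfolding w_def using AE_pz[of v] by eventually_elim simp
    qed (use vi prim_mult_ploc[OF p w] measurable_torusI[OF continuous_lebesgue_measurable[OF prim_continuous[OF p]]] in auto)
    ultimately show ?thesis using assms t unfolding is_weak_deriv_iff by metis
  qed
  have mean0: "mean w = 0" using weak[OF test_const[of 1]] by (simp add: mean_def pint_const)
  have p: "prim (J w) w" using prim_J[OF w] by (simp add: mean0)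
  define z where "z = (\<lambda>x. pz u x - J w x)"
  have z: "ploc z" unfolding z_def by (intro ploc_diff pu pl2_ploc prim_pl2[OF p])
  have z0: "pint (\<lambda>x. \<phi>' x * z x) = 0" if t: "test \<phi> \<phi>'" for \<phi> \<phi>'
  proof -
    have q: "prim \<phi> \<phi>'" by (rule test_prim[OF t])
    have c: "continuous_on UNIV \<phi>'" "\<And>x. \<phi>' (x + L) = \<phi>' x"
      using t ploc_periodic[OF prim_ploc[OF q]] by (auto simp: test_def)
    have "pint (\<lambda>x. \<phi>' x * z x) = pint (\<lambda>x. \<phi>' x * pz u x) - pint (\<lambda>x. \<phi>' x * J w x)"
      unfolding z_def right_diff_distrib
      by (intro pint_diff ploc_continuous_mult[OF c] pu pl2_ploc prim_pl2[OF p])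
    also have "pint (\<lambda>x. \<phi>' x * J w x) = - pint (\<lambda>x. \<phi> x * w x)"
      using prim_by_parts[OF q p] by simp
    finally show ?thesis using weak[OF t] by simp
  qed
  have "AE x in torus L. z x - mean z = 0"
  proof (rule fundamental_lemma)
    show "ploc (\<lambda>x. z x - mean z)" by (intro ploc_diff ploc_const z)
    fix \<phi> \<phi>' assume t: "test \<phi> \<phi>'"
    note q = prim_continuous[OF test_prim[OF t]] prim_periodic[OF test_prim[OF t]]
    have "0 = pint (\<lambda>x. (\<phi> x - mean \<phi>) * z x)" using z0[OF test_J[OF q]] by simp
    also have "\<dots> = pint (\<lambda>x. \<phi> x * z x) - mean \<phi> * pint z"
      unfolding left_diff_distrib using pint_diff[OF ploc_continuous_mult[OF q z] ploc_cmult[OF z, of "mean \<phi>"]] by (simp add: pint_cmult)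
    also have "\<dots> = pint (\<lambda>x. \<phi> x * z x) - mean z * pint \<phi>" by (simp add: mean_def)
    also have "\<dots> = pint (\<lambda>x. \<phi> x * z x - mean z * \<phi> x)"
      using pint_diff[OF ploc_continuous_mult[OF q z] ploc_cmult[OF pl2_ploc[OF pl2_continuous[OF q]], of "mean z"]] by (simp add: pint_cmult)
    also have "(\<lambda>x. \<phi> x * z x - mean z * \<phi> x) = (\<lambda>x. (z x - mean z) * \<phi> x)" by (auto simp: algebra_simps)
    finally show "pint (\<lambda>x. (z x - mean z) * \<phi> x) = 0" by simp
  qed
  hence "AE x in torus L. u x = J w x + mean z"
    using AE_pz[of u] by eventually_elim (simp add: z_def)
  moreover have "prim (\<lambda>x. J w x + mean z) w" using prim_add[OF p prim_const, of "mean z"] by simp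
  ultimately show ?thesis unfolding w_def by blast
qed

lemma weak_deriv_unique:
  assumes "is_weak_deriv L u v" "is_weak_deriv L u v'"
  shows "AE x in torus L. v x = v' x"
proof -
  obtain F where F: "prim F (pz v)" "AE x in torus L. u x = F x" using weak_deriv_representation[OF assms(1)] by blast
  obtain G where G: "prim G (pz v')" "AE x in torus L. u x = G x" using weak_deriv_representation[OF assms(2)] by blast
  have p: "prim (\<lambda>x. F x + (- 1) * G x) (\<lambda>x. pz v x + (- 1) * pz v' x)" by (intro prim_add prim_cmult F G)
  have ploc: "ploc (\<lambda>x. pz v x + (- 1) * pz v' x)" by (rule prim_ploc[OF p])
  have "AE x in torus L. pz v x + (- 1) * pz v' x = 0"
  proof (rule fundamental_lemma[OF ploc])
    fix \<phi> \<phi>' assume t: "test \<phi> \<phi>'"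
    note q = test_prim[OF t]
    have "pint (\<lambda>x. (F x + (- 1) * G x) * \<phi>' x) = (LINT x|torus L. 0)"
    proof (rule LINT_torus_cong[symmetric])
      show "AE x in torus L. 0 = (F x + (- 1) * G x) * \<phi>' x" using F(2) G(2) by eventually_elim simp
    qed (use prim_mult_ploc[OF p prim_ploc[OF q]] in auto)
    thus "pint (\<lambda>x. (pz v x + (- 1) * pz v' x) * \<phi> x) = 0" using prim_by_parts[OF p q] by simp
  qed
  thus ?thesis using AE_pz[of v] AE_pz[of v'] by eventually_elim simp
qed

lemma weak_deriv_AE:
  assumes "is_weak_deriv L u v"
  shows "AE x in torus L. weak_deriv L u x = v x" "is_weak_deriv L u (weak_deriv L u)"
proof -
  show *: "is_weak_deriv L u (weak_deriv L u)" unfolding weak_deriv_def by (rule someI[of "is_weak_deriv L u", OF assms])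
  show "AE x in torus L. weak_deriv L u x = v x" by (rule weak_deriv_unique[OF * assms])
qed

end

section \<open>Classes of periodic functions and their operators\<close>

context circle begin

text \<open>\<open>cls\<close> sends a function on a period to its class, extended by zero; \<open>rp\<close> goes back to a periodic
representative. On classes of functions that do not vanish outside the period, \<open>rp\<close> first restricts
them.\<close>

definition cls :: "(real \<Rightarrow> real) \<Rightarrow> l2" where "cls u = l2_class (\<lambda>x. if x \<in> {0..L} then u x else 0)"

definition rp :: "l2 \<Rightarrow> real \<Rightarrow> real" where "rp U = pz (rep_l2 U)"

lemma cut_square_integrable:
  assumes "in_L2 L u"
  shows "square_integrable (\<lambda>x. if x \<in> {0..L} then u x else 0)"
proof -
  have "(\<lambda>x. if x \<in> {0..L} then u x else 0) \<in> borel_measurable lebesgue"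
    using assms borel_measurable_if[of "{0..L}" u] by (simp add: torus_def in_L2_def)
  moreover have "integrable lebesgue (\<lambda>x. if x \<in> {0..L} then (u x)\<^sup>2 else 0)"
    using assms Lebesgue_Measure.integrable_restrict_UNIV[of "{0..L}" "\<lambda>x. (u x)\<^sup>2"] by (simp add: torus_def in_L2_def)
  moreover have "(\<lambda>x. if x \<in> {0..L} then (u x)\<^sup>2 else 0) = (\<lambda>x. (if x \<in> {0..L} then u x else 0)\<^sup>2)" by auto
  ultimately show ?thesis by (simp only: square_integrable_def)
qed

lemma square_integrable_in_L2: "square_integrable u \<Longrightarrow> in_L2 L u"
  unfolding in_L2_def square_integrable_def torus_def
  by (auto intro: lebesgue_on_measurableI intro!: integrable_restrict_space[THEN iffD2] integrable_mult_indicator)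

lemma LINT_cut: "(LINT x|lebesgue. (if x \<in> {0..L} then f x else 0)) = (LINT x|torus L. f x)" for f :: "real \<Rightarrow> real"
  unfolding torus_def by (rule Lebesgue_Measure.integral_restrict_UNIV) simp

lemma AE_torus_iff: "(AE x in torus L. P x) \<longleftrightarrow> (AE x in lebesgue. x \<in> {0..L} \<longrightarrow> P x)"
  unfolding torus_def by (rule AE_restrict_space_iff) simp

lemma cls_cong:
  assumes "in_L2 L u" "in_L2 L v" "AE x in torus L. u x = v x"
  shows "cls u = cls v"
  unfolding cls_def
  by (rule l2_class_eqI[OF cut_square_integrable[OF assms(1)] cut_square_integrable[OF assms(2)]])
     (use assms(3) in \<open>auto simp: AE_torus_iff\<close>)

lemma inner_cls: "in_L2 L u \<Longrightarrow> in_L2 L v \<Longrightarrow> inner (cls u) (cls v) = L2_inner L u v"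
  unfolding cls_def L2_inner_def LINT_cut[symmetric]
  by (subst l2_class_inner[OF cut_square_integrable cut_square_integrable]) (auto intro!: Bochner_Integration.integral_cong)

lemma norm_cls: "in_L2 L u \<Longrightarrow> norm (cls u) = L2_norm L u"
  by (simp add: norm_eq_sqrt_inner inner_cls L2_norm_def L2_inner_def power2_eq_square)

lemma rp_pl2: "pl2 (rp U)"
  unfolding rp_def by (intro pz_pl2 square_integrable_in_L2 rep_l2_square_integrable)

lemma rp_AE: "AE x in torus L. rp U x = rep_l2 U x"
  unfolding rp_def by (rule AE_pz)

lemma rep_cls: "in_L2 L u \<Longrightarrow> AE x in torus L. rep_l2 (cls u) x = u x"
  using rep_l2_class[OF cut_square_integrable, of u] unfolding cls_def AE_torus_iff
  by (auto elim!: AE_mp)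

lemma rp_cls: "in_L2 L u \<Longrightarrow> AE x in torus L. rp (cls u) x = u x"
  using rp_AE[of "cls u"] rep_cls[of u] by (auto elim: AE_mp)

lemma cls_rp_cls: "in_L2 L u \<Longrightarrow> cls (rp (cls u)) = cls u"
  by (rule cls_cong[OF pl2_in_L2[OF rp_pl2] _ rp_cls])

lemma inner_cls_l2:
  assumes "in_L2 L u"
  shows "inner (cls u) U = L2_inner L u (rp U)"
proof -
  have r: "square_integrable (rep_l2 U)" by (rule rep_l2_square_integrable)
  have m: "u \<in> borel_measurable (torus L)" "rep_l2 U \<in> borel_measurable (torus L)" "rp U \<in> borel_measurable (torus L)"
    using assms square_integrable_in_L2[OF r] pl2_in_L2[OF rp_pl2[of U]] by (auto simp: in_L2_def)
  have "inner (cls u) U = inner (cls u) (l2_class (rep_l2 U))" by (simp add: l2_class_rep)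
  also have "\<dots> = (LINT x|lebesgue. (if x \<in> {0..L} then u x else 0) * rep_l2 U x)"
    unfolding cls_def by (rule l2_class_inner[OF cut_square_integrable[OF assms] r])
  also have "\<dots> = (LINT x|torus L. u x * rep_l2 U x)"
    unfolding LINT_cut[symmetric] by (rule Bochner_Integration.integral_cong) auto
  also have "\<dots> = (LINT x|torus L. u x * rp U x)"
  proof (rule integral_cong_AE)
    show "AE x in torus L. u x * rep_l2 U x = u x * rp U x" using rp_AE[of U] by eventually_elim simp
  qed (use m in auto)
  finally show ?thesis by (simp add: L2_inner_def)
qed

lemma inner_cls_pint: "pl2 u \<Longrightarrow> inner (cls u) U = pint (\<lambda>x. u x * rp U x)"
  using inner_cls_l2[OF pl2_in_L2, of u U] pint_torus[OF pl2_mult[OF _ rp_pl2], of u U] by (simp add: L2_inner_def)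

lemma inner_cls2: "pl2 u \<Longrightarrow> pl2 v \<Longrightarrow> inner (cls u) (cls v) = pint (\<lambda>x. u x * v x)"
  using inner_cls[OF pl2_in_L2 pl2_in_L2, of u v] pint_torus[OF pl2_mult, of u v] by (simp add: L2_inner_def)

lemma norm2_cls: "pl2 u \<Longrightarrow> (norm (cls u))\<^sup>2 = pint (\<lambda>x. (u x)\<^sup>2)"
  by (simp add: power2_norm_eq_inner inner_cls2 power2_eq_square[of "u _"])

lemma in_L2_add:
  assumes u: "in_L2 L u" and v: "in_L2 L v"
  shows "in_L2 L (\<lambda>x. u x + v x)"
proof -
  have m: "u \<in> borel_measurable (torus L)" "v \<in> borel_measurable (torus L)" using u v by (auto simp: in_L2_def)
  have mm: "(\<lambda>x. u x + v x) \<in> borel_measurable (torus L)" by (intro borel_measurable_add m)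
  have i: "integrable (torus L) (\<lambda>x. 2 * (u x)\<^sup>2 + 2 * (v x)\<^sup>2)" using u v by (simp add: in_L2_def)
  have b: "norm ((u x + v x)\<^sup>2) \<le> norm (2 * (u x)\<^sup>2 + 2 * (v x)\<^sup>2)" for x
  proof -
    have "(u x + v x)\<^sup>2 \<le> 2 * (u x)\<^sup>2 + 2 * (v x)\<^sup>2"
      using sum_squares_bound[of "u x" "v x"] by (simp add: power2_sum)
    thus ?thesis by simp
  qed
  have "integrable (torus L) (\<lambda>x. (u x + v x)\<^sup>2)"
    by (rule Bochner_Integration.integrable_bound[OF i borel_measurable_power[OF mm] always_eventually[OF allI[OF b]]])
  with mm show ?thesis by (simp add: in_L2_def)
qed

lemma in_L2_cmult: "in_L2 L u \<Longrightarrow> in_L2 L (\<lambda>x. c * u x)"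
  by (auto simp: in_L2_def power_mult_distrib)

lemma in_L2_diff: "in_L2 L u \<Longrightarrow> in_L2 L v \<Longrightarrow> in_L2 L (\<lambda>x. u x - v x)"
  using in_L2_add[OF _ in_L2_cmult[of v "-1"], of u] by simp

lemma cls_add: "in_L2 L u \<Longrightarrow> in_L2 L v \<Longrightarrow> cls (\<lambda>x. u x + v x) = cls u + cls v"
proof -
  assume "in_L2 L u" "in_L2 L v"
  note c = cut_square_integrable[OF this(1)] cut_square_integrable[OF this(2)]
  have "(\<lambda>x. if x \<in> {0..L} then u x + v x else 0)
      = (\<lambda>x. (if x \<in> {0..L} then u x else 0) + (if x \<in> {0..L} then v x else 0))" by auto
  thus ?thesis unfolding cls_def l2_class_add[OF c] by simp
qed

lemma cls_cmult: "in_L2 L u \<Longrightarrow> cls (\<lambda>x. c * u x) = c *\<^sub>R cls u"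
proof -
  assume "in_L2 L u"
  note c = cut_square_integrable[OF this]
  have "(\<lambda>x. if x \<in> {0..L} then c * u x else 0) = (\<lambda>x. c * (if x \<in> {0..L} then u x else 0))" by auto
  thus ?thesis unfolding cls_def l2_class_scaleR[OF c] by simp
qed

lemma cls_diff: "in_L2 L u \<Longrightarrow> in_L2 L v \<Longrightarrow> cls (\<lambda>x. u x - v x) = cls u - cls v"
  using cls_add[OF _ in_L2_cmult[of v "-1"], of u] cls_cmult[of v "-1"] by simp

lemma cls_eq_iff_AE:
  assumes "pl2 u"
  shows "cls u = 0 \<longleftrightarrow> (AE x in torus L. u x = 0)"
proof
  assume "cls u = 0"
  hence "(LINT x|torus L. (u x)\<^sup>2) = 0" using norm2_cls[OF assms] pint_torus[OF pl2_square[OF assms]] by simp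
  thus "AE x in torus L. u x = 0"
    using integral_nonneg_eq_0_iff_AE[OF ploc_torus[OF pl2_square[OF assms]]] by simp
next
  assume ae: "AE x in torus L. u x = 0"
  have z: "in_L2 L (\<lambda>x. 0)" by (intro pl2_in_L2 pl2_const)
  have "cls u = cls (\<lambda>x. 0)" by (rule cls_cong[OF pl2_in_L2[OF assms] z ae])
  also have "\<dots> = 0" using cls_cmult[OF z, of 0] by simp
  finally show "cls u = 0" .
qed

lemma rep_l2_add: "AE x in lebesgue. rep_l2 (U + V) x = rep_l2 U x + rep_l2 V x"
proof -
  note s = rep_l2_square_integrable
  have "U + V = l2_class (\<lambda>x. rep_l2 U x + rep_l2 V x)"
    using l2_class_add[OF s s, of U V] by (simp add: l2_class_rep)
  thus ?thesis using rep_l2_class[OF square_integrable_add[OF s s], of U V] by simp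
qed

lemma rep_l2_scaleR: "AE x in lebesgue. rep_l2 (c *\<^sub>R U) x = c * rep_l2 U x"
proof -
  note s = rep_l2_square_integrable
  have "c *\<^sub>R U = l2_class (\<lambda>x. c * rep_l2 U x)"
    using l2_class_scaleR[OF s, of c U] by (simp add: l2_class_rep)
  thus ?thesis using rep_l2_class[OF square_integrable_cmult[OF s], of c U] by simp
qed

lemma AE_torusI: "AE x in lebesgue. P x \<Longrightarrow> AE x in torus L. P x"
  unfolding AE_torus_iff by (auto elim: AE_mp)

lemma norm_cls_rp: "norm (cls (rp U)) \<le> norm U"
proof -
  have "(norm (cls (rp U)))\<^sup>2 = inner (cls (rp U)) U"
    unfolding inner_cls_pint[OF rp_pl2] norm2_cls[OF rp_pl2] by (simp add: power2_eq_square)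
  also have "\<dots> \<le> norm (cls (rp U)) * norm U" by (rule norm_cauchy_schwarz)
  finally show ?thesis
    by (cases "norm (cls (rp U)) = 0") (auto simp: power2_eq_square mult_le_cancel_left)
qed

text \<open>Operators on periodic functions that are linear pointwise and bounded by \<open>C\<close>. They respect equality
almost everywhere, so that \<open>hat\<close> is the bounded operator that they induce on classes.\<close>

definition l2op :: "((real \<Rightarrow> real) \<Rightarrow> real \<Rightarrow> real) \<Rightarrow> real \<Rightarrow> bool" where
  "l2op T C \<longleftrightarrow> 0 \<le> C \<and> (\<forall>u. pl2 u \<longrightarrow> pl2 (T u))
     \<and> (\<forall>u v. pl2 u \<longrightarrow> pl2 v \<longrightarrow> T (\<lambda>x. u x + v x) = (\<lambda>x. T u x + T v x))
     \<and> (\<forall>c u. pl2 u \<longrightarrow> T (\<lambda>x. c * u x) = (\<lambda>x. c * T u x))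
     \<and> (\<forall>u. pl2 u \<longrightarrow> norm (cls (T u)) \<le> C * norm (cls u))"

definition hat :: "((real \<Rightarrow> real) \<Rightarrow> real \<Rightarrow> real) \<Rightarrow> l2 \<Rightarrow> l2" where "hat T U = cls (T (rp U))"

lemma l2opD:
  assumes "l2op T C"
  shows "0 \<le> C" "\<And>u. pl2 u \<Longrightarrow> pl2 (T u)" "\<And>u v. pl2 u \<Longrightarrow> pl2 v \<Longrightarrow> T (\<lambda>x. u x + v x) = (\<lambda>x. T u x + T v x)"
    "\<And>c u. pl2 u \<Longrightarrow> T (\<lambda>x. c * u x) = (\<lambda>x. c * T u x)" "\<And>u. pl2 u \<Longrightarrow> norm (cls (T u)) \<le> C * norm (cls u)"
  using assms unfolding l2op_def by auto

text \<open>Linearity and boundedness applied to the difference, whose class is \<open>0\<close>.\<close>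

lemma l2op_cong:
  assumes T: "l2op T C" and u: "pl2 u" and v: "pl2 v" and ae: "AE x in torus L. u x = v x"
  shows "cls (T u) = cls (T v)"
proof -
  have vm: "pl2 (\<lambda>x. (- 1) * v x)" by (rule pl2_cmult[OF v])
  have d: "pl2 (\<lambda>x. u x + (- 1) * v x)" by (rule pl2_add[OF u vm])
  have "cls (\<lambda>x. u x + (- 1) * v x) = 0"
    unfolding cls_eq_iff_AE[OF d] using ae by eventually_elim simp
  hence "cls (T (\<lambda>x. u x + (- 1) * v x)) = 0" using l2opD(5)[OF T d] by simp
  also have "T (\<lambda>x. u x + (- 1) * v x) = (\<lambda>x. T u x + (- 1) * T v x)"
    unfolding l2opD(3)[OF T u vm] l2opD(4)[OF T v] ..
  also have "cls \<dots> = cls (T u) + (- 1) *\<^sub>R cls (T v)"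
    using cls_add[OF pl2_in_L2[OF l2opD(2)[OF T u]] in_L2_cmult[OF pl2_in_L2[OF l2opD(2)[OF T v]], of "-1"]]
      cls_cmult[OF pl2_in_L2[OF l2opD(2)[OF T v]], of "-1"] by simp
  finally show ?thesis by simp
qed

lemma hat_cls: "l2op T C \<Longrightarrow> pl2 u \<Longrightarrow> hat T (cls u) = cls (T u)"
  unfolding hat_def by (rule l2op_cong[OF _ rp_pl2 _ rp_cls[OF pl2_in_L2]])

lemma hat_norm: "l2op T C \<Longrightarrow> norm (hat T U) \<le> C * norm U"
  unfolding hat_def using l2opD(5)[OF _ rp_pl2] mult_left_mono[OF norm_cls_rp l2opD(1)] order_trans by meson

lemma hat_bounded_linear:
  assumes T: "l2op T C"
  shows "bounded_linear (hat T)"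
proof (rule bounded_linear_intro[where K = C])
  note m = pl2_in_L2[OF l2opD(2)[OF T rp_pl2]]
  fix U V and c :: real
  have "cls (T (rp (U + V))) = cls (T (\<lambda>x. rp U x + rp V x))"
  proof (rule l2op_cong[OF T rp_pl2 pl2_add[OF rp_pl2 rp_pl2]])
    show "AE x in torus L. rp (U + V) x = rp U x + rp V x"
      using AE_torusI[OF rep_l2_add[of U V]] rp_AE[of "U + V"] rp_AE[of U] rp_AE[of V] by eventually_elim simp
  qed
  thus "hat T (U + V) = hat T U + hat T V"
    unfolding hat_def l2opD(3)[OF T rp_pl2 rp_pl2] by (simp add: cls_add[OF m m])
  have "cls (T (rp (c *\<^sub>R U))) = cls (T (\<lambda>x. c * rp U x))"
  proof (rule l2op_cong[OF T rp_pl2 pl2_cmult[OF rp_pl2]])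
    show "AE x in torus L. rp (c *\<^sub>R U) x = c * rp U x"
      using AE_torusI[OF rep_l2_scaleR[of c U]] rp_AE[of "c *\<^sub>R U"] rp_AE[of U] by eventually_elim simp
  qed
  thus "hat T (c *\<^sub>R U) = c *\<^sub>R hat T U"
    unfolding hat_def l2opD(4)[OF T rp_pl2] by (simp add: cls_cmult[OF m])
  show "norm (hat T U) \<le> norm U * C" using hat_norm[OF T, of U] by (simp add: mult.commute)
qed

lemma inner_hat: "l2op T C \<Longrightarrow> inner (hat T U) V = pint (\<lambda>x. T (rp U) x * rp V x)"
  unfolding hat_def by (rule inner_cls_pint[OF l2opD(2)[OF _ rp_pl2]])

lemma norm_cls_leI:
  assumes "pl2 v" "pl2 u" "0 \<le> C" "pint (\<lambda>x. (v x)\<^sup>2) \<le> C\<^sup>2 * pint (\<lambda>x. (u x)\<^sup>2)"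
  shows "norm (cls v) \<le> C * norm (cls u)"
proof (rule power2_le_imp_le)
  show "(norm (cls v))\<^sup>2 \<le> (C * norm (cls u))\<^sup>2"
    unfolding power_mult_distrib norm2_cls[OF assms(1)] norm2_cls[OF assms(2)] by (rule assms(4))
qed (use assms(3) in simp)

lemma l2opI:
  assumes "0 \<le> C" "\<And>u. pl2 u \<Longrightarrow> pl2 (T u)" "\<And>u v x. pl2 u \<Longrightarrow> pl2 v \<Longrightarrow> T (\<lambda>x. u x + v x) x = T u x + T v x"
    "\<And>c u x. pl2 u \<Longrightarrow> T (\<lambda>x. c * u x) x = c * T u x"
    "\<And>u. pl2 u \<Longrightarrow> pint (\<lambda>x. (T u x)\<^sup>2) \<le> C\<^sup>2 * pint (\<lambda>x. (u x)\<^sup>2)"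
  shows "l2op T C"
  unfolding l2op_def using assms by (auto intro!: norm_cls_leI)

lemma l2op_R: "0 < h \<Longrightarrow> l2op (R h) 1"
  by (rule l2opI) (auto intro: R_pl2 pl2_ploc simp: R_add[OF pl2_ploc pl2_ploc] R_cmult R_norm_le)

lemma l2op_dl: "0 < h \<Longrightarrow> l2op (dl h) (1 / h)"
proof (rule l2opI)
  show "dl h (\<lambda>x. u x + v x) x = dl h u x + dl h v x" for u v x
    by (simp add: dl_def add_divide_distrib diff_divide_distrib)
  show "dl h (\<lambda>x. c * u x) x = c * dl h u x" for c u x
    by (simp add: dl_def right_diff_distrib diff_divide_distrib)
qed (auto intro: dl_pl2 dl_norm_le)

lemma l2op_J: "l2op J (4 * L)"
  by (rule l2opI) (use L_pos J_norm_le in \<open>auto intro: prim_pl2[OF prim_J] pl2_ploc simp: J_add[OF pl2_ploc pl2_ploc] J_cmult\<close>)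

lemma periodic_bounded:
  assumes b: "continuous_on UNIV b" "\<And>x. b (x + L) = (b x :: real)"
  obtains B where "B \<ge> 0" "\<And>x. \<bar>b x\<bar> \<le> B"
proof -
  obtain B where B: "B \<ge> 0" "\<And>x. x \<in> {0..L} \<Longrightarrow> \<bar>b x\<bar> \<le> B" using continuous_bounded[OF b(1)] by blast
  have "\<bar>b x\<bar> \<le> B" for x
  proof -
    define n where "n = \<lfloor>x / L\<rfloor>"
    have n: "real_of_int n \<le> x / L" "x / L \<le> real_of_int n + 1" unfolding n_def by linarith+
    have "L * real_of_int n \<le> L * (x / L)" "L * (x / L) \<le> L * (real_of_int n + 1)"
      by (rule mult_left_mono[OF n(1)] mult_left_mono[OF n(2)], use L_pos in simp)+
    hence y: "x - L * real_of_int n \<in> {0..L}" using L_pos by (simp_all add: distrib_left)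
    have "b (x - L * real_of_int n) = b x"
    proof (cases "0 \<le> n")
      case True
      thus ?thesis using periodic_int(2)[of b x "nat n", OF b(2)] by (simp add: mult.commute)
    next
      case False
      thus ?thesis using periodic_int(1)[of b x "nat (- n)", OF b(2)] by (simp add: mult.commute)
    qed
    thus ?thesis using B(2)[OF y] by simp
  qed
  with B(1) show ?thesis by (rule that)
qed

lemma l2op_mult:
  assumes b: "continuous_on UNIV b" "\<And>x. b (x + L) = b x" and B: "B \<ge> 0" "\<And>x. \<bar>b x\<bar> \<le> B"
  shows "l2op (\<lambda>u x. b x * u x) B"
proof (rule l2opI[OF B(1)])
  show "pl2 (\<lambda>x. b x * u x)" if "pl2 u" for u by (rule pl2_bmult[OF b that])
  fix u assume u: "pl2 u"
  have "pint (\<lambda>x. (b x * u x)\<^sup>2) \<le> pint (\<lambda>x. B\<^sup>2 * (u x)\<^sup>2)"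
  proof (intro pint_mono pl2_square pl2_bmult b ploc_cmult u)
    fix x
    have "(b x)\<^sup>2 \<le> B\<^sup>2" using B(2)[of x] by (metis abs_ge_zero power2_abs power_mono)
    thus "(b x * u x)\<^sup>2 \<le> B\<^sup>2 * (u x)\<^sup>2" by (simp add: power_mult_distrib mult_right_mono)
  qed
  thus "pint (\<lambda>x. (b x * u x)\<^sup>2) \<le> B\<^sup>2 * pint (\<lambda>x. (u x)\<^sup>2)" by (simp add: pint_cmult)
qed (auto simp: algebra_simps)

lemma l2op_mean: "l2op (\<lambda>u x. mean u) 1"
proof (rule l2opI)
  fix u assume u: "pl2 u"
  show "pl2 (\<lambda>x. mean u)" by (rule pl2_const)
  have "\<bar>pint u\<bar> \<le> pint (\<lambda>x. \<bar>u x\<bar>)"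
    unfolding pint_def real_norm_def[symmetric]
    by (rule integral_norm_bound_integral[OF ploc_integrable_on[OF pl2_ploc[OF u]]
        ploc_integrable_on[OF pl2_ploc[OF pl2_abs[OF u, folded real_norm_def]]]]) simp
  hence "(pint u)\<^sup>2 \<le> (pint (\<lambda>x. \<bar>u x\<bar>))\<^sup>2" by (metis abs_ge_zero power2_abs power_mono)
  also have "\<dots> \<le> L * pint (\<lambda>x. (u x)\<^sup>2)" by (rule pint_abs_square_le[OF u])
  finally show "pint (\<lambda>x. (mean u)\<^sup>2) \<le> 1\<^sup>2 * pint (\<lambda>x. (u x)\<^sup>2)"
    using L_pos by (simp add: pint_const mean_def power2_eq_square field_simps)
qed (auto simp: mean_def pint_add[OF pl2_ploc pl2_ploc] pint_cmult add_divide_distrib)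

lemma l2op_comp: 
  assumes S: "l2op S C" and T: "l2op T D"
  shows "l2op (\<lambda>u. S (T u)) (C * D)"
  unfolding l2op_def
proof (intro conjI allI impI)
  show "0 \<le> C * D" using l2opD(1)[OF S] l2opD(1)[OF T] by simp
  fix u v and c :: real assume u: "pl2 u"
  note t = l2opD(2)[OF T]
  show "pl2 (S (T u))" by (intro l2opD(2)[OF S] t u)
  show "S (T (\<lambda>x. c * u x)) = (\<lambda>x. c * S (T u) x)" unfolding l2opD(4)[OF T u] by (rule l2opD(4)[OF S t[OF u]])
  show "S (T (\<lambda>x. u x + v x)) = (\<lambda>x. S (T u) x + S (T v) x)" if v: "pl2 v"
    unfolding l2opD(3)[OF T u v] by (rule l2opD(3)[OF S t[OF u] t[OF v]])
  show "norm (cls (S (T u))) \<le> C * D * norm (cls u)"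
    using l2opD(5)[OF S t[OF u]] mult_left_mono[OF l2opD(5)[OF T u] l2opD(1)[OF S]] by (simp add: mult.assoc)
qed

lemma l2op_add: 
  assumes S: "l2op S C" and T: "l2op T D"
  shows "l2op (\<lambda>u x. S u x + T u x) (C + D)"
  unfolding l2op_def
proof (intro conjI allI impI)
  show "0 \<le> C + D" using l2opD(1)[OF S] l2opD(1)[OF T] by simp
  fix u v and c :: real assume u: "pl2 u"
  show "pl2 (\<lambda>x. S u x + T u x)" by (intro pl2_add l2opD(2)[OF S] l2opD(2)[OF T] u)
  show "(\<lambda>x. S (\<lambda>x. c * u x) x + T (\<lambda>x. c * u x) x) = (\<lambda>x. c * (S u x + T u x))"
    unfolding l2opD(4)[OF T u] l2opD(4)[OF S u] by (simp add: distrib_left)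
  show "(\<lambda>x. S (\<lambda>x. u x + v x) x + T (\<lambda>x. u x + v x) x) = (\<lambda>x. S u x + T u x + (S v x + T v x))" if v: "pl2 v"
    unfolding l2opD(3)[OF T u v] l2opD(3)[OF S u v] by (simp add: algebra_simps)
  show "norm (cls (\<lambda>x. S u x + T u x)) \<le> (C + D) * norm (cls u)"
    unfolding cls_add[OF pl2_in_L2[OF l2opD(2)[OF S u]] pl2_in_L2[OF l2opD(2)[OF T u]]]
    using norm_triangle_ineq[of "cls (S u)" "cls (T u)"] l2opD(5)[OF S u] l2opD(5)[OF T u] by (simp add: distrib_right)
qed

lemma l2op_id: "l2op (\<lambda>u. u) 1"
  by (rule l2opI) auto

end

section \<open>Density of test functions and difference quotients\<close>

context circle begin

lemma test_add: "test \<phi> \<phi>' \<Longrightarrow> test \<psi> \<psi>' \<Longrightarrow> test (\<lambda>x. \<phi> x + \<psi> x) (\<lambda>x. \<phi>' x + \<psi>' x)"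
  unfolding test_def by (auto intro: DERIV_add continuous_on_add)
lemma test_cmult: "test \<phi> \<phi>' \<Longrightarrow> test (\<lambda>x. c * \<phi> x) (\<lambda>x. c * \<phi>' x)"
  unfolding test_def by (auto intro: DERIV_cmult continuous_on_mult continuous_on_const)

lemma test_pl2: "test \<phi> \<phi>' \<Longrightarrow> pl2 \<phi>" and test_deriv_pl2: "test \<phi> \<phi>' \<Longrightarrow> pl2 \<phi>'"
proof -
  assume t: "test \<phi> \<phi>'"
  show "pl2 \<phi>" by (rule prim_pl2[OF test_prim[OF t]])
  show "pl2 \<phi>'" using t ploc_periodic[OF prim_ploc[OF test_prim[OF t]]] by (intro pl2_continuous) (auto simp: test_def)
qed

definition tests :: "l2 set" where "tests = {cls \<phi> | \<phi> \<phi>'. test \<phi> \<phi>'}"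

lemma testsI: "test \<phi> \<phi>' \<Longrightarrow> cls \<phi> \<in> tests" by (auto simp: tests_def)

lemma cls_test_add: "test \<phi> \<phi>' \<Longrightarrow> test \<psi> \<psi>' \<Longrightarrow> cls \<phi> + cls \<psi> = cls (\<lambda>x. \<phi> x + \<psi> x)"
  by (rule cls_add[symmetric]) (auto intro: pl2_in_L2 test_pl2)
lemma cls_test_cmult: "test \<phi> \<phi>' \<Longrightarrow> c *\<^sub>R cls \<phi> = cls (\<lambda>x. c * \<phi> x)"
  by (rule cls_cmult[symmetric]) (auto intro: pl2_in_L2 test_pl2)

lemma subspace_tests: "subspace tests"
proof (rule subspaceI)
  have "cls (\<lambda>x. 0 * 0) = 0" using cls_cmult[OF pl2_in_L2[OF pl2_const[of 0]], of 0] by simp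
  thus "0 \<in> tests" using testsI[OF test_const[of 0]] by simp
  show "x + y \<in> tests" if xy: "x \<in> tests" "y \<in> tests" for x y
  proof -
    obtain \<phi> \<phi>' \<psi> \<psi>' where t: "test \<phi> \<phi>'" "x = cls \<phi>" "test \<psi> \<psi>'" "y = cls \<psi>"
      using xy by (auto simp: tests_def)
    show ?thesis unfolding t(2,4) cls_test_add[OF t(1,3)] by (rule testsI[OF test_add[OF t(1,3)]])
  qed
  show "c *\<^sub>R x \<in> tests" if x: "x \<in> tests" for c x
  proof -
    obtain \<phi> \<phi>' where t: "test \<phi> \<phi>'" "x = cls \<phi>" using x by (auto simp: tests_def)
    show ?thesis unfolding t(2) cls_test_cmult[OF t(1)] by (rule testsI[OF test_cmult[OF t(1)]])
  qed
qed

text \<open>The functional \<open>inner (cls u)\<close> on the test functions is represented by some \<open>v\<close> in their closure, and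
\<open>v - cls u\<close> is orthogonal to all test functions, hence zero by the fundamental lemma.\<close>

lemma tests_dense:
  assumes u: "in_L2 L u"
  shows "cls u \<in> closure tests"
proof -
  obtain v where v: "v \<in> closure tests" "\<And>x. x \<in> tests \<Longrightarrow> inner v x = inner (cls u) x"
    by (rule riesz_subspace[OF subspace_tests, of "inner (cls u)" "norm (cls u)"])
      (auto simp: inner_add_right Cauchy_Schwarz_ineq2)
  define w where "w = v - cls u"
  have "pint (\<lambda>x. rp w x * \<phi> x) = 0" if "test \<phi> \<phi>'" for \<phi> \<phi>'
  proof -
    have "pint (\<lambda>x. \<phi> x * rp w x) = inner w (cls \<phi>)"
      using inner_cls_pint[OF test_pl2[OF that], of w] by (simp add: inner_commute)
    also have "\<dots> = 0" using v(2)[OF testsI[OF that]] by (simp add: w_def inner_diff_left)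
    finally show ?thesis by (simp add: mult.commute)
  qed
  hence "AE x in torus L. rp w x = 0" by (intro fundamental_lemma pl2_ploc rp_pl2)
  \<comment> \<open>The operator induced by the identity cuts a class down to one period, so it fixes exactly the classes that live there.\<close>
  hence w0: "hat (\<lambda>u. u) w = 0" unfolding hat_def using cls_eq_iff_AE[OF rp_pl2] by blast
  have lin: "bounded_linear (hat (\<lambda>u. u))" by (rule hat_bounded_linear[OF l2op_id])
  have "hat (\<lambda>u. u) x = x" if "x \<in> closure tests" for x
  proof -
    have "closed {x. hat (\<lambda>u. u) x = x}"
      by (intro closed_Collect_eq linear_continuous_on[OF lin] continuous_on_id)
    moreover have "tests \<subseteq> {x. hat (\<lambda>u. u) x = x}"
      by (auto simp: tests_def hat_cls[OF l2op_id test_pl2])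
    ultimately show ?thesis using that closure_minimal by blast
  qed
  with v(1) have 1: "hat (\<lambda>u. u) v = v" by blast
  have "hat (\<lambda>u. u) (cls u) = cls u" unfolding hat_def by (rule cls_rp_cls[OF u])
  hence "v = cls u"
    using 1 w0 linear_diff[OF bounded_linear.linear[OF lin], of v "cls u"] unfolding w_def by simp
  with v(1) show ?thesis by simp
qed

lemma test_Lipschitz:
  assumes t: "test \<phi> \<phi>'"
  obtains K where "K \<ge> 0" "\<And>x y. \<bar>\<phi> x - \<phi> y\<bar> \<le> K * \<bar>x - y\<bar>"
proof -
  note p = test_prim[OF t]
  obtain K where K: "K \<ge> 0" "\<And>x. \<bar>\<phi>' x\<bar> \<le> K"
    using periodic_bounded[of \<phi>'] t ploc_periodic[OF prim_ploc[OF p]] by (auto simp: test_def)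
  have "norm (\<phi> x - \<phi> y) \<le> K * norm (x - y)" for x y
    by (rule field_differentiable_bound[where S = UNIV and f = \<phi> and f' = \<phi>' and B = K])
      (use t K in \<open>auto simp: test_def\<close>)
  thus ?thesis using that[of K] K by simp
qed

lemma hat_R_test_tendsto:
  assumes t: "test \<phi> \<phi>'"
  shows "((\<lambda>h. hat (R h) (cls \<phi>)) \<longlongrightarrow> cls \<phi>) (at_right 0)"
proof -
  obtain K where K: "K \<ge> 0" "\<And>x y. \<bar>\<phi> x - \<phi> y\<bar> \<le> K * \<bar>x - y\<bar>" using test_Lipschitz[OF t] by blast
  note q = test_pl2[OF t] and c = prim_continuous[OF test_prim[OF t]] and per = prim_periodic[OF test_prim[OF t]]
  have bound: "norm (hat (R h) (cls \<phi>) - cls \<phi>) \<le> K * h * norm (cls (\<lambda>x. 1))" if h: "0 < h" for h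
  proof -
    have Rq: "pl2 (R h \<phi>)" by (rule R_pl2[OF pl2_ploc[OF q] h])
    have "hat (R h) (cls \<phi>) - cls \<phi> = cls (\<lambda>x. R h \<phi> x - \<phi> x)"
      unfolding hat_cls[OF l2op_R[OF h] q] by (rule cls_diff[symmetric]) (intro pl2_in_L2 Rq q)+
    moreover have "norm (cls (\<lambda>x. R h \<phi> x - \<phi> x)) \<le> K * h * norm (cls (\<lambda>x. 1))"
      using R_commutator_le[OF pl2_const[of 1] h c per K] h K(1)
      by (intro norm_cls_leI pl2_diff Rq q pl2_const) (auto simp: R_const[OF h])
    ultimately show ?thesis by simp
  qed
  have "((\<lambda>h. K * h * norm (cls (\<lambda>x. 1))) \<longlongrightarrow> K * 0 * norm (cls (\<lambda>x. 1))) (at_right 0)"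
    by (intro tendsto_intros)
  hence "((\<lambda>h. K * h * norm (cls (\<lambda>x. 1))) \<longlongrightarrow> 0) (at_right 0)" by simp
  hence "((\<lambda>h. hat (R h) (cls \<phi>) - cls \<phi>) \<longlongrightarrow> 0) (at_right 0)"
    by (rule Lim_null_comparison[rotated]) (use bound in \<open>auto simp: eventually_at_right_less intro: eventually_mono[OF eventually_at_right_less]\<close>)
  thus ?thesis by (simp add: LIM_zero_iff)
qed

text \<open>On test functions the convergence follows from their Lipschitz continuity; density and the uniform
bound of \<open>hat (R h)\<close> extend it to all classes.\<close>

lemma hat_R_tendsto:
  assumes u: "in_L2 L u"
  shows "((\<lambda>h. hat (R h) (cls u)) \<longlongrightarrow> cls u) (at_right 0)"
proof (rule tendstoI)
  fix e :: real assume e: "0 < e"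
  obtain y where y: "y \<in> tests" "dist y (cls u) < e / 3"
    using tests_dense[OF u] e unfolding closure_approachable by (metis zero_less_divide_iff zero_less_numeral)
  then obtain \<phi> \<phi>' where t: "test \<phi> \<phi>'" "y = cls \<phi>" by (auto simp: tests_def)
  have "0 < e / 3" using e by simp
  from tendstoD[OF hat_R_test_tendsto[OF t(1)] this] eventually_at_right_less[of 0]
  show "\<forall>\<^sub>F h in at_right 0. dist (hat (R h) (cls u)) (cls u) < e"
  proof eventually_elim
    case (elim h)
    have "dist (hat (R h) (cls u)) (hat (R h) (cls \<phi>)) \<le> dist (cls u) (cls \<phi>)"
      using hat_norm[OF l2op_R[OF elim(2)], of "cls u - cls \<phi>"] linear_diff[OF bounded_linear.linear[OF hat_bounded_linear[OF l2op_R[OF elim(2)]]]]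
      by (simp add: dist_norm)
    thus ?case using elim(1) y(2) t(2) dist_triangle[of "hat (R h) (cls u)" "cls u" "hat (R h) (cls \<phi>)"]
        dist_triangle[of "hat (R h) (cls \<phi>)" "cls u" "cls \<phi>"] by (simp add: dist_commute)
  qed
qed

lemma hat_RR_tendsto:
  assumes u: "in_L2 L u"
  shows "((\<lambda>h. hat (R h) (hat (R h) (cls u))) \<longlongrightarrow> cls u) (at_right 0)"
proof -
  have "((\<lambda>h. norm (hat (R h) (cls u) - cls u)) \<longlongrightarrow> 0) (at_right 0)"
    using hat_R_tendsto[OF u] by (intro tendsto_norm_zero) (simp add: LIM_zero_iff)
  hence "((\<lambda>h. hat (R h) (hat (R h) (cls u)) - hat (R h) (cls u)) \<longlongrightarrow> 0) (at_right 0)"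
  proof (rule Lim_null_comparison[rotated])
    show "\<forall>\<^sub>F h in at_right 0. norm (hat (R h) (hat (R h) (cls u)) - hat (R h) (cls u)) \<le> norm (hat (R h) (cls u) - cls u)"
      using eventually_at_right_less[of 0]
    proof eventually_elim
      case (elim h)
      show ?case
        using hat_norm[OF l2op_R[OF elim], of "hat (R h) (cls u) - cls u"] linear_diff[OF bounded_linear.linear[OF hat_bounded_linear[OF l2op_R[OF elim]]]]
        by simp
    qed
  qed
  from tendsto_add[OF this hat_R_tendsto[OF u]] show ?thesis by simp
qed

text \<open>The bound makes \<open>cls \<phi> \<mapsto> - inner (cls u) (cls \<phi>')\<close> a well-defined bounded functional on the test
functions; the vector that represents it is a weak derivative.\<close>

lemma H1_criterion:
  assumes u: "in_L2 L u" and bound: "\<And>\<phi> \<phi>'. test \<phi> \<phi>' \<Longrightarrow> \<bar>inner (cls u) (cls \<phi>')\<bar> \<le> C * norm (cls \<phi>)"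
  shows "\<exists>v. pl2 v \<and> is_weak_deriv L u v"
proof -
  define l where "l X = (SOME s. \<exists>\<phi> \<phi>'. test \<phi> \<phi>' \<and> X = cls \<phi> \<and> s = - inner (cls u) (cls \<phi>'))" for X
  have l: "l (cls \<phi>) = - inner (cls u) (cls \<phi>')" if t: "test \<phi> \<phi>'" for \<phi> \<phi>'
  proof -
    have "\<exists>\<psi> \<psi>'. test \<psi> \<psi>' \<and> cls \<phi> = cls \<psi> \<and> l (cls \<phi>) = - inner (cls u) (cls \<psi>')"
      unfolding l_def by (rule someI_ex) (use t in blast)
    then obtain \<psi> \<psi>' where s: "test \<psi> \<psi>'" "cls \<phi> = cls \<psi>" "l (cls \<phi>) = - inner (cls u) (cls \<psi>')" by blast
    note ts = test_add[OF t test_cmult[OF s(1), of "-1"]]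
    have "cls (\<lambda>x. \<phi> x + (- 1) * \<psi> x) = cls \<phi> + (- 1) *\<^sub>R cls \<psi>"
      unfolding cls_test_cmult[OF s(1)] by (rule cls_test_add[OF t test_cmult[OF s(1)], symmetric])
    hence "cls (\<lambda>x. \<phi> x + (- 1) * \<psi> x) = 0" using s(2) by simp
    hence "inner (cls u) (cls (\<lambda>x. \<phi>' x + (- 1) * \<psi>' x)) = 0" using bound[OF ts] by simp
    moreover have "cls (\<lambda>x. \<phi>' x + (- 1) * \<psi>' x) = cls \<phi>' + (- 1) *\<^sub>R cls \<psi>'"
      using cls_add[OF pl2_in_L2[OF test_deriv_pl2[OF t]] in_L2_cmult[OF pl2_in_L2[OF test_deriv_pl2[OF s(1)]], of "-1"]]
        cls_cmult[OF pl2_in_L2[OF test_deriv_pl2[OF s(1)]], of "-1"] by simp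
    ultimately show ?thesis using s(3) by (simp add: inner_diff_right)
  qed
  obtain V where V: "\<And>x. x \<in> tests \<Longrightarrow> inner V x = l x"
  proof (rule riesz_subspace[OF subspace_tests, of l C])
    fix x y assume "x \<in> tests" "y \<in> tests"
    then obtain \<phi> \<phi>' \<psi> \<psi>' where t: "test \<phi> \<phi>'" "x = cls \<phi>" "test \<psi> \<psi>'" "y = cls \<psi>" by (auto simp: tests_def)
    show "l (x + y) = l x + l y"
      unfolding t(2,4) cls_test_add[OF t(1,3)] l[OF test_add[OF t(1,3)]] l[OF t(1)] l[OF t(3)]
        cls_add[OF pl2_in_L2[OF test_deriv_pl2[OF t(1)]] pl2_in_L2[OF test_deriv_pl2[OF t(3)]]] by (simp add: inner_add_right)
  next
    fix c x assume "x \<in> tests"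
    then obtain \<phi> \<phi>' where t: "test \<phi> \<phi>'" "x = cls \<phi>" by (auto simp: tests_def)
    show "l (c *\<^sub>R x) = c * l x"
      unfolding t(2) cls_test_cmult[OF t(1)] l[OF test_cmult[OF t(1)]] l[OF t(1)] cls_cmult[OF pl2_in_L2[OF test_deriv_pl2[OF t(1)]]] by simp
  next
    fix x assume "x \<in> tests"
    then obtain \<phi> \<phi>' where t: "test \<phi> \<phi>'" "x = cls \<phi>" by (auto simp: tests_def)
    show "\<bar>l x\<bar> \<le> C * norm x" unfolding t(2) l[OF t(1)] using bound[OF t(1)] by simp
  qed (use that in blast)
  have "is_weak_deriv L u (rp V)"
    unfolding is_weak_deriv_iff
  proof (intro conjI allI impI)
    show "integrable (torus L) u" by (rule in_L2_integrable[OF u])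
    show "integrable (torus L) (rp V)" by (intro ploc_torus pl2_ploc rp_pl2)
    fix \<phi> \<phi>' assume t: "test \<phi> \<phi>'"
    have "(LINT x|torus L. u x * \<phi>' x) = inner (cls u) (cls \<phi>')"
      unfolding inner_cls[OF u pl2_in_L2[OF test_deriv_pl2[OF t]]] by (simp add: L2_inner_def)
    also have "\<dots> = - inner (cls \<phi>) V" using V[OF testsI[OF t]] l[OF t] by (simp add: inner_commute)
    also have "inner (cls \<phi>) V = (LINT x|torus L. rp V x * \<phi> x)"
      using inner_cls_l2[OF pl2_in_L2[OF test_pl2[OF t]], of V] by (simp add: L2_inner_def mult.commute)
    finally show "(LINT x|torus L. u x * \<phi>' x) = - (LINT x|torus L. rp V x * \<phi> x)" .
  qed
  thus ?thesis using rp_pl2 by blast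
qed

lemma H1_of_bounded_difference_quotients:
  assumes u: "in_L2 L u" and bound: "\<forall>\<^sub>F h in at_right 0. norm (hat (dl h) (hat (R h) (cls u))) \<le> C"
  shows "\<exists>v. pl2 v \<and> is_weak_deriv L u v"
proof (rule H1_criterion[OF u])
  fix \<phi> \<phi>' assume t: "test \<phi> \<phi>'"
  have "((\<lambda>h. \<bar>inner (hat (R h) (hat (R h) (cls u))) (cls \<phi>')\<bar>) \<longlongrightarrow> \<bar>inner (cls u) (cls \<phi>')\<bar>) (at_right 0)"
    by (intro tendsto_intros hat_RR_tendsto u)
  moreover have "\<forall>\<^sub>F h in at_right 0. \<bar>inner (hat (R h) (hat (R h) (cls u))) (cls \<phi>')\<bar> \<le> C * norm (cls \<phi>)"
    using bound eventually_at_right_less[of 0]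
  proof eventually_elim
    case (elim h)
    define w where "w = R h (rp (cls u))"
    have w: "pl2 w" unfolding w_def by (intro R_pl2 pl2_ploc rp_pl2 elim(2))
    have hw: "hat (R h) (cls u) = cls w" by (simp add: hat_def w_def)
    have "inner (hat (R h) (cls w)) (cls \<phi>') = pint (\<lambda>x. R h w x * \<phi>' x)"
      unfolding hat_cls[OF l2op_R[OF elim(2)] w]
      by (rule inner_cls2[OF R_pl2[OF pl2_ploc[OF w] elim(2)] test_deriv_pl2[OF t]])
    also have "\<dots> = - pint (\<lambda>x. dl h w x * \<phi> x)"
      by (rule prim_by_parts[OF prim_R[OF pl2_ploc[OF w] elim(2)] test_prim[OF t]])
    also have "\<dots> = - inner (hat (dl h) (cls w)) (cls \<phi>)"
      unfolding hat_cls[OF l2op_dl[OF elim(2)] w] inner_cls2[OF dl_pl2[OF w] test_pl2[OF t]] ..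
    finally have "\<bar>inner (hat (R h) (cls w)) (cls \<phi>')\<bar> \<le> norm (hat (dl h) (cls w)) * norm (cls \<phi>)"
      using Cauchy_Schwarz_ineq2 by simp
    also have "\<dots> \<le> C * norm (cls \<phi>)" using elim(1) unfolding hw by (intro mult_right_mono) auto
    finally show ?case unfolding hw .
  qed
  ultimately show "\<bar>inner (cls u) (cls \<phi>')\<bar> \<le> C * norm (cls \<phi>)"
    by (intro tendsto_upperbound[OF _ _ trivial_limit_at_right_real])
qed

text \<open>By the representation of weakly differentiable functions as primitives, \<open>dl h\<close> acts on them as \<open>R h\<close>
on their derivatives.\<close>

lemma regularised_derivative:
  assumes u: "in_L2 L u" and v: "in_L2 L v" and uv: "is_weak_deriv L u v" and h: "0 < h"
  shows "hat (dl h) (hat (R h) (cls u)) = hat (R h) (hat (R h) (cls v))"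
proof -
  obtain F where F: "prim F (pz v)" "AE x in torus L. u x = F x" using weak_deriv_representation[OF uv] by blast
  note Fp = prim_pl2[OF F(1)] and vp = pz_pl2[OF v]
  have cu: "cls u = cls F" by (rule cls_cong[OF u pl2_in_L2[OF Fp] F(2)])
  have cv: "cls v = cls (pz v)" by (rule cls_cong[OF pl2_in_L2[OF vp] v AE_pz, symmetric])
  have "dl h (R h F) = R h (R h (pz v))"
  proof
    fix x
    have "dl h F = R h (pz v)" by (rule ext) (rule dl_prim[OF F(1) h])
    thus "dl h (R h F) x = R h (R h (pz v)) x" using R_dl[OF pl2_ploc[OF Fp], of h x] by simp
  qed
  thus ?thesis
    unfolding cu cv hat_cls[OF l2op_R[OF h] Fp] hat_cls[OF l2op_R[OF h] vp]
      hat_cls[OF l2op_R[OF h] R_pl2[OF pl2_ploc[OF vp] h]] hat_cls[OF l2op_dl[OF h] R_pl2[OF pl2_ploc[OF Fp] h]] by simp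
qed

end

section \<open>The right inverse of the adjoint operator\<close>

text \<open>\<open>m\<close> spans the kernel of \<open>r \<partial> - b\<close>; it is a multiple of the square root of the stationary density.\<close>

locale circle_field = circle L for L +
  fixes r :: real and b m :: "real \<Rightarrow> real" and K B :: real
  assumes r_pos: "r > 0" and K: "K \<ge> 0" "\<And>x y. \<bar>b x - b y\<bar> \<le> K * \<bar>x - y\<bar>"
    and b_cont: "continuous_on UNIV b" and b_per: "\<And>x. b (x + L) = b x" and B: "B \<ge> 0" "\<And>x. \<bar>b x\<bar> \<le> B"
    and m_pos: "\<And>x. m x > 0" and m_per: "\<And>x. m (x + L) = m x"
    and m_deriv: "\<And>x. (m has_real_derivative b x * m x / r) (at x)"
begin

definition mi :: "real \<Rightarrow> real" where "mi x = 1 / m x"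

lemma m_cont: "continuous_on UNIV m"
  using m_deriv DERIV_isCont continuous_at_imp_continuous_on by blast

lemma mi_per: "mi (x + L) = mi x" by (simp add: mi_def m_per)

lemma mi_deriv: "(mi has_real_derivative - (b x * mi x / r)) (at x)"
proof -
  have "((\<lambda>y. 1 / m y) has_real_derivative (0 * m x - 1 * (b x * m x / r)) / (m x * m x)) (at x)"
    by (rule DERIV_divide[OF DERIV_const m_deriv]) (use m_pos[of x] in simp)
  thus ?thesis unfolding mi_def[abs_def] by (rule DERIV_cong) (use m_pos[of x] in simp)
qed

lemma mi_cont: "continuous_on UNIV mi"
  using mi_deriv DERIV_isCont continuous_at_imp_continuous_on by blast

lemma prim_m: "prim m (\<lambda>x. b x * m x / r)"
  by (rule prim_C1[OF m_per m_deriv]) (intro continuous_intros b_cont m_cont, use r_pos in simp)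

lemma prim_mi: "prim mi (\<lambda>x. - (b x * mi x / r))"
  by (rule prim_C1[OF mi_per mi_deriv]) (intro continuous_intros b_cont mi_cont, use r_pos in simp)

text \<open>With the integrating factor \<open>m\<close> one has \<open>r v' + b v = (r / m) * (m * v)'\<close>. Integrating
\<open>- m * u\<close>, after subtraction of its mean, gives \<open>S u\<close>; in \<open>S1\<close> its derivative is written out. \<open>S'\<close> is
the adjoint of \<open>S\<close>, and \<open>S1'\<close> its derivative.\<close>

definition S :: "(real \<Rightarrow> real) \<Rightarrow> real \<Rightarrow> real" where
  "S u x = - (1 / r) * mi x * J (\<lambda>y. m y * u y) x"
definition S1 :: "(real \<Rightarrow> real) \<Rightarrow> real \<Rightarrow> real" where
  "S1 u x = b x * mi x / (r * r) * J (\<lambda>y. m y * u y) x + (- (1 / r) * u x + 1 / r * mi x * mean (\<lambda>y. m y * u y))"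
definition S' :: "(real \<Rightarrow> real) \<Rightarrow> real \<Rightarrow> real" where
  "S' u x = 1 / r * m x * J (\<lambda>y. mi y * u y) x"
definition S1' :: "(real \<Rightarrow> real) \<Rightarrow> real \<Rightarrow> real" where
  "S1' u x = b x * m x / (r * r) * J (\<lambda>y. mi y * u y) x + (1 / r * u x + - (1 / r) * m x * mean (\<lambda>y. mi y * u y))"

lemma mi_m: "mi x * m x = 1" "m x * mi x = 1"
  using m_pos[of x] by (simp_all add: mi_def)

lemma prim_S:
  assumes u: "pl2 u"
  shows "prim (S u) (S1 u)"
proof -
  have mu: "pl2 (\<lambda>y. m y * u y)" by (rule pl2_bmult[OF m_cont m_per u])
  have "prim (\<lambda>x. - (1 / r) * (mi x * J (\<lambda>y. m y * u y) x))
     (\<lambda>x. - (1 / r) * (mi x * (m x * u x - mean (\<lambda>y. m y * u y)) + - (b x * mi x / r) * J (\<lambda>y. m y * u y) x))"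
    by (intro prim_cmult prim_mult prim_mi prim_J pl2_ploc mu)
  moreover have "(\<lambda>x. - (1 / r) * (mi x * J (\<lambda>y. m y * u y) x)) = S u"
    by (rule ext) (simp add: S_def)
  moreover have "(\<lambda>x. - (1 / r) * (mi x * (m x * u x - mean (\<lambda>y. m y * u y)) + - (b x * mi x / r) * J (\<lambda>y. m y * u y) x)) = S1 u"
  proof
    fix x
    have "mi x * (m x * u x - mean (\<lambda>y. m y * u y)) = u x - mi x * mean (\<lambda>y. m y * u y)"
      using mi_m(1)[of x] by (simp add: right_diff_distrib mult.assoc[symmetric])
    thus "- (1 / r) * (mi x * (m x * u x - mean (\<lambda>y. m y * u y)) + - (b x * mi x / r) * J (\<lambda>y. m y * u y) x) = S1 u x"
      unfolding S1_def using r_pos by (simp add: field_simps)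
  qed
  ultimately show ?thesis by simp
qed

lemma prim_S':
  assumes u: "pl2 u"
  shows "prim (S' u) (S1' u)"
proof -
  have mu: "pl2 (\<lambda>y. mi y * u y)" by (rule pl2_bmult[OF mi_cont mi_per u])
  have "prim (\<lambda>x. 1 / r * (m x * J (\<lambda>y. mi y * u y) x))
     (\<lambda>x. 1 / r * (m x * (mi x * u x - mean (\<lambda>y. mi y * u y)) + b x * m x / r * J (\<lambda>y. mi y * u y) x))"
    by (intro prim_cmult prim_mult prim_m prim_J pl2_ploc mu)
  moreover have "(\<lambda>x. 1 / r * (m x * J (\<lambda>y. mi y * u y) x)) = S' u"
    by (rule ext) (simp add: S'_def)
  moreover have "(\<lambda>x. 1 / r * (m x * (mi x * u x - mean (\<lambda>y. mi y * u y)) + b x * m x / r * J (\<lambda>y. mi y * u y) x)) = S1' u"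
  proof
    fix x
    have "m x * (mi x * u x - mean (\<lambda>y. mi y * u y)) = u x - m x * mean (\<lambda>y. mi y * u y)"
      using mi_m(2)[of x] by (simp add: right_diff_distrib mult.assoc[symmetric])
    thus "1 / r * (m x * (mi x * u x - mean (\<lambda>y. mi y * u y)) + b x * m x / r * J (\<lambda>y. mi y * u y) x) = S1' u x"
      unfolding S1'_def using r_pos by (simp add: field_simps)
  qed
  ultimately show ?thesis by simp
qed

lemma S_identity: "r * S1 u x + b x * S u x = mean (\<lambda>y. m y * u y) * mi x - u x"
  unfolding S1_def S_def using r_pos by (simp add: field_simps)

lemma S_adjoint:
  assumes u: "pl2 u" and w: "pl2 w"
  shows "pint (\<lambda>x. S u x * w x) = pint (\<lambda>x. u x * S' w x)"
proof -
  have mu: "pl2 (\<lambda>y. m y * u y)" by (rule pl2_bmult[OF m_cont m_per u])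
  have mw: "pl2 (\<lambda>y. mi y * w y)" by (rule pl2_bmult[OF mi_cont mi_per w])
  have "pint (\<lambda>x. S u x * w x) = pint (\<lambda>x. - (1 / r) * (J (\<lambda>y. m y * u y) x * (mi x * w x)))"
    by (simp add: S_def mult_ac)
  also have "\<dots> = - (1 / r) * pint (\<lambda>x. J (\<lambda>y. m y * u y) x * (mi x * w x))" by (rule pint_cmult)
  also have "\<dots> = 1 / r * pint (\<lambda>x. m x * u x * J (\<lambda>y. mi y * w y) x)"
    using J_anti[OF mu mw] by simp
  also have "\<dots> = pint (\<lambda>x. 1 / r * (m x * u x * J (\<lambda>y. mi y * w y) x))" by (rule pint_cmult[symmetric])
  also have "\<dots> = pint (\<lambda>x. u x * S' w x)" by (simp add: S'_def mult_ac)
  finally show ?thesis .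
qed

lemma ex_l2op_mult:
  assumes "continuous_on UNIV f" "\<And>x. f (x + L) = f x"
  shows "\<exists>C. l2op (\<lambda>u x. f x * u x) C"
  using periodic_bounded[OF assms] l2op_mult[OF assms] by metis

lemma ex_l2op_comp: "\<exists>C. l2op T1 C \<Longrightarrow> \<exists>C. l2op T2 C \<Longrightarrow> \<exists>C. l2op (\<lambda>u. T1 (T2 u)) C"
  using l2op_comp by blast
lemma ex_l2op_add: "\<exists>C. l2op T1 C \<Longrightarrow> \<exists>C. l2op T2 C \<Longrightarrow> \<exists>C. l2op (\<lambda>u x. T1 u x + T2 u x) C"
  using l2op_add by blast

lemma ex_l2op_sandwich:
  assumes "\<exists>C. l2op T C" "continuous_on UNIV f" "\<And>x. f (x + L) = f x" "continuous_on UNIV g" "\<And>x. g (x + L) = g x"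
  shows "\<exists>C. l2op (\<lambda>u x. f x * T (\<lambda>y. g y * u y) x) C"
  using ex_l2op_comp[OF ex_l2op_mult[OF assms(2,3)] ex_l2op_comp[OF assms(1) ex_l2op_mult[OF assms(4,5)]]] by simp

lemma ex_l2op_J: "\<exists>C. l2op J C" and ex_l2op_mean: "\<exists>C. l2op (\<lambda>u x. mean u) C"
  using l2op_J l2op_mean by blast+

lemma cmult_cont: "continuous_on UNIV f \<Longrightarrow> continuous_on UNIV (\<lambda>x. k * f x)"
  for f :: "real \<Rightarrow> real" by (intro continuous_on_mult continuous_on_const)

lemma ex_l2op_S: "\<exists>C. l2op S C"
  unfolding S_def[abs_def]
  by (rule ex_l2op_sandwich[OF ex_l2op_J cmult_cont[OF mi_cont] _ m_cont m_per]) (simp add: mi_per)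

lemma ex_l2op_S': "\<exists>C. l2op S' C"
  unfolding S'_def[abs_def]
  by (rule ex_l2op_sandwich[OF ex_l2op_J cmult_cont[OF m_cont] _ mi_cont mi_per]) (simp add: m_per)

lemma b_over_cont: "continuous_on UNIV f \<Longrightarrow> continuous_on UNIV (\<lambda>x. b x * f x / (r * r))"
  using r_pos by (intro continuous_intros b_cont) auto

lemma ex_l2op_S1: "\<exists>C. l2op S1 C"
  unfolding S1_def[abs_def]
proof (intro ex_l2op_add)
  show "\<exists>C. l2op (\<lambda>u x. b x * mi x / (r * r) * J (\<lambda>y. m y * u y) x) C"
    by (rule ex_l2op_sandwich[OF ex_l2op_J b_over_cont[OF mi_cont] _ m_cont m_per]) (simp add: mi_per b_per)
  show "\<exists>C. l2op (\<lambda>u x. - (1 / r) * u x) C"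
    by (rule ex_l2op_mult[OF continuous_on_const]) simp
  show "\<exists>C. l2op (\<lambda>u x. 1 / r * mi x * mean (\<lambda>y. m y * u y)) C"
    by (rule ex_l2op_sandwich[OF ex_l2op_mean cmult_cont[OF mi_cont] _ m_cont m_per]) (simp add: mi_per)
qed

lemma ex_l2op_S1': "\<exists>C. l2op S1' C"
  unfolding S1'_def[abs_def]
proof (intro ex_l2op_add)
  show "\<exists>C. l2op (\<lambda>u x. b x * m x / (r * r) * J (\<lambda>y. mi y * u y) x) C"
    by (rule ex_l2op_sandwich[OF ex_l2op_J b_over_cont[OF m_cont] _ mi_cont mi_per]) (simp add: m_per b_per)
  show "\<exists>C. l2op (\<lambda>u x. 1 / r * u x) C"
    by (rule ex_l2op_mult[OF continuous_on_const]) simp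
  show "\<exists>C. l2op (\<lambda>u x. - (1 / r) * m x * mean (\<lambda>y. mi y * u y)) C"
    by (rule ex_l2op_sandwich[OF ex_l2op_mean cmult_cont[OF m_cont] _ mi_cont mi_per]) (simp add: m_per)
qed

abbreviation bop :: "(real \<Rightarrow> real) \<Rightarrow> real \<Rightarrow> real" where "bop u \<equiv> (\<lambda>x. b x * u x)"

lemma l2op_bop: "l2op bop B" by (rule l2op_mult[OF b_cont b_per B])

lemma hat_hat:
  assumes T1: "l2op T1 C" and T2: "l2op T2 D"
  shows "hat T1 (hat T2 U) = cls (T1 (T2 (rp U)))"
  unfolding hat_def[of T2] by (rule hat_cls[OF T1 l2opD(2)[OF T2 rp_pl2]])

lemma hat_diff_norm:
  assumes "pl2 u" "pl2 v" "0 \<le> C" "pint (\<lambda>x. (u x - v x)\<^sup>2) \<le> C\<^sup>2 * pint (\<lambda>x. (rp U x)\<^sup>2)"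
  shows "norm (cls u - cls v) \<le> C * norm U"
proof -
  have "norm (cls (\<lambda>x. u x - v x)) \<le> C * norm (cls (rp U))"
    by (rule norm_cls_leI[OF pl2_diff[OF assms(1,2)] rp_pl2 assms(3,4)])
  also have "\<dots> \<le> C * norm U" using norm_cls_rp assms(3) by (rule mult_left_mono)
  finally show ?thesis by (simp add: cls_diff pl2_in_L2 assms)
qed

text \<open>The scale bound \<open>1\<close> is arbitrary. The constant \<open>c\<close> has to dominate the bounds of all four operators
\<open>S\<close>, \<open>S1\<close>, \<open>S'\<close> and \<open>S1'\<close>.\<close>

lemma calculus: "\<exists>c. coercive_calculus (\<lambda>h. hat (R h)) (\<lambda>h. hat (dl h)) (hat bop) r K B 1
    (hat S) (hat S1) (hat S') (hat S1') (cls m) (cls (\<lambda>x. mi x / L)) c"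
proof -
  obtain C1 C2 C3 C4 where C: "l2op S C1" "l2op S1 C2" "l2op S' C3" "l2op S1' C4"
    using ex_l2op_S ex_l2op_S1 ex_l2op_S' ex_l2op_S1' by blast
  define c where "c = C1 + C2 + C3 + C4 + 1"
  have C0: "0 \<le> C1" "0 \<le> C2" "0 \<le> C3" "0 \<le> C4" using C l2opD(1) by blast+
  hence cs: "C1 \<le> c" "C2 \<le> c" "C3 \<le> c" "C4 \<le> c" by (auto simp: c_def)
  have le: "norm (hat T u) \<le> c * norm u" if "l2op T D" "D \<le> c" for T D u
    using hat_norm[OF that(1), of u] mult_right_mono[OF that(2), of "norm u"] by simp
  have m2: "pl2 m" by (rule pl2_continuous[OF m_cont m_per])
  have mi2: "pl2 mi" by (rule pl2_continuous[OF mi_cont mi_per])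
  show ?thesis
  proof (intro exI[of _ c] coercive_calculus.intro regularised_calculus.intro coercive_calculus_axioms.intro)
    show "0 < r" "0 \<le> K" "0 \<le> B" "(0::real) < 1" using r_pos K B by auto
    show "0 < c" using C0 by (simp add: c_def)
    show "bounded_linear (hat bop)" by (rule hat_bounded_linear[OF l2op_bop])
    show "bounded_linear (hat S)" by (rule hat_bounded_linear[OF C(1)])
    show "norm (hat bop u) \<le> B * norm u" for u by (rule hat_norm[OF l2op_bop])
    show "norm (hat S u) \<le> c * norm u" "norm (hat S1 u) \<le> c * norm u"
      "norm (hat S' u) \<le> c * norm u" "norm (hat S1' u) \<le> c * norm u" for u
      by (rule le[OF C(1) cs(1)] le[OF C(2) cs(2)] le[OF C(3) cs(3)] le[OF C(4) cs(4)])+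
    show "inner (hat bop u) v = inner u (hat bop v)" for u v
      using inner_hat[OF l2op_bop, of u v] inner_hat[OF l2op_bop, of v u] by (simp add: inner_commute mult_ac)
    show "inner (hat S u) v = inner u (hat S' v)" for u v
      using inner_hat[OF C(1), of u v] inner_hat[OF C(3), of v u] S_adjoint[OF rp_pl2 rp_pl2, of u v]
      by (simp add: inner_commute mult.commute)
    show "((\<lambda>h. hat (R h) (cls m)) \<longlongrightarrow> cls m) (at_right 0)" by (rule hat_R_tendsto[OF pl2_in_L2[OF m2]])
    fix h :: real and u v :: l2 assume h: "0 < h"
    show "bounded_linear (hat (R h))" by (rule hat_bounded_linear[OF l2op_R[OF h]])
    show "bounded_linear (hat (dl h))" by (rule hat_bounded_linear[OF l2op_dl[OF h]])
    show "inner (hat (R h) u) v = inner u (hat (R h) v)"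
      using inner_hat[OF l2op_R[OF h], of u v] inner_hat[OF l2op_R[OF h], of v u] R_sym[OF rp_pl2 rp_pl2 h, of u v]
      by (simp add: inner_commute mult.commute)
    show "inner (hat (dl h) u) v = - inner u (hat (dl h) v)"
      using inner_hat[OF l2op_dl[OF h], of u v] inner_hat[OF l2op_dl[OF h], of v u] dl_anti[OF rp_pl2 rp_pl2, of h u v]
      by (simp add: inner_commute mult.commute)
    show "hat (R h) (hat (dl h) u) = hat (dl h) (hat (R h) u)"
      unfolding hat_hat[OF l2op_R[OF h] l2op_dl[OF h]] hat_hat[OF l2op_dl[OF h] l2op_R[OF h]]
      using R_dl[OF pl2_ploc[OF rp_pl2], of h u, abs_def] by (simp add: ext)
    show "norm (hat (R h) u) \<le> norm u" using hat_norm[OF l2op_R[OF h], of u] by simp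
    show "norm (hat (dl h) u) \<le> norm u / h" using hat_norm[OF l2op_dl[OF h], of u] by simp
    show "norm (hat (R h) (hat bop u) - hat bop (hat (R h) u)) \<le> K * h * norm u"
      unfolding hat_hat[OF l2op_R[OF h] l2op_bop] hat_hat[OF l2op_bop l2op_R[OF h]]
      by (rule hat_diff_norm[OF _ _ _ R_commutator_le[OF rp_pl2 h b_cont b_per K]])
        (use K h in \<open>auto intro!: R_pl2 pl2_ploc pl2_bmult[OF b_cont b_per] rp_pl2\<close>)
    show "norm (hat (dl h) (hat bop u) - hat bop (hat (dl h) u)) \<le> K * norm u"
      unfolding hat_hat[OF l2op_dl[OF h] l2op_bop] hat_hat[OF l2op_bop l2op_dl[OF h]]
      by (rule hat_diff_norm[OF _ _ _ dl_commutator_le[OF rp_pl2 h b_cont b_per K]])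
        (use K h in \<open>auto intro!: dl_pl2 pl2_bmult[OF b_cont b_per] rp_pl2\<close>)
    have "dl h (S (rp u)) = R h (S1 (rp u))" by (rule ext) (rule dl_prim[OF prim_S[OF rp_pl2] h])
    thus "hat (dl h) (hat S u) = hat (R h) (hat S1 u)"
      unfolding hat_hat[OF l2op_R[OF h] C(2)] hat_hat[OF l2op_dl[OF h] C(1)] by simp
    have "dl h (S' (rp u)) = R h (S1' (rp u))" by (rule ext) (rule dl_prim[OF prim_S'[OF rp_pl2] h])
    thus "hat (dl h) (hat S' u) = hat (R h) (hat S1' u)"
      unfolding hat_hat[OF l2op_R[OF h] C(4)] hat_hat[OF l2op_dl[OF h] C(3)] by simp
    define g where "g = R h (rp u)"
    have g: "pl2 g" unfolding g_def by (rule R_pl2[OF pl2_ploc[OF rp_pl2] h])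
    have gu: "hat (R h) u = cls g" by (simp add: hat_def g_def)
    note in_L2_S = pl2_in_L2[OF l2opD(2)[OF C(1) g]] pl2_in_L2[OF l2opD(2)[OF C(2) g]]
    have "r *\<^sub>R cls (S1 g) + cls (bop (S g)) = cls (\<lambda>x. r * S1 g x + b x * S g x)"
      using cls_add[OF in_L2_cmult[OF in_L2_S(2), of r] pl2_in_L2[OF l2opD(2)[OF l2op_bop l2opD(2)[OF C(1) g]]]]
      by (simp add: cls_cmult[OF in_L2_S(2)])
    also have "(\<lambda>x. r * S1 g x + b x * S g x) = (\<lambda>x. (pint (\<lambda>y. g y * m y)) * (mi x / L) - g x)"
      by (rule ext) (simp add: S_identity mean_def mult.commute)
    also have "cls \<dots> = pint (\<lambda>y. g y * m y) *\<^sub>R cls (\<lambda>x. mi x / L) - cls g"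
    proof -
      have miL: "in_L2 L (\<lambda>x. mi x / L)" using pl2_in_L2[OF pl2_cmult[OF mi2, of "1 / L"]] by simp
      show ?thesis
        using cls_diff[OF in_L2_cmult[OF miL, of "pint (\<lambda>y. g y * m y)"] pl2_in_L2[OF g]]
        unfolding cls_cmult[OF miL] .
    qed
    also have "pint (\<lambda>y. g y * m y) = inner (cls g) (cls m)" by (rule inner_cls2[OF g m2, symmetric])
    finally show "r *\<^sub>R hat S1 (hat (R h) u) + hat bop (hat S (hat (R h) u))
       = inner (hat (R h) u) (cls m) *\<^sub>R cls (\<lambda>x. mi x / L) - hat (R h) u"
      unfolding gu hat_cls[OF C(2) g] hat_cls[OF C(1) g] hat_cls[OF l2op_bop l2opD(2)[OF C(1) g]] .
  qed
qed

end

text \<open>A potential with two bounded weak derivatives agrees almost everywhere with a function \<open>P\<close> that is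
continuously differentiable with Lipschitz derivative \<open>p\<close>, so the field \<open>E\<close> may be replaced by the
Lipschitz function \<open>- p\<close>.\<close>

lemma (in circle) potential_normal_form:
  assumes \<Phi>: "in_W2inf L \<Phi>"
  obtains P p K B where "prim P p" "AE x in torus L. \<Phi> x = P x" "AE x in torus L. field_E L \<Phi> x = - p x"
    "continuous_on UNIV p" "\<And>x. p (x + L) = p x" "\<And>x. (P has_real_derivative p x) (at x)"
    "K \<ge> 0" "\<And>x y. \<bar>p x - p y\<bar> \<le> K * \<bar>x - y\<bar>" "B \<ge> 0" "\<And>x. \<bar>p x\<bar> \<le> B"
proof -
  obtain u1 u2 where u: "is_weak_deriv L \<Phi> u1" "in_Linf L u1" "is_weak_deriv L u1 u2" "in_Linf L u2"
    using \<Phi> by (auto simp: in_W2inf_def)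
  obtain P0 where P0: "prim P0 (pz u1)" "AE x in torus L. \<Phi> x = P0 x" using weak_deriv_representation[OF u(1)] by blast
  obtain p where p: "prim p (pz u2)" "AE x in torus L. u1 x = p x" using weak_deriv_representation[OF u(3)] by blast
  have pc: "continuous_on UNIV p" "\<And>x. p (x + L) = p x" using prim_continuous[OF p(1)] prim_periodic[OF p(1)] .
  have pp: "ploc p" by (rule pl2_ploc[OF prim_pl2[OF p(1)]])
  have weak: "is_weak_deriv L \<Phi> p"
    unfolding is_weak_deriv_iff
  proof (intro conjI allI impI)
    show "integrable (torus L) \<Phi>" using u(1) by (simp add: is_weak_deriv_iff)
    show "integrable (torus L) p" by (rule ploc_torus[OF pp])
    fix \<phi> \<phi>' assume t: "test \<phi> \<phi>'"
    have pm: "ploc (\<lambda>x. p x * \<phi> x)" by (intro pl2_mult prim_pl2[OF p(1)] test_pl2[OF t])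
    have "(LINT x|torus L. u1 x * \<phi> x) = pint (\<lambda>x. p x * \<phi> x)"
    proof (rule LINT_torus_cong[OF _ _ pm])
      show "AE x in torus L. u1 x * \<phi> x = p x * \<phi> x" using p(2) by eventually_elim simp
    qed (use u(1) measurable_torusI[OF pl2_measurable[OF test_pl2[OF t]]] in \<open>auto simp: is_weak_deriv_iff\<close>)
    also have "\<dots> = (LINT x|torus L. p x * \<phi> x)" by (rule pint_torus[OF pm, symmetric])
    finally show "(LINT x|torus L. \<Phi> x * \<phi>' x) = - (LINT x|torus L. p x * \<phi> x)"
      using u(1) t unfolding is_weak_deriv_iff by metis
  qed
  obtain P where P: "prim P (pz p)" "AE x in torus L. \<Phi> x = P x" using weak_deriv_representation[OF weak] by blast
  have "pz p = p"
  proof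
    fix x
    define n where "n = \<lfloor>x / L\<rfloor>"
    show "pz p x = p x"
    proof (cases "0 \<le> n")
      case True
      thus ?thesis using periodic_int(2)[of p x "nat n", OF pc(2)] by (simp add: mult.commute pz_def n_def)
    next
      case False
      thus ?thesis using periodic_int(1)[of p x "nat (- n)", OF pc(2)] by (simp add: mult.commute pz_def n_def)
    qed
  qed
  with P have P': "prim P p" by simp
  have E: "AE x in torus L. field_E L \<Phi> x = - p x"
    using weak_deriv_AE(1)[OF weak] by eventually_elim (simp add: field_E_def)
  obtain M where M: "AE x in torus L. \<bar>u2 x\<bar> \<le> M" using u(4) by (auto simp: in_Linf_def)
  define K where "K = max M 0"
  have K0: "0 \<le> K" by (simp add: K_def)
  define g where "g = pz u2"
  \<comment> \<open>The bound on the second derivative holds almost everywhere only; truncation makes it hold everywhere without changing the primitive.\<close>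
  define g2 where "g2 = (\<lambda>x. max (- K) (min K (g x)))"
  have gl: "ploc g" unfolding g_def by (rule prim_ploc[OF p(1)])
  have g2m: "g2 \<in> borel_measurable lebesgue"
    unfolding g2_def by (intro borel_measurable_max borel_measurable_min borel_measurable_const ploc_measurable[OF gl])
  have g2b: "\<bar>g2 x\<bar> \<le> K" for x using K0 by (auto simp: g2_def)
  have g2l: "ploc g2"
    by (rule ploc_boundedI[of _ "\<lambda>x. K"]) (use g2m g2b ploc_periodic[OF gl] in \<open>auto simp: g2_def\<close>)
  define d where "d = (\<lambda>x. \<bar>g x - g2 x\<bar>)"
  have dl': "ploc d" unfolding d_def by (intro ploc_abs ploc_diff gl g2l)
  have d0: "pint d = 0"
  proof -
    have "(LINT x|torus L. (0::real)) = pint d"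
    proof (rule LINT_torus_cong[OF _ _ dl'])
      show "AE x in torus L. 0 = d x"
        using M AE_pz[of u2]
      proof eventually_elim
        case (elim x)
        hence "\<bar>g x\<bar> \<le> K" by (auto simp: g_def K_def)
        thus ?case by (auto simp: d_def g2_def)
      qed
    qed simp
    thus ?thesis by simp
  qed
  have abs_bound: "\<bar>integral T f\<bar> \<le> integral T k"
    if "f integrable_on T" "k integrable_on T" "\<And>z. z \<in> T \<Longrightarrow> \<bar>f z\<bar> \<le> k z" for f k :: "real \<Rightarrow> real" and T
    using Henstock_Kurzweil_Integration.integral_norm_bound_integral[of f T k] that by simp
  have short: "\<bar>p y - p x\<bar> \<le> K * (y - x)" if "x \<le> y" "y \<le> x + L" for x y
  proof -
    have "\<bar>integral {x..y} (\<lambda>z. g z - g2 z)\<bar> \<le> integral {x..y} d"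
      by (rule abs_bound) (auto intro!: ploc_integrable_on[OF ploc_diff[OF gl g2l]] ploc_integrable_on[OF dl'] simp: d_def[THEN fun_cong])
    also have "\<dots> \<le> integral {x..x + L} d"
      by (rule integral_subset_le) (use that ploc_integrable_on[OF dl'] in \<open>auto simp: d_def[THEN fun_cong]\<close>)
    also have "\<dots> = 0" using integral_window[OF dl'] d0 by simp
    finally have "integral {x..y} g = integral {x..y} g2"
      using Henstock_Kurzweil_Integration.integral_diff[OF ploc_integrable_on[OF gl] ploc_integrable_on[OF g2l], of x y] by simp
    hence "p y - p x = integral {x..y} g2" using primD[OF p(1) that(1)] by (simp add: g_def)
    also have "\<bar>\<dots>\<bar> \<le> integral {x..y} (\<lambda>z. K)"
      by (rule abs_bound) (auto intro!: ploc_integrable_on g2l g2b ploc_const)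
    finally show ?thesis using that(1) by (simp add: mult.commute)
  qed
  have long: "\<bar>p y - p x\<bar> \<le> K * (y - x)" if "x \<le> y" "y \<le> x + real n * L" for x y n
    using that
  proof (induction n arbitrary: y)
    case 0 thus ?case by simp
  next
    case (Suc n)
    show ?case
    proof (cases "y \<le> x + L")
      case True thus ?thesis using short Suc.prems by blast
    next
      case False
      have "\<bar>p (y - L) - p x\<bar> \<le> K * (y - L - x)"
        by (rule Suc.IH) (use False Suc.prems in \<open>auto simp: algebra_simps\<close>)
      also have "\<dots> \<le> K * (y - x)" using K0 L_pos by (intro mult_left_mono) auto
      finally show ?thesis using pc(2)[of "y - L"] by simp
    qed
  qed
  have lip1: "\<bar>p y - p x\<bar> \<le> K * (y - x)" if xy: "x \<le> y" for x y
  proof -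
    obtain n :: nat where "(y - x) / L \<le> real n" using real_arch_simple by blast
    thus ?thesis using long[OF xy, of n] L_pos by (simp add: field_simps)
  qed
  have lip: "\<bar>p x - p y\<bar> \<le> K * \<bar>x - y\<bar>" for x y
    using lip1[of x y] lip1[of y x] by (cases "x \<le> y") (auto simp: abs_minus_commute)
  obtain B where B: "B \<ge> 0" "\<And>x. \<bar>p x\<bar> \<le> B" using periodic_bounded[OF pc] by blast
  show ?thesis
    by (rule that[OF P' P(2) E pc prim_deriv[OF P' pc(1)] _ lip B]) (auto simp: K_def)
qed

section \<open>The operators and the equilibrium on classes\<close>

text \<open>Minkowski's inequality in \<open>\<ell>\<^sup>2\<close>, passing to the limit in its finite version.\<close>

lemma Minkowski_sequences:
  fixes x y z :: "nat \<Rightarrow> real"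
  assumes "\<And>k. 0 \<le> x k" "\<And>k. 0 \<le> y k" "\<And>k. 0 \<le> z k" and le: "\<And>k. x k \<le> y k + z k"
    and y: "summable (\<lambda>k. (y k)\<^sup>2)" and z: "summable (\<lambda>k. (z k)\<^sup>2)"
  shows "summable (\<lambda>k. (x k)\<^sup>2)" "sqrt (\<Sum>k. (x k)\<^sup>2) \<le> sqrt (\<Sum>k. (y k)\<^sup>2) + sqrt (\<Sum>k. (z k)\<^sup>2)"
proof -
  define X where "X = sqrt (\<Sum>k. (y k)\<^sup>2) + sqrt (\<Sum>k. (z k)\<^sup>2)"
  have X0: "0 \<le> X" unfolding X_def using suminf_nonneg[OF y] suminf_nonneg[OF z] by simp
  have part: "(\<Sum>k<n. (x k)\<^sup>2) \<le> X\<^sup>2" for n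
  proof -
    have "L2_set x {..<n} \<le> L2_set (\<lambda>k. y k + z k) {..<n}" by (rule L2_set_mono) (use assms le in auto)
    also have "\<dots> \<le> L2_set y {..<n} + L2_set z {..<n}" by (rule L2_set_triangle_ineq)
    also have "\<dots> \<le> X"
      unfolding L2_set_def X_def
      by (intro add_mono real_sqrt_le_mono sum_le_suminf y z) auto
    finally show ?thesis unfolding L2_set_def by (rule sqrt_le_D)
  qed
  show s: "summable (\<lambda>k. (x k)\<^sup>2)"
    by (rule summableI_nonneg_bounded[OF _ part]) simp
  have "(\<Sum>k. (x k)\<^sup>2) \<le> X\<^sup>2" by (rule suminf_le_const[OF s part])
  thus "sqrt (\<Sum>k. (x k)\<^sup>2) \<le> sqrt (\<Sum>k. (y k)\<^sup>2) + sqrt (\<Sum>k. (z k)\<^sup>2)"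
    unfolding X_def[symmetric] using X0 by (intro real_le_lsqrt suminf_nonneg s) auto
qed

context circle begin

lemma seq_L2_cls: "seq_L2 L G \<longleftrightarrow> (\<forall>k. in_L2 L (G k)) \<and> summable (\<lambda>k. (norm (cls (G k)))\<^sup>2)"
  unfolding seq_L2_def by (rule conj_cong[OF refl]) (simp add: norm_cls)

lemma seq_norm_cls: "seq_L2 L G \<Longrightarrow> seq_norm L G = sqrt (\<Sum>k. (norm (cls (G k)))\<^sup>2)"
  by (simp add: seq_norm_def seq_L2_def norm_cls)

lemma seq_L2_diff:
  assumes "seq_L2 L F" "seq_L2 L G"
  shows "seq_L2 L (seq_diff F G)"
  using assms summable_norm2_diff[of "\<lambda>k. cls (F k)" "\<lambda>k. cls (G k)"]
  by (simp add: seq_L2_cls seq_diff_def in_L2_diff cls_diff)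

lemma in_L2_cong:
  assumes f: "f \<in> borel_measurable (torus L)" and g: "in_L2 L g" and ae: "AE x in torus L. f x = g x"
  shows "in_L2 L f"
proof -
  have "integrable (torus L) (\<lambda>x. (f x)\<^sup>2) \<longleftrightarrow> integrable (torus L) (\<lambda>x. (g x)\<^sup>2)"
    by (rule integrable_cong_AE) (use f g ae in \<open>auto simp: in_L2_def\<close>)
  thus ?thesis using f g by (simp add: in_L2_def)
qed

lemma is_weak_deriv_add:
  assumes u: "is_weak_deriv L u u'" and v: "is_weak_deriv L v v'"
  shows "is_weak_deriv L (\<lambda>x. u x + c * v x) (\<lambda>x. u' x + c * v' x)"
  unfolding is_weak_deriv_iff
proof (intro conjI allI impI)
  have i: "integrable (torus L) u" "integrable (torus L) u'" "integrable (torus L) v" "integrable (torus L) v'"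
    using u v by (auto simp: is_weak_deriv_iff)
  show "integrable (torus L) (\<lambda>x. u x + c * v x)" "integrable (torus L) (\<lambda>x. u' x + c * v' x)"
    using i by auto
  fix \<phi> \<phi>' assume t: "test \<phi> \<phi>'"
  have prod: "integrable (torus L) (\<lambda>x. f x * g x)"
    if f: "integrable (torus L) f" and g: "continuous_on UNIV g" "\<And>x. g (x + L) = g x" for f g :: "real \<Rightarrow> real"
  proof -
    obtain M where M: "\<And>x. \<bar>g x\<bar> \<le> M" using periodic_bounded[OF g] by blast
    show ?thesis
    proof (rule Bochner_Integration.integrable_bound[where f = "\<lambda>x. M * f x"])
      show "integrable (torus L) (\<lambda>x. M * f x)" using f by simp
      show "(\<lambda>x. f x * g x) \<in> borel_measurable (torus L)"
        using f measurable_torusI[OF continuous_lebesgue_measurable[OF g(1)]] by auto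
      show "AE x in torus L. norm (f x * g x) \<le> norm (M * f x)"
      proof (rule AE_I2)
        fix x
        have "\<bar>g x\<bar> \<le> \<bar>M\<bar>" using M[of x] by linarith
        thus "norm (f x * g x) \<le> norm (M * f x)"
          by (simp add: abs_mult mult.commute[of "\<bar>f x\<bar>"] mult_right_mono)
      qed
    qed
  qed
  have c: "continuous_on UNIV \<phi>" "\<And>x. \<phi> (x + L) = \<phi> x" "continuous_on UNIV \<phi>'" "\<And>x. \<phi>' (x + L) = \<phi>' x"
    using prim_continuous[OF test_prim[OF t]] t ploc_periodic[OF prim_ploc[OF test_prim[OF t]]]
    by (auto simp: test_def)
  have "(LINT x|torus L. (u x + c * v x) * \<phi>' x) = (LINT x|torus L. u x * \<phi>' x + c * (v x * \<phi>' x))"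
    by (simp add: algebra_simps)
  also have "\<dots> = (LINT x|torus L. u x * \<phi>' x) + c * (LINT x|torus L. v x * \<phi>' x)"
    using prod[OF i(1) c(3,4)] prod[OF i(3) c(3,4)] by simp
  also have "\<dots> = - ((LINT x|torus L. u' x * \<phi> x) + c * (LINT x|torus L. v' x * \<phi> x))"
    using u v t by (simp add: is_weak_deriv_iff)
  also have "\<dots> = - (LINT x|torus L. u' x * \<phi> x + c * (v' x * \<phi> x))"
    using prod[OF i(2) c(1,2)] prod[OF i(4) c(1,2)] by simp
  finally show "(LINT x|torus L. (u x + c * v x) * \<phi>' x) = - (LINT x|torus L. (u' x + c * v' x) * \<phi> x)"
    by (simp add: algebra_simps)
qed

lemma is_weak_deriv_cong:
  assumes u: "is_weak_deriv L u v" and ae: "AE x in torus L. w x = u x" and w: "w \<in> borel_measurable (torus L)"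
  shows "is_weak_deriv L w v"
  unfolding is_weak_deriv_iff
proof (intro conjI allI impI)
  have m: "u \<in> borel_measurable (torus L)" using u by (auto simp: is_weak_deriv_iff)
  show "integrable (torus L) w" "integrable (torus L) v"
    using u integrable_cong_AE[OF w m ae] by (auto simp: is_weak_deriv_iff)
  fix \<phi> \<phi>' assume t: "test \<phi> \<phi>'"
  have "\<phi>' \<in> borel_measurable (torus L)"
    using t by (auto simp: test_def intro!: measurable_torusI continuous_lebesgue_measurable)
  hence "(LINT x|torus L. w x * \<phi>' x) = (LINT x|torus L. u x * \<phi>' x)"
    using w m ae by (intro integral_cong_AE) auto
  thus "(LINT x|torus L. w x * \<phi>' x) = - (LINT x|torus L. v x * \<phi> x)"
    using u t by (simp add: is_weak_deriv_iff)
qed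

end

text \<open>The potential and the field themselves are known only almost everywhere; \<open>b\<close> and \<open>m\<close> are their
regular representatives.\<close>

locale hermite_torus = circle_field L r b m K B for L r b m K B +
  fixes T0 :: real and \<Phi> :: "real \<Rightarrow> real"
  assumes T0: "T0 > 0" and r_eq: "r = sqrt T0"
    and \<Phi>_meas: "\<Phi> \<in> borel_measurable (torus L)" and E_meas: "field_E L \<Phi> \<in> borel_measurable (torus L)"
    and E_b: "AE x in torus L. field_E L \<Phi> x / (2 * sqrt T0) = b x"
    and \<Phi>_m: "AE x in torus L. exp (- \<Phi> x / T0) = (m x)\<^sup>2"
begin

lemma m_pl2: "pl2 m" by (rule pl2_continuous[OF m_cont m_per])

lemma bm_pl2: "pl2 (\<lambda>x. b x * m x / r)"
proof (rule pl2_continuous)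
  show "continuous_on UNIV (\<lambda>x. b x * m x / r)"
    by (intro continuous_on_divide continuous_on_mult continuous_on_const b_cont m_cont) (use r_pos in simp)
qed (simp add: b_per m_per)

lemma in_L2_bop: "in_L2 L u \<Longrightarrow> in_L2 L (bop u)"
  and cls_bop: "in_L2 L u \<Longrightarrow> cls (bop u) = hat bop (cls u)"
proof -
  assume u: "in_L2 L u"
  have p: "pl2 (pz u)" by (rule pz_pl2[OF u])
  have q: "in_L2 L (bop (pz u))" by (rule pl2_in_L2[OF l2opD(2)[OF l2op_bop p]])
  have ae: "AE x in torus L. bop u x = bop (pz u) x" using AE_pz[of u] by eventually_elim simp
  have bu: "bop u \<in> borel_measurable (torus L)"
    using u measurable_torusI[OF continuous_lebesgue_measurable[OF b_cont]] by (auto simp: in_L2_def)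
  show 1: "in_L2 L (bop u)" by (rule in_L2_cong[OF bu q ae])
  have "cls (bop u) = cls (bop (pz u))" by (rule cls_cong[OF 1 q ae])
  also have "\<dots> = hat bop (cls (pz u))" by (rule hat_cls[OF l2op_bop p, symmetric])
  also have "cls (pz u) = cls u" by (rule cls_cong[OF pl2_in_L2[OF p] u AE_pz])
  finally show "cls (bop u) = hat bop (cls u)" .
qed

lemma op_classes:
  assumes u: "in_L2 L u" and v: "in_L2 L v" and d: "is_weak_deriv L u v"
  shows "in_L2 L (op_A L T0 \<Phi> u)" "cls (op_A L T0 \<Phi> u) = r *\<^sub>R cls v - hat bop (cls u)"
    and "in_L2 L (op_A_star L T0 \<Phi> u)" "cls (op_A_star L T0 \<Phi> u) = - (r *\<^sub>R cls v + hat bop (cls u))"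
proof -
  note bu = in_L2_bop[OF u]
  have um: "u \<in> borel_measurable (torus L)" using u by (simp add: in_L2_def)
  have wm: "weak_deriv L u \<in> borel_measurable (torus L)"
    using weak_deriv_AE(2)[OF d] by (auto simp: is_weak_deriv_iff)
  have g1: "in_L2 L (\<lambda>x. r * v x - bop u x)" and g2: "in_L2 L (\<lambda>x. - r * v x - bop u x)"
    by (intro in_L2_diff in_L2_cmult v bu)+
  have meas: "op_A L T0 \<Phi> u \<in> borel_measurable (torus L)" "op_A_star L T0 \<Phi> u \<in> borel_measurable (torus L)"
    unfolding op_A_def op_A_star_def
    by (intro borel_measurable_diff borel_measurable_times borel_measurable_divide borel_measurable_const um wm E_meas)+
  have ae: "AE x in torus L. op_A L T0 \<Phi> u x = r * v x - bop u x"
      "AE x in torus L. op_A_star L T0 \<Phi> u x = - r * v x - bop u x"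
    by (rule eventually_mono[OF eventually_conj[OF weak_deriv_AE(1)[OF d] E_b]];
      simp add: op_A_def op_A_star_def r_eq times_divide_eq_left[symmetric] del: times_divide_eq_left)+
  show A: "in_L2 L (op_A L T0 \<Phi> u)" by (rule in_L2_cong[OF meas(1) g1 ae(1)])
  show As: "in_L2 L (op_A_star L T0 \<Phi> u)" by (rule in_L2_cong[OF meas(2) g2 ae(2)])
  show "cls (op_A L T0 \<Phi> u) = r *\<^sub>R cls v - hat bop (cls u)"
    unfolding cls_cong[OF A g1 ae(1)] cls_diff[OF in_L2_cmult[OF v] bu] cls_cmult[OF v] cls_bop[OF u] ..
  show "cls (op_A_star L T0 \<Phi> u) = - (r *\<^sub>R cls v + hat bop (cls u))"
    unfolding cls_cong[OF As g2 ae(2)] cls_diff[OF in_L2_cmult[OF v] bu] cls_cmult[OF v] cls_bop[OF u] by simp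
qed

text \<open>\<open>\<A>\<^sup>*\<close> maps into the orthogonal complement of the kernel of \<open>\<A>\<close>.\<close>

lemma kernel_pairing:
  assumes p: "prim \<phi> \<phi>'" and \<phi>': "pl2 \<phi>'"
  shows "inner (cls m) (r *\<^sub>R cls \<phi>' + hat bop (cls \<phi>)) = 0"
proof -
  have \<phi>: "pl2 \<phi>" by (rule prim_pl2[OF p])
  have "inner (cls m) (r *\<^sub>R cls \<phi>' + hat bop (cls \<phi>)) = r * pint (\<lambda>x. m x * \<phi>' x) + pint (\<lambda>x. m x * (b x * \<phi> x))"
    using inner_cls2[OF m_pl2 \<phi>'] inner_cls2[OF m_pl2 l2opD(2)[OF l2op_bop \<phi>]]
    by (simp add: inner_add_right hat_cls[OF l2op_bop \<phi>])
  also have "pint (\<lambda>x. m x * \<phi>' x) = - pint (\<lambda>x. b x * m x / r * \<phi> x)"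
    by (rule prim_by_parts[OF prim_m p])
  also have "pint (\<lambda>x. b x * m x / r * \<phi> x) = 1 / r * pint (\<lambda>x. m x * (b x * \<phi> x))"
    by (subst pint_cmult[symmetric]) (simp add: mult_ac)
  finally show ?thesis using r_pos by simp
qed

lemma kernel_deriv: "r *\<^sub>R cls (\<lambda>x. b x * m x / r) = hat bop (cls m)"
  using cls_cmult[OF pl2_in_L2[OF bm_pl2], of r] r_pos by (simp add: hat_cls[OF l2op_bop m_pl2])

lemma equilibrium:
  assumes c0: "c0 > 0"
  shows "in_L2 L (D_inf T0 \<Phi> c0 k)" "cls (D_inf T0 \<Phi> c0 k) = (if k = 0 then sqrt c0 *\<^sub>R cls m else 0)"
    and "is_weak_deriv L (D_inf T0 \<Phi> c0 k) (\<lambda>x. (if k = 0 then sqrt c0 else 0) * (b x * m x / r))"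
proof -
  define a where "a = (if k = 0 then sqrt c0 else 0)"
  have ae: "AE x in torus L. D_inf T0 \<Phi> c0 k x = a * m x"
    using \<Phi>_m
  proof eventually_elim
    case (elim x)
    thus ?case using m_pos[of x] c0
      by (simp add: D_inf_def rho_inf_def a_def real_sqrt_mult)
  qed
  have meas: "D_inf T0 \<Phi> c0 k \<in> borel_measurable (torus L)" for k
    unfolding D_inf_def rho_inf_def using \<Phi>_meas by measurable
  have am: "in_L2 L (\<lambda>x. a * m x)" by (rule in_L2_cmult[OF pl2_in_L2[OF m_pl2]])
  show L2: "in_L2 L (D_inf T0 \<Phi> c0 k)" by (rule in_L2_cong[OF meas am ae])
  show "cls (D_inf T0 \<Phi> c0 k) = (if k = 0 then sqrt c0 *\<^sub>R cls m else 0)"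
    using cls_cong[OF L2 am ae] cls_cmult[OF pl2_in_L2[OF m_pl2], of a] by (simp add: a_def)
  have "is_weak_deriv L (\<lambda>x. a * m x) (\<lambda>x. a * (b x * m x / r))"
    by (rule prim_weak_deriv[OF prim_cmult[OF prim_m]])
  thus "is_weak_deriv L (D_inf T0 \<Phi> c0 k) (\<lambda>x. (if k = 0 then sqrt c0 else 0) * (b x * m x / r))"
    unfolding a_def[symmetric] by (rule is_weak_deriv_cong[OF _ ae meas])
qed

lemma equilibrium_mass:
  assumes c0: "c0 > 0"
  shows "(LINT x|torus L. rho_inf T0 \<Phi> c0 x) = (norm (cls (D_inf T0 \<Phi> c0 0)))\<^sup>2"
proof -
  have "(D_inf T0 \<Phi> c0 0 x)\<^sup>2 = rho_inf T0 \<Phi> c0 x" for x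
    using c0 by (simp add: D_inf_def rho_inf_def)
  moreover have "0 \<le> (LINT x|torus L. rho_inf T0 \<Phi> c0 x)"
    by (rule Bochner_Integration.integral_nonneg) (use c0 in \<open>simp add: rho_inf_def\<close>)
  ultimately show ?thesis by (simp add: norm_cls[OF equilibrium(1)[OF c0]] L2_norm_def)
qed

end

section \<open>Solutions of the Hermite system as flows of classes\<close>

context hermite_torus begin

text \<open>The constant has to depend on the potential and on \<open>T0\<close> only; choosing it once, in a context without
a solution, ensures this.\<close>

definition calc_bound :: real where
  "calc_bound = (SOME c. coercive_calculus (\<lambda>h. hat (R h)) (\<lambda>h. hat (dl h)) (hat bop) r K B 1
    (hat S) (hat S1) (hat S') (hat S1') (cls m) (cls (\<lambda>x. mi x / L)) c)"

sublocale calc: coercive_calculus "\<lambda>h. hat (R h)" "\<lambda>h. hat (dl h)" "hat bop" r K B 1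
    "hat S" "hat S1" "hat S'" "hat S1'" "cls m" "cls (\<lambda>x. mi x / L)" calc_bound
  unfolding calc_bound_def using calculus by (rule someI_ex)

lemma pairings:
  assumes p: "prim \<phi> \<phi>'" and \<phi>': "pl2 \<phi>'" and d: "in_L2 L d"
  shows "in_H1 L \<phi>"
    "L2_inner L d (op_A L T0 \<Phi> \<phi>) = inner (cls d) (r *\<^sub>R cls \<phi>' - hat bop (cls \<phi>))"
    "L2_inner L d (op_A_star L T0 \<Phi> \<phi>) = - inner (cls d) (r *\<^sub>R cls \<phi>' + hat bop (cls \<phi>))"
proof -
  note \<phi> = pl2_in_L2[OF prim_pl2[OF p]] and \<phi>'L = pl2_in_L2[OF \<phi>'] and wd = prim_weak_deriv[OF p]
  show "in_H1 L \<phi>" unfolding in_H1_def using \<phi> \<phi>'L wd by blast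
  note op = op_classes[OF \<phi> \<phi>'L wd]
  show "L2_inner L d (op_A L T0 \<Phi> \<phi>) = inner (cls d) (r *\<^sub>R cls \<phi>' - hat bop (cls \<phi>))"
    using inner_cls[OF d op(1)] op(2) by simp
  show "L2_inner L d (op_A_star L T0 \<Phi> \<phi>) = - inner (cls d) (r *\<^sub>R cls \<phi>' + hat bop (cls \<phi>))"
    unfolding inner_cls[OF d op(3), symmetric] op(4) inner_minus_right ..
qed

text \<open>As \<open>\<A> sqrt \<rho>\<^sub>\<infinity> = 0\<close>, the components of \<open>\<B> D\<close> are those of \<open>\<B> U\<close>, that is \<open>\<plusminus> r v - b w\<close> with \<open>w\<close> the
deviation and \<open>v\<close> its derivative.\<close>

lemma op_B_component:
  assumes c0: "c0 > 0" and d: "in_L2 L (d k)" and v: "in_L2 L v"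
    and wd: "is_weak_deriv L (seq_diff d (D_inf T0 \<Phi> c0) k) v"
  defines "w \<equiv> cls (seq_diff d (D_inf T0 \<Phi> c0) k)"
  shows "in_H1 L (d k)" "in_L2 L (op_B L T0 \<Phi> d k)"
    "norm (cls (op_B L T0 \<Phi> d k)) \<le> r * norm (cls v) + B * norm w"
    "r * norm (cls v) \<le> norm (cls (op_B L T0 \<Phi> d k)) + B * norm w"
proof -
  define a where "a = (if k = 0 then sqrt c0 else 0)"
  define e where "e x = b x * m x / r" for x
  have e: "in_L2 L e" unfolding e_def[abs_def] by (rule pl2_in_L2[OF bm_pl2])
  note E = equilibrium[OF c0, of k]
  have "is_weak_deriv L (\<lambda>x. seq_diff d (D_inf T0 \<Phi> c0) k x + 1 * D_inf T0 \<Phi> c0 k x) (\<lambda>x. v x + 1 * (a * e x))"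
    unfolding a_def e_def by (rule is_weak_deriv_add[OF wd E(3)])
  hence wd': "is_weak_deriv L (d k) (\<lambda>x. v x + a * e x)" by (simp add: seq_diff_def)
  have v': "in_L2 L (\<lambda>x. v x + a * e x)" by (intro in_L2_add in_L2_cmult v e)
  show "in_H1 L (d k)" unfolding in_H1_def using d v' wd' by blast
  note op = op_classes[OF d v' wd']
  show L2: "in_L2 L (op_B L T0 \<Phi> d k)" using op(1,3) by (cases "k = 0") (simp_all add: op_B_def)
  have clsv: "cls (\<lambda>x. v x + a * e x) = cls v + a *\<^sub>R cls e"
    by (simp add: cls_add[OF v in_L2_cmult[OF e]] cls_cmult[OF e])
  have dk: "cls (d k) = w + a *\<^sub>R cls m"
    unfolding w_def seq_diff_def cls_diff[OF d E(1)] E(2) by (simp add: a_def)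
  have lin: "hat bop (x + y) = hat bop x + hat bop y" "hat bop (k *\<^sub>R x) = k *\<^sub>R hat bop x" for x y k
    using linear_add[OF bounded_linear.linear[OF calc.b_bl]] linear_scale[OF bounded_linear.linear[OF calc.b_bl]] by auto
  have ke: "hat bop (cls m) = r *\<^sub>R cls e" unfolding e_def[abs_def] by (rule kernel_deriv[symmetric])
  have bw: "norm (hat bop w) \<le> B * norm w" by (rule calc.b_norm)
  have rv: "norm (r *\<^sub>R cls v) = r * norm (cls v)" using r_pos by simp
  have "cls (op_B L T0 \<Phi> d k) = (if k = 0 then r *\<^sub>R cls v - hat bop w else - (r *\<^sub>R cls v + hat bop w))"
    using op(2,4) unfolding clsv dk lin ke by (auto simp: op_B_def a_def algebra_simps)
  hence N: "norm (cls (op_B L T0 \<Phi> d k)) = (if k = 0 then norm (r *\<^sub>R cls v - hat bop w) else norm (r *\<^sub>R cls v + hat bop w))"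
    by (simp only: norm_minus_cancel split: if_split) simp
  have T: "norm (X - Y) \<le> norm X + norm Y" "norm (X + Y) \<le> norm X + norm Y"
      "norm X \<le> norm (X - Y) + norm Y" "norm X \<le> norm (X + Y) + norm Y" for X Y :: l2
    using norm_triangle_ineq4[of X Y] norm_triangle_ineq[of X Y] norm_triangle_ineq[of "X - Y" Y]
      norm_triangle_ineq4[of "X + Y" Y] by simp_all
  note T' = T[of "r *\<^sub>R cls v" "hat bop w", unfolded rv]
  show "norm (cls (op_B L T0 \<Phi> d k)) \<le> r * norm (cls v) + B * norm w"
    using T'(1,2) bw unfolding N by (split if_split, intro conjI impI; linarith)
  show "r * norm (cls v) \<le> norm (cls (op_B L T0 \<Phi> d k)) + B * norm w"
    using T'(3,4) bw unfolding N by (split if_split, intro conjI impI; linarith)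
qed

lemma weak_deriv_of_deviation:
  assumes c0: "c0 > 0" and d: "in_H1 L (d k)"
  obtains v where "in_L2 L v" "is_weak_deriv L (seq_diff d (D_inf T0 \<Phi> c0) k) v"
proof -
  obtain u where u: "is_weak_deriv L (d k) u" "in_L2 L u" using d by (auto simp: in_H1_def)
  have "is_weak_deriv L (\<lambda>x. d k x + (- 1) * D_inf T0 \<Phi> c0 k x)
      (\<lambda>x. u x + (- 1) * ((if k = 0 then sqrt c0 else 0) * (b x * m x / r)))"
    by (rule is_weak_deriv_add[OF u(1) equilibrium(3)[OF c0]])
  moreover have "in_L2 L (\<lambda>x. u x + (- 1) * ((if k = 0 then sqrt c0 else 0) * (b x * m x / r)))"
    by (intro in_L2_add in_L2_cmult u pl2_in_L2[OF bm_pl2])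
  ultimately show ?thesis by (intro that) (auto simp: seq_diff_def)
qed

end

text \<open>A solution together with the condition on the total mass that fixes \<open>c0\<close>.\<close>

locale hermite_data = hermite_torus L r b m K B T0 \<Phi> for L r b m K B T0 \<Phi> +
  fixes D :: "real \<Rightarrow> nat \<Rightarrow> real \<Rightarrow> real" and \<epsilon> \<tau> \<tau>0 c0 :: real
  assumes sol: "hermite_solution L T0 \<Phi> \<epsilon> \<tau> D" and pos: "\<epsilon> > 0" "\<tau> > 0" "\<tau>0 > 0" "c0 > 0"
    and tau_ratio: "\<tau> / \<epsilon> \<le> \<tau>0"
    and mass: "(LINT x|torus L. rho_inf T0 \<Phi> c0 x) = (LINT x|torus L. D 0 0 x * sqrt (rho_inf T0 \<Phi> c0 x))"
begin

abbreviation Deq where "Deq \<equiv> D_inf T0 \<Phi> c0"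

definition U :: "real \<Rightarrow> nat \<Rightarrow> l2" where "U t k = cls (seq_diff (D t) Deq k)"

lemma D_L2: "0 \<le> t \<Longrightarrow> seq_L2 L (D t)" using sol by (simp add: hermite_solution_def)

lemma D_in_L2: "0 \<le> t \<Longrightarrow> in_L2 L (D t k)" using D_L2 by (simp add: seq_L2_def)

lemma Deq_L2: "seq_L2 L Deq"
  unfolding seq_L2_cls using equilibrium[OF pos(4)] 
  by (auto intro!: summable_finite[of "{0}"] split: if_splits)

lemma deviation_L2: "0 \<le> t \<Longrightarrow> seq_L2 L (seq_diff (D t) Deq)"
  by (rule seq_L2_diff[OF D_L2 Deq_L2])

lemma U_eq: "0 \<le> t \<Longrightarrow> U t k = cls (D t k) - cls (Deq k)"
  unfolding U_def seq_diff_def by (rule cls_diff[OF D_in_L2 equilibrium(1)[OF pos(4)]])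

text \<open>The equilibrium drops out of the equation: it enters only that of mode \<open>1\<close>, paired with an element
of the range of \<open>\<A>\<^sup>*\<close>.\<close>

lemma weak_equation:
  assumes t: "0 \<le> t" and p: "prim \<phi> \<phi>'" and \<phi>': "pl2 \<phi>'"
  shows "((\<lambda>s. inner (U s k) (cls \<phi>)) has_real_derivative
      (1 / \<epsilon> * (sqrt (real k) * inner (U t (k - 1)) (r *\<^sub>R cls \<phi>' + hat bop (cls \<phi>))
              + sqrt (real (k + 1)) * inner (U t (k + 1)) (r *\<^sub>R cls \<phi>' - hat bop (cls \<phi>)))
        - real k / \<tau> * inner (U t k) (cls \<phi>))) (at t within {0..})"
proof -
  note P = pairings[OF p \<phi>' D_in_L2[OF t]]
  have \<phi>: "in_L2 L \<phi>" by (rule pl2_in_L2[OF prim_pl2[OF p]])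
  have Dt: "((\<lambda>s. L2_inner L (D s k) \<phi>) has_real_derivative
      (- (1 / \<epsilon>) * (sqrt (real k) * - inner (cls (D t (k - 1))) (r *\<^sub>R cls \<phi>' + hat bop (cls \<phi>))
             - sqrt (real (k + 1)) * inner (cls (D t (k + 1))) (r *\<^sub>R cls \<phi>' - hat bop (cls \<phi>)))
            - real k / \<tau> * inner (cls (D t k)) (cls \<phi>))) (at t within {0..})"
    using sol t P(1) unfolding hermite_solution_def P(2,3)[symmetric] inner_cls[OF D_in_L2[OF t] \<phi>] by blast
  have eqk: "cls (D t j) = U t j + cls (Deq j)" for j using U_eq[OF t] by simp
  have z1: "sqrt (real k) * inner (cls (Deq (k - 1))) (r *\<^sub>R cls \<phi>' + hat bop (cls \<phi>)) = 0"
    by (cases "k = 0 \<or> k = 1") (auto simp: equilibrium(2)[OF pos(4)] kernel_pairing[OF p \<phi>'])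
  have z2: "cls (Deq (k + 1)) = 0" "real k * inner (cls (Deq k)) (cls \<phi>) = 0"
    by (auto simp: equilibrium(2)[OF pos(4)])
  have val: "- (1 / \<epsilon>) * (sqrt (real k) * - inner (cls (D t (k - 1))) (r *\<^sub>R cls \<phi>' + hat bop (cls \<phi>))
             - sqrt (real (k + 1)) * inner (cls (D t (k + 1))) (r *\<^sub>R cls \<phi>' - hat bop (cls \<phi>)))
            - real k / \<tau> * inner (cls (D t k)) (cls \<phi>)
      = 1 / \<epsilon> * (sqrt (real k) * inner (U t (k - 1)) (r *\<^sub>R cls \<phi>' + hat bop (cls \<phi>))
              + sqrt (real (k + 1)) * inner (U t (k + 1)) (r *\<^sub>R cls \<phi>' - hat bop (cls \<phi>)))
        - real k / \<tau> * inner (U t k) (cls \<phi>)"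
  proof -
    define X Y where "X = r *\<^sub>R cls \<phi>' + hat bop (cls \<phi>)" and "Y = r *\<^sub>R cls \<phi>' - hat bop (cls \<phi>)"
    have 1: "sqrt (real k) * inner (cls (D t (k - 1))) X = sqrt (real k) * inner (U t (k - 1)) X"
      using z1 unfolding eqk X_def[symmetric] by (simp add: inner_add_left distrib_left)
    have 2: "cls (D t (k + 1)) = U t (k + 1)" unfolding eqk z2(1) by simp
    have 3: "real k / \<tau> * inner (cls (D t k)) (cls \<phi>) = real k / \<tau> * inner (U t k) (cls \<phi>)"
      using z2(2) unfolding eqk by (simp add: inner_add_left distrib_left)
    show ?thesis unfolding X_def[symmetric] Y_def[symmetric] 3 2 mult_minus_right 1 by (simp add: algebra_simps)
  qed
  have "((\<lambda>s. L2_inner L (D s k) \<phi> - inner (cls (Deq k)) (cls \<phi>)) has_real_derivative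
      (1 / \<epsilon> * (sqrt (real k) * inner (U t (k - 1)) (r *\<^sub>R cls \<phi>' + hat bop (cls \<phi>))
              + sqrt (real (k + 1)) * inner (U t (k + 1)) (r *\<^sub>R cls \<phi>' - hat bop (cls \<phi>)))
        - real k / \<tau> * inner (U t k) (cls \<phi>)) - 0) (at t within {0..})"
    by (rule DERIV_diff[OF Dt[unfolded val] DERIV_const])
  hence "((\<lambda>s. L2_inner L (D s k) \<phi> - inner (cls (Deq k)) (cls \<phi>)) has_real_derivative
      (1 / \<epsilon> * (sqrt (real k) * inner (U t (k - 1)) (r *\<^sub>R cls \<phi>' + hat bop (cls \<phi>))
              + sqrt (real (k + 1)) * inner (U t (k + 1)) (r *\<^sub>R cls \<phi>' - hat bop (cls \<phi>)))
        - real k / \<tau> * inner (U t k) (cls \<phi>))) (at t within {0..})"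
    unfolding diff_zero .
  thus ?thesis
  proof (rule has_field_derivative_transform_within[OF _ zero_less_one])
    show "t \<in> {0..}" using t by simp
    fix s :: real assume "s \<in> {0..}"
    thus "L2_inner L (D s k) \<phi> - inner (cls (Deq k)) (cls \<phi>) = inner (U s k) (cls \<phi>)"
      using inner_cls[OF D_in_L2[of s k] \<phi>] by (simp add: U_eq inner_diff_left)
  qed
qed

text \<open>The equation of mode \<open>0\<close> tested against \<open>m\<close> has right-hand side zero, because \<open>\<A> m = 0\<close>; the
choice of \<open>c0\<close> makes the initial value zero.\<close>

lemma mass_conserved: "0 \<le> t \<Longrightarrow> inner (U t 0) (cls m) = 0"
proof -
  assume t: "0 \<le> t"
  have "((\<lambda>s. inner (U s 0) (cls m)) has_real_derivative 0) (at s within {0..})" if "s \<in> {0..}" for s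
    using weak_equation[OF _ prim_m bm_pl2, of s 0] that by (simp add: kernel_deriv)
  then obtain q where q: "\<And>s. s \<in> {0..} \<Longrightarrow> inner (U s 0) (cls m) = q"
    using has_field_derivative_zero_constant[OF convex_real_interval(1)] by metis
  have "(norm (cls (Deq 0)))\<^sup>2 = L2_inner L (D 0 0) (Deq 0)"
    using mass equilibrium_mass[OF pos(4)] by (simp add: L2_inner_def D_inf_def)
  also have "\<dots> = inner (cls (D 0 0)) (cls (Deq 0))"
    by (rule inner_cls[symmetric, OF D_in_L2 equilibrium(1)[OF pos(4)]]) simp
  finally have "inner (U 0 0) (cls (Deq 0)) = 0"
    by (simp add: U_eq inner_diff_left power2_norm_eq_inner)
  hence "inner (U 0 0) (cls m) = 0" using pos(4) by (simp add: equilibrium(2)[OF pos(4)])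
  thus "inner (U t 0) (cls m) = 0" using q[of t] q[of 0] t by simp
qed

sublocale flow: coercive_flow "\<lambda>h. hat (R h)" "\<lambda>h. hat (dl h)" "hat bop" r K B 1 U \<epsilon> \<tau>
    "hat S" "hat S1" "hat S'" "hat S1'" "cls m" "cls (\<lambda>x. mi x / L)" calc_bound \<tau>0
proof (intro coercive_flow.intro hermite_flow.intro hermite_flow_axioms.intro coercive_flow_axioms.intro)
  show "regularised_calculus (\<lambda>h. hat (R h)) (\<lambda>h. hat (dl h)) (hat bop) r K B 1" by (rule calc.regularised_calculus_axioms)
  show "coercive_calculus (\<lambda>h. hat (R h)) (\<lambda>h. hat (dl h)) (hat bop) r K B 1
     (hat S) (hat S1) (hat S') (hat S1') (cls m) (cls (\<lambda>x. mi x / L)) calc_bound" by (rule calc.coercive_calculus_axioms)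
  show "0 < \<epsilon>" "0 < \<tau>" "0 < \<tau>0" "\<tau> / \<epsilon> \<le> \<tau>0" using pos tau_ratio by auto
  fix t :: real assume t: "0 \<le> t"
  show "inner (U t 0) (cls m) = 0" by (rule mass_conserved[OF t])
  show "summable (\<lambda>k. (norm (U t k))\<^sup>2)" using deviation_L2[OF t] by (simp add: seq_L2_cls U_def)
  show "((\<lambda>s. \<Sum>k. (norm (U s k - U t k))\<^sup>2) \<longlongrightarrow> 0) (at t within {0..})"
  proof -
    have "((\<lambda>s. (seq_norm L (seq_diff (D s) (D t)))\<^sup>2) \<longlongrightarrow> 0\<^sup>2) (at t within {0..})"
      using sol t by (intro tendsto_power) (simp add: hermite_solution_def)
    moreover have "\<forall>\<^sub>F s in at t within {0..}. (seq_norm L (seq_diff (D s) (D t)))\<^sup>2 = (\<Sum>k. (norm (U s k - U t k))\<^sup>2)"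
      unfolding eventually_at_filter
    proof (intro always_eventually allI impI)
      fix s :: real assume s: "s \<in> {0..}"
      have d: "seq_L2 L (seq_diff (D s) (D t))" using seq_L2_diff D_L2 s t by auto
      have "cls (seq_diff (D s) (D t) k) = U s k - U t k" for k
        using s t by (simp add: U_eq seq_diff_def cls_diff D_in_L2)
      thus "(seq_norm L (seq_diff (D s) (D t)))\<^sup>2 = (\<Sum>k. (norm (U s k - U t k))\<^sup>2)"
        using d by (simp add: seq_norm_cls seq_L2_cls suminf_nonneg)
    qed
    ultimately show ?thesis using Lim_transform_eventually by fastforce
  qed
  show "((\<lambda>h. hat (R h) (U t k)) \<longlongrightarrow> U t k) (at_right 0)" for k
    unfolding U_def by (rule hat_R_tendsto) (use deviation_L2[OF t] in \<open>simp add: seq_L2_def\<close>)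
  fix h :: real and k w assume h: "0 < h"
  show "((\<lambda>s. inner (U s k) (hat (R h) w)) has_real_derivative
      1 / \<epsilon> * (sqrt (real k) * inner (U t (k - 1)) (r *\<^sub>R hat (dl h) w + hat bop (hat (R h) w))
              + sqrt (real (k + 1)) * inner (U t (k + 1)) (r *\<^sub>R hat (dl h) w - hat bop (hat (R h) w)))
        - real k / \<tau> * inner (U t k) (hat (R h) w)) (at t within {0..})"
    using weak_equation[OF t prim_R[OF pl2_ploc[OF rp_pl2] h] dl_pl2[OF rp_pl2]]
    unfolding hat_def[of "R h"] hat_def[of "dl h"] .
qed

end

section \<open>The decay estimates\<close>

context hermite_torus begin

text \<open>The first summand comes from the rate, the other two from the prefactor of the gradient estimate.\<close>

definition rate_const :: real where "rate_const = 6 / calc.gap + 2 * B + r * sqrt calc.C4"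

lemma rate_const_bounds: "0 < rate_const" "6 / calc.gap \<le> rate_const" "2 * B + r * sqrt calc.C4 \<le> rate_const"
proof -
  have "0 < 6 / calc.gap" "0 \<le> r * sqrt calc.C4" using calc.gap_pos(1) r_pos calc.C4_nonneg by auto
  thus "0 < rate_const" "6 / calc.gap \<le> rate_const" "2 * B + r * sqrt calc.C4 \<le> rate_const"
    unfolding rate_const_def using B(1) by linarith+
qed

end

context hermite_data begin

text \<open>Norms decay at the rate \<open>\<mu> / 2\<close> in the first estimate and \<open>\<mu> / 4\<close> in the second, half of the rates of
their squares; the smaller one determines the constant.\<close>

lemma rate_bound:
  assumes t: "0 \<le> t" and a: "1 / 4 \<le> a"
  shows "exp (- (a * flow.\<mu>) * t) \<le> exp (- (\<tau> / \<epsilon>\<^sup>2) * (1 / (rate_const * (\<tau>0\<^sup>2 + 1))) * t)"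
proof -
  have p: "0 < \<tau>0\<^sup>2 + 1" by (simp add: add_nonneg_pos)
  have q: "0 \<le> \<tau> / \<epsilon>\<^sup>2 / (\<tau>0\<^sup>2 + 1)" using pos p by simp
  have "6 \<le> rate_const * calc.gap" using rate_const_bounds(2) calc.gap_pos(1) by (simp add: pos_divide_le_eq)
  hence i: "1 / rate_const \<le> calc.gap / 6" using rate_const_bounds(1) by (simp add: divide_simps mult.commute)
  have "(\<tau> / \<epsilon>\<^sup>2) * (1 / (rate_const * (\<tau>0\<^sup>2 + 1))) = \<tau> / \<epsilon>\<^sup>2 / (\<tau>0\<^sup>2 + 1) * (1 / rate_const)"
    by simp
  also have "\<dots> \<le> \<tau> / \<epsilon>\<^sup>2 / (\<tau>0\<^sup>2 + 1) * (calc.gap / 6)" using i q by (rule mult_left_mono)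
  also have "\<dots> = 1 / 4 * flow.\<mu>"
    using pos by (simp add: flow.\<mu>_def flow.wt_def power2_eq_square add.commute)
  also have "\<dots> \<le> a * flow.\<mu>"
    by (rule mult_right_mono[OF a]) (use flow.wt_bounds(1) pos in \<open>simp add: flow.\<mu>_def\<close>)
  finally have "(\<tau> / \<epsilon>\<^sup>2) * (1 / (rate_const * (\<tau>0\<^sup>2 + 1))) * t \<le> a * flow.\<mu> * t" using t by (rule mult_right_mono)
  thus ?thesis by simp
qed

lemma deviation_norm: "0 \<le> t \<Longrightarrow> seq_norm L (seq_diff (D t) Deq) = sqrt (flow.mass2 t)"
  using seq_norm_cls[OF deviation_L2] by (simp add: flow.mass2_def U_def)

lemma sqrt_exp: "sqrt (exp (x :: real)) = exp (x / 2)"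
  by (rule real_sqrt_unique) (simp_all add: exp_double[symmetric])

lemma deviation_decay:
  assumes t: "0 \<le> t"
  shows "sqrt (flow.mass2 t) \<le> sqrt 3 * sqrt (flow.mass2 0) * exp (- (1 / 2 * flow.\<mu>) * t)"
proof -
  have "sqrt (flow.mass2 t) \<le> sqrt (3 * flow.mass2 0 * exp (- flow.\<mu> * t))"
    by (rule real_sqrt_le_mono[OF flow.mass2_decay[OF t]])
  thus ?thesis by (simp add: real_sqrt_mult sqrt_exp)
qed

theorem L2_decay:
  assumes t: "0 \<le> t"
  shows "seq_norm L (seq_diff (D t) Deq) \<le> sqrt 3 * seq_norm L (seq_diff (D 0) Deq)
     * exp (- (\<tau> / \<epsilon>\<^sup>2) * (1 / (rate_const * (\<tau>0\<^sup>2 + 1))) * t)"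
proof -
  have "sqrt (flow.mass2 t) \<le> sqrt 3 * sqrt (flow.mass2 0) * exp (- (1 / 2 * flow.\<mu>) * t)"
    by (rule deviation_decay[OF t])
  also have "\<dots> \<le> sqrt 3 * sqrt (flow.mass2 0) * exp (- (\<tau> / \<epsilon>\<^sup>2) * (1 / (rate_const * (\<tau>0\<^sup>2 + 1))) * t)"
    by (rule mult_left_mono[OF rate_bound[OF t]]) (use flow.mass2_nonneg[of 0] in auto)
  finally show ?thesis using t by (simp add: deviation_norm)
qed

text \<open>The difference quotients of \<open>R\<^sub>h U\<^sub>k (t)\<close> are bounded uniformly in \<open>h\<close>, which gives the weak derivatives
\<open>v k\<close>. The quotients converge to the classes of these, so the sharp bound passes to the limit.\<close>

lemma propagation_of_derivatives:
  assumes t: "0 \<le> t"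
    and v0: "\<And>k. in_L2 L (v0 k)" "\<And>k. is_weak_deriv L (seq_diff (D 0) Deq k) (v0 k)"
    and s0: "summable (\<lambda>k. (norm (cls (v0 k)))\<^sup>2)"
  obtains v where "\<And>k. in_L2 L (v k)" "\<And>k. is_weak_deriv L (seq_diff (D t) Deq k) (v k)"
    "summable (\<lambda>k. (norm (cls (v k)))\<^sup>2)"
    "(\<Sum>k. (norm (cls (v k)))\<^sup>2) \<le> exp (- (flow.\<mu> / 2) * t)
       * (3 * (\<Sum>k. (norm (cls (v0 k)))\<^sup>2) + calc.C4 * (1 + \<tau>0\<^sup>2) * flow.mass2 0)"
proof -
  define Z0 where "Z0 = (\<Sum>k. (norm (cls (v0 k)))\<^sup>2)"
  define X where "X = exp (- (flow.\<mu> / 2) * t) * (3 * Z0 + calc.C4 * (1 + \<tau>0\<^sup>2) * flow.mass2 0)"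
  have L2: "in_L2 L (seq_diff (D s) Deq k)" if "0 \<le> s" for s k
    using deviation_L2[OF that] by (simp add: seq_L2_def)
  have Rn: "norm (hat (R h) x) \<le> norm x" if "0 < h" for h x using hat_norm[OF l2op_R[OF that]] by simp
  have init: "(\<Sum>k<n. (norm (hat (dl h) (hat (R h) (U 0 k))))\<^sup>2) \<le> Z0" if h: "0 < h" for h n
  proof -
    have "norm (hat (dl h) (hat (R h) (U 0 k))) \<le> norm (cls (v0 k))" for k
      unfolding U_def regularised_derivative[OF L2[OF order_refl] v0 h]
      using Rn[OF h] order_trans by blast
    hence "(\<Sum>k<n. (norm (hat (dl h) (hat (R h) (U 0 k))))\<^sup>2) \<le> (\<Sum>k<n. (norm (cls (v0 k)))\<^sup>2)"
      by (intro sum_mono power_mono) auto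
    also have "\<dots> \<le> Z0" unfolding Z0_def by (rule sum_le_suminf[OF s0]) auto
    finally show ?thesis .
  qed
  have quot: "\<forall>\<^sub>F h in at_right 0. (\<Sum>k<n. (norm (hat (dl h) (hat (R h) (U t k))))\<^sup>2) \<le> X + \<eta>" if "0 < \<eta>" for n \<eta>
    unfolding X_def by (rule flow.gradient_bound[OF t that init])
  have "\<exists>v. pl2 v \<and> is_weak_deriv L (seq_diff (D t) Deq k) v" for k
  proof (rule H1_of_bounded_difference_quotients[OF L2[OF t]])
    show "\<forall>\<^sub>F h in at_right 0. norm (hat (dl h) (hat (R h) (cls (seq_diff (D t) Deq k)))) \<le> sqrt (X + 1)"
      using quot[OF zero_less_one, of "Suc k"]
    proof eventually_elim
      case (elim h)
      have "(norm (hat (dl h) (hat (R h) (U t k))))\<^sup>2 \<le> (\<Sum>k<Suc k. (norm (hat (dl h) (hat (R h) (U t k))))\<^sup>2)"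
        by (rule member_le_sum) auto
      thus ?case using elim unfolding U_def by (intro real_le_rsqrt) linarith
    qed
  qed
  then obtain v where v: "\<And>k. pl2 (v k)" "\<And>k. is_weak_deriv L (seq_diff (D t) Deq k) (v k)" by metis
  have vL: "in_L2 L (v k)" for k by (rule pl2_in_L2[OF v(1)])
  have part: "(\<Sum>k<n. (norm (cls (v k)))\<^sup>2) \<le> X" for n
  proof (rule field_le_epsilon)
    fix \<eta> :: real assume \<eta>: "0 < \<eta>"
    have lim: "((\<lambda>h. \<Sum>k<n. (norm (hat (R h) (hat (R h) (cls (v k)))))\<^sup>2) \<longlongrightarrow> (\<Sum>k<n. (norm (cls (v k)))\<^sup>2)) (at_right 0)"
      by (intro tendsto_sum tendsto_power tendsto_norm hat_RR_tendsto vL)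
    have "\<forall>\<^sub>F h in at_right 0. (\<Sum>k<n. (norm (hat (R h) (hat (R h) (cls (v k)))))\<^sup>2) \<le> X + \<eta>"
      using quot[OF \<eta>, of n] eventually_at_right_less[of 0]
    proof eventually_elim
      case (elim h)
      thus ?case unfolding U_def by (simp add: regularised_derivative[OF L2[OF t] vL v(2)])
    qed
    thus "(\<Sum>k<n. (norm (cls (v k)))\<^sup>2) \<le> X + \<eta>"
      by (rule tendsto_upperbound[OF lim]) simp
  qed
  have s: "summable (\<lambda>k. (norm (cls (v k)))\<^sup>2)" by (rule summableI_nonneg_bounded[OF _ part]) simp
  have "(\<Sum>k. (norm (cls (v k)))\<^sup>2) \<le> X" by (rule suminf_le_const[OF s part])
  with that[OF vL v(2) s] show thesis by (simp add: X_def Z0_def)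
qed

text \<open>The derivatives of the deviation and \<open>\<B> D\<close> control each other up to \<open>B\<close> times the norm of the
deviation, at time \<open>0\<close> in one direction and at time \<open>t\<close> in the other.\<close>

theorem H1_decay:
  assumes t: "0 \<le> t" and BD: "seq_B_L2 L T0 \<Phi> (D 0)"
  shows "seq_B_L2 L T0 \<Phi> (D t)"
    and "seq_norm L (op_B L T0 \<Phi> (D t)) \<le> sqrt 3 * (rate_const * (\<tau>0 + 1) * seq_norm L (seq_diff (D 0) Deq)
         + seq_norm L (op_B L T0 \<Phi> (D 0))) * exp (- (\<tau> / \<epsilon>\<^sup>2) * (1 / (rate_const * (\<tau>0\<^sup>2 + 1))) * t)"
proof -
  have "\<exists>v. in_L2 L v \<and> is_weak_deriv L (seq_diff (D 0) Deq k) v" for k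
    using weak_deriv_of_deviation[OF pos(4), where d = "D 0" and k = k] BD unfolding seq_B_L2_def by metis
  then obtain v0 where v0: "\<And>k. in_L2 L (v0 k)" "\<And>k. is_weak_deriv L (seq_diff (D 0) Deq k) (v0 k)" by metis
  have BU: "summable (\<lambda>k. (B * norm (U s k))\<^sup>2)" "sqrt (\<Sum>k. (B * norm (U s k))\<^sup>2) = B * sqrt (flow.mass2 s)" if "0 \<le> s" for s
    using flow.U_summable[OF that] B(1)
    by (simp_all add: power_mult_distrib summable_mult flow.mass2_def suminf_mult real_sqrt_mult)
  have rv: "sqrt (\<Sum>k. (r * norm (cls (v k)))\<^sup>2) = r * sqrt (\<Sum>k. (norm (cls (v k)))\<^sup>2)"
    "summable (\<lambda>k. (r * norm (cls (v k)))\<^sup>2)"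
    if "summable (\<lambda>k. (norm (cls (v k)))\<^sup>2)" for v :: "nat \<Rightarrow> real \<Rightarrow> real"
    using that r_pos by (simp_all add: power_mult_distrib summable_mult suminf_mult real_sqrt_mult)
  have SB: "seq_L2 L (op_B L T0 \<Phi> (D 0))" using BD by (simp add: seq_B_L2_def)
  define N where "N = seq_norm L (op_B L T0 \<Phi> (D 0))"
  define M where "M = sqrt (flow.mass2 0)"
  have M0: "0 \<le> M" unfolding M_def using flow.mass2_nonneg[of 0] by simp
  note comp0 = op_B_component[OF pos(4) D_in_L2[OF order_refl] v0, folded U_def]
  have "summable (\<lambda>k. (norm (cls (op_B L T0 \<Phi> (D 0) k)))\<^sup>2)" using SB by (simp add: seq_L2_cls)
  note mink0 = Minkowski_sequences[OF _ _ _ comp0(4) this BU(1)[OF order_refl]]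
  have sv: "summable (\<lambda>k. (r * norm (cls (v0 k)))\<^sup>2)" by (rule mink0(1)) (use r_pos B(1) in auto)
  have s0: "summable (\<lambda>k. (norm (cls (v0 k)))\<^sup>2)"
    using summable_mult[OF sv, of "1 / r\<^sup>2"] r_pos by (simp add: power_mult_distrib)
  define Z where "Z = sqrt (\<Sum>k. (norm (cls (v0 k)))\<^sup>2)"
  have "sqrt (\<Sum>k. (r * norm (cls (v0 k)))\<^sup>2) \<le> N + B * M"
    unfolding N_def seq_norm_cls[OF SB] M_def BU(2)[OF order_refl, symmetric]
    by (rule mink0(2)) (use r_pos B(1) in auto)
  hence rZ: "r * Z \<le> N + B * M" unfolding rv(1)[OF s0] Z_def .
  obtain v where v: "\<And>k. in_L2 L (v k)" "\<And>k. is_weak_deriv L (seq_diff (D t) Deq k) (v k)"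
      "summable (\<lambda>k. (norm (cls (v k)))\<^sup>2)"
      "(\<Sum>k. (norm (cls (v k)))\<^sup>2) \<le> exp (- (flow.\<mu> / 2) * t)
         * (3 * (\<Sum>k. (norm (cls (v0 k)))\<^sup>2) + calc.C4 * (1 + \<tau>0\<^sup>2) * flow.mass2 0)"
    using propagation_of_derivatives[OF t v0 s0] by blast
  note comp = op_B_component[OF pos(4) D_in_L2[OF t] v(1,2), folded U_def]
  note mink = Minkowski_sequences[OF _ _ _ comp(3) rv(2)[OF v(3)] BU(1)[OF t]]
  have SBt: "seq_L2 L (op_B L T0 \<Phi> (D t))"
    unfolding seq_L2_cls using comp(2) mink(1) r_pos B(1) by auto
  thus "seq_B_L2 L T0 \<Phi> (D t)" unfolding seq_B_L2_def using comp(1) by blast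
  \<comment> \<open>The first-order terms decay at the rate \<open>\<mu> / 4\<close>; those without derivatives decay faster.\<close>
  define E where "E = exp (- (1 / 4 * flow.\<mu>) * t)"
  have mu: "0 \<le> flow.\<mu>" using flow.wt_bounds(1) pos by (simp add: flow.\<mu>_def)
  have E2: "exp (- (1 / 2 * flow.\<mu>) * t) \<le> E" unfolding E_def using mu t by (simp add: mult_right_mono)
  have "sqrt (\<Sum>k. (norm (cls (v k)))\<^sup>2) \<le> E * (sqrt 3 * Z + sqrt calc.C4 * (\<tau>0 + 1) * M)"
  proof -
    have "sqrt (\<Sum>k. (norm (cls (v k)))\<^sup>2) \<le> sqrt (exp (- (flow.\<mu> / 2) * t)
         * (3 * (\<Sum>k. (norm (cls (v0 k)))\<^sup>2) + calc.C4 * (1 + \<tau>0\<^sup>2) * flow.mass2 0))"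
      by (rule real_sqrt_le_mono[OF v(4)])
    also have "\<dots> = E * sqrt (3 * (\<Sum>k. (norm (cls (v0 k)))\<^sup>2) + calc.C4 * (1 + \<tau>0\<^sup>2) * flow.mass2 0)"
      by (simp add: real_sqrt_mult sqrt_exp E_def)
    also have "\<dots> \<le> E * (sqrt (3 * (\<Sum>k. (norm (cls (v0 k)))\<^sup>2)) + sqrt (calc.C4 * (1 + \<tau>0\<^sup>2) * flow.mass2 0))"
      by (intro mult_left_mono sqrt_add_le_add_sqrt)
        (use suminf_nonneg[OF s0] calc.C4_nonneg flow.mass2_nonneg[of 0] in \<open>auto simp: E_def add_nonneg_nonneg\<close>)
    also have "\<dots> = E * (sqrt 3 * Z + sqrt calc.C4 * sqrt (1 + \<tau>0\<^sup>2) * M)"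
      by (simp add: real_sqrt_mult Z_def M_def)
    also have "\<dots> \<le> E * (sqrt 3 * Z + sqrt calc.C4 * (\<tau>0 + 1) * M)"
    proof (intro mult_left_mono add_left_mono mult_right_mono M0)
      show "sqrt (1 + \<tau>0\<^sup>2) \<le> \<tau>0 + 1" using pos by (intro real_le_lsqrt) (auto simp: power2_sum)
    qed (auto simp: E_def calc.C4_nonneg)
    finally show ?thesis .
  qed
  hence v_bound: "r * sqrt (\<Sum>k. (norm (cls (v k)))\<^sup>2) \<le> E * (sqrt 3 * (r * Z) + r * sqrt calc.C4 * (\<tau>0 + 1) * M)"
    using r_pos mult_left_mono[of _ _ r] by (fastforce simp: algebra_simps)
  have "seq_norm L (op_B L T0 \<Phi> (D t)) \<le> r * sqrt (\<Sum>k. (norm (cls (v k)))\<^sup>2) + B * sqrt (flow.mass2 t)"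
    unfolding seq_norm_cls[OF SBt] BU(2)[OF t, symmetric] rv(1)[OF v(3), symmetric]
    by (rule mink(2)) (use r_pos B(1) in auto)
  also have "\<dots> \<le> E * (sqrt 3 * (r * Z) + r * sqrt calc.C4 * (\<tau>0 + 1) * M) + B * (sqrt 3 * M * E)"
  proof (intro add_mono v_bound mult_left_mono B(1))
    have "sqrt (flow.mass2 t) \<le> sqrt 3 * M * exp (- (1 / 2 * flow.\<mu>) * t)"
      unfolding M_def by (rule deviation_decay[OF t])
    also have "\<dots> \<le> sqrt 3 * M * E" using E2 M0 by (intro mult_left_mono) auto
    finally show "sqrt (flow.mass2 t) \<le> sqrt 3 * M * E" .
  qed
  also have "\<dots> = E * (sqrt 3 * (r * Z) + r * sqrt calc.C4 * (\<tau>0 + 1) * M + sqrt 3 * (B * M))"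
    by (simp add: algebra_simps)
  also have "\<dots> \<le> E * (sqrt 3 * (rate_const * (\<tau>0 + 1) * M + N))"
  proof (rule mult_left_mono)
    have "0 \<le> r * sqrt calc.C4 * (\<tau>0 + 1) * M"
      using r_pos calc.C4_nonneg pos M0 by (intro mult_nonneg_nonneg) auto
    hence "1 * (r * sqrt calc.C4 * (\<tau>0 + 1) * M) \<le> sqrt 3 * (r * sqrt calc.C4 * (\<tau>0 + 1) * M)"
      by (intro mult_right_mono) auto
    hence "r * sqrt calc.C4 * (\<tau>0 + 1) * M \<le> sqrt 3 * (r * sqrt calc.C4 * (\<tau>0 + 1) * M)" by simp
    moreover have "sqrt 3 * (r * Z) \<le> sqrt 3 * (N + B * M)" using rZ by simp
    ultimately have "sqrt 3 * (r * Z) + r * sqrt calc.C4 * (\<tau>0 + 1) * M + sqrt 3 * (B * M)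
        \<le> sqrt 3 * (2 * B * M + r * sqrt calc.C4 * (\<tau>0 + 1) * M + N)" by (simp add: algebra_simps)
    also have "\<dots> \<le> sqrt 3 * (rate_const * (\<tau>0 + 1) * M + N)"
    proof -
      have "2 * B * M * 1 \<le> 2 * B * M * (\<tau>0 + 1)" using B(1) M0 pos by (intro mult_left_mono) auto
      hence "2 * B * M + r * sqrt calc.C4 * (\<tau>0 + 1) * M \<le> (2 * B + r * sqrt calc.C4) * ((\<tau>0 + 1) * M)"
        by (simp add: algebra_simps)
      also have "\<dots> \<le> rate_const * ((\<tau>0 + 1) * M)"
        using M0 pos by (intro mult_right_mono rate_const_bounds(3)) auto
      finally show ?thesis by (simp add: mult.assoc)
    qed
    finally show "sqrt 3 * (r * Z) + r * sqrt calc.C4 * (\<tau>0 + 1) * M + sqrt 3 * (B * M)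
        \<le> sqrt 3 * (rate_const * (\<tau>0 + 1) * M + N)" .
  qed (simp add: E_def)
  also have "\<dots> = sqrt 3 * (rate_const * (\<tau>0 + 1) * M + N) * E" by simp
  also have "\<dots> \<le> sqrt 3 * (rate_const * (\<tau>0 + 1) * M + N) * exp (- (\<tau> / \<epsilon>\<^sup>2) * (1 / (rate_const * (\<tau>0\<^sup>2 + 1))) * t)"
  proof (rule mult_left_mono)
    show "E \<le> exp (- (\<tau> / \<epsilon>\<^sup>2) * (1 / (rate_const * (\<tau>0\<^sup>2 + 1))) * t)"
      unfolding E_def by (rule rate_bound[OF t order_refl])
    have "0 \<le> N" unfolding N_def seq_norm_cls[OF SB] using SB by (simp add: seq_L2_cls suminf_nonneg)
    thus "0 \<le> sqrt 3 * (rate_const * (\<tau>0 + 1) * M + N)" using rate_const_bounds(1) pos M0 by simp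
  qed
  finally show "seq_norm L (op_B L T0 \<Phi> (D t)) \<le> sqrt 3 * (rate_const * (\<tau>0 + 1) * seq_norm L (seq_diff (D 0) Deq)
         + seq_norm L (op_B L T0 \<Phi> (D 0))) * exp (- (\<tau> / \<epsilon>\<^sup>2) * (1 / (rate_const * (\<tau>0\<^sup>2 + 1))) * t)"
    unfolding M_def N_def by (simp add: deviation_norm)
qed

end

text \<open>\<open>b = - p / (2 * sqrt T0)\<close> and \<open>m = exp (- P / (2 * T0))\<close> for the regular representatives \<open>P\<close> and \<open>p\<close> of the
potential and of its derivative.\<close>

lemma (in circle) hermite_torus_exists:
  assumes T0: "T0 > 0" and \<Phi>: "in_W2inf L \<Phi>"
  obtains b m K B where "hermite_torus L (sqrt T0) b m K B T0 \<Phi>"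
proof -
  obtain P p K B where p: "prim P p" "AE x in torus L. \<Phi> x = P x" "AE x in torus L. field_E L \<Phi> x = - p x"
    "continuous_on UNIV p" "\<And>x. p (x + L) = p x" "\<And>x. (P has_real_derivative p x) (at x)"
    "K \<ge> 0" "\<And>x y. \<bar>p x - p y\<bar> \<le> K * \<bar>x - y\<bar>" "B \<ge> 0" "\<And>x. \<bar>p x\<bar> \<le> B"
    using potential_normal_form[OF \<Phi>] by blast
  define r where "r = sqrt T0"
  have r: "r > 0" "r\<^sup>2 = T0" using T0 by (auto simp: r_def)
  define b where "b x = - (1 / (2 * r)) * p x" for x
  define m where "m x = exp (- (1 / (2 * T0)) * P x)" for x
  obtain u1 where u1: "is_weak_deriv L \<Phi> u1" using \<Phi> by (auto simp: in_W2inf_def)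
  have "hermite_torus L r b m (1 / (2 * r) * K) (1 / (2 * r) * B) T0 \<Phi>"
  proof (intro hermite_torus.intro circle_field.intro circle_field_axioms.intro hermite_torus_axioms.intro)
    show "circle L" by (rule circle_axioms)
    show "0 < r" "0 < T0" "r = sqrt T0" "0 \<le> 1 / (2 * r) * K" "0 \<le> 1 / (2 * r) * B"
      using r T0 p by (auto simp: r_def)
    have s: "\<bar>- (1 / (2 * r)) * z\<bar> = 1 / (2 * r) * \<bar>z\<bar>" for z using r by (simp add: abs_mult)
    show "\<bar>b x - b y\<bar> \<le> 1 / (2 * r) * K * \<bar>x - y\<bar>" for x y
      unfolding b_def right_diff_distrib[symmetric] s mult.assoc
      using p(8)[of x y] r by (intro mult_left_mono) auto
    show "\<bar>b x\<bar> \<le> 1 / (2 * r) * B" for x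
      unfolding b_def s using p(10)[of x] r by (intro mult_left_mono) auto
    show "continuous_on UNIV b" unfolding b_def[abs_def] by (intro continuous_on_mult continuous_on_const p)
    show "b (x + L) = b x" for x by (simp add: b_def p)
    show "m x > 0" for x by (simp add: m_def)
    show "m (x + L) = m x" for x by (simp add: m_def prim_periodic[OF p(1)])
    show "(m has_real_derivative b x * m x / r) (at x)" for x
    proof -
      have "(m has_real_derivative exp (- (1 / (2 * T0)) * P x) * (- (1 / (2 * T0)) * p x)) (at x)"
        unfolding m_def[abs_def] by (intro DERIV_fun_exp DERIV_cmult p)
      moreover have "exp (- (1 / (2 * T0)) * P x) * (- (1 / (2 * T0)) * p x) = b x * m x / r"
        unfolding r(2)[symmetric] b_def m_def power2_eq_square using r by (simp add: mult_ac)
      ultimately show ?thesis by simp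
    qed
    show "\<Phi> \<in> borel_measurable (torus L)" using \<Phi> by (auto simp: in_W2inf_def in_Linf_def)
    have "weak_deriv L \<Phi> \<in> borel_measurable (torus L)"
      using weak_deriv_AE(2)[OF u1] by (auto simp: is_weak_deriv_iff)
    thus "field_E L \<Phi> \<in> borel_measurable (torus L)" unfolding field_E_def by simp
    show "AE x in torus L. field_E L \<Phi> x / (2 * sqrt T0) = b x"
      by (rule eventually_mono[OF p(3)]) (simp add: b_def r_def)
    show "AE x in torus L. exp (- \<Phi> x / T0) = (m x)\<^sup>2"
      by (rule eventually_mono[OF p(2)]) (simp add: m_def exp_double[symmetric])
  qed
  thus thesis unfolding r_def by (rule that)
qed

theorem theorem2p1:
  fixes L T0 :: real and \<Phi> :: "real \<Rightarrow> real"
  assumes "L > 0" and "T0 > 0" and "in_W2inf L \<Phi>"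
  shows "\<exists>C>0. \<forall>(\<tau> :: real \<Rightarrow> real) (\<tau>0 :: real) \<kappa>.
    (\<forall>\<epsilon>>0. \<tau> \<epsilon> > 0) \<and> \<tau>0 > 0 \<and>
    (SUP \<epsilon>\<in>{0<..}. ereal (\<tau> \<epsilon> / \<epsilon>)) \<le> ereal \<tau>0 \<and>
    \<kappa> = 1 / (C * (\<tau>0\<^sup>2 + 1)) \<longrightarrow>
    \<kappa> > 0 \<and>
    (\<forall>\<epsilon>>0. \<forall>(D :: real \<Rightarrow> nat \<Rightarrow> real \<Rightarrow> real) c0.
       hermite_solution L T0 \<Phi> \<epsilon> (\<tau> \<epsilon>) D \<and>
       c0 > 0 \<and>
       (LINT x|torus L. rho_inf T0 \<Phi> c0 x)
         = (LINT x|torus L. D 0 0 x * sqrt (rho_inf T0 \<Phi> c0 x)) \<longrightarrow>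
       (seq_L2 L (D 0) \<longrightarrow>
          (\<forall>t\<ge>0. seq_L2 L (seq_diff (D t) (D_inf T0 \<Phi> c0)) \<and>
             seq_norm L (seq_diff (D t) (D_inf T0 \<Phi> c0))
               \<le> sqrt 3 * seq_norm L (seq_diff (D 0) (D_inf T0 \<Phi> c0))
                 * exp (- (\<tau> \<epsilon> / \<epsilon>\<^sup>2) * \<kappa> * t))) \<and>
       (seq_B_L2 L T0 \<Phi> (D 0) \<and> seq_L2 L (D 0) \<longrightarrow>
          (\<forall>t\<ge>0. seq_B_L2 L T0 \<Phi> (D t) \<and>
             seq_norm L (op_B L T0 \<Phi> (D t))
               \<le> sqrt 3 * (C * (\<tau>0 + 1) * seq_norm L (seq_diff (D 0) (D_inf T0 \<Phi> c0))
                            + seq_norm L (op_B L T0 \<Phi> (D 0)))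
                 * exp (- (\<tau> \<epsilon> / \<epsilon>\<^sup>2) * \<kappa> * t))))"
proof -
  interpret circle L by unfold_locales (rule assms(1))
  obtain b m K B where "hermite_torus L (sqrt T0) b m K B T0 \<Phi>"
    using hermite_torus_exists[OF assms(2,3)] .
  then interpret H: hermite_torus L "sqrt T0" b m K B T0 \<Phi> .
  define adm where "adm \<tau> \<tau>0 \<kappa> \<longleftrightarrow> (\<forall>\<epsilon>>0. \<tau> \<epsilon> > 0) \<and> \<tau>0 > 0 \<and>
    (SUP \<epsilon>\<in>{0<..}. ereal (\<tau> \<epsilon> / \<epsilon>)) \<le> ereal \<tau>0 \<and> \<kappa> = 1 / (H.rate_const * (\<tau>0\<^sup>2 + 1))"
    for \<tau> :: "real \<Rightarrow> real" and \<tau>0 \<kappa> :: real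
  define solves where "solves \<tau> \<epsilon> D c0 \<longleftrightarrow> hermite_solution L T0 \<Phi> \<epsilon> (\<tau> \<epsilon>) D \<and> c0 > 0 \<and>
     (LINT x|torus L. rho_inf T0 \<Phi> c0 x) = (LINT x|torus L. D 0 0 x * sqrt (rho_inf T0 \<Phi> c0 x))"
    for \<tau> :: "real \<Rightarrow> real" and \<epsilon> c0 :: real and D :: "real \<Rightarrow> nat \<Rightarrow> real \<Rightarrow> real"
  have data: "hermite_data L (sqrt T0) b m K B T0 \<Phi> D \<epsilon> (\<tau> \<epsilon>) \<tau>0 c0" and \<kappa>: "\<kappa> = 1 / (H.rate_const * (\<tau>0\<^sup>2 + 1))"
    if adm: "adm \<tau> \<tau>0 \<kappa>" and \<epsilon>: "0 < \<epsilon>" and sol: "solves \<tau> \<epsilon> D c0" for \<tau> \<tau>0 \<kappa> \<epsilon> D c0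
  proof -
    have "ereal (\<tau> \<epsilon> / \<epsilon>) \<le> (SUP \<epsilon>\<in>{0<..}. ereal (\<tau> \<epsilon> / \<epsilon>))" by (rule SUP_upper) (use \<epsilon> in simp)
    also have "\<dots> \<le> ereal \<tau>0" using adm by (simp add: adm_def)
    finally have "\<tau> \<epsilon> / \<epsilon> \<le> \<tau>0" by simp
    thus "hermite_data L (sqrt T0) b m K B T0 \<Phi> D \<epsilon> (\<tau> \<epsilon>) \<tau>0 c0"
      using adm \<epsilon> sol by unfold_locales (auto simp: adm_def solves_def)
    show "\<kappa> = 1 / (H.rate_const * (\<tau>0\<^sup>2 + 1))" using adm by (simp add: adm_def)
  qed
  show ?thesis
  proof (intro exI[of _ H.rate_const] conjI allI impI, unfold adm_def[symmetric] solves_def[symmetric])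
    show "0 < H.rate_const" by (rule H.rate_const_bounds(1))
  next
    fix \<tau> \<tau>0 \<kappa> assume "adm \<tau> \<tau>0 \<kappa>"
    thus "0 < \<kappa>" using H.rate_const_bounds(1) by (simp add: adm_def add_nonneg_pos)
  next
    fix \<tau> \<tau>0 \<kappa> \<epsilon> D c0 t
    assume A: "adm \<tau> \<tau>0 \<kappa>" "0 < \<epsilon>" "solves \<tau> \<epsilon> D c0" and t: "0 \<le> (t :: real)"
    interpret S: hermite_data L "sqrt T0" b m K B T0 \<Phi> D \<epsilon> "\<tau> \<epsilon>" \<tau>0 c0 by (rule data[OF A])
    show "seq_L2 L (seq_diff (D t) (D_inf T0 \<Phi> c0))" by (rule S.deviation_L2[OF t])
    show "seq_norm L (seq_diff (D t) (D_inf T0 \<Phi> c0)) \<le> sqrt 3 * seq_norm L (seq_diff (D 0) (D_inf T0 \<Phi> c0))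
                 * exp (- (\<tau> \<epsilon> / \<epsilon>\<^sup>2) * \<kappa> * t)"
      unfolding \<kappa>[OF A] by (rule S.L2_decay[OF t])
  next
    fix \<tau> \<tau>0 \<kappa> \<epsilon> D c0 t
    assume A: "adm \<tau> \<tau>0 \<kappa>" "0 < \<epsilon>" "solves \<tau> \<epsilon> D c0" and t: "0 \<le> (t :: real)"
      and B: "seq_B_L2 L T0 \<Phi> (D 0) \<and> seq_L2 L (D 0)"
    interpret S: hermite_data L "sqrt T0" b m K B T0 \<Phi> D \<epsilon> "\<tau> \<epsilon>" \<tau>0 c0 by (rule data[OF A])
    show "seq_B_L2 L T0 \<Phi> (D t)" by (rule S.H1_decay(1)[OF t conjunct1[OF B]])
    show "seq_norm L (op_B L T0 \<Phi> (D t)) \<le> sqrt 3 * (H.rate_const * (\<tau>0 + 1) * seq_norm L (seq_diff (D 0) (D_inf T0 \<Phi> c0))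
        + seq_norm L (op_B L T0 \<Phi> (D 0))) * exp (- (\<tau> \<epsilon> / \<epsilon>\<^sup>2) * \<kappa> * t)"
      unfolding \<kappa>[OF A] by (rule S.H1_decay(2)[OF t conjunct1[OF B]])
  qed
qed

end
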